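(* Let $s,\sigma>0$, let $E$ be an ordered basis of $\mathbf R^d$, let $F$ be a quasi-periodic Gelfand-Shilov distribution with respect to $E$, and let $\phi\in\mathcal S_{s,\sigma}^{\sigma,s}(\mathbf R^{2d})\setminus0$ ($\phi\in\Sigma_{s,\sigma}^{\sigma,s}(\mathbf R^{2d})\setminus0$). Then the following conditions are equivalent: (1) $F\in\mathcal E^{\sigma,s}_{Z,E}(\mathbf R^{2d})$ ($F\in\mathcal E^{\sigma,s;0}_{Z,E}(\mathbf R^{2d})$); (2) for some $r>0$ (for every $r>0$) it holds $$|(V_\phi F)(x,\xi,\eta,y)|\lesssim e^{-r(|\eta|^{1/\sigma}+|y|^{1/s})},\qquad x\in Q_E,\ \xi,\eta,y\in\mathbf R^d;$$ (3) for some $r>0$ (for every $r>0$) it holds $$|(V_\phi F)(x,\xi,\eta,y)|\lesssim e^{-r(|\eta|^{1/\sigma}+|x-y|^{1/s})},\qquad x,\xi,\eta,y\in\mathbf R^d.$$ (The version in parentheses is a second, parallel statement.)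
   Context: For an ordered basis $E=\{e_1,\dots,e_d\}$ of $\mathbf R^d$, the dual basis $E'$ is defined by $\langle e_j,e_k'\rangle=2\pi\delta_{jk}$; $\Lambda_E$ is the lattice of integer combinations of $E$, $\Lambda_E'=\Lambda_{E'}$; $Q_E=\{\sum t_je_j:0\le t_j\le1\}$. A function or distribution $F$ on $\mathbf R^{2d}$ is quasi-periodic with respect to $E$ if $F(x+k,\xi)=e^{i\langle k,\xi\rangle}F(x,\xi)$ and $F(x,\xi+\kappa)=F(x,\xi)$ for all $k\in\Lambda_E$, $\kappa\in\Lambda_E'$. Gelfand-Shilov spaces: $\mathcal S_{s,\sigma}^{\sigma,s}(\mathbf R^{2d})$ (respectively $\Sigma_{s,\sigma}^{\sigma,s}(\mathbf R^{2d})$) is the set of all $\Phi\in C^\infty(\mathbf R^{2d})$ such that $$\sup\frac{|x^{\alpha_1}\xi^{\alpha_2}\partial_x^{\beta_1}\partial_\xi^{\beta_2}\Phi(x,\xi)|}{h^{|\alpha_1|+|\alpha_2|+|\beta_1|+|\beta_2|}\alpha_1!^{s}\alpha_2!^{\sigma}\beta_1!^{\sigma}\beta_2!^{s}}<\infty$$ (supremum over $x,\xi\in\mathbf R^d$ and multi-indices) for some (respectively every) $h>0$, with inductive (respectively projective) limit topology in $h$. Primes denote duals. A Gelfand-Shilov distribution on $\mathbf R^{2d}$ is an element of $(\mathcal S_{s_0,\sigma_0}^{\sigma_0,s_0})'(\mathbf R^{2d})$ for some $s_0,\sigma_0>0$ with $s_0+\sigma_0\ge1$. Short-time Fourier transform: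 $V_\phi F(x,\xi,\eta,y)=(2\pi)^{-d}\iint F(z,\zeta)\overline{\phi(z-x,\zeta-\xi)}e^{-i(\langle z,\eta\rangle+\langle\zeta,y\rangle)}dzd\zeta$, extended to distributions (in general $V_\phi F$ is a Gelfand-Shilov distribution on $\mathbf R^{4d}$; the estimates include the assertion that it is a function). Gevrey classes: $\mathcal E^{\sigma,s}_{Z,E}(\mathbf R^{2d})$ (respectively $\mathcal E^{\sigma,s;0}_{Z,E}(\mathbf R^{2d})$) is the set of quasi-periodic $F\in C^\infty(\mathbf R^{2d})$ with respect to $E$ such that for every compact $K\subseteq\mathbf R^{2d}$, $\sup_{\alpha,\beta\in\mathbf N^d}\sup_{(x,\xi)\in K}\frac{|\partial_x^\alpha\partial_\xi^\beta F(x,\xi)|}{h^{|\alpha+\beta|}\alpha!^\sigma\beta!^s}<\infty$ for some (respectively every) $h>0$. $A\lesssim B$ means $A\le CB$ with $C>0$ independent of the variables (it may depend on $r$). *)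

theory Defs
  imports "HOL-Analysis.Analysis"
begin

section \<open>Multi-indices and smooth functions\<close>

text \<open>A multi-index on a Euclidean space is a function of type \<open>'a \<Rightarrow> nat\<close>, of which only the
  values on \<open>Basis\<close> are ever used.\<close>

definition mlength :: "('a::euclidean_space \<Rightarrow> nat) \<Rightarrow> nat" where
  "mlength \<alpha> = (\<Sum>b\<in>Basis. \<alpha> b)"

definition mfact :: "('a::euclidean_space \<Rightarrow> nat) \<Rightarrow> real" where
  "mfact \<alpha> = (\<Prod>b\<in>Basis. fact (\<alpha> b))"

definition mpower :: "'a::euclidean_space \<Rightarrow> ('a \<Rightarrow> nat) \<Rightarrow> real" where
  "mpower x \<alpha> = (\<Prod>b\<in>Basis. (x \<bullet> b) ^ \<alpha> b)"

definition pderivative :: "'v::euclidean_space \<Rightarrow> ('v \<Rightarrow> complex) \<Rightarrow> 'v \<Rightarrow> complex" where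
  "pderivative v f X = vector_derivative (\<lambda>t. f (X + t *\<^sub>R v)) (at 0)"

fun C_k :: "nat \<Rightarrow> ('v::euclidean_space \<Rightarrow> complex) \<Rightarrow> bool" where
  "C_k 0 f \<longleftrightarrow> continuous_on UNIV f"
| "C_k (Suc k) f \<longleftrightarrow> f differentiable_on UNIV \<and> (\<forall>b\<in>Basis. C_k k (pderivative b f))"

definition C_infinity :: "('v::euclidean_space \<Rightarrow> complex) \<Rightarrow> bool" where
  "C_infinity f \<longleftrightarrow> (\<forall>k. C_k k f)"

text \<open>The order in which the coordinates are enumerated does not matter for smooth functions,
  and \<open>mderiv\<close> is applied to smooth functions only.\<close>

definition basis_list :: "'a::euclidean_space list" where
  "basis_list = (SOME bs. distinct bs \<and> set bs = Basis)"

text \<open>\<open>mderiv \<iota> \<alpha>\<close> differentiates \<open>\<alpha> b\<close> times in the direction \<open>\<iota> b\<close>, for each basis vector \<open>b\<close>.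
  The function \<open>\<iota>\<close> places the basis of \<open>'a\<close> into the first or second factor of \<open>'a \<times> 'a\<close>.\<close>

definition mderiv ::
  "('a::euclidean_space \<Rightarrow> 'v::euclidean_space) \<Rightarrow> ('a \<Rightarrow> nat) \<Rightarrow> ('v \<Rightarrow> complex) \<Rightarrow> 'v \<Rightarrow> complex" where
  "mderiv \<iota> \<alpha> f = fold (\<lambda>b. pderivative (\<iota> b) ^^ \<alpha> b) basis_list f"

definition mixed_deriv ::
  "('a::euclidean_space \<Rightarrow> nat) \<Rightarrow> ('a \<Rightarrow> nat) \<Rightarrow> ('a \<times> 'a \<Rightarrow> complex) \<Rightarrow> 'a \<times> 'a \<Rightarrow> complex" where
  "mixed_deriv \<alpha> \<beta> f = mderiv (\<lambda>b. (b, 0)) \<alpha> (mderiv (\<lambda>b. (0, b)) \<beta> f)"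


section \<open>Gelfand--Shilov spaces and distributions\<close>

text \<open>The spaces \<open>\<S>\<^bsub>s,\<sigma>\<^esub>\<^bsup>\<sigma>,s\<^esup>\<close> (\<open>GS\<close>) and \<open>\<Sigma>\<^bsub>s,\<sigma>\<^esub>\<^bsup>\<sigma>,s\<^esup>\<close> (\<open>GS_proj\<close>) on \<open>'a \<times> 'a\<close>.\<close>

definition GS_norm ::
  "real \<Rightarrow> real \<Rightarrow> real \<Rightarrow> ('a::euclidean_space \<times> 'a \<Rightarrow> complex) \<Rightarrow> ennreal" where
  "GS_norm s \<sigma> h \<Phi> =
    (SUP x. SUP \<xi>. SUP \<alpha>1. SUP \<alpha>2. SUP \<beta>1. SUP \<beta>2.
      ennreal (\<bar>mpower x \<alpha>1 * mpower \<xi> \<alpha>2\<bar> * norm (mixed_deriv \<beta>1 \<beta>2 \<Phi> (x, \<xi>)) /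
        (h ^ (mlength \<alpha>1 + mlength \<alpha>2 + mlength \<beta>1 + mlength \<beta>2) *
          mfact \<alpha>1 powr s * mfact \<alpha>2 powr \<sigma> * mfact \<beta>1 powr \<sigma> * mfact \<beta>2 powr s)))"

definition GS :: "real \<Rightarrow> real \<Rightarrow> ('a::euclidean_space \<times> 'a \<Rightarrow> complex) set" where
  "GS s \<sigma> = {\<Phi>. C_infinity \<Phi> \<and> (\<exists>h>0. GS_norm s \<sigma> h \<Phi> < \<infinity>)}"

definition GS_proj :: "real \<Rightarrow> real \<Rightarrow> ('a::euclidean_space \<times> 'a \<Rightarrow> complex) set" where
  "GS_proj s \<sigma> = {\<Phi>. C_infinity \<Phi> \<and> (\<forall>h>0. GS_norm s \<sigma> h \<Phi> < \<infinity>)}"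

text \<open>The locally convex inductive limit topology on \<open>GS s \<sigma>\<close> of the Banach spaces
  \<open>{\<Phi>. C_infinity \<Phi> \<and> GS_norm s \<sigma> h \<Phi> < \<infinity>}\<close>, \<open>h > 0\<close>. A base of neighbourhoods of \<open>0\<close> consists of
  the absolutely convex sets that contain a ball around \<open>0\<close> of each of these spaces.\<close>

definition GS_nbhds0 :: "real \<Rightarrow> real \<Rightarrow> ('a::euclidean_space \<times> 'a \<Rightarrow> complex) set set" where
  "GS_nbhds0 s \<sigma> = {N. N \<subseteq> GS s \<sigma> \<and>
    (\<forall>\<Phi>\<in>N. \<forall>\<Psi>\<in>N. \<forall>a b. norm a + norm b \<le> 1 \<longrightarrow> (\<lambda>X. a * \<Phi> X + b * \<Psi> X) \<in> N) \<and>
    (\<forall>h>0. \<exists>\<epsilon>>0. \<forall>\<Phi>\<in>GS s \<sigma>. GS_norm s \<sigma> h \<Phi> < ennreal \<epsilon> \<longrightarrow> \<Phi> \<in> N)}"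

definition GS_topology :: "real \<Rightarrow> real \<Rightarrow> ('a::euclidean_space \<times> 'a \<Rightarrow> complex) topology" where
  "GS_topology s \<sigma> = topology (\<lambda>U. U \<subseteq> GS s \<sigma> \<and>
    (\<forall>\<Phi>\<in>U. \<exists>N\<in>GS_nbhds0 s \<sigma>. \<forall>\<Psi>\<in>N. (\<lambda>X. \<Phi> X + \<Psi> X) \<in> U))"

lemma GS_nbhds0_Int:
  assumes "M \<in> GS_nbhds0 s \<sigma>" and "N \<in> GS_nbhds0 s \<sigma>"
  shows "M \<inter> N \<in> GS_nbhds0 s \<sigma>"
proof -
  have "\<exists>\<epsilon>>0. \<forall>\<Phi>\<in>GS s \<sigma>. GS_norm s \<sigma> h \<Phi> < ennreal \<epsilon> \<longrightarrow> \<Phi> \<in> M \<inter> N" if "h > 0" for h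
  proof -
    obtain \<delta> \<epsilon> where "\<delta> > 0" "\<forall>\<Phi>\<in>GS s \<sigma>. GS_norm s \<sigma> h \<Phi> < ennreal \<delta> \<longrightarrow> \<Phi> \<in> M"
      and "\<epsilon> > 0" "\<forall>\<Phi>\<in>GS s \<sigma>. GS_norm s \<sigma> h \<Phi> < ennreal \<epsilon> \<longrightarrow> \<Phi> \<in> N"
      using assms \<open>h > 0\<close> unfolding GS_nbhds0_def by blast
    moreover have "c < ennreal \<delta> \<and> c < ennreal \<epsilon>" if "c < ennreal (min \<delta> \<epsilon>)" for c
      using that by (meson ennreal_leI min.cobounded1 min.cobounded2 order_less_le_trans)
    ultimately show ?thesis
      by (intro exI[of _ "min \<delta> \<epsilon>"]) auto
  qed
  then show ?thesis
    using assms unfolding GS_nbhds0_def by auto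
qed

lemma openin_GS_topology:
  fixes U :: "('a::euclidean_space \<times> 'a \<Rightarrow> complex) set"
  shows "openin (GS_topology s \<sigma>) U \<longleftrightarrow> U \<subseteq> GS s \<sigma> \<and>
    (\<forall>\<Phi>\<in>U. \<exists>N\<in>GS_nbhds0 s \<sigma>. \<forall>\<Psi>\<in>N. (\<lambda>X. \<Phi> X + \<Psi> X) \<in> U)"
proof -
  let ?L = "\<lambda>U :: ('a \<times> 'a \<Rightarrow> complex) set. U \<subseteq> GS s \<sigma> \<and> (\<forall>\<Phi>\<in>U. \<exists>N\<in>GS_nbhds0 s \<sigma>. \<forall>\<Psi>\<in>N. (\<lambda>X. \<Phi> X + \<Psi> X) \<in> U)"
  have "?L (U \<inter> V)" if "?L U" "?L V" for U V
  proof -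
    have "\<exists>N\<in>GS_nbhds0 s \<sigma>. \<forall>\<Psi>\<in>N. (\<lambda>X. \<Phi> X + \<Psi> X) \<in> U \<inter> V" if \<Phi>: "\<Phi> \<in> U \<inter> V" for \<Phi>
    proof -
      obtain M N where "M \<in> GS_nbhds0 s \<sigma>" "\<forall>\<Psi>\<in>M. (\<lambda>X. \<Phi> X + \<Psi> X) \<in> U"
        and "N \<in> GS_nbhds0 s \<sigma>" "\<forall>\<Psi>\<in>N. (\<lambda>X. \<Phi> X + \<Psi> X) \<in> V"
        using \<open>?L U\<close> \<open>?L V\<close> \<Phi> by blast
      then show ?thesis
        by (intro bexI[of _ "M \<inter> N"]) (auto intro: GS_nbhds0_Int)
    qed
    then show ?thesis using \<open>?L U\<close> by blast
  qed
  moreover have "?L (\<Union>\<K>)" if "\<forall>K\<in>\<K>. ?L K" for \<K>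
    using that by (meson Sup_least UnionE UnionI)
  ultimately have "istopology ?L"
    unfolding istopology_def by blast
  then show ?thesis
    unfolding GS_topology_def by (simp only: topology_inverse')
qed

definition GS_dual :: "real \<Rightarrow> real \<Rightarrow> (('a::euclidean_space \<times> 'a \<Rightarrow> complex) \<Rightarrow> complex) set" where
  "GS_dual s \<sigma> = {F. continuous_map (GS_topology s \<sigma>) euclidean F \<and>
    (\<forall>\<Phi>\<in>GS s \<sigma>. \<forall>\<Psi>\<in>GS s \<sigma>. \<forall>a b. F (\<lambda>X. a * \<Phi> X + b * \<Psi> X) = a * F \<Phi> + b * F \<Psi>)}"

text \<open>The distribution \<open>F\<close> on \<open>GS s \<sigma>\<close> is (given by) the function \<open>f\<close>. In general \<open>GS s \<sigma>\<close> contains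
  no non-zero functions of compact support, so integrability against all test functions
  takes the place of local integrability.\<close>

definition is_function ::
  "real \<Rightarrow> real \<Rightarrow> (('a::euclidean_space \<times> 'a \<Rightarrow> complex) \<Rightarrow> complex) \<Rightarrow> ('a \<times> 'a \<Rightarrow> complex) \<Rightarrow> bool" where
  "is_function s \<sigma> F f \<longleftrightarrow> f \<in> borel_measurable borel \<and>
    (\<forall>\<Phi>\<in>GS s \<sigma>. integrable lborel (\<lambda>X. f X * \<Phi> X) \<and>
      F \<Phi> = (LINT X|lborel. f X * \<Phi> X))"


section \<open>Lattices, quasi-periodicity and Gevrey classes\<close>

definition is_basis :: "('n::finite \<Rightarrow> real ^ 'n) \<Rightarrow> bool" where
  "is_basis E \<longleftrightarrow> inj E \<and> independent (range E) \<and> span (range E) = UNIV"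

definition dual_basis :: "('n::finite \<Rightarrow> real ^ 'n) \<Rightarrow> 'n \<Rightarrow> real ^ 'n" where
  "dual_basis E = (THE E'. \<forall>j k. E j \<bullet> E' k = (if j = k then 2 * pi else 0))"

definition lattice_of :: "('n::finite \<Rightarrow> real ^ 'n) \<Rightarrow> (real ^ 'n) set" where
  "lattice_of E = {\<Sum>j\<in>UNIV. of_int (m j) *\<^sub>R E j |m. True}"

definition cell :: "('n::finite \<Rightarrow> real ^ 'n) \<Rightarrow> (real ^ 'n) set" where
  "cell E = {\<Sum>j\<in>UNIV. t j *\<^sub>R E j |t. \<forall>j. 0 \<le> t j \<and> t j \<le> 1}"

definition quasi_periodic ::
  "('n::finite \<Rightarrow> real ^ 'n) \<Rightarrow> ((real ^ 'n) \<times> (real ^ 'n) \<Rightarrow> complex) \<Rightarrow> bool" where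
  "quasi_periodic E f \<longleftrightarrow>
    (\<forall>k\<in>lattice_of E. \<forall>x \<xi>. f (x + k, \<xi>) = exp (\<i> * of_real (k \<bullet> \<xi>)) * f (x, \<xi>)) \<and>
    (\<forall>\<kappa>\<in>lattice_of (dual_basis E). \<forall>x \<xi>. f (x, \<xi> + \<kappa>) = f (x, \<xi>))"

text \<open>The same for a distribution on \<open>GS s \<sigma>\<close>; translations and multiplications act on
  distributions by transposition.\<close>

definition quasi_periodic_dist ::
  "real \<Rightarrow> real \<Rightarrow> ('n::finite \<Rightarrow> real ^ 'n) \<Rightarrow>
    (((real ^ 'n) \<times> (real ^ 'n) \<Rightarrow> complex) \<Rightarrow> complex) \<Rightarrow> bool" where
  "quasi_periodic_dist s \<sigma> E F \<longleftrightarrow>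
    (\<forall>\<Phi>\<in>GS s \<sigma>.
      (\<forall>k\<in>lattice_of E.
        F (\<lambda>(x, \<xi>). \<Phi> (x - k, \<xi>)) = F (\<lambda>(x, \<xi>). exp (\<i> * of_real (k \<bullet> \<xi>)) * \<Phi> (x, \<xi>))) \<and>
      (\<forall>\<kappa>\<in>lattice_of (dual_basis E). F (\<lambda>(x, \<xi>). \<Phi> (x, \<xi> - \<kappa>)) = F \<Phi>))"

definition gevrey_sup ::
  "real \<Rightarrow> real \<Rightarrow> real \<Rightarrow> ('a::euclidean_space \<times> 'a) set \<Rightarrow> ('a \<times> 'a \<Rightarrow> complex) \<Rightarrow> ennreal" where
  "gevrey_sup \<sigma> s h K f =
    (SUP \<alpha>. SUP \<beta>. SUP X\<in>K.
      ennreal (norm (mixed_deriv \<alpha> \<beta> f X) /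
        (h ^ (mlength \<alpha> + mlength \<beta>) * mfact \<alpha> powr \<sigma> * mfact \<beta> powr s)))"

text \<open>The classes \<open>\<E>\<^bsub>Z,E\<^esub>\<^bsup>\<sigma>,s\<^esup>\<close> (\<open>gevrey\<close>) and \<open>\<E>\<^bsub>Z,E\<^esub>\<^bsup>\<sigma>,s;0\<^esup>\<close> (\<open>gevrey_proj\<close>).\<close>

definition gevrey ::
  "real \<Rightarrow> real \<Rightarrow> ('n::finite \<Rightarrow> real ^ 'n) \<Rightarrow> ((real ^ 'n) \<times> (real ^ 'n) \<Rightarrow> complex) set" where
  "gevrey \<sigma> s E = {f. C_infinity f \<and> quasi_periodic E f \<and>
    (\<forall>K. compact K \<longrightarrow> (\<exists>h>0. gevrey_sup \<sigma> s h K f < \<infinity>))}"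

definition gevrey_proj ::
  "real \<Rightarrow> real \<Rightarrow> ('n::finite \<Rightarrow> real ^ 'n) \<Rightarrow> ((real ^ 'n) \<times> (real ^ 'n) \<Rightarrow> complex) set" where
  "gevrey_proj \<sigma> s E = {f. C_infinity f \<and> quasi_periodic E f \<and>
    (\<forall>K. compact K \<longrightarrow> (\<forall>h>0. gevrey_sup \<sigma> s h K f < \<infinity>))}"


section \<open>The short-time Fourier transform of a distribution\<close>

text \<open>\<open>V\<^sub>\<phi>F\<close> is a distribution in the variables \<open>(x, \<xi>, \<eta>, y)\<close>, obtained by letting \<open>F\<close> act in
  \<open>(z, \<zeta>)\<close> on the integral of \<open>\<Psi>\<close> against the kernel of the transform; if \<open>F\<close> is a function, this
  is the pairing of the usual \<open>V\<^sub>\<phi>F\<close> with \<open>\<Psi>\<close> by Fubini's theorem. The window \<open>\<phi>\<close> need not be a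
  test function for \<open>F\<close>.

  For \<open>F \<in> GS_dual s \<sigma>\<close> the natural test functions \<open>\<Psi>\<close> have decay and regularity \<open>s, \<sigma>\<close> in
  \<open>x\<close> and \<open>y\<close>, and \<open>\<sigma>, s\<close> in \<open>\<xi>\<close> and \<open>\<eta>\<close>, as \<open>\<eta>\<close> and \<open>y\<close> are dual to the first and second variable
  of \<open>F\<close>. Hence they are the elements of \<open>GS s \<sigma>\<close> when the variables are
  grouped as \<open>((x, y), (\<xi>, \<eta>))\<close>.\<close>

definition STFT ::
  "((real ^ 'n) \<times> (real ^ 'n) \<Rightarrow> complex) \<Rightarrow>
    (((real ^ 'n) \<times> (real ^ 'n) \<Rightarrow> complex) \<Rightarrow> complex) \<Rightarrow>
    (((real ^ 'n) \<times> (real ^ 'n)) \<times> ((real ^ 'n) \<times> (real ^ 'n)) \<Rightarrow> complex) \<Rightarrow> complex" where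
  "STFT \<phi> F \<Psi> = of_real (1 / (2 * pi) ^ CARD('n::finite)) *
    F (\<lambda>(z, \<zeta>). LINT ((x, y), (\<xi>, \<eta>))|lborel.
      cnj (\<phi> (z - x, \<zeta> - \<xi>)) * exp (- \<i> * of_real (z \<bullet> \<eta> + \<zeta> \<bullet> y)) * \<Psi> ((x, y), (\<xi>, \<eta>)))"

definition STFT_is_function ::
  "real \<Rightarrow> real \<Rightarrow> ((real ^ 'n::finite) \<times> (real ^ 'n) \<Rightarrow> complex) \<Rightarrow>
    (((real ^ 'n) \<times> (real ^ 'n) \<Rightarrow> complex) \<Rightarrow> complex) \<Rightarrow>
    (real ^ 'n \<Rightarrow> real ^ 'n \<Rightarrow> real ^ 'n \<Rightarrow> real ^ 'n \<Rightarrow> complex) \<Rightarrow> bool" where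
  "STFT_is_function s \<sigma> \<phi> F V \<longleftrightarrow>
    is_function s \<sigma> (STFT \<phi> F) (\<lambda>((x, y), (\<xi>, \<eta>)). V x \<xi> \<eta> y)"

end

theory Submission
  imports Defs "HOL-Probability.Probability"
begin

text \<open>If \<open>F\<close> is a quasi-periodic Gevrey function, its derivatives of all orders on the whole space are
  controlled by those on a product of two cells up to a factor \<open>exp (r |x|\<^bsup>1/s\<^esup>)\<close>; integrating by
  parts in \<open>V\<^sub>\<phi>F\<close> and optimising over the number of integrations gives the decay in \<open>\<eta>\<close> and \<open>y\<close> for \<open>x\<close>
  in a cell. The transform itself is quasi-periodic, with \<open>V(x + k, \<xi>, \<eta>, y + k)\<close> equal to \<open>V(x, \<xi>, \<eta>, y)\<close>
  up to a unimodular factor, which moves the estimate between the cell and the whole space.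

  Conversely, let \<open>Q \<Psi>\<close> be the integral of \<open>\<Psi>\<close> against the kernel of the transform, so that \<open>V\<^sub>\<phi>F\<close> acts
  as \<open>\<Psi> \<mapsto> F (Q \<Psi>)\<close>. For a test function \<open>\<theta>\<close> with \<open>\<integral>\<phi>\<^sup>* \<theta> \<noteq> 0\<close> the operator \<open>Q\<close> has a right inverse
  \<open>\<Phi> \<mapsto> S \<Phi>\<close>, up to a constant. Hence \<open>F \<Phi>\<close> is the pairing of \<open>V\<close> with \<open>S \<Phi>\<close>, and \<open>F\<close> is a bounded continuous
  function when \<open>V\<close> decays. Fourier inversion then expresses \<open>F |\<phi>|\<^sup>2\<close>, integrated over all translates of
  the window, as an integral of \<open>V\<close> against translated and modulated windows \<open>\<phi>\<close>. This integral can be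
  differentiated under the integral sign, and the decay of \<open>V\<close> and the regularity of \<open>\<phi>\<close> yield the Gevrey bounds.

  Only the linearity of \<open>F\<close> is used. Identities between functions on test functions turn into identities
  almost everywhere because translations and modulations of one non-zero test function \<open>g\<close> already
  separate: \<open>h g(\<cdot> - A)\<close> has vanishing Fourier transform. If the test function space is
  zero, so is \<open>F\<close>.\<close>

subsection \<open>Directional derivatives and smooth functions\<close>

text \<open>Two obstacles shape the argument. The window has exponents \<open>s\<close>,
  \<open>\<sigma>\<close>, while \<open>F\<close> acts on a space with unrelated exponents
  \<open>s\<^sub>0\<close>, \<open>\<sigma>\<^sub>0\<close>, which in general has no non-zero
  elements of compact support. So the window is not a test function, and cut-offs are excluded. That
  \<open>Q\<close> still preserves test functions rests on moving derivatives of the window onto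
  \<open>\<Psi>\<close> by parts: only bounds on the window and its first derivatives enter. For the
  same reason \<open>S\<close> is built with a test function \<open>\<theta>\<close>; only after
  \<open>F\<close> has become a bounded continuous function can the window itself be used for
  synthesis. Membership in test spaces is checked on words of multiplications and derivatives, since
  \<open>Q\<close> and \<open>S\<close> may exchange the two kinds of operation but keep the
  exponent attached to each. The second obstacle: the transform is given only up to null sets, so a
  bound on the cell is propagated through one representative that serves all rates. Passing between
  cell and whole space divides the rate by \<open>2 powr (1 / s)\<close>, which is harmless for
  either quantifier over the rate.\<close>

lemma has_vector_derivative_line:
  fixes f :: "'v::euclidean_space \<Rightarrow> complex"
  assumes "f differentiable (at (X + t *\<^sub>R v))"
  shows "((\<lambda>t. f (X + t *\<^sub>R v)) has_vector_derivative frechet_derivative f (at (X + t *\<^sub>R v)) v) (at t)"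
proof -
  have "(f has_derivative frechet_derivative f (at (X + t *\<^sub>R v))) (at (X + t *\<^sub>R v))"
    using assms frechet_derivative_works by blast
  moreover have "((\<lambda>t. X + t *\<^sub>R v) has_derivative (\<lambda>s. s *\<^sub>R v)) (at t)"
    by (auto intro!: derivative_eq_intros)
  ultimately have "((\<lambda>t. f (X + t *\<^sub>R v)) has_derivative
      (\<lambda>s. frechet_derivative f (at (X + t *\<^sub>R v)) (s *\<^sub>R v))) (at t)"
    using has_derivative_compose by blast
  moreover have "linear (frechet_derivative f (at (X + t *\<^sub>R v)))"
    using assms linear_frechet_derivative by blast
  ultimately show ?thesis
    by (simp add: has_vector_derivative_def linear_cmul)
qed

lemma pderivative_frechet:
  fixes f :: "'v::euclidean_space \<Rightarrow> complex"
  assumes "f differentiable (at X)"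
  shows "pderivative v f X = frechet_derivative f (at X) v"
  using has_vector_derivative_line[of f X 0 v] assms
  by (auto simp: pderivative_def intro: vector_derivative_at)

lemma has_derivative_pderivative:
  fixes f :: "'v::euclidean_space \<Rightarrow> complex"
  assumes "f differentiable (at X)"
  shows "(f has_derivative (\<lambda>v. pderivative v f X)) (at X)"
proof -
  have "frechet_derivative f (at X) = (\<lambda>v. pderivative v f X)"
    using pderivative_frechet[OF assms] by auto
  then show ?thesis using assms frechet_derivative_works[of f "at X"] by simp
qed

lemma pderivative_eqI:
  assumes "(f has_derivative f') (at X)"
  shows "pderivative v f X = f' v"
  using pderivative_frechet[OF differentiableI[OF assms], of v] frechet_derivative_at[OF assms] by simp

lemma has_vector_derivative_pderivative:
  fixes f :: "'v::euclidean_space \<Rightarrow> complex"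
  assumes "f differentiable (at (X + t *\<^sub>R v))"
  shows "((\<lambda>t. f (X + t *\<^sub>R v)) has_vector_derivative pderivative v f (X + t *\<^sub>R v)) (at t)"
  using has_vector_derivative_line[OF assms] pderivative_frechet[OF assms] by simp

lemma linear_pderivative:
  "f differentiable (at X) \<Longrightarrow> linear (\<lambda>v. pderivative v f X)"
  by (rule has_derivative_linear[OF has_derivative_pderivative])

lemma pderivative_Basis:
  assumes "f differentiable (at X)"
  shows "pderivative v f X = (\<Sum>b\<in>Basis. of_real (v \<bullet> b) * pderivative b f X)"
proof -
  have "pderivative v f X = pderivative (\<Sum>b\<in>Basis. (v \<bullet> b) *\<^sub>R b) f X"
    by (simp add: euclidean_representation)
  also have "\<dots> = (\<Sum>b\<in>Basis. (v \<bullet> b) *\<^sub>R pderivative b f X)"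
    using linear_sum[OF linear_pderivative[OF assms], of "\<lambda>b. (v \<bullet> b) *\<^sub>R b" Basis]
    by (simp add: linear_cmul[OF linear_pderivative[OF assms]])
  finally show ?thesis by (simp add: scaleR_conv_of_real)
qed

lemma pderivative_add:
  assumes "f differentiable (at X)" "g differentiable (at X)"
  shows "pderivative v (\<lambda>X. f X + g X) X = pderivative v f X + pderivative v g X"
  by (rule pderivative_eqI[THEN trans])
     (auto intro!: derivative_eq_intros has_derivative_pderivative assms)

lemma pderivative_cmult:
  assumes "f differentiable (at X)"
  shows "pderivative v (\<lambda>X. c * f X) X = c * pderivative v f X"
  by (rule pderivative_eqI[THEN trans])
     (auto intro!: derivative_eq_intros has_derivative_pderivative assms)

lemma pderivative_mult:
  assumes "f differentiable (at X)" "g differentiable (at X)"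
  shows "pderivative v (\<lambda>X. f X * g X) X = pderivative v f X * g X + f X * pderivative v g X"
  by (rule pderivative_eqI[THEN trans])
     (auto intro!: derivative_eq_intros has_derivative_pderivative assms)

lemma pderivative_affine:
  assumes "f differentiable (at (A + L X))" "bounded_linear L"
  shows "pderivative v (\<lambda>X. f (A + L X)) X = pderivative (L v) f (A + L X)"
proof -
  have "((\<lambda>X. A + L X) has_derivative L) (at X)"
    using has_derivative_add[OF has_derivative_const bounded_linear_imp_has_derivative[OF assms(2)], of A "at X"]
    by simp
  from has_derivative_compose[OF this has_derivative_pderivative[OF assms(1)]]
  show ?thesis by (rule pderivative_eqI)
qed

lemma pderivative_cnj:
  assumes "f differentiable (at X)"
  shows "pderivative v (\<lambda>X. cnj (f X)) X = cnj (pderivative v f X)"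
  by (rule pderivative_eqI[THEN trans])
     (auto intro!: derivative_eq_intros has_derivative_pderivative assms
        bounded_linear.has_derivative[OF bounded_linear_cnj])

lemma has_derivative_exp_inner:
  "((\<lambda>X. exp (\<i> * of_real (B \<bullet> X))) has_derivative
    (\<lambda>v. exp (\<i> * of_real (B \<bullet> X)) * (\<i> * of_real (B \<bullet> v)))) (at X)"
proof -
  have "((\<lambda>X. \<i> * of_real (B \<bullet> X)) has_derivative (\<lambda>v. \<i> * of_real (B \<bullet> v))) (at X)"
    by (auto intro!: derivative_eq_intros)
  from has_derivative_compose[OF this DERIV_exp[unfolded has_field_derivative_def]]
  show ?thesis .
qed

lemma pderivative_exp_inner:
  "pderivative v (\<lambda>X. exp (\<i> * of_real (B \<bullet> X))) X = \<i> * of_real (B \<bullet> v) * exp (\<i> * of_real (B \<bullet> X))"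
  by (subst pderivative_eqI[OF has_derivative_exp_inner]) simp

lemma pderivative_inner:
  "pderivative v (\<lambda>X. of_real (X \<bullet> B)) X = of_real (v \<bullet> B)"
  by (rule pderivative_eqI[THEN trans]) (auto intro!: derivative_eq_intros)

lemma C_k_add: "C_k k f \<Longrightarrow> C_k k g \<Longrightarrow> C_k k (\<lambda>X. f X + g X)"
proof (induction k arbitrary: f g)
  case (Suc k)
  then have "pderivative b (\<lambda>X. f X + g X) = (\<lambda>X. pderivative b f X + pderivative b g X)" for b
    by (auto simp: pderivative_add differentiable_on_def)
  with Suc show ?case by (auto simp: differentiable_on_add)
qed (auto intro: continuous_intros)

text \<open>Smoothness by closure: induction on \<open>k\<close> in \<open>C_k\<close> passes from a
  member of \<open>A\<close> to its derivatives. Two summands are allowed because a derivative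
  applied to the families used in \<open>GS_intro\<close> yields two terms of the same kind.\<close>

lemma C_infinity_coinduct:
  assumes "f \<in> A"
    and "\<And>g. g \<in> A \<Longrightarrow> g differentiable_on UNIV"
    and "\<And>g b. g \<in> A \<Longrightarrow> b \<in> Basis \<Longrightarrow> \<exists>g1\<in>A. \<exists>g2\<in>A. pderivative b g = (\<lambda>X. g1 X + g2 X)"
  shows "C_infinity f"
proof -
  have "C_k k g" if "g \<in> A" for k g
    using that
  proof (induction k arbitrary: g)
    case 0
    then show ?case using assms(2) differentiable_imp_continuous_on by auto
  next
    case (Suc k)
    then show ?case using assms(2,3) by (metis C_k.simps(2) C_k_add)
  qed
  then show ?thesis using assms(1) by (simp add: C_infinity_def)
qed

lemma C_infinity_coinduct1:
  assumes "f \<in> A"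
    and "\<And>g. g \<in> A \<Longrightarrow> g differentiable_on UNIV"
    and "\<And>g b. g \<in> A \<Longrightarrow> b \<in> Basis \<Longrightarrow> pderivative b g \<in> A"
  shows "C_infinity f"
proof -
  have "C_k k g" if "g \<in> A" for k g
    using that
    by (induction k arbitrary: g) (use assms(2,3) in \<open>auto intro: differentiable_imp_continuous_on\<close>)
  then show ?thesis using assms(1) by (simp add: C_infinity_def)
qed

lemma C_infinity_differentiable_on: "C_infinity f \<Longrightarrow> f differentiable_on UNIV"
  unfolding C_infinity_def using C_k.simps(2)[of 0 f] by blast

lemma C_infinity_differentiable: "C_infinity f \<Longrightarrow> f differentiable (at X)"
  using C_infinity_differentiable_on by (auto simp: differentiable_on_def)

lemma C_infinity_continuous_on: "C_infinity f \<Longrightarrow> continuous_on S f"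
  unfolding C_infinity_def using C_k.simps(1)[of f] continuous_on_subset[of UNIV f S] by auto

lemma C_infinity_borel: "C_infinity f \<Longrightarrow> f \<in> borel_measurable borel"
  by (intro borel_measurable_continuous_onI C_infinity_continuous_on)

lemma C_infinity_pderivative_Basis:
  "C_infinity f \<Longrightarrow> b \<in> Basis \<Longrightarrow> C_infinity (pderivative b f)"
  unfolding C_infinity_def using C_k.simps(2)[of _ f] by blast

lemma C_infinity_add: "C_infinity f \<Longrightarrow> C_infinity g \<Longrightarrow> C_infinity (\<lambda>X. f X + g X)"
  unfolding C_infinity_def by (auto intro: C_k_add)

lemma pderivative_const: "pderivative v (\<lambda>X. c) = (\<lambda>X. 0)"
  by (rule ext, rule pderivative_eqI[THEN trans, OF has_derivative_const]) simp

lemma C_infinity_const: "C_infinity (\<lambda>X. c)"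
proof (rule C_infinity_coinduct1[where A = "{f. \<exists>c. f = (\<lambda>X. c)}"])
  fix g :: "'a \<Rightarrow> complex" and b :: 'a assume "g \<in> {f. \<exists>c. f = (\<lambda>X. c)}"
  then show "pderivative b g \<in> {f. \<exists>c. f = (\<lambda>X. c)}"
    by (auto simp: pderivative_const)
qed auto

lemma C_infinity_sum:
  "(\<And>i. i \<in> I \<Longrightarrow> C_infinity (f i)) \<Longrightarrow> C_infinity (\<lambda>X. \<Sum>i\<in>I. f i X)"
  by (induction I rule: infinite_finite_induct) (auto intro: C_infinity_add C_infinity_const)

lemma C_k_Suc_imp: "C_k (Suc k) f \<Longrightarrow> C_k k f"
proof (induction k arbitrary: f)
  case 0
  then show ?case by (auto intro: differentiable_imp_continuous_on)
next
  case (Suc k)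
  then show ?case by (metis C_k.simps(2))
qed

lemma C_k_mult: "C_k k f \<Longrightarrow> C_k k g \<Longrightarrow> C_k k (\<lambda>X. f X * g X)"
proof (induction k arbitrary: f g)
  case (Suc k)
  then have "pderivative b (\<lambda>X. f X * g X) = (\<lambda>X. pderivative b f X * g X + f X * pderivative b g X)" for b
    by (auto simp: pderivative_mult differentiable_on_def)
  moreover have "C_k k f" "C_k k g" using Suc.prems C_k_Suc_imp by blast+
  ultimately show ?case using Suc
    by (auto simp: differentiable_on_mult intro!: C_k_add)
qed (auto intro: continuous_intros)

lemma C_infinity_mult: "C_infinity f \<Longrightarrow> C_infinity g \<Longrightarrow> C_infinity (\<lambda>X. f X * g X)"
  unfolding C_infinity_def by (auto intro: C_k_mult)

lemma C_infinity_cmult: "C_infinity f \<Longrightarrow> C_infinity (\<lambda>X. c * f X)"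
  by (intro C_infinity_mult C_infinity_const)

lemma C_infinity_pderivative: "C_infinity f \<Longrightarrow> C_infinity (pderivative v f)"
proof -
  assume f: "C_infinity f"
  then have "pderivative v f = (\<lambda>X. \<Sum>b\<in>Basis. of_real (v \<bullet> b) * pderivative b f X)"
    using pderivative_Basis C_infinity_differentiable by blast
  then show "C_infinity (pderivative v f)"
    by (simp only:) (intro C_infinity_sum C_infinity_cmult C_infinity_pderivative_Basis f)
qed

lemma differentiable_on_affine:
  assumes "C_infinity f" "bounded_linear L"
  shows "(\<lambda>X. f (A + L X)) differentiable_on UNIV"
proof -
  have "((\<lambda>X. A + L X) has_derivative L) (at X)" for X
    using has_derivative_add[OF has_derivative_const bounded_linear_imp_has_derivative[OF assms(2)], of A "at X"]
    by simp
  from has_derivative_compose[OF this has_derivative_pderivative[OF C_infinity_differentiable[OF assms(1)]]]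
  show ?thesis by (auto simp: differentiable_on_def differentiable_def)
qed

lemma C_infinity_affine:
  assumes "C_infinity f" "bounded_linear L"
  shows "C_infinity (\<lambda>X. f (A + L X))"
proof (rule C_infinity_coinduct1[where A = "{\<lambda>X. f (A + L X) | f. C_infinity f}"])
  fix g b assume "g \<in> {\<lambda>X. f (A + L X) | f. C_infinity f}"
  then obtain f where f: "C_infinity f" and g: "g = (\<lambda>X. f (A + L X))" by auto
  show "g differentiable_on UNIV" unfolding g by (rule differentiable_on_affine) fact+
  show "pderivative b g \<in> {\<lambda>X. f (A + L X) | f. C_infinity f}"
    using f assms(2) unfolding g
    by (auto simp: pderivative_affine C_infinity_differentiable
        intro!: exI[of _ "pderivative (L b) f"] C_infinity_pderivative)
qed (use assms in auto)

lemma C_infinity_shift: "C_infinity f \<Longrightarrow> C_infinity (\<lambda>X. f (X - A))"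
  using C_infinity_affine[of f id "-A"] by (simp add: bounded_linear_ident[unfolded id_def[symmetric]])

lemma pderivative_shift:
  "C_infinity f \<Longrightarrow> pderivative v (\<lambda>X. f (X - A)) X = pderivative v f (X - A)"
  using pderivative_affine[of f "-A" "\<lambda>X. X" X v] C_infinity_differentiable[of f "X - A"]
  by (simp add: bounded_linear_ident)

lemma differentiable_cnj:
  fixes f :: "'v::euclidean_space \<Rightarrow> complex"
  assumes "f differentiable (at X)" shows "(\<lambda>X. cnj (f X)) differentiable (at X)"
  using assms bounded_linear.has_derivative[OF bounded_linear_cnj] unfolding differentiable_def by blast

lemma C_infinity_cnj:
  assumes "C_infinity f" shows "C_infinity (\<lambda>X. cnj (f X))"
proof (rule C_infinity_coinduct1[where A = "{\<lambda>X. cnj (f X) | f. C_infinity f}"])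
  fix g b assume "g \<in> {\<lambda>X. cnj (f X) | f :: 'a \<Rightarrow> complex. C_infinity f}"
  then obtain f where f: "C_infinity f" and g: "g = (\<lambda>X. cnj (f X))" by auto
  show "g differentiable_on UNIV" unfolding g differentiable_on_def
    using differentiable_cnj[OF C_infinity_differentiable[OF f]] by simp
  show "pderivative b g \<in> {\<lambda>X. cnj (f X) | f. C_infinity f}"
    using f unfolding g
    by (auto simp: pderivative_cnj C_infinity_differentiable
        intro!: exI[of _ "pderivative b f"] C_infinity_pderivative)
next
  show "(\<lambda>X. cnj (f X)) \<in> {\<lambda>X. cnj (f X) | f. C_infinity f}"
    by (rule CollectI, rule exI[of _ f], rule conjI[OF refl assms])
qed

lemma C_infinity_inner: "C_infinity (\<lambda>X. of_real (X \<bullet> B))"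
proof (rule C_infinity_coinduct1[where A = "{\<lambda>X. of_real (X \<bullet> B) + c | B c. True}"])
  fix g :: "'a \<Rightarrow> complex" and b assume "g \<in> {\<lambda>X. of_real (X \<bullet> B) + c | B c. True}"
  then obtain B c where g: "g = (\<lambda>X. of_real (X \<bullet> B) + c)" by auto
  have D: "(g has_derivative (\<lambda>X. of_real (X \<bullet> B))) (at X)" for X
    unfolding g by (auto intro!: derivative_eq_intros)
  then show "g differentiable_on UNIV"
    by (auto simp: differentiable_on_def differentiable_def)
  show "pderivative b g \<in> {\<lambda>X. of_real (X \<bullet> B) + c | B c. True}"
    using pderivative_eqI[OF D] by (auto intro!: exI[of _ 0] exI[of _ "of_real (b \<bullet> B)"])
next
  have "(\<lambda>X. of_real (X \<bullet> B)) = (\<lambda>X. of_real (X \<bullet> B) + (0::complex))" by simp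
  then show "(\<lambda>X. of_real (X \<bullet> B)) \<in> {\<lambda>X. of_real (X \<bullet> B) + (c::complex) | B c. True}" by blast
qed

lemma C_infinity_exp_inner: "C_infinity (\<lambda>X. exp (\<i> * of_real (B \<bullet> X)))"
proof (rule C_infinity_coinduct1[where A = "{\<lambda>X. c * exp (\<i> * of_real (B \<bullet> X)) | c. True}"])
  fix g :: "'a \<Rightarrow> complex" and b assume "g \<in> {\<lambda>X. c * exp (\<i> * of_real (B \<bullet> X)) | c. True}"
  then obtain c where g: "g = (\<lambda>X. c * exp (\<i> * of_real (B \<bullet> X)))" by auto
  show "g differentiable_on UNIV" unfolding g
    unfolding differentiable_on_def by (auto intro!: derivative_intros differentiableI[OF has_derivative_exp_inner])
  show "pderivative b g \<in> {\<lambda>X. c * exp (\<i> * of_real (B \<bullet> X)) | c. True}"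
    unfolding g
    by (auto simp: pderivative_cmult[OF differentiableI[OF has_derivative_exp_inner]] pderivative_exp_inner
        intro!: exI[of _ "c * (\<i> * of_real (B \<bullet> b))"])
qed (auto intro!: exI[of _ 1])

subsection \<open>Symmetry of second derivatives\<close>

text \<open>The second difference is the increment over \<open>[0, \<tau>]\<close>, in
  \<open>t\<close>, of the difference of \<open>f\<close> along two parallel lines of direction
  \<open>b\<close>, displaced by \<open>\<tau>\<close> times \<open>a\<close>. Its derivative is a
  difference of values of the derivative along \<open>b\<close>, which differentiability at
  \<open>X\<close> replaces by \<open>\<tau>\<close> times the mixed derivative; the mean value
  inequality supplies the second factor \<open>\<tau>\<close>.\<close>

lemma second_difference_estimate:
  fixes f :: "'v::euclidean_space \<Rightarrow> complex"
  assumes f: "C_infinity f" and "\<epsilon> > 0"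
  shows "\<exists>\<delta>>0. \<forall>\<tau>. 0 < \<tau> \<and> \<tau> < \<delta> \<longrightarrow>
    norm (f (X + \<tau> *\<^sub>R a + \<tau> *\<^sub>R b) - f (X + \<tau> *\<^sub>R b) - (f (X + \<tau> *\<^sub>R a) - f X) -
      of_real (\<tau>\<^sup>2) * pderivative a (pderivative b f) X) \<le> \<epsilon> * \<tau>\<^sup>2"
proof -
  let ?g = "pderivative b f"
  let ?L = "\<lambda>v. pderivative v ?g X"
  \<comment> \<open>The two points compared with \<open>X\<close> below lie at distances at most
    \<open>\<tau>\<close> times \<open>norm a + norm b\<close> and \<open>\<tau>\<close> times
    \<open>norm b\<close>. \<open>C\<close> is the sum of these two numbers, plus 1 for
    positivity.\<close>
  define C where "C = norm a + 2 * norm b + 1"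
  have C: "C > 0" by (simp add: C_def add_nonneg_pos)
  have g: "?g differentiable (at X)"
    using f C_infinity_pderivative C_infinity_differentiable by blast
  note lin = linear_pderivative[OF g]
  obtain \<delta> where \<delta>: "\<delta> > 0"
    and d: "\<And>Y. norm (Y - X) < \<delta> \<Longrightarrow> norm (?g Y - ?g X - ?L (Y - X)) \<le> \<epsilon> / C * norm (Y - X)"
    using has_derivative_pderivative[OF g] \<open>\<epsilon> > 0\<close> C
    unfolding has_derivative_at_alt by (metis divide_pos_pos)
  show ?thesis
  proof (intro exI[of _ "\<delta> / C"] conjI allI impI)
    show "\<delta> / C > 0" using \<delta> C by simp
    fix \<tau> assume "0 < \<tau> \<and> \<tau> < \<delta> / C"
    then have \<tau>: "0 < \<tau>" "\<tau> * C < \<delta>" using C by (auto simp: field_simps)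
    \<comment> \<open>Subtracting the expected linear term leaves a function whose derivative
      \<open>?h'\<close> is as small as \<open>\<epsilon> * \<tau>\<close>.\<close>
    let ?h = "\<lambda>t. f ((X + \<tau> *\<^sub>R a) + t *\<^sub>R b) - f (X + t *\<^sub>R b) - t *\<^sub>R (\<tau> *\<^sub>R ?L a)"
    let ?h' = "\<lambda>t. ?g ((X + \<tau> *\<^sub>R a) + t *\<^sub>R b) - ?g (X + t *\<^sub>R b) - \<tau> *\<^sub>R ?L a"
    have h: "(?h has_derivative (\<lambda>s. s *\<^sub>R ?h' t)) (at t within {0..\<tau>})" for t
    proof -
      have "((\<lambda>t. t *\<^sub>R (\<tau> *\<^sub>R ?L a)) has_vector_derivative \<tau> *\<^sub>R ?L a) (at t)"
        unfolding has_vector_derivative_def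
        by (rule bounded_linear_imp_has_derivative[OF bounded_linear_scaleR_left])
      then show ?thesis
        unfolding has_vector_derivative_def[symmetric]
        by (rule has_vector_derivative_at_within[OF has_vector_derivative_diff[OF has_vector_derivative_diff[OF
              has_vector_derivative_pderivative[OF C_infinity_differentiable[OF f]]
              has_vector_derivative_pderivative[OF C_infinity_differentiable[OF f]]]]])
    qed
    have bound: "norm (?h' t) \<le> \<epsilon> * \<tau>" if t: "t \<in> {0..\<tau>}" for t
    proof -
      let ?Y = "X + \<tau> *\<^sub>R a + t *\<^sub>R b" and ?Z = "X + t *\<^sub>R b"
      have nZ: "norm (?Z - X) \<le> \<tau> * norm b"
        using t \<tau> by (simp add: mult_right_mono)
      have nY: "norm (?Y - X) \<le> \<tau> * norm a + \<tau> * norm b"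
      proof -
        have "norm (?Y - X) \<le> norm (\<tau> *\<^sub>R a) + norm (t *\<^sub>R b)"
          using norm_triangle_ineq[of "\<tau> *\<^sub>R a" "t *\<^sub>R b"] by (simp add: add.assoc)
        then show ?thesis using t \<tau> by (simp add: mult_right_mono order_trans[OF _ add_left_mono])
      qed
      have sm: "\<tau> * norm a + \<tau> * norm b < \<delta>"
      proof -
        have "\<tau> * norm a + \<tau> * norm b \<le> \<tau> * C" using \<tau> by (simp add: C_def algebra_simps)
        then show ?thesis using \<tau> by simp
      qed
      have sm': "\<tau> * norm b < \<delta>"
        using sm \<tau> mult_nonneg_nonneg[of \<tau> "norm a"] by (simp del: mult_nonneg_nonneg)
      have e1: "norm (?g ?Y - ?g X - ?L (?Y - X)) \<le> \<epsilon> / C * (\<tau> * norm a + \<tau> * norm b)"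
        using nY sm \<open>\<epsilon> > 0\<close> C
        by (intro order_trans[OF d mult_left_mono]) auto
      have e2: "norm (?g ?Z - ?g X - ?L (?Z - X)) \<le> \<epsilon> / C * (\<tau> * norm b)"
        using nZ sm' \<open>\<epsilon> > 0\<close> C
        by (intro order_trans[OF d mult_left_mono]) auto
      have "?L (?Y - X) = \<tau> *\<^sub>R ?L a + t *\<^sub>R ?L b" "?L (?Z - X) = t *\<^sub>R ?L b"
        using linear_add[OF lin, of "\<tau> *\<^sub>R a" "t *\<^sub>R b"] by (simp_all add: linear_cmul[OF lin] add.assoc)
      then have "?h' t = (?g ?Y - ?g X - ?L (?Y - X)) - (?g ?Z - ?g X - ?L (?Z - X))"
        by (simp only:) simp
      then have "norm (?h' t) \<le> \<epsilon> / C * (\<tau> * norm a + \<tau> * norm b) + \<epsilon> / C * (\<tau> * norm b)"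
        using norm_triangle_le_diff[OF add_mono[OF e1 e2]] by (simp only:)
      also have "\<dots> = \<epsilon> * \<tau> * ((norm a + 2 * norm b) / C)"
        using C by (simp add: field_simps)
      also have "\<dots> \<le> \<epsilon> * \<tau> * 1"
        using C \<open>\<epsilon> > 0\<close> \<tau> by (intro mult_left_mono) (auto simp: C_def)
      finally show ?thesis by simp
    qed
    have "norm (?h \<tau> - ?h 0) \<le> \<epsilon> * \<tau> * norm (\<tau> - 0)"
    proof (rule differentiable_bound[OF convex_real_interval(5) h])
      fix t assume "t \<in> {0..\<tau>}"
      then show "onorm (\<lambda>s. s *\<^sub>R ?h' t) \<le> \<epsilon> * \<tau>"
        using bound[of t] by (intro onorm_le) (simp add: mult.commute mult_left_mono del: atLeastAtMost_iff)
    qed (use \<tau> in auto)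
    moreover have "?h \<tau> - ?h 0 = f (X + \<tau> *\<^sub>R a + \<tau> *\<^sub>R b) - f (X + \<tau> *\<^sub>R b) - (f (X + \<tau> *\<^sub>R a) - f X) -
      of_real (\<tau>\<^sup>2) * ?L a"
      by (simp add: scaleR_conv_of_real power2_eq_square algebra_simps)
    ultimately have "norm (f (X + \<tau> *\<^sub>R a + \<tau> *\<^sub>R b) - f (X + \<tau> *\<^sub>R b) - (f (X + \<tau> *\<^sub>R a) - f X) -
      of_real (\<tau>\<^sup>2) * ?L a) \<le> \<epsilon> * \<tau> * norm (\<tau> - 0)"
      by (simp only:)
    then show "norm (f (X + \<tau> *\<^sub>R a + \<tau> *\<^sub>R b) - f (X + \<tau> *\<^sub>R b) - (f (X + \<tau> *\<^sub>R a) - f X) -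
      of_real (\<tau>\<^sup>2) * ?L a) \<le> \<epsilon> * \<tau>\<^sup>2"
      using \<tau> by (simp add: power2_eq_square mult.assoc)
  qed
qed

text \<open>The second difference is symmetric in \<open>a\<close> and \<open>b\<close>, so
  \<open>\<tau>\<^sup>2\<close> times either mixed derivative approximates the same number with
  error at most \<open>\<epsilon> / 2 * \<tau>\<^sup>2\<close>.\<close>

lemma pderivative_commute:
  assumes f: "C_infinity f"
  shows "pderivative a (pderivative b f) = pderivative b (pderivative a f)"
proof
  fix X
  let ?A = "pderivative a (pderivative b f) X" and ?B = "pderivative b (pderivative a f) X"
  have "norm (?A - ?B) \<le> \<epsilon>" if "\<epsilon> > 0" for \<epsilon>
  proof -
    from that have e: "\<epsilon> / 2 > 0" by simp
    obtain d1 d2 where d: "d1 > 0" "d2 > 0" and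
      1: "\<And>\<tau>. 0 < \<tau> \<Longrightarrow> \<tau> < d1 \<Longrightarrow> norm (f (X + \<tau> *\<^sub>R a + \<tau> *\<^sub>R b) - f (X + \<tau> *\<^sub>R b) - (f (X + \<tau> *\<^sub>R a) - f X) -
        of_real (\<tau>\<^sup>2) * ?A) \<le> \<epsilon> / 2 * \<tau>\<^sup>2" and
      2: "\<And>\<tau>. 0 < \<tau> \<Longrightarrow> \<tau> < d2 \<Longrightarrow> norm (f (X + \<tau> *\<^sub>R b + \<tau> *\<^sub>R a) - f (X + \<tau> *\<^sub>R a) - (f (X + \<tau> *\<^sub>R b) - f X) -
        of_real (\<tau>\<^sup>2) * ?B) \<le> \<epsilon> / 2 * \<tau>\<^sup>2"
      using second_difference_estimate[OF f e, of X a b] second_difference_estimate[OF f e, of X b a] by metis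
    define \<tau> where "\<tau> = min d1 d2 / 2"
    have \<tau>: "0 < \<tau>" "\<tau> < d1" "\<tau> < d2" using d by (auto simp: \<tau>_def)
    let ?D = "f (X + \<tau> *\<^sub>R a + \<tau> *\<^sub>R b) - f (X + \<tau> *\<^sub>R b) - (f (X + \<tau> *\<^sub>R a) - f X)"
    have "norm (of_real (\<tau>\<^sup>2) * (?A - ?B)) = norm ((?D - of_real (\<tau>\<^sup>2) * ?B) - (?D - of_real (\<tau>\<^sup>2) * ?A))"
      by (simp add: algebra_simps)
    also have "\<dots> \<le> \<epsilon> / 2 * \<tau>\<^sup>2 + \<epsilon> / 2 * \<tau>\<^sup>2"
    proof -
      have "?D - of_real (\<tau>\<^sup>2) * ?B = f (X + \<tau> *\<^sub>R b + \<tau> *\<^sub>R a) - f (X + \<tau> *\<^sub>R a) -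
          (f (X + \<tau> *\<^sub>R b) - f X) - of_real (\<tau>\<^sup>2) * ?B"
        by (simp add: add_ac)
      with 2[OF \<tau>(1,3)] have "norm (?D - of_real (\<tau>\<^sup>2) * ?B) \<le> \<epsilon> / 2 * \<tau>\<^sup>2" by metis
      with 1[OF \<tau>(1,2)] norm_triangle_ineq4[of "?D - of_real (\<tau>\<^sup>2) * ?B" "?D - of_real (\<tau>\<^sup>2) * ?A"]
      show ?thesis by linarith
    qed
    finally have "\<tau>\<^sup>2 * norm (?A - ?B) \<le> \<tau>\<^sup>2 * \<epsilon>"
      by (simp add: norm_mult norm_power mult.commute)
    then show ?thesis using \<tau> by simp
  qed
  then have "norm (?A - ?B) \<le> 0" by (meson dense_ge)
  then show "?A = ?B" by simp
qed

subsection \<open>Iterated derivatives and the Leibniz rule\<close>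

text \<open>Lists of directions replace multi-indices: the Leibniz rule becomes a recursion over the
  list, and for smooth functions only the multiset of directions matters
  (\<open>dd_mset\<close>).\<close>

definition dd :: "'v::euclidean_space list \<Rightarrow> ('v \<Rightarrow> complex) \<Rightarrow> 'v \<Rightarrow> complex" where
  "dd ds f = foldr pderivative ds f"

lemma dd_Nil [simp]: "dd [] f = f"
  and dd_Cons [simp]: "dd (d # ds) f = pderivative d (dd ds f)"
  by (simp_all add: dd_def)

lemma dd_append: "dd (xs @ ys) f = dd xs (dd ys f)"
  by (simp add: dd_def)

lemma C_infinity_dd: "C_infinity f \<Longrightarrow> C_infinity (dd ds f)"
  by (induction ds) (auto intro: C_infinity_pderivative)

lemma dd_pderivative_commute:
  "C_infinity f \<Longrightarrow> dd ds (pderivative d f) = pderivative d (dd ds f)"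
proof (induction ds)
  case (Cons a ds)
  then show ?case using pderivative_commute[OF C_infinity_dd, of f d a ds] by simp
qed simp

lemma dd_mset: "C_infinity f \<Longrightarrow> mset xs = mset ys \<Longrightarrow> dd xs f = dd ys f"
proof (induction xs arbitrary: ys)
  case (Cons x xs)
  then have "x \<in> set ys" by (metis list.set_intros(1) mset_eq_setD)
  then obtain as bs where ys: "ys = as @ x # bs" by (meson split_list)
  with Cons.prems have "mset xs = mset (as @ bs)" by simp
  then have "dd xs f = dd (as @ bs) f" using Cons by blast
  then show ?case
    using Cons.prems(1) by (simp add: ys dd_append dd_pderivative_commute C_infinity_dd)
qed simp

lemma dd_shift:
  assumes "C_infinity f"
  shows "dd ds (\<lambda>X. f (X - A)) = (\<lambda>X. dd ds f (X - A))"
  by (induction ds) (auto simp: pderivative_shift C_infinity_dd assms)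

lemma dd_cnj:
  assumes "C_infinity f"
  shows "dd ds (\<lambda>X. cnj (f X)) = (\<lambda>X. cnj (dd ds f X))"
  by (induction ds) (auto simp: pderivative_cnj C_infinity_dd C_infinity_differentiable assms)

lemma dd_cmult:
  assumes "C_infinity f"
  shows "dd ds (\<lambda>X. c * f X) = (\<lambda>X. c * dd ds f X)"
  by (induction ds) (auto simp: pderivative_cmult C_infinity_dd C_infinity_differentiable assms)

lemma dd_exp_inner:
  "dd ds (\<lambda>X. exp (\<i> * of_real (B \<bullet> X))) =
    (\<lambda>X. (\<Prod>v\<leftarrow>ds. \<i> * of_real (B \<bullet> v)) * exp (\<i> * of_real (B \<bullet> X)))"
  by (induction ds)
     (auto simp: pderivative_cmult C_infinity_exp_inner C_infinity_differentiable pderivative_exp_inner)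

text \<open>One entry for each way to distribute the positions of the list over two factors.
  Repeated entries take the place of binomial coefficients, so counting Leibniz terms reduces to
  \<open>length_splits\<close>.\<close>

fun splits :: "'v list \<Rightarrow> ('v list \<times> 'v list) list" where
  "splits [] = [([], [])]"
| "splits (d # ds) = map (\<lambda>(as, bs). (d # as, bs)) (splits ds) @ map (\<lambda>(as, bs). (as, d # bs)) (splits ds)"

lemma length_splits: "length (splits ds) = 2 ^ length ds"
  by (induction ds) auto

lemma splits_mset: "(as, bs) \<in> set (splits ds) \<Longrightarrow> mset as + mset bs = mset ds"
  by (induction ds arbitrary: as bs) auto

lemma pderivative_sum_list:
  assumes "\<And>i. i \<in> set is \<Longrightarrow> C_infinity (F i)"
  shows "pderivative v (\<lambda>X. \<Sum>i\<leftarrow>is. F i X) X = (\<Sum>i\<leftarrow>is. pderivative v (F i) X)"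
    and "C_infinity (\<lambda>X. \<Sum>i\<leftarrow>is. F i X)"
proof -
  have "C_infinity (\<lambda>X. \<Sum>i\<leftarrow>is. F i X) \<and>
    pderivative v (\<lambda>X. \<Sum>i\<leftarrow>is. F i X) X = (\<Sum>i\<leftarrow>is. pderivative v (F i) X)"
    using assms
  proof (induction "is")
    case Nil
    then show ?case by (simp add: C_infinity_const pderivative_const)
  next
    case (Cons a "is")
    then have 1: "C_infinity (F a)" "C_infinity (\<lambda>X. \<Sum>i\<leftarrow>is. F i X)"
      and 2: "pderivative v (\<lambda>X. \<Sum>i\<leftarrow>is. F i X) X = (\<Sum>i\<leftarrow>is. pderivative v (F i) X)" by auto
    then show ?case
      by (simp add: C_infinity_add pderivative_add C_infinity_differentiable)
  qed
  then show "pderivative v (\<lambda>X. \<Sum>i\<leftarrow>is. F i X) X = (\<Sum>i\<leftarrow>is. pderivative v (F i) X)"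
    and "C_infinity (\<lambda>X. \<Sum>i\<leftarrow>is. F i X)" by auto
qed

lemma dd_mult:
  assumes f: "C_infinity f" and g: "C_infinity g"
  shows "dd ds (\<lambda>X. f X * g X) = (\<lambda>X. \<Sum>(as, bs)\<leftarrow>splits ds. dd as f X * dd bs g X)"
proof (induction ds)
  case (Cons d ds)
  have "dd (d # ds) (\<lambda>X. f X * g X) X = (\<Sum>(as, bs)\<leftarrow>splits (d # ds). dd as f X * dd bs g X)" for X
  proof -
    have "dd (d # ds) (\<lambda>X. f X * g X) X =
        pderivative d (\<lambda>X. \<Sum>p\<leftarrow>splits ds. dd (fst p) f X * dd (snd p) g X) X"
      using Cons by (simp add: case_prod_unfold)
    also have "\<dots> = (\<Sum>p\<leftarrow>splits ds. pderivative d (\<lambda>X. dd (fst p) f X * dd (snd p) g X) X)"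
      by (rule pderivative_sum_list) (intro C_infinity_mult C_infinity_dd f g)
    also have "\<dots> = (\<Sum>p\<leftarrow>splits ds. dd (d # fst p) f X * dd (snd p) g X + dd (fst p) f X * dd (d # snd p) g X)"
      by (simp add: pderivative_mult C_infinity_differentiable C_infinity_dd f g)
    also have "\<dots> = (\<Sum>(as, bs)\<leftarrow>splits (d # ds). dd as f X * dd bs g X)"
      by (simp add: sum_list_addf case_prod_unfold o_def)
    finally show ?thesis .
  qed
  then show ?case by blast
qed simp

subsection \<open>Multi-indices as lists of basis vectors\<close>

text \<open>The degree in the first variable, with \<open>n2\<close> for the second, of a list read
  either as a derivative or as a monomial. On basis vectors the test \<open>snd v = 0\<close>
  recognises the first factor.\<close>

definition n1 :: "('a::euclidean_space \<times> 'a) list \<Rightarrow> nat" where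
  "n1 ds = length (filter (\<lambda>v. snd v = 0) ds)"

definition n2 :: "('a::euclidean_space \<times> 'a) list \<Rightarrow> nat" where
  "n2 ds = length (filter (\<lambda>v. snd v \<noteq> 0) ds)"

lemma n1_simps [simp]:
  "n1 [] = 0" "n2 [] = 0" "n1 (d # ds) = (if snd d = 0 then Suc (n1 ds) else n1 ds)"
  "n2 (d # ds) = (if snd d = 0 then n2 ds else Suc (n2 ds))"
  "n1 (xs @ ys) = n1 xs + n1 ys" "n2 (xs @ ys) = n2 xs + n2 ys"
  by (auto simp: n1_def n2_def)

lemma n1_add_n2: "n1 ds + n2 ds = length ds"
  by (induction ds) auto

lemma n1_mset: "n1 ds = size (filter_mset (\<lambda>v. snd v = 0) (mset ds))"
  and n2_mset: "n2 ds = size (filter_mset (\<lambda>v. snd v \<noteq> 0) (mset ds))"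
  by (simp_all add: n1_def n2_def flip: mset_filter)

lemma splits_n:
  assumes "(as, bs) \<in> set (splits ds)"
  shows "n1 as + n1 bs = n1 ds" "n2 as + n2 bs = n2 ds" "length as + length bs = length ds"
    "set as \<subseteq> set ds" "set bs \<subseteq> set ds"
proof -
  note m = splits_mset[OF assms]
  show "n1 as + n1 bs = n1 ds" "n2 as + n2 bs = n2 ds"
    unfolding n1_mset n2_mset m[symmetric] by simp_all
  show "length as + length bs = length ds" by (metis m size_mset size_union)
  show "set as \<subseteq> set ds" "set bs \<subseteq> set ds"
    by (metis m set_mset_mset set_mset_union sup_ge1, metis m set_mset_mset set_mset_union sup_ge2)
qed

text \<open>\<open>fold\<close> applies the head of the basis list first, hence innermost, whereas
  \<open>dd\<close> puts the head outermost; \<open>rev\<close> reconciles the two orders.\<close>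

definition mlist :: "('a::euclidean_space \<Rightarrow> 'v) \<Rightarrow> ('a \<Rightarrow> nat) \<Rightarrow> 'a list \<Rightarrow> 'v list" where
  "mlist \<iota> \<alpha> bs = concat (map (\<lambda>b. replicate (\<alpha> b) (\<iota> b)) (rev bs))"

lemma funpow_pderivative: "(pderivative v ^^ k) f = dd (replicate k v) f"
  by (induction k) auto

lemma fold_mderiv:
  "fold (\<lambda>b. pderivative (\<iota> b) ^^ \<alpha> b) bs f = dd (mlist \<iota> \<alpha> bs) f"
  by (induction bs arbitrary: f) (simp_all add: mlist_def dd_append funpow_pderivative)

lemma basis_list: "distinct (basis_list :: 'a::euclidean_space list)" "set (basis_list :: 'a list) = Basis"
proof -
  have "\<exists>bs. distinct bs \<and> set bs = (Basis :: 'a set)"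
    using finite_distinct_list[OF finite_Basis] by blast
  from someI_ex[OF this] show "distinct (basis_list :: 'a list)" "set (basis_list :: 'a list) = Basis"
    by (auto simp: basis_list_def)
qed

lemma mixed_deriv_dd:
  "mixed_deriv \<alpha> \<beta> f = dd (mlist (\<lambda>b. (b, 0)) \<alpha> basis_list @ mlist (\<lambda>b. (0, b)) \<beta> basis_list) f"
  by (simp add: mixed_deriv_def mderiv_def fold_mderiv dd_append)

lemma mixed_deriv_list:
  fixes \<alpha> \<beta> :: "'a::euclidean_space \<Rightarrow> nat"
  defines "ds \<equiv> mlist (\<lambda>b. (b, 0)) \<alpha> basis_list @ mlist (\<lambda>b. (0, b)) \<beta> (basis_list :: 'a list)"
  shows "set ds \<subseteq> Basis" "n1 ds = mlength \<alpha>" "n2 ds = mlength \<beta>" "length ds = mlength \<alpha> + mlength \<beta>"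
proof -
  have b0: "\<forall>b\<in>set (basis_list :: 'a list). b \<in> Basis" by (simp add: basis_list)
  show "set ds \<subseteq> Basis"
    using b0 by (auto simp: ds_def mlist_def Basis_prod_def)
  have 1: "n1 (mlist (\<lambda>b. (b, 0::'a)) \<gamma> bs) = (\<Sum>b\<leftarrow>bs. \<gamma> b)" "n2 (mlist (\<lambda>b. (b, 0::'a)) \<gamma> bs) = 0"
    for \<gamma> and bs :: "'a list"
    by (induction bs) (simp_all add: mlist_def n1_def n2_def filter_concat filter_replicate)
  have 2: "n2 (mlist (\<lambda>b. (0::'a, b)) \<gamma> bs) = (\<Sum>b\<leftarrow>bs. \<gamma> b)" "n1 (mlist (\<lambda>b. (0::'a, b)) \<gamma> bs) = 0"
    if "0 \<notin> set bs" for \<gamma> and bs :: "'a list"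
    using that by (induction bs) (auto simp: mlist_def n1_def n2_def filter_concat filter_replicate)
  have z: "0 \<notin> set (basis_list :: 'a list)" by (simp add: basis_list)
  have s: "(\<Sum>b\<leftarrow>basis_list. \<gamma> b) = mlength \<gamma>" for \<gamma> :: "'a \<Rightarrow> nat"
    using basis_list by (metis mlength_def sum_list_distinct_conv_sum_set)
  show "n1 ds = mlength \<alpha>" "n2 ds = mlength \<beta>"
    by (simp_all add: ds_def 1 2 z s)
  then show "length ds = mlength \<alpha> + mlength \<beta>" using n1_add_n2[of ds] by simp
qed

lemma mset_mlist:
  "mset (mlist \<iota> \<alpha> bs) = (\<Sum>b\<leftarrow>bs. replicate_mset (\<alpha> b) (\<iota> b))"
  by (induction bs) (simp_all add: mlist_def)

text \<open>The multi-indices count the occurrences of each basis vector in \<open>ds\<close>, and a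
  derivative depends only on the multiset of its directions. Together with
  \<open>mixed_deriv_dd\<close> this makes bounds over lists and over multi-indices
  interchangeable.\<close>

lemma dd_mixed_deriv:
  fixes f :: "'a::euclidean_space \<times> 'a \<Rightarrow> complex"
  assumes f: "C_infinity f" and ds: "set ds \<subseteq> Basis"
  shows "\<exists>\<alpha> \<beta>. dd ds f = mixed_deriv \<alpha> \<beta> f \<and> mlength \<alpha> = n1 ds \<and> mlength \<beta> = n2 ds"
proof -
  define \<alpha> \<beta> where "\<alpha> b = count (mset ds) (b, 0)" and "\<beta> b = count (mset ds) (0, b)" for b
  let ?es = "mlist (\<lambda>b. (b, 0)) \<alpha> basis_list @ mlist (\<lambda>b. (0, b)) \<beta> basis_list"
  have *: "(\<Sum>b\<leftarrow>basis_list. replicate_mset (\<gamma> b) (\<iota> b)) = (\<Sum>b\<in>Basis. replicate_mset (\<gamma> b) (\<iota> b))"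
    for \<gamma> :: "'a \<Rightarrow> nat" and \<iota> :: "'a \<Rightarrow> 'a \<times> 'a"
    using basis_list by (metis sum_list_distinct_conv_sum_set)
  have "count (mset ?es) v = count (mset ds) v" for v
  proof -
    have c: "count (mset ?es) v = (\<Sum>b\<in>Basis. if (b, 0) = v then \<alpha> b else 0) + (\<Sum>b\<in>Basis. if (0, b) = v then \<beta> b else 0)"
      by (simp add: mset_mlist * count_sum count_replicate_mset if_distrib[of "count _"] eq_commute[of v] cong: if_cong)
    show ?thesis
    proof (cases "v \<in> Basis")
      case True
      then consider b where "v = (b, 0)" "b \<in> Basis" | b where "v = (0, b)" "b \<in> Basis"
        by (auto simp: Basis_prod_def)
      then show ?thesis
      proof cases
        case 1
        then have "(\<Sum>b\<in>Basis. if (0, b) = v then \<beta> b else 0) = 0" by (intro sum.neutral) auto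
        moreover have "(\<Sum>b\<in>Basis. if (b, 0) = v then \<alpha> b else 0) = \<alpha> b" using 1 by simp
        ultimately show ?thesis using c 1 by (simp add: \<alpha>_def)
      next
        case 2
        then have "(\<Sum>b\<in>Basis. if (b, 0) = v then \<alpha> b else 0) = 0" by (intro sum.neutral) auto
        moreover have "(\<Sum>b\<in>Basis. if (0, b) = v then \<beta> b else 0) = \<beta> b" using 2 by simp
        ultimately show ?thesis using c 2 by (simp add: \<beta>_def)
      qed
    next
      case False
      then have "count (mset ds) v = 0" using ds by (auto simp: count_eq_zero_iff)
      moreover have "(\<Sum>b\<in>Basis. if (b, 0) = v then \<alpha> b else 0) = 0" "(\<Sum>b\<in>Basis. if (0, b) = v then \<beta> b else 0) = 0"
        using False by (auto intro!: sum.neutral simp: Basis_prod_def)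
      ultimately show ?thesis using c by presburger
    qed
  qed
  then have m: "mset ?es = mset ds" by (rule multiset_eqI)
  then have "dd ds f = mixed_deriv \<alpha> \<beta> f"
    unfolding mixed_deriv_dd using f dd_mset by metis
  moreover have "n1 ?es = n1 ds" "n2 ?es = n2 ds" using m by (simp_all only: n1_mset n2_mset)
  ultimately show ?thesis using mixed_deriv_list[of \<alpha> \<beta>] by metis
qed

subsection \<open>Lattices\<close>

lemma is_basis_coords:
  fixes E :: "'n::finite \<Rightarrow> real ^ 'n"
  assumes "is_basis E"
  shows "\<exists>t. x = (\<Sum>j\<in>UNIV. t j *\<^sub>R E j)"
proof -
  have "x \<in> span (range E)" using assms by (simp add: is_basis_def)
  then obtain u where "x = (\<Sum>v\<in>range E. u v *\<^sub>R v)"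
    using span_finite[of "range E"] by auto
  also have "\<dots> = (\<Sum>j\<in>UNIV. u (E j) *\<^sub>R E j)"
    using assms by (simp add: is_basis_def sum.reindex)
  finally show ?thesis by (intro exI[of _ "\<lambda>j. u (E j)"])
qed

text \<open>Fractional and integer parts of the coordinates. The hypothesis asks only that
  coordinates exist, which is the form available for \<open>E\<close> and for the dual basis
  alike.\<close>

lemma cell_lattice_decomposition:
  fixes E :: "'n::finite \<Rightarrow> real ^ 'n"
  assumes "\<And>x. \<exists>t. x = (\<Sum>j\<in>UNIV. t j *\<^sub>R E j)"
  shows "\<exists>x0\<in>cell E. \<exists>k\<in>lattice_of E. x = x0 + k"
proof -
  obtain t where t: "x = (\<Sum>j\<in>UNIV. t j *\<^sub>R E j)" using assms by blast
  let ?x0 = "\<Sum>j\<in>UNIV. frac (t j) *\<^sub>R E j" and ?k = "\<Sum>j\<in>UNIV. of_int \<lfloor>t j\<rfloor> *\<^sub>R E j"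
  have "?x0 \<in> cell E"
    unfolding cell_def by (auto intro!: exI[of _ "\<lambda>j. frac (t j)"] simp: frac_lt_1 less_imp_le)
  moreover have "?k \<in> lattice_of E"
    unfolding lattice_of_def by (auto intro!: exI[of _ "\<lambda>j. \<lfloor>t j\<rfloor>"])
  moreover have "x = ?x0 + ?k"
    unfolding t sum.distrib[symmetric] scaleR_add_left[symmetric] by (simp add: frac_def)
  ultimately show ?thesis by blast
qed

lemma compact_cell: "compact (cell (E :: 'n::finite \<Rightarrow> real ^ 'n))"
proof -
  have "cell E = (\<lambda>t :: real ^ 'n. \<Sum>j\<in>UNIV. (t $ j) *\<^sub>R E j) ` cbox 0 1"
  proof (intro set_eqI iffI)
    fix x assume "x \<in> cell E"
    then obtain t where t: "x = (\<Sum>j\<in>UNIV. t j *\<^sub>R E j)" "\<forall>j. 0 \<le> t j \<and> t j \<le> 1"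
      by (auto simp: cell_def)
    then show "x \<in> (\<lambda>t :: real ^ 'n. \<Sum>j\<in>UNIV. (t $ j) *\<^sub>R E j) ` cbox 0 1"
      by (intro image_eqI[of _ _ "\<chi> j. t j"]) (auto simp: mem_box_cart)
  next
    fix x assume "x \<in> (\<lambda>t :: real ^ 'n. \<Sum>j\<in>UNIV. (t $ j) *\<^sub>R E j) ` cbox 0 1"
    then show "x \<in> cell E" unfolding cell_def mem_box_cart image_iff by (auto simp: mem_box_cart)
  qed
  moreover have "compact ((\<lambda>t :: real ^ 'n. \<Sum>j\<in>UNIV. (t $ j) *\<^sub>R E j) ` cbox 0 1)"
    by (intro compact_continuous_image continuous_intros compact_cbox)
  ultimately show ?thesis by simp
qed

lemma bounded_cell: "\<exists>R>0. \<forall>x\<in>cell (E :: 'n::finite \<Rightarrow> real ^ 'n). norm x \<le> R"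
  using compact_imp_bounded[OF compact_cell] bounded_pos by blast

text \<open>This allows one exceptional null set per lattice vector to be merged into a single null
  set.\<close>

lemma countable_lattice: "countable (lattice_of (E :: 'n::finite \<Rightarrow> real ^ 'n))"
proof -
  have "countable (range (\<lambda>m :: 'n \<Rightarrow> int. \<Sum>j\<in>UNIV. of_int (m j) *\<^sub>R E j))" by simp
  then show ?thesis by (simp add: lattice_of_def full_SetCompr_eq)
qed

lemma uminus_lattice:
  assumes "k \<in> lattice_of E"
  shows "- k \<in> lattice_of E"
proof -
  from assms obtain m where "k = (\<Sum>j\<in>UNIV. of_int (m j) *\<^sub>R E j)" by (auto simp: lattice_of_def)
  then have "- k = (\<Sum>j\<in>UNIV. of_int (- m j) *\<^sub>R E j)" by (simp add: sum_negf)
  then show ?thesis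
    unfolding lattice_of_def by (intro CollectI exI[of _ "\<lambda>j. - m j"]) simp
qed

text \<open>With the vectors of \<open>E\<close> as rows of a matrix, the dual vectors are
  \<open>2 * pi\<close> times the columns of its inverse. As \<open>E\<close> spans, the inner
  products with \<open>E\<close> determine a vector; this yields both the uniqueness behind
  \<open>THE\<close> and the expansion in dual vectors.\<close>

lemma dual_basis:
  fixes E :: "'n::finite \<Rightarrow> real ^ 'n"
  assumes "is_basis E"
  shows "E j \<bullet> dual_basis E k = (if j = k then 2 * pi else 0)"
    and "\<exists>t. x = (\<Sum>j\<in>UNIV. t j *\<^sub>R dual_basis E j)"
proof -
  define A :: "real ^ 'n ^ 'n" where "A = (\<chi> j. E j)"
  have "rows A = range E" by (auto simp: rows_def row_def A_def)
  then have "\<exists>B. A ** B = mat 1"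
    using assms matrix_left_invertible_span_rows[of A] matrix_left_right_inverse[of _ A]
    by (auto simp: is_basis_def)
  then obtain B where B: "A ** B = mat 1" by blast
  define D where "D k = (2 * pi) *\<^sub>R column k B" for k
  have col: "E j \<bullet> column k B = (if j = k then 1 else 0)" for j k
  proof -
    have "E j \<bullet> column k B = (A ** B) $ j $ k"
      by (simp add: A_def matrix_matrix_mult_def inner_vec_def column_def)
    then show ?thesis by (simp add: B mat_def)
  qed
  have D: "\<forall>j k. E j \<bullet> D k = (if j = k then 2 * pi else 0)"
    by (simp add: D_def col)
  have inj: "u = v" if uv: "\<And>j. E j \<bullet> u = E j \<bullet> v" for u v
  proof -
    obtain t where "u - v = (\<Sum>j\<in>UNIV. t j *\<^sub>R E j)" using is_basis_coords[OF assms] by blast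
    then have "(u - v) \<bullet> (u - v) = (\<Sum>j\<in>UNIV. t j * (E j \<bullet> (u - v)))"
      by (metis (no_types, lifting) inner_scaleR_left inner_sum_left sum.cong)
    also have "\<dots> = 0" using uv by (simp add: inner_diff_right)
    finally show ?thesis by simp
  qed
  have "dual_basis E = D" unfolding dual_basis_def
  proof (rule the_equality)
    fix D' assume D': "\<forall>j k. E j \<bullet> D' k = (if j = k then 2 * pi else 0)"
    show "D' = D" using D D' by (intro ext inj) simp
  qed (fact D)
  then show "E j \<bullet> dual_basis E k = (if j = k then 2 * pi else 0)" using D by simp
  have "x = (\<Sum>j\<in>UNIV. (E j \<bullet> x / (2 * pi)) *\<^sub>R D j)"
    using D by (intro inj) (simp add: inner_sum_right if_distrib[of "(*) _"] cong: if_cong)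
  with \<open>dual_basis E = D\<close> show "\<exists>t. x = (\<Sum>j\<in>UNIV. t j *\<^sub>R dual_basis E j)" by metis
qed

subsection \<open>Factorials\<close>

lemma fact_mult_le_fact_add: "fact m * fact n \<le> (fact (m + n) :: real)"
proof -
  have "fact m * fact n dvd (fact (m + n) :: nat)" by (rule fact_fact_dvd_fact)
  then have "fact m * fact n \<le> (fact (m + n) :: nat)" by (rule dvd_imp_le) simp
  then have "real (fact m * fact n) \<le> real (fact (m + n))" by (simp only: of_nat_le_iff)
  then show ?thesis by simp
qed

lemma fact_add_le: "fact (m + n) \<le> 2 ^ (m + n) * (fact m * fact n :: real)"
proof -
  have "(m + n) choose m \<le> 2 ^ (m + n)" by (rule binomial_le_pow2)
  then have "fact m * fact n * ((m + n) choose m) \<le> fact m * fact n * (2 ^ (m + n) :: nat)"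
    by (intro mult_left_mono) auto
  moreover have "fact m * fact n * ((m + n) choose m) = (fact (m + n) :: nat)"
    using binomial_fact_lemma[of m "m + n"] by simp
  ultimately have "real (fact (m + n)) \<le> real (fact m * fact n * (2 ^ (m + n) :: nat))"
    by (simp only: of_nat_le_iff)
  then show ?thesis by (simp add: mult_ac)
qed

lemma fact_powr_mult_le:
  assumes "s \<ge> 0"
  shows "fact m powr s * fact n powr s \<le> (fact (m + n) :: real) powr s"
  using fact_mult_le_fact_add[of m n] assms by (simp add: powr_mult[symmetric] powr_mono2)

lemma fact_powr_add_le:
  assumes "s \<ge> 0"
  shows "fact (m + n) powr s \<le> (2 powr s) ^ (m + n) * (fact m powr s * fact n powr s :: real)"
proof -
  have "fact (m + n) powr s \<le> (2 ^ (m + n) * (fact m * fact n :: real)) powr s"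
    using fact_add_le assms by (intro powr_mono2) auto
  also have "\<dots> = (2 powr s) ^ (m + n) * (fact m powr s * fact n powr s)"
    by (simp add: powr_mult powr_powr powr_realpow[symmetric] mult.commute)
  finally show ?thesis .
qed

lemma fact_powr_mono: "s \<ge> 0 \<Longrightarrow> m \<le> n \<Longrightarrow> fact m powr s \<le> (fact n :: real) powr s"
  by (intro powr_mono2 fact_mono) auto

lemma mfact_le: "mfact \<alpha> \<le> fact (mlength \<alpha>)"
proof -
  have "(\<Prod>b\<in>S. fact (\<alpha> b)) \<le> (fact (\<Sum>b\<in>S. \<alpha> b) :: real)" if "finite S" for S :: "'a set"
    using that
  proof (induction S)
    case (insert b S)
    then have "(\<Prod>b\<in>insert b S. fact (\<alpha> b)) \<le> (fact (\<alpha> b) * fact (\<Sum>b\<in>S. \<alpha> b) :: real)"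
      by (simp add: mult_left_mono)
    also have "\<dots> \<le> fact (\<alpha> b + (\<Sum>b\<in>S. \<alpha> b))" by (rule fact_mult_le_fact_add)
    finally show ?case using insert by simp
  qed simp
  then show ?thesis by (simp add: mfact_def mlength_def)
qed

lemma mfact_ge_1: "mfact \<alpha> \<ge> 1"
  unfolding mfact_def by (intro prod_ge_1) (simp add: fact_ge_1)

lemma mfact_pos [simp]: "mfact \<alpha> > 0" "mfact \<alpha> \<noteq> 0"
  using mfact_ge_1[of \<alpha>] by auto

text \<open>The converse of \<open>mfact_le\<close> up to a geometric factor, which every seminorm
  absorbs into \<open>h\<close>. Hence factorials of multi-indices can be traded for factorials of
  their lengths.\<close>

lemma fact_mlength_le:
  fixes \<alpha> :: "'a::euclidean_space \<Rightarrow> nat"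
  shows "fact (mlength \<alpha>) \<le> (2 ^ DIM('a)) ^ mlength \<alpha> * mfact \<alpha>"
proof -
  have "(fact (\<Sum>b\<in>S. \<alpha> b) :: real) \<le> (2 ^ card S) ^ (\<Sum>b\<in>S. \<alpha> b) * (\<Prod>b\<in>S. fact (\<alpha> b))"
    if "finite S" for S :: "'a set"
    using that
  proof (induction S)
    case (insert b S)
    let ?n = "\<Sum>b\<in>S. \<alpha> b"
    have "fact (\<alpha> b + ?n) \<le> 2 ^ (\<alpha> b + ?n) * (fact (\<alpha> b) * fact ?n :: real)" by (rule fact_add_le)
    also have "\<dots> \<le> 2 ^ (\<alpha> b + ?n) * (fact (\<alpha> b) * ((2 ^ card S) ^ ?n * (\<Prod>b\<in>S. fact (\<alpha> b))))"
      by (intro mult_left_mono insert) auto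
    also have "\<dots> \<le> 2 ^ (\<alpha> b + ?n) * (fact (\<alpha> b) * ((2 ^ card S) ^ (\<alpha> b + ?n) * (\<Prod>b\<in>S. fact (\<alpha> b))))"
      by (intro mult_left_mono mult_right_mono power_increasing prod_nonneg) auto
    also have "\<dots> = (2 ^ card (insert b S)) ^ (\<Sum>b\<in>insert b S. \<alpha> b) * (\<Prod>b\<in>insert b S. fact (\<alpha> b))"
      using insert by (simp add: power_mult_distrib mult_ac)
    finally show ?case using insert by simp
  qed simp
  then show ?thesis by (simp add: mfact_def mlength_def)
qed

subsection \<open>Words of multiplications and derivatives\<close>

datatype 'v letter = Mul 'v | Der 'v

fun act1 :: "'v::euclidean_space letter \<Rightarrow> ('v \<Rightarrow> complex) \<Rightarrow> 'v \<Rightarrow> complex" where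
  "act1 (Mul v) f = (\<lambda>X. of_real (X \<bullet> v) * f X)"
| "act1 (Der v) f = pderivative v f"

definition act :: "'v::euclidean_space letter list \<Rightarrow> ('v \<Rightarrow> complex) \<Rightarrow> 'v \<Rightarrow> complex" where
  "act ws f = foldr act1 ws f"

text \<open>Multiplication by a coordinate of the first variable and differentiation in the second
  variable are both governed by the exponent \<open>s\<close>; letters of this kind commute with each other.\<close>

fun ty :: "('a::euclidean_space \<times> 'a) letter \<Rightarrow> bool" where
  "ty (Mul v) \<longleftrightarrow> snd v = 0"
| "ty (Der v) \<longleftrightarrow> snd v \<noteq> 0"

fun vec_of :: "'v letter \<Rightarrow> 'v" where
  "vec_of (Mul v) = v"
| "vec_of (Der v) = v"

definition cs :: "('a::euclidean_space \<times> 'a) letter list \<Rightarrow> nat" where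
  "cs ws = length (filter ty ws)"

definition ct :: "('a::euclidean_space \<times> 'a) letter list \<Rightarrow> nat" where
  "ct ws = length (filter (\<lambda>l. \<not> ty l) ws)"

text \<open>Regularity and decay are measured by bounds of the form
  \<open>C * h ^ (a + b) * fact a powr s * fact b powr \<sigma>\<close> on all words of this class,
  whatever the order of the letters.\<close>

definition words :: "nat \<Rightarrow> nat \<Rightarrow> ('a::euclidean_space \<times> 'a) letter list set" where
  "words a b = {ws. vec_of ` set ws \<subseteq> Basis \<and> cs ws = a \<and> ct ws = b}"

lemma cs_ct_simps [simp]:
  "cs [] = 0" "ct [] = 0"
  "cs (l # ws) = (if ty l then Suc (cs ws) else cs ws)" "ct (l # ws) = (if ty l then ct ws else Suc (ct ws))"
  "cs (ws @ vs) = cs ws + cs vs" "ct (ws @ vs) = ct ws + ct vs"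
  by (auto simp: cs_def ct_def)

lemma cs_ct_map:
  "cs (map Mul ms) = n1 ms" "ct (map Mul ms) = n2 ms" "cs (map Der ms) = n2 ms" "ct (map Der ms) = n1 ms"
  by (induction ms) auto

lemma cs_ct_length: "cs ws + ct ws = length ws"
  by (induction ws) auto

lemma words_append: "ws \<in> words a b \<Longrightarrow> vs \<in> words c d \<Longrightarrow> ws @ vs \<in> words (a + c) (b + d)"
  by (auto simp: words_def)

lemma words_Nil [simp]: "[] \<in> words 0 0"
  by (simp add: words_def)

lemma words_Cons:
  "ws \<in> words a b \<Longrightarrow> vec_of l \<in> Basis \<Longrightarrow> l # ws \<in> words (if ty l then Suc a else a) (if ty l then b else Suc b)"
  by (simp add: words_def)

lemma act_simps [simp]:
  "act [] f = f" "act (l # ws) f = act1 l (act ws f)" "act (ws @ vs) f = act ws (act vs f)"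
  by (simp_all add: act_def)

lemma act_Mul: "act (map Mul ms) f X = (\<Prod>m\<leftarrow>ms. of_real (X \<bullet> m)) * f X"
  by (induction ms) (auto simp: mult_ac)

lemma act_Der: "act (map Der ds) f = dd ds f"
  by (induction ds) auto

lemma C_infinity_act1: "C_infinity f \<Longrightarrow> C_infinity (act1 l f)"
  by (cases l) (auto intro: C_infinity_pderivative C_infinity_mult C_infinity_inner)

lemma C_infinity_act: "C_infinity f \<Longrightarrow> C_infinity (act ws f)"
  by (induction ws) (auto intro: C_infinity_act1)

lemma act_add:
  "C_infinity f \<Longrightarrow> C_infinity g \<Longrightarrow> act ws (\<lambda>X. f X + g X) = (\<lambda>X. act ws f X + act ws g X)"
proof (induction ws)
  case (Cons l ws)
  then show ?case
    by (cases l) (auto simp: pderivative_add C_infinity_differentiable C_infinity_act algebra_simps)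
qed simp

text \<open>A linear factor survives at most one derivative, so commuting
  \<open>X \<bullet> m\<close> past the derivatives costs one correction term for each occurrence of
  \<open>m\<close> in \<open>ds\<close>.\<close>

lemma dd_inner_mult:
  assumes f: "C_infinity f" and m: "m \<in> Basis" and ds: "set ds \<subseteq> Basis"
  shows "dd ds (\<lambda>X. of_real (X \<bullet> m) * f X) =
    (\<lambda>X. of_real (X \<bullet> m) * dd ds f X + of_nat (count_list ds m) * dd (remove1 m ds) f X)"
  using ds
proof (induction ds)
  case (Cons d ds)
  have sm: "C_infinity (\<lambda>X. of_real (X \<bullet> m) * dd ds f X)"
    "C_infinity (\<lambda>X. of_nat (count_list ds m) * dd (remove1 m ds) f X)"
    by (intro C_infinity_mult C_infinity_inner C_infinity_dd C_infinity_const f)+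
  have "dd (d # ds) (\<lambda>X. of_real (X \<bullet> m) * f X) X =
      of_real (d \<bullet> m) * dd ds f X + of_real (X \<bullet> m) * dd (d # ds) f X +
      of_nat (count_list ds m) * dd (d # remove1 m ds) f X" for X
    using Cons sm f
    by (simp add: pderivative_add pderivative_mult pderivative_const pderivative_inner C_infinity_differentiable
        C_infinity_inner C_infinity_dd C_infinity_const)
  moreover have "of_nat (count_list ds m) * dd (m # remove1 m ds) f X = of_nat (count_list ds m) * dd ds f X" for X
  proof (cases "m \<in> set ds")
    case True
    then have "mset (m # remove1 m ds) = mset ds" by simp
    then show ?thesis using dd_mset[OF f] by metis
  qed (simp add: count_list_0_iff)
  moreover have "d \<bullet> m = (if d = m then 1 else 0)" using Cons.prems m by (simp add: inner_Basis)
  ultimately show ?case by (auto simp: algebra_simps)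
qed simp

definition npos :: "'v letter list \<Rightarrow> nat" where "npos ws = length (filter (\<lambda>l. \<exists>v. l = Mul v) ws)"
definition nder :: "'v letter list \<Rightarrow> nat" where "nder ws = length (filter (\<lambda>l. \<exists>v. l = Der v) ws)"

text \<open>Moving all derivatives to the right produces, for each number \<open>k\<close> of contractions of a
  derivative with a multiplication, at most \<open>(p choose k) q! / (q - k)!\<close> terms, where \<open>p\<close> and \<open>q\<close> are the
  numbers of multiplications and derivatives.\<close>

lemma act_normal_order:
  fixes f :: "('a::euclidean_space \<times> 'a) \<Rightarrow> complex"
  assumes "C_infinity f" "vec_of ` set ws \<subseteq> Basis"
    and "\<And>k ms ds. set ms \<subseteq> Basis \<Longrightarrow> set ds \<subseteq> Basis \<Longrightarrow> n1 ms + n2 ds + k = cs ws \<Longrightarrow> n2 ms + n1 ds + k = ct ws \<Longrightarrow>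
      length ds + k = nder ws \<Longrightarrow> length ms + k = npos ws \<Longrightarrow>
      fact (nder ws) / fact (nder ws - k) * norm (act (map Mul ms) (dd ds f) X) \<le> B"
  shows "norm (act ws f X) \<le> 2 ^ npos ws * B"
  using assms
proof (induction ws arbitrary: f B rule: rev_induct)
  case Nil
  then show ?case using Nil(3)[of "[]" "[]" 0] by (simp add: npos_def nder_def)
next
  case (snoc l ws)
  show ?case
  proof (cases l)
    case (Der d)
    have d: "d \<in> Basis" using snoc.prems(2) Der by auto
    have np: "npos (ws @ [l]) = npos ws" "nder (ws @ [l]) = Suc (nder ws)" by (simp_all add: npos_def nder_def Der)
    \<comment> \<open>A last letter \<open>Der\<close> is absorbed into the function. The number
      \<open>q\<close> of derivatives of the word drops by one, and \<open>q! / (q - k)!\<close>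
      increases with \<open>q\<close>, so the hypothesis for the longer word suffices.\<close>
    have "norm (act ws (pderivative d f) X) \<le> 2 ^ npos ws * B"
    proof (rule snoc.IH)
      show "C_infinity (pderivative d f)" using snoc.prems(1) by (rule C_infinity_pderivative)
      fix k :: nat and ms ds :: "('a \<times> 'a) list"
      assume A: "set ms \<subseteq> Basis" "set ds \<subseteq> Basis" "n1 ms + n2 ds + k = cs ws" "n2 ms + n1 ds + k = ct ws"
        "length ds + k = nder ws" "length ms + k = npos ws"
      have eq: "dd ds (pderivative d f) = dd (ds @ [d]) f" by (simp add: dd_append)
      have "fact (nder ws) / fact (nder ws - k) * norm (act (map Mul ms) (dd (ds @ [d]) f) X) \<le>
          fact (Suc (nder ws)) / fact (Suc (nder ws) - k) * norm (act (map Mul ms) (dd (ds @ [d]) f) X)"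
      proof (rule mult_right_mono)
        have k: "k \<le> nder ws" using A by simp
        have "fact (nder ws) * (real (Suc (nder ws) - k) * fact (nder ws - k)) \<le> (real (Suc (nder ws)) * fact (nder ws)) * (fact (nder ws - k) :: real)"
          by (simp add: mult_ac mult_left_mono)
        then show "fact (nder ws) / fact (nder ws - k) \<le> (fact (Suc (nder ws)) / fact (Suc (nder ws) - k) :: real)"
          using k by (simp add: Suc_diff_le divide_le_eq le_divide_eq mult_ac)
      qed simp
      also have "\<dots> \<le> B"
        using snoc.prems(3)[of ms "ds @ [d]" k] A d unfolding np by (auto simp: Der)
      finally show "fact (nder ws) / fact (nder ws - k) * norm (act (map Mul ms) (dd ds (pderivative d f)) X) \<le> B"
        unfolding eq .
    qed (use snoc.prems in auto)
    then show ?thesis by (simp add: Der npos_def)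
  next
    case (Mul m)
    have m: "m \<in> Basis" using snoc.prems(2) Mul by auto
    have np: "npos (ws @ [l]) = Suc (npos ws)" "nder (ws @ [l]) = nder ws" by (simp_all add: npos_def nder_def Mul)
    \<comment> \<open>A last letter \<open>Mul\<close> gives an uncontracted term and one with an
      additional contraction; this is the factor 2 per multiplication.\<close>
    have "norm (act ws (\<lambda>X. of_real (X \<bullet> m) * f X) X) \<le> 2 ^ npos ws * (2 * B)"
    proof (rule snoc.IH)
      show "C_infinity (\<lambda>X. of_real (X \<bullet> m) * f X)" by (intro C_infinity_mult C_infinity_inner snoc.prems)
      fix k :: nat and ms ds :: "('a \<times> 'a) list"
      assume A: "set ms \<subseteq> Basis" "set ds \<subseteq> Basis" "n1 ms + n2 ds + k = cs ws" "n2 ms + n1 ds + k = ct ws"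
        "length ds + k = nder ws" "length ms + k = npos ws"
      let ?P = "norm (\<Prod>m\<leftarrow>ms. complex_of_real (X \<bullet> m))"
      let ?F = "fact (nder ws) / fact (nder ws - k) :: real"
      have F: "?F \<ge> 0" by simp
      have 1: "?F * (?P * norm (of_real (X \<bullet> m) * dd ds f X)) \<le> B"
        using snoc.prems(3)[of "m # ms" ds k] A m unfolding np
        by (auto simp: Mul act_Mul norm_mult mult_ac split: if_splits)
      have 2: "?F * (?P * norm (of_nat (count_list ds m) * dd (remove1 m ds) f X)) \<le> B"
      proof (cases "m \<in> set ds")
        case True
        then have len: "length ds = Suc (length (remove1 m ds))"
          using length_pos_if_in_set[OF True] by (simp add: length_remove1)
        have ms: "mset ds = mset (m # remove1 m ds)" using True by simp
        have n: "n1 ds = (if snd m = 0 then Suc (n1 (remove1 m ds)) else n1 (remove1 m ds))"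
          "n2 ds = (if snd m = 0 then n2 (remove1 m ds) else Suc (n2 (remove1 m ds)))"
          unfolding n1_mset n2_mset ms by simp_all
        have B: "fact (nder ws) / fact (nder ws - Suc k) * (?P * norm (dd (remove1 m ds) f X)) \<le> B"
          using snoc.prems(3)[of ms "remove1 m ds" "Suc k"] A n len set_remove1_subset[of m ds] unfolding np
          by (auto simp: Mul act_Mul norm_mult split: if_splits)
        have "count_list ds m \<le> length ds" by (rule count_le_length)
        moreover have "length ds = nder ws - k" using A by simp
        ultimately have c: "count_list ds m \<le> nder ws - k" by simp
        have q: "nder ws - k = Suc (nder ws - Suc k)" using A len by simp
        \<comment> \<open>After \<open>k\<close> contractions only \<open>q - k\<close> derivatives
          are left to meet the new multiplication, and this factor turns
          \<open>q! / (q - k)!\<close> into \<open>q! / (q - k - 1)!\<close>.\<close>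
        have "?F * count_list ds m \<le> ?F * (nder ws - k)"
          using c by (intro mult_left_mono) auto
        also have "\<dots> = fact (nder ws) / fact (nder ws - Suc k)"
          unfolding q by (simp del: of_nat_Suc)
        finally have "?F * count_list ds m * (?P * norm (dd (remove1 m ds) f X)) \<le>
            fact (nder ws) / fact (nder ws - Suc k) * (?P * norm (dd (remove1 m ds) f X))"
          by (intro mult_right_mono) auto
        with B show ?thesis by (simp add: norm_mult mult_ac)
      next
        case False
        have "0 \<le> ?F * (?P * norm (of_real (X \<bullet> m) * dd ds f X))" by simp
        with 1 have "0 \<le> B" by linarith
        then show ?thesis using False by (simp add: count_list_0_iff)
      qed
      have "norm (act (map Mul ms) (dd ds (\<lambda>X. of_real (X \<bullet> m) * f X)) X) \<le>
          ?P * norm (of_real (X \<bullet> m) * dd ds f X) + ?P * norm (of_nat (count_list ds m) * dd (remove1 m ds) f X)"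
        unfolding dd_inner_mult[OF snoc.prems(1) m A(2)] act_Mul norm_mult[of "prod_list _"] distrib_left[symmetric]
        by (intro mult_left_mono norm_triangle_ineq) auto
      then have "?F * norm (act (map Mul ms) (dd ds (\<lambda>X. of_real (X \<bullet> m) * f X)) X) \<le>
          ?F * (?P * norm (of_real (X \<bullet> m) * dd ds f X) + ?P * norm (of_nat (count_list ds m) * dd (remove1 m ds) f X))"
        using F by (rule mult_left_mono)
      with 1 2 show "?F * norm (act (map Mul ms) (dd ds (\<lambda>X. of_real (X \<bullet> m) * f X)) X) \<le> 2 * B"
        unfolding distrib_left by linarith
    qed (use snoc.prems in auto)
    then show ?thesis unfolding np by (simp add: Mul)
  qed
qed

subsection \<open>Lebesgue integrals of products\<close>

lemma lborel_integral_prod_Basis: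
  fixes f :: "'v::euclidean_space \<Rightarrow> real \<Rightarrow> 'c::{real_normed_field,banach,second_countable_topology}"
  assumes int: "\<And>b. b \<in> Basis \<Longrightarrow> integrable lborel (f b)"
  shows "integrable lborel (\<lambda>X :: 'v. \<Prod>b\<in>Basis. f b (X \<bullet> b))"
    and "(LINT X|lborel. (\<Prod>b\<in>Basis. f b (X \<bullet> b))) = (\<Prod>b\<in>Basis. LINT t|lborel. f b t)"
proof -
  interpret product_sigma_finite "\<lambda>b :: 'v. lborel :: real measure"
    by standard
  let ?T = "\<lambda>f :: 'v \<Rightarrow> real. \<Sum>b\<in>Basis. f b *\<^sub>R b"
  let ?F = "\<lambda>X :: 'v. \<Prod>b\<in>Basis. f b (X \<bullet> b)"
  have T [measurable]: "?T \<in> (\<Pi>\<^sub>M b\<in>Basis. lborel) \<rightarrow>\<^sub>M borel" by measurable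
  have fm: "f b \<in> borel_measurable borel" if "b \<in> Basis" for b
    using borel_measurable_integrable[OF int[OF that]] by simp
  have F [measurable]: "?F \<in> borel_measurable borel"
    by (intro borel_measurable_prod measurable_compose[OF _ fm]) auto
  have TF: "?F (?T g) = (\<Prod>b\<in>Basis. f b (g b))" for g
    by (simp add: inner_sum_left_Basis)
  have *: "integrable (\<Pi>\<^sub>M b\<in>Basis. lborel) (\<lambda>g. \<Prod>b\<in>Basis. f b (g b))"
    by (rule product_integrable_prod) (auto intro: int)
  show "integrable lborel ?F"
    by (subst lborel_eq, subst integrable_distr_eq) (simp_all only: TF * T F)
  show "(LINT X|lborel. ?F X) = (\<Prod>b\<in>Basis. LINT t|lborel. f b t)"
    by (subst lborel_eq, subst integral_distr)
       (simp_all only: TF T F product_integral_prod[OF finite_Basis int])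
qed

lemma integrable_lborel_affine:
  fixes f :: "'v::euclidean_space \<Rightarrow> 'c::{banach,second_countable_topology}"
  assumes "c \<noteq> 0" "integrable lborel f"
  shows "integrable lborel (\<lambda>X. f (A + c *\<^sub>R X))"
proof -
  have [measurable]: "f \<in> borel_measurable borel" using borel_measurable_integrable[OF assms(2)] by simp
  have "integrable (density (distr lborel borel (\<lambda>X. A + c *\<^sub>R X)) (\<lambda>_. ennreal (\<bar>c\<bar>^DIM('v)))) f"
    using lborel_affine[OF assms(1), of A] assms(2) by (simp add: ennreal_power)
  then have "integrable (distr lborel borel (\<lambda>X. A + c *\<^sub>R X)) (\<lambda>X. \<bar>c\<bar>^DIM('v) *\<^sub>R f X)"
    by (subst (asm) integrable_density) auto
  then have "integrable lborel (\<lambda>X. \<bar>c\<bar>^DIM('v) *\<^sub>R f (A + c *\<^sub>R X))"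
    by (subst (asm) integrable_distr_eq) auto
  then have "integrable lborel (\<lambda>X. inverse (\<bar>c\<bar>^DIM('v)) *\<^sub>R (\<bar>c\<bar>^DIM('v) *\<^sub>R f (A + c *\<^sub>R X)))"
    by (rule integrable_scaleR_right)
  then show ?thesis using assms(1) by simp
qed

lemma integral_lborel_affine:
  fixes f :: "'v::euclidean_space \<Rightarrow> 'c::{banach,second_countable_topology}"
  assumes "c \<noteq> 0" and [measurable]: "f \<in> borel_measurable borel"
  shows "(LINT X|lborel. f X) = \<bar>c\<bar>^DIM('v) *\<^sub>R (LINT X|lborel. f (A + c *\<^sub>R X))"
proof -
  have "(LINT X|lborel. f X) = integral\<^sup>L (density (distr lborel borel (\<lambda>X. A + c *\<^sub>R X)) (\<lambda>_. ennreal (\<bar>c\<bar>^DIM('v)))) f"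
    using lborel_affine[OF assms(1), of A] by (simp add: ennreal_power)
  also have "\<dots> = (LINT X|distr lborel borel (\<lambda>X. A + c *\<^sub>R X). \<bar>c\<bar>^DIM('v) *\<^sub>R f X)"
    by (subst integral_density) auto
  also have "\<dots> = (LINT X|lborel. \<bar>c\<bar>^DIM('v) *\<^sub>R f (A + c *\<^sub>R X))"
    by (subst integral_distr) auto
  finally show ?thesis by simp
qed

lemma integrable_lborel_shift:
  fixes f :: "'v::euclidean_space \<Rightarrow> 'c::{banach,second_countable_topology}"
  assumes "integrable lborel f"
  shows "integrable lborel (\<lambda>X. f (X - A))" "integrable lborel (\<lambda>X. f (X + A))" "integrable lborel (\<lambda>X. f (A - X))"
  using integrable_lborel_affine[OF _ assms, of 1 "-A"] integrable_lborel_affine[OF _ assms, of 1 A]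
    integrable_lborel_affine[OF _ assms, of "-1" A] by (simp_all add: add.commute)

lemma integral_lborel_shift:
  fixes f :: "'v::euclidean_space \<Rightarrow> 'c::{banach,second_countable_topology}"
  assumes "f \<in> borel_measurable borel"
  shows "(LINT X|lborel. f (X - A)) = (LINT X|lborel. f X)" "(LINT X|lborel. f (X + A)) = (LINT X|lborel. f X)"
    "(LINT X|lborel. f (A - X)) = (LINT X|lborel. f X)"
  using integral_lborel_affine[OF _ assms, of 1 "-A"] integral_lborel_affine[OF _ assms, of 1 A]
    integral_lborel_affine[OF _ assms, of "-1" A] by (simp_all add: add.commute)

subsection \<open>Gaussians\<close>

text \<open>A rescaling of the characteristic function of the standard normal distribution.\<close>

lemma gaussian_1d:
  fixes \<epsilon> t :: real assumes "\<epsilon> > 0"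
  shows "integrable lborel (\<lambda>b. exp (\<i> * of_real (t * b)) * of_real (exp (- (\<epsilon> * b)\<^sup>2 / 2)))"
    and "(LINT b|lborel. exp (\<i> * of_real (t * b)) * of_real (exp (- (\<epsilon> * b)\<^sup>2 / 2))) =
      of_real (sqrt (2 * pi) / \<epsilon> * exp (- (t / \<epsilon>)\<^sup>2 / 2))"
proof -
  let ?g = "\<lambda>b. exp (\<i> * of_real (t / \<epsilon> * b)) * complex_of_real (exp (- b\<^sup>2 / 2))"
  have "integrable lborel (\<lambda>b :: real. exp (- b\<^sup>2 / 2))"
    using integrable_mult_right[OF integrable_std_normal_moment[of 0], of "sqrt (2 * pi)"]
    by (simp add: std_normal_density_def)
  then have r: "integrable lborel (\<lambda>b :: real. complex_of_real (exp (- b\<^sup>2 / 2)))"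
    by (rule integrable_of_real)
  have g: "integrable lborel ?g"
    by (rule Bochner_Integration.integrable_bound[OF r]) (auto simp: norm_mult)
  have "char std_normal_distribution (t / \<epsilon>) = (CLBINT b. of_real (std_normal_density b) * iexp (t / \<epsilon> * b))"
    unfolding char_def by (subst integral_density) (auto simp: scaleR_conv_of_real normal_density_nonneg)
  also have "\<dots> = (CLBINT b. of_real (1 / sqrt (2 * pi)) * ?g b)"
    by (intro Bochner_Integration.integral_cong) (auto simp: std_normal_density_def mult_ac)
  also have "\<dots> = of_real (1 / sqrt (2 * pi)) * (CLBINT b. ?g b)" by simp
  finally have G: "(CLBINT b. ?g b) = of_real (sqrt (2 * pi) * exp (- (t / \<epsilon>)\<^sup>2 / 2))"
    unfolding char_std_normal_distribution by (simp add: field_simps)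
  have eq: "?g (0 + \<epsilon> * b) = exp (\<i> * of_real (t * b)) * of_real (exp (- (\<epsilon> * b)\<^sup>2 / 2))" for b
    using assms by simp
  show "integrable lborel (\<lambda>b. exp (\<i> * of_real (t * b)) * of_real (exp (- (\<epsilon> * b)\<^sup>2 / 2)))"
    using lborel_integrable_real_affine[OF g, of \<epsilon> 0] assms unfolding eq by simp
  show "(LINT b|lborel. exp (\<i> * of_real (t * b)) * of_real (exp (- (\<epsilon> * b)\<^sup>2 / 2))) =
      of_real (sqrt (2 * pi) / \<epsilon> * exp (- (t / \<epsilon>)\<^sup>2 / 2))"
    using lborel_integral_real_affine[of \<epsilon> ?g 0] assms unfolding eq G
    by (simp add: scaleR_conv_of_real field_simps)
qed

definition gauss :: "'v::euclidean_space \<Rightarrow> real" where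
  "gauss W = exp (- (norm W)\<^sup>2 / 2)"

lemma gauss_facts [simp]:
  "gauss W \<ge> 0" "gauss W \<le> 1" "gauss 0 = 1" "gauss (- W) = gauss W" "\<bar>gauss W\<bar> = gauss W"
  by (simp_all add: gauss_def)

lemma gauss_measurable [measurable]: "gauss \<in> borel_measurable borel"
  by (intro borel_measurable_continuous_onI) (auto simp: gauss_def[abs_def] intro!: continuous_intros)

lemma norm_eq_sum_Basis: "(norm X)\<^sup>2 = (\<Sum>b\<in>Basis. (X \<bullet> b)\<^sup>2)"
  unfolding power2_norm_eq_inner by (subst euclidean_inner) (simp add: power2_eq_square)

lemma gaussian_integral:
  fixes T :: "'v::euclidean_space" assumes "\<epsilon> > 0"
  shows "integrable lborel (\<lambda>B. exp (\<i> * of_real (T \<bullet> B)) * of_real (gauss (\<epsilon> *\<^sub>R B)))"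
    and "(LINT B|lborel. exp (\<i> * of_real (T \<bullet> B)) * of_real (gauss (\<epsilon> *\<^sub>R B))) =
      of_real ((sqrt (2 * pi) / \<epsilon>) ^ DIM('v) * gauss (T /\<^sub>R \<epsilon>))"
proof -
  let ?f = "\<lambda>b t. exp (\<i> * of_real ((T \<bullet> b) * t)) * complex_of_real (exp (- (\<epsilon> * t)\<^sup>2 / 2))"
  have n: "gauss (\<epsilon> *\<^sub>R B) = (\<Prod>b\<in>Basis. exp (- (\<epsilon> * (B \<bullet> b))\<^sup>2 / 2))" for \<epsilon> and B :: 'v
    unfolding gauss_def norm_eq_sum_Basis by (simp add: exp_sum[symmetric] sum_negf sum_divide_distrib)
  have e: "exp (\<i> * of_real (T \<bullet> B)) = (\<Prod>b\<in>Basis. exp (\<i> * complex_of_real ((T \<bullet> b) * (B \<bullet> b))))" for B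
    by (subst euclidean_inner) (simp add: exp_sum[symmetric] sum_distrib_left)
  have eq: "exp (\<i> * of_real (T \<bullet> B)) * of_real (gauss (\<epsilon> *\<^sub>R B)) = (\<Prod>b\<in>Basis. ?f b (B \<bullet> b))" for B
    unfolding n e by (simp add: prod.distrib)
  show "integrable lborel (\<lambda>B. exp (\<i> * of_real (T \<bullet> B)) * of_real (gauss (\<epsilon> *\<^sub>R B)))"
    unfolding eq using gaussian_1d(1)[OF assms] by (rule lborel_integral_prod_Basis(1))
  have "(LINT B|lborel. exp (\<i> * of_real (T \<bullet> B)) * of_real (gauss (\<epsilon> *\<^sub>R B))) =
      (\<Prod>b\<in>Basis. LINT t|lborel. ?f b t)"
    unfolding eq using gaussian_1d(1)[OF assms] by (rule lborel_integral_prod_Basis(2))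
  also have "\<dots> = (\<Prod>b\<in>Basis. of_real (sqrt (2 * pi) / \<epsilon> * exp (- ((T \<bullet> b) / \<epsilon>)\<^sup>2 / 2)))"
    by (simp only: gaussian_1d(2)[OF assms])
  also have "\<dots> = of_real ((sqrt (2 * pi) / \<epsilon>) ^ DIM('v) * gauss (T /\<^sub>R \<epsilon>))"
  proof -
    have "gauss (T /\<^sub>R \<epsilon>) = (\<Prod>b\<in>Basis. exp (- ((T \<bullet> b) / \<epsilon>)\<^sup>2 / 2))"
    proof -
      have "inverse \<epsilon> * t = t / \<epsilon>" for t by (simp add: divide_inverse)
      then show ?thesis unfolding n by (simp only:)
    qed
    then show ?thesis
      unfolding of_real_prod[symmetric] by (simp only: prod.distrib prod_constant)
  qed
  finally show "(LINT B|lborel. exp (\<i> * of_real (T \<bullet> B)) * of_real (gauss (\<epsilon> *\<^sub>R B))) =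
      of_real ((sqrt (2 * pi) / \<epsilon>) ^ DIM('v) * gauss (T /\<^sub>R \<epsilon>))" .
qed

lemma gaussian_real:
  fixes dummy :: "'v::euclidean_space"
  shows "integrable lborel (\<lambda>W :: 'v. gauss W)"
    and "(LINT W|lborel. gauss (W :: 'v)) = sqrt (2 * pi) ^ DIM('v)"
proof -
  have i: "integrable lborel (\<lambda>W :: 'v. complex_of_real (gauss W))"
    using gaussian_integral(1)[of 1 "0::'v"] by simp
  from integrable_Re[OF i] show "integrable lborel (\<lambda>W :: 'v. gauss W)" by simp
  show "(LINT W|lborel. gauss (W :: 'v)) = sqrt (2 * pi) ^ DIM('v)"
    using gaussian_integral(2)[of 1 "0::'v"] integral_Re[OF i] by simp
qed

subsection \<open>Fourier inversion and uniqueness\<close>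

definition FT :: "('v::euclidean_space \<Rightarrow> complex) \<Rightarrow> 'v \<Rightarrow> complex" where
  "FT g B = (LINT X|lborel. exp (- \<i> * of_real (B \<bullet> X)) * g X)"

lemma integrable_unimodular:
  fixes g :: "'v::euclidean_space \<Rightarrow> complex"
  assumes "integrable lborel g" "u \<in> borel_measurable borel" "\<And>X. norm (u X) \<le> 1"
  shows "integrable lborel (\<lambda>X. u X * g X)"
proof (rule Bochner_Integration.integrable_bound[OF assms(1)])
  show "(\<lambda>X. u X * g X) \<in> borel_measurable lborel"
    using assms(2) borel_measurable_integrable[OF assms(1)] by simp
  show "AE X in lborel. norm (u X * g X) \<le> norm (g X)"
    using assms(3) by (auto simp: norm_mult intro!: mult_left_le_one_le)
qed

text \<open>\<open>FT g\<close> need not be integrable; the Gaussian factor makes the double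
  integral absolutely convergent. After Fubini the inner integral is the transform of a Gaussian,
  and the substitution of \<open>X + \<epsilon> *\<^sub>R W\<close> for \<open>Y\<close> turns it
  into a Gaussian average of \<open>g\<close> around \<open>X\<close>.\<close>

lemma FT_gaussian_regularisation:
  fixes g :: "'v::euclidean_space \<Rightarrow> complex"
  assumes g: "integrable lborel g" and "\<epsilon> > 0"
  shows "(LINT B|lborel. FT g B * exp (\<i> * of_real (B \<bullet> X)) * of_real (gauss (\<epsilon> *\<^sub>R B))) =
    of_real (sqrt (2 * pi) ^ DIM('v)) * (LINT W|lborel. g (X + \<epsilon> *\<^sub>R W) * of_real (gauss W))"
proof -
  have gm [measurable]: "g \<in> borel_measurable borel" using borel_measurable_integrable[OF g] by simp
  let ?G = "\<lambda>B :: 'v. gauss (\<epsilon> *\<^sub>R B)"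
  let ?K = "\<lambda>Y B. exp (- \<i> * of_real (B \<bullet> Y)) * g Y * exp (\<i> * of_real (B \<bullet> X)) * complex_of_real (?G B)"
  have Gi: "integrable lborel ?G"
  proof -
    have "integrable lborel (\<lambda>B :: 'v. complex_of_real (?G B))" using gaussian_integral(1)[OF assms(2), of "0::'v"] by simp
    from integrable_Re[OF this] show ?thesis by simp
  qed
  have Ki: "integrable (lborel \<Otimes>\<^sub>M lborel) (\<lambda>(Y, B). ?K Y B)"
  proof (rule lborel_pair.Fubini_integrable)
    show "(\<lambda>(Y, B). ?K Y B) \<in> borel_measurable (lborel \<Otimes>\<^sub>M lborel)" by measurable
    show "integrable lborel (\<lambda>Y. LINT B|lborel. norm (case (Y, B) of (Y, B) \<Rightarrow> ?K Y B))"
      using g by (simp add: norm_mult)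
    show "AE Y in lborel. integrable lborel (\<lambda>B. case (Y, B) of (Y, B) \<Rightarrow> ?K Y B)"
    proof (intro AE_I2)
      fix Y
      have "integrable lborel (\<lambda>B. (exp (- \<i> * of_real (B \<bullet> Y)) * exp (\<i> * of_real (B \<bullet> X))) * (g Y * complex_of_real (?G B)))"
        using Gi by (intro integrable_unimodular integrable_mult_right integrable_of_real) (auto simp: norm_mult)
      then show "integrable lborel (\<lambda>B. case (Y, B) of (Y, B) \<Rightarrow> ?K Y B)" by (simp add: mult_ac)
    qed
  qed
  have "(LINT B|lborel. FT g B * exp (\<i> * of_real (B \<bullet> X)) * of_real (?G B)) = (LINT B|lborel. LINT Y|lborel. ?K Y B)"
    unfolding FT_def by simp
  also have "\<dots> = (LINT Y|lborel. LINT B|lborel. ?K Y B)"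
    using lborel_pair.Fubini_integral[OF Ki] by simp
  also have "\<dots> = (LINT Y|lborel. g Y * (LINT B|lborel. exp (\<i> * of_real ((X - Y) \<bullet> B)) * of_real (?G B)))"
  proof (intro Bochner_Integration.integral_cong refl)
    fix Y
    have "?K Y B = g Y * (exp (\<i> * of_real ((X - Y) \<bullet> B)) * of_real (?G B))" for B
    proof -
      have "exp (- \<i> * complex_of_real (B \<bullet> Y)) * exp (\<i> * of_real (B \<bullet> X)) = exp (\<i> * of_real ((X - Y) \<bullet> B))"
        by (simp add: exp_add[symmetric] inner_commute algebra_simps)
      from arg_cong[OF this, of "\<lambda>z. g Y * (z * of_real (gauss (\<epsilon> *\<^sub>R B)))"]
      show ?thesis by (simp only: mult_ac)
    qed
    then have "(LINT B|lborel. ?K Y B) = (LINT B|lborel. g Y * (exp (\<i> * of_real ((X - Y) \<bullet> B)) * of_real (?G B)))"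
      by (simp only:)
    then show "(LINT B|lborel. ?K Y B) = g Y * (LINT B|lborel. exp (\<i> * of_real ((X - Y) \<bullet> B)) * of_real (?G B))"
      by simp
  qed
  also have "\<dots> = (LINT Y|lborel. g Y * of_real ((sqrt (2 * pi) / \<epsilon>) ^ DIM('v) * gauss ((X - Y) /\<^sub>R \<epsilon>)))"
    by (simp only: gaussian_integral(2)[OF assms(2)])
  also have "\<dots> = \<epsilon> ^ DIM('v) *\<^sub>R (LINT W|lborel. g (X + \<epsilon> *\<^sub>R W) *
      of_real ((sqrt (2 * pi) / \<epsilon>) ^ DIM('v) * gauss ((X - (X + \<epsilon> *\<^sub>R W)) /\<^sub>R \<epsilon>)))"
    using assms(2) by (subst integral_lborel_affine[of \<epsilon> _ X]) auto
  also have "\<dots> = \<epsilon> ^ DIM('v) *\<^sub>R (LINT W|lborel. of_real ((sqrt (2 * pi) / \<epsilon>) ^ DIM('v)) *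
      (g (X + \<epsilon> *\<^sub>R W) * of_real (gauss W)))"
    using assms(2) by (simp add: mult_ac)
  also have "\<dots> = of_real (sqrt (2 * pi) ^ DIM('v)) * (LINT W|lborel. g (X + \<epsilon> *\<^sub>R W) * of_real (gauss W))"
    using assms(2) by (simp add: scaleR_conv_of_real power_divide)
  finally show ?thesis .
qed

lemma gaussian_average_tendsto:
  fixes k :: "'v::euclidean_space \<Rightarrow> complex"
  assumes k: "continuous_on UNIV k" and bd: "\<And>X. norm (k X) \<le> M"
  shows "(\<lambda>n. LINT W|lborel. k (X + (1 / real (Suc n)) *\<^sub>R W) * of_real (gauss W))
    \<longlonglongrightarrow> of_real (sqrt (2 * pi) ^ DIM('v)) * k X"
proof -
  have [measurable]: "k \<in> borel_measurable borel" by (rule borel_measurable_continuous_onI[OF k])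
  let ?e = "\<lambda>W :: 'v. gauss W"
  have "(\<lambda>n. LINT W|lborel. k (X + (1 / real (Suc n)) *\<^sub>R W) * complex_of_real (?e W))
    \<longlonglongrightarrow> (LINT W|lborel. k X * complex_of_real (?e W))"
  proof (rule integral_dominated_convergence[where w = "\<lambda>W. M * ?e W"])
    show "integrable lborel (\<lambda>W. M * ?e W)" using gaussian_real(1)[where 'v='v] by simp
    show "AE W in lborel. (\<lambda>n. k (X + (1 / real (Suc n)) *\<^sub>R W) * of_real (?e W)) \<longlonglongrightarrow> k X * of_real (?e W)"
    proof (intro AE_I2 tendsto_mult tendsto_const)
      fix W
      have "(\<lambda>n. X + (1 / real (Suc n)) *\<^sub>R W) \<longlonglongrightarrow> X + 0 *\<^sub>R W"
        by (intro tendsto_intros LIMSEQ_Suc lim_1_over_n)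
      then show "(\<lambda>n. k (X + (1 / real (Suc n)) *\<^sub>R W)) \<longlonglongrightarrow> k X"
        using k continuous_on_tendsto_compose[of UNIV k] by simp
    qed
    show "AE W in lborel. norm (k (X + (1 / real (Suc n)) *\<^sub>R W) * of_real (?e W)) \<le> M * ?e W" for n
      using bd by (intro AE_I2) (simp add: norm_mult mult_right_mono)
  qed auto
  moreover have "(LINT W|lborel. k X * complex_of_real (?e W)) = k X * of_real (sqrt (2 * pi) ^ DIM('v))"
    using gaussian_real(2)[where 'v = 'v] by simp
  ultimately show ?thesis by (simp only: mult.commute[of "k X"])
qed

lemma FT_borel_measurable:
  assumes "g \<in> borel_measurable borel"
  shows "FT g \<in> borel_measurable borel"
proof -
  note [measurable] = assms
  have "(\<lambda>B. LINT X|lborel. exp (- \<i> * of_real (B \<bullet> X)) * g X) \<in> borel_measurable borel"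
    by (rule lborel.borel_measurable_lebesgue_integral) measurable
  then show ?thesis by (simp add: FT_def[abs_def])
qed

text \<open>Both sides of the regularised formula converge for
  \<open>\<epsilon> = 1 / (n + 1)\<close>: the left one by domination with
  \<open>norm (FT g B)\<close>, the right one by continuity and boundedness of
  \<open>g\<close>.\<close>

theorem fourier_inversion:
  fixes g :: "'v::euclidean_space \<Rightarrow> complex"
  assumes g: "integrable lborel g" "continuous_on UNIV g" "\<And>X. norm (g X) \<le> M"
    and FTg: "integrable lborel (FT g)"
  shows "(LINT B|lborel. FT g B * exp (\<i> * of_real (B \<bullet> X))) = of_real ((2 * pi) ^ DIM('v)) * g X"
proof -
  have [measurable]: "FT g \<in> borel_measurable borel" using borel_measurable_integrable[OF FTg] by simp
  let ?e = "\<lambda>n B. of_real (gauss ((1 / real (Suc n)) *\<^sub>R B))"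
  have "(\<lambda>n. LINT B|lborel. FT g B * exp (\<i> * of_real (B \<bullet> X)) * ?e n B) \<longlonglongrightarrow>
      (LINT B|lborel. FT g B * exp (\<i> * of_real (B \<bullet> X)) * of_real (gauss (0::'v)))"
  proof (rule integral_dominated_convergence[where w = "\<lambda>B. norm (FT g B)"])
    show "AE B in lborel. (\<lambda>n. FT g B * exp (\<i> * of_real (B \<bullet> X)) * ?e n B) \<longlonglongrightarrow>
        FT g B * exp (\<i> * of_real (B \<bullet> X)) * of_real (gauss (0::'v))"
    proof (intro AE_I2 tendsto_mult tendsto_const tendsto_of_real)
      fix B :: 'v
      have "(\<lambda>n. gauss ((1 / real (Suc n)) *\<^sub>R B)) \<longlonglongrightarrow> gauss (0 *\<^sub>R B)"
        unfolding gauss_def by (intro tendsto_intros LIMSEQ_Suc lim_1_over_n) simp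
      then show "(\<lambda>n. gauss ((1 / real (Suc n)) *\<^sub>R B)) \<longlonglongrightarrow> gauss (0::'v)" by simp
    qed
    show "AE B in lborel. norm (FT g B * exp (\<i> * of_real (B \<bullet> X)) * ?e n B) \<le> norm (FT g B)" for n
      by (intro AE_I2) (auto simp: norm_mult intro!: mult_left_le)
  qed (use FTg in auto)
  moreover have "(LINT B|lborel. FT g B * exp (\<i> * of_real (B \<bullet> X)) * ?e n B) =
      of_real (sqrt (2 * pi) ^ DIM('v)) * (LINT W|lborel. g (X + (1 / real (Suc n)) *\<^sub>R W) * of_real (gauss W))" for n
    by (rule FT_gaussian_regularisation[OF g(1)]) simp
  moreover have "(\<lambda>n. of_real (sqrt (2 * pi) ^ DIM('v)) * (LINT W|lborel. g (X + (1 / real (Suc n)) *\<^sub>R W) * of_real (gauss W)))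
      \<longlonglongrightarrow> of_real (sqrt (2 * pi) ^ DIM('v)) * (of_real (sqrt (2 * pi) ^ DIM('v)) * g X)"
    by (intro tendsto_mult tendsto_const gaussian_average_tendsto[OF g(2,3)])
  ultimately have eq: "(LINT B|lborel. FT g B * exp (\<i> * of_real (B \<bullet> X)) * of_real (gauss (0::'v))) =
      of_real (sqrt (2 * pi) ^ DIM('v)) * (of_real (sqrt (2 * pi) ^ DIM('v)) * g X)"
    by (auto intro: LIMSEQ_unique)
  have "sqrt (2 * pi) ^ DIM('v) * sqrt (2 * pi) ^ DIM('v) = (2 * pi) ^ DIM('v)"
  proof -
    have "sqrt (2 * pi) ^ DIM('v) * sqrt (2 * pi) ^ DIM('v) = (sqrt (2 * pi) * sqrt (2 * pi)) ^ DIM('v)"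
      by (rule power_mult_distrib[symmetric])
    then show ?thesis by (simp only: real_sqrt_mult_self) simp
  qed
  then have "complex_of_real (sqrt (2 * pi) ^ DIM('v)) * (of_real (sqrt (2 * pi) ^ DIM('v)) * g X) = of_real ((2 * pi) ^ DIM('v)) * g X"
    by (simp only: mult.assoc[symmetric] of_real_mult[symmetric])
  with eq show ?thesis by (simp only: gauss_facts of_real_1 mult_1_right)
qed

text \<open>As \<open>h\<close> is merely integrable, its Gaussian averages, which vanish, have no
  evident pointwise limit. The averaging is therefore transferred to bounded continuous functions
  \<open>k\<close>, where it converges. So \<open>h\<close> integrates to zero against all such
  \<open>k\<close>, then over closed sets, then over all Borel sets.\<close>

theorem FT_zero_imp_AE_zero:
  fixes h :: "'v::euclidean_space \<Rightarrow> complex"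
  assumes h: "integrable lborel h" and z: "\<And>B. FT h B = 0"
  shows "AE X in lborel. h X = 0"
proof -
  have hm [measurable]: "h \<in> borel_measurable borel" using borel_measurable_integrable[OF h] by simp
  let ?e = "\<lambda>W :: 'v. gauss W"
  have av: "(LINT W|lborel. h (X + \<epsilon> *\<^sub>R W) * of_real (?e W)) = 0" if "\<epsilon> > 0" for X \<epsilon>
    using FT_gaussian_regularisation[OF h that, of X] by (simp add: z)
  have cont: "(LINT Y|lborel. h Y * k Y) = 0"
    if k: "continuous_on UNIV k" and bd: "\<And>X. norm (k X) \<le> M" for k :: "'v \<Rightarrow> complex" and M
  proof -
    have [measurable]: "k \<in> borel_measurable borel" by (rule borel_measurable_continuous_onI[OF k])
    define M' where "M' = max M 0"
    have bd': "norm (k X) \<le> M'" for X using bd[of X] by (auto simp: M'_def)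
    have M': "M' \<ge> 0" by (simp add: M'_def)
    let ?k = "\<lambda>n Y. LINT W|lborel. k (Y + (1 / real (Suc n)) *\<^sub>R W) * complex_of_real (?e W)"
    have kb: "norm (?k n Y) \<le> M' * sqrt (2 * pi) ^ DIM('v)" for n Y
    proof -
      have "norm (?k n Y) \<le> (LINT W|lborel. M' * ?e W)"
      proof (rule Bochner_Integration.integral_norm_bound_integral)
        show "integrable lborel (\<lambda>W. k (Y + (1 / real (Suc n)) *\<^sub>R W) * complex_of_real (?e W))"
          by (rule Bochner_Integration.integrable_bound[of _ "\<lambda>W. M' * ?e W"])
             (use gaussian_real(1)[where 'v='v] bd' M' in \<open>auto simp: norm_mult intro!: mult_right_mono\<close>)
      qed (use gaussian_real(1)[where 'v='v] bd' in \<open>auto simp: norm_mult intro!: mult_right_mono\<close>)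
      then show ?thesis by (simp add: gaussian_real(2))
    qed
    have "(LINT Y|lborel. h Y * ?k n Y) = 0" for n
    proof -
      let ?d = "1 / real (Suc n)"
      let ?K = "\<lambda>Y W. h Y * (k (Y + ?d *\<^sub>R W) * complex_of_real (?e W))"
      have Ki: "integrable (lborel \<Otimes>\<^sub>M lborel) (\<lambda>(Y, W). ?K Y W)"
      proof (rule Bochner_Integration.integrable_bound[of _ "\<lambda>(Y, W). (M' * norm (h Y)) * ?e W"])
        show "integrable (lborel \<Otimes>\<^sub>M lborel) (\<lambda>(Y, W). (M' * norm (h Y)) * ?e W)"
        proof (rule lborel_pair.Fubini_integrable)
          show "integrable lborel (\<lambda>Y. LINT W|lborel. norm (case (Y, W) of (Y, W) \<Rightarrow> M' * norm (h Y) * ?e W))"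
            using h M' by (simp add: abs_mult)
        qed (use gaussian_real(1)[where 'v='v] in \<open>auto intro!: AE_I2\<close>)
        show "AE x in lborel \<Otimes>\<^sub>M lborel. norm (case x of (Y, W) \<Rightarrow> ?K Y W) \<le> norm (case x of (Y, W) \<Rightarrow> M' * norm (h Y) * ?e W)"
        proof (intro AE_I2, clarify)
          fix Y W :: 'v
          have "norm (h Y) * (norm (k (Y + ?d *\<^sub>R W)) * gauss W) \<le> norm (h Y) * (M' * gauss W)"
            by (intro mult_left_mono mult_right_mono bd') auto
          then show "norm (?K Y W) \<le> norm (M' * norm (h Y) * gauss W)"
            using M' by (simp add: norm_mult abs_mult mult_ac)
        qed
      qed measurable
      have "(LINT Y|lborel. h Y * ?k n Y) = (LINT Y|lborel. LINT W|lborel. ?K Y W)" by simp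
      also have "\<dots> = (LINT W|lborel. LINT Y|lborel. ?K Y W)"
        using lborel_pair.Fubini_integral[OF Ki] by simp
      \<comment> \<open>Translating \<open>Y\<close> by a multiple of \<open>W\<close> moves the
        average from \<open>k\<close> to \<open>h\<close>, up to the sign of \<open>W\<close>, which
        the even Gaussian does not notice.\<close>
      also have "\<dots> = (LINT W|lborel. LINT Y|lborel. ?K (Y - ?d *\<^sub>R W) W)"
        by (intro Bochner_Integration.integral_cong refl integral_lborel_shift(1)[symmetric]) measurable
      also have "\<dots> = (LINT W|lborel. LINT Y|lborel. k Y * (h (Y + ?d *\<^sub>R (- W)) * complex_of_real (?e (- W))))"
        by (simp add: mult_ac)
      also have "\<dots> = (LINT Y|lborel. LINT W|lborel. k Y * (h (Y + ?d *\<^sub>R (- W)) * complex_of_real (?e (- W))))"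
      proof -
        have *: "integrable (lborel \<Otimes>\<^sub>M lborel) (\<lambda>(W, Y). M' * (norm (h (Y + ?d *\<^sub>R (- W))) * ?e (- W)))"
        proof (rule lborel_pair.Fubini_integrable)
          have "(LINT Y|lborel. norm (h (Y + A))) = (LINT Y|lborel. norm (h Y))" for A
            by (rule integral_lborel_shift(2)[of "\<lambda>Y. norm (h Y)"]) measurable
          from this[of "- (?d *\<^sub>R W)" for W]
          show "integrable lborel (\<lambda>W. LINT Y|lborel. norm (case (W, Y) of (W, Y) \<Rightarrow> M' * (norm (h (Y + ?d *\<^sub>R (- W))) * ?e (- W))))"
            using gaussian_real(1)[where 'v='v] M' by simp
          show "AE W in lborel. integrable lborel (\<lambda>Y. case (W, Y) of (W, Y) \<Rightarrow> M' * (norm (h (Y + ?d *\<^sub>R (- W))) * ?e (- W)))"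
            using integrable_lborel_shift(1,2)[OF integrable_norm[OF h]] by (intro AE_I2) auto
        qed measurable
        have "integrable (lborel \<Otimes>\<^sub>M lborel) (\<lambda>(W, Y). k Y * (h (Y + ?d *\<^sub>R (- W)) * complex_of_real (?e (- W))))"
        proof (rule Bochner_Integration.integrable_bound[OF *])
          show "AE x in lborel \<Otimes>\<^sub>M lborel. norm (case x of (W, Y) \<Rightarrow> k Y * (h (Y + ?d *\<^sub>R (- W)) * complex_of_real (?e (- W)))) \<le>
              norm (case x of (W, Y) \<Rightarrow> M' * (norm (h (Y + ?d *\<^sub>R (- W))) * ?e (- W)))"
            using bd' M' by (intro AE_I2) (auto simp: norm_mult abs_mult intro!: mult_right_mono)
        qed measurable
        from lborel_pair.Fubini_integral[OF this] show ?thesis by simp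
      qed
      also have "\<dots> = (LINT Y|lborel. k Y * (LINT W|lborel. h (Y + ?d *\<^sub>R (- W)) * complex_of_real (?e (- W))))"
        by simp
      also have "\<dots> = (LINT Y|lborel. k Y * (LINT W|lborel. h (Y + ?d *\<^sub>R W) * complex_of_real (?e W)))"
        using integral_lborel_shift(3)[of "\<lambda>W. h (Y + ?d *\<^sub>R W) * complex_of_real (?e W)" 0 for Y] by simp
      also have "\<dots> = 0" using av[of ?d] by simp
      finally show ?thesis .
    qed
    moreover have "(\<lambda>n. LINT Y|lborel. h Y * ?k n Y) \<longlonglongrightarrow>
        (LINT Y|lborel. h Y * (of_real (sqrt (2 * pi) ^ DIM('v)) * k Y))"
    proof (rule integral_dominated_convergence[where w = "\<lambda>Y. norm (h Y) * (M' * sqrt (2 * pi) ^ DIM('v))"])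
      show "AE Y in lborel. (\<lambda>n. h Y * ?k n Y) \<longlonglongrightarrow> h Y * (of_real (sqrt (2 * pi) ^ DIM('v)) * k Y)"
        using gaussian_average_tendsto[OF k bd] by (intro AE_I2 tendsto_mult tendsto_const)
      show "AE Y in lborel. norm (h Y * ?k n Y) \<le> norm (h Y) * (M' * sqrt (2 * pi) ^ DIM('v))" for n
        using kb by (intro AE_I2) (simp add: norm_mult mult_left_mono)
    qed (use h in \<open>auto simp: intro!: borel_measurable_times\<close>)
    ultimately have "(LINT Y|lborel. h Y * (of_real (sqrt (2 * pi) ^ DIM('v)) * k Y)) = 0"
      using LIMSEQ_unique[OF _ tendsto_const] by simp
    moreover have "(\<lambda>Y. h Y * (of_real (sqrt (2 * pi) ^ DIM('v)) * k Y)) =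
        (\<lambda>Y. of_real (sqrt (2 * pi) ^ DIM('v)) * (h Y * k Y))"
      by (rule ext) (rule mult.left_commute)
    ultimately show ?thesis by (simp del: of_real_power)
  qed
  have clos: "set_lebesgue_integral lborel C h = 0" if C: "closed C" for C
  proof (cases "C = {}")
    case False
    \<comment> \<open>Continuous functions decreasing to the indicator of \<open>C\<close>;
      closedness of \<open>C\<close> makes the distance positive outside it.\<close>
    let ?k = "\<lambda>n X. max 0 (1 - real n * infdist X C)"
    have 1: "(LINT Y|lborel. h Y * complex_of_real (?k n Y)) = 0" for n
      by (rule cont[of _ 1])
         (auto intro!: continuous_intros simp: infdist_nonneg mult_nonneg_nonneg)
    have "(\<lambda>n. LINT Y|lborel. h Y * complex_of_real (?k n Y)) \<longlonglongrightarrow> (LINT Y|lborel. h Y * complex_of_real (indicator C Y))"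
    proof (rule integral_dominated_convergence[where w = "\<lambda>Y. norm (h Y)"])
      show "AE Y in lborel. (\<lambda>n. h Y * complex_of_real (?k n Y)) \<longlonglongrightarrow> h Y * complex_of_real (indicator C Y)"
      proof (intro AE_I2 tendsto_mult tendsto_const tendsto_of_real)
        fix Y
        show "(\<lambda>n. ?k n Y) \<longlonglongrightarrow> indicator C Y"
        proof (cases "Y \<in> C")
          case True
          then show ?thesis by simp
        next
          case F: False
          then have p: "infdist Y C > 0"
            using C False in_closed_iff_infdist_zero[of C Y] infdist_nonneg[of Y C] by linarith
          then obtain N where N: "real N * infdist Y C > 1" using reals_Archimedean3 by blast
          have "?k n Y = 0" if "n \<ge> N" for n
          proof -
            have "real n * infdist Y C \<ge> real N * infdist Y C" using that p by (intro mult_right_mono) auto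
            then show ?thesis using N by simp
          qed
          then have "\<forall>\<^sub>F n in sequentially. ?k n Y = 0" by (auto simp: eventually_sequentially)
          then show ?thesis using F by (simp add: tendsto_eventually)
        qed
      qed
      show "AE Y in lborel. norm (h Y * complex_of_real (?k n Y)) \<le> norm (h Y)" for n
        by (intro AE_I2) (auto simp: norm_mult infdist_nonneg intro!: mult_left_le)
      have [measurable]: "C \<in> sets borel" using C by simp
      show "(\<lambda>Y. h Y * complex_of_real (indicator C Y)) \<in> borel_measurable lborel" by measurable
      have [measurable]: "(\<lambda>Y. ?k n Y) \<in> borel_measurable borel" for n
        by (intro borel_measurable_continuous_onI continuous_intros)
      show "(\<lambda>Y. h Y * complex_of_real (?k n Y)) \<in> borel_measurable lborel" for n by measurable
    qed (use h in simp)
    with 1 have "(LINT Y|lborel. h Y * complex_of_real (indicator C Y)) = 0"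
      using LIMSEQ_unique[OF _ tendsto_const] by simp
    then show ?thesis
      by (simp add: set_lebesgue_integral_def scaleR_conv_of_real mult.commute)
  qed (simp add: set_lebesgue_integral_def)
  have "set_lebesgue_integral lborel A h = 0" if "A \<in> sets borel" for A
  proof -
    have hi: "set_integrable lborel A h" if "A \<in> sets borel" for A
      using that h by (auto simp: set_integrable_def intro: integrable_mult_indicator)
    \<comment> \<open>Closed sets form an intersection-stable generator, so the identity passes to
      all Borel sets by Dynkin's argument.\<close>
    have "Int_stable (Collect closed :: 'v set set)" "Collect closed \<subseteq> Pow (UNIV :: 'v set)"
      and "A \<in> sigma_sets UNIV (Collect closed)"
      using that by (auto simp: borel_eq_closed Int_stable_def closed_Int)
    then show ?thesis
    proof (induction rule: sigma_sets_induct_disjoint)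
      case (basic A)
      then show ?case using clos by auto
    next
      case empty
      then show ?case by (simp add: set_lebesgue_integral_def)
    next
      case (compl A)
      then have A: "A \<in> sets borel" by (simp add: borel_eq_closed)
      have "set_lebesgue_integral lborel UNIV h = set_lebesgue_integral lborel (A \<union> (UNIV - A)) h" by simp
      also have "\<dots> = set_lebesgue_integral lborel A h + set_lebesgue_integral lborel (UNIV - A) h"
        using A by (intro set_integral_Un hi) auto
      finally show ?case using clos[of UNIV] compl by simp
    next
      case (union A)
      then have A: "A i \<in> sets borel" for i by (auto simp: borel_eq_closed)
      have "set_lebesgue_integral lborel (\<Union>i. A i) h = (\<Sum>i. set_lebesgue_integral lborel (A i) h)"
        using A union by (intro lebesgue_integral_countable_add hi) (auto simp: disjoint_family_on_def)
      then show ?case using union by simp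
    qed
  qed
  then show ?thesis using sigma_finite_measure.density_zero[OF sigma_finite_lborel h] by simp
qed

subsection \<open>The spaces in terms of words\<close>

lemma prod_list_mpower:
  assumes "set ms \<subseteq> Basis"
  shows "\<exists>\<alpha>1 \<alpha>2. (\<Prod>m\<leftarrow>ms. X \<bullet> m) = mpower (fst X) \<alpha>1 * mpower (snd X) \<alpha>2 \<and>
    mlength \<alpha>1 = n1 ms \<and> mlength \<alpha>2 = n2 ms"
  using assms
proof (induction ms)
  case Nil
  show ?case by (auto intro!: exI[of _ "\<lambda>_. 0"] simp: mpower_def mlength_def)
next
  case (Cons m ms)
  then obtain \<alpha>1 \<alpha>2 where IH: "(\<Prod>m\<leftarrow>ms. X \<bullet> m) = mpower (fst X) \<alpha>1 * mpower (snd X) \<alpha>2"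
    "mlength \<alpha>1 = n1 ms" "mlength \<alpha>2 = n2 ms" by auto
  have upd: "mpower x (\<alpha>(b := Suc (\<alpha> b))) = (x \<bullet> b) * mpower x \<alpha>" "mlength (\<alpha>(b := Suc (\<alpha> b))) = Suc (mlength \<alpha>)"
    if "b \<in> Basis" for x b :: 'a and \<alpha>
    unfolding mpower_def mlength_def
    using that by (simp_all add: prod.remove[of _ b] sum.remove[of _ b])
  from Cons.prems consider b where "m = (b, 0)" "b \<in> Basis" | b where "m = (0, b)" "b \<in> Basis"
    by (auto simp: Basis_prod_def)
  then show ?case
  proof cases
    case 1
    then have "(\<Prod>m\<leftarrow>m # ms. X \<bullet> m) = mpower (fst X) (\<alpha>1(b := Suc (\<alpha>1 b))) * mpower (snd X) \<alpha>2 \<and>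
        mlength (\<alpha>1(b := Suc (\<alpha>1 b))) = n1 (m # ms) \<and> mlength \<alpha>2 = n2 (m # ms)"
      using IH by (cases X) (simp add: upd del: fun_upd_apply)
    then show ?thesis by blast
  next
    case 2
    then have "b \<noteq> 0" by auto
    with 2 have "(\<Prod>m\<leftarrow>m # ms. X \<bullet> m) = mpower (fst X) \<alpha>1 * mpower (snd X) (\<alpha>2(b := Suc (\<alpha>2 b))) \<and>
        mlength \<alpha>1 = n1 (m # ms) \<and> mlength (\<alpha>2(b := Suc (\<alpha>2 b))) = n2 (m # ms)"
      using IH by (cases X) (simp add: upd del: fun_upd_apply)
    then show ?thesis by blast
  qed
qed

lemma mpower_prod_list:
  fixes X :: "'a::euclidean_space \<times> 'a"
  shows "mpower (fst X) \<alpha> = (\<Prod>m\<leftarrow>mlist (\<lambda>b. (b, 0)) \<alpha> basis_list. X \<bullet> m)"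
    and "mpower (snd X) \<alpha> = (\<Prod>m\<leftarrow>mlist (\<lambda>b. (0, b)) \<alpha> basis_list. X \<bullet> m)"
proof -
  have *: "(\<Prod>m\<leftarrow>mlist \<iota> \<alpha> bs. X \<bullet> m) = (\<Prod>b\<leftarrow>bs. (X \<bullet> \<iota> b) ^ \<alpha> b)"
    for bs and \<iota> :: "'a \<Rightarrow> 'a \<times> 'a"
    by (induction bs) (simp_all add: mlist_def mult.commute)
  have "(\<Prod>b\<leftarrow>basis_list. g b) = prod g Basis" for g :: "'a \<Rightarrow> real"
    using basis_list prod.distinct_set_conv_list by metis
  then show "mpower (fst X) \<alpha> = (\<Prod>m\<leftarrow>mlist (\<lambda>b. (b, 0)) \<alpha> basis_list. X \<bullet> m)"
    and "mpower (snd X) \<alpha> = (\<Prod>m\<leftarrow>mlist (\<lambda>b. (0, b)) \<alpha> basis_list. X \<bullet> m)"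
    unfolding * by (cases X, simp add: mpower_def)+
qed

lemma prod_list_norm: "norm (\<Prod>m\<leftarrow>ms. complex_of_real (f m)) = \<bar>\<Prod>m\<leftarrow>ms. f m\<bar>"
  by (induction ms) (auto simp: norm_mult abs_mult)

lemma ennreal_bound:
  assumes "c < \<infinity>"
  shows "\<exists>C\<ge>0. \<forall>x. ennreal x \<le> c \<longrightarrow> x \<le> C"
proof (intro exI[of _ "enn2real c"] conjI allI impI)
  fix x assume "ennreal x \<le> c"
  then have "ennreal x \<le> ennreal (enn2real c)" using assms by (simp add: less_top)
  then show "x \<le> enn2real c" by (simp add: ennreal_le_iff)
qed simp

text \<open>The seminorm in the language of lists; \<open>mfact_le\<close> permits enlarging the
  factorials of multi-indices to those of their lengths.\<close>

lemma GS_norm_bound: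
  fixes \<Phi> :: "'a::euclidean_space \<times> 'a \<Rightarrow> complex"
  assumes s: "s \<ge> 0" "\<sigma> \<ge> 0" and h: "h > 0" and \<Phi>: "C_infinity \<Phi>" and fin: "GS_norm s \<sigma> h \<Phi> < \<infinity>"
  shows "\<exists>C\<ge>0. \<forall>ms ds X. set ms \<subseteq> Basis \<longrightarrow> set ds \<subseteq> Basis \<longrightarrow> \<bar>\<Prod>m\<leftarrow>ms. X \<bullet> m\<bar> * norm (dd ds \<Phi> X) \<le>
    C * (h ^ (length ms + length ds) * fact (n1 ms) powr s * fact (n2 ms) powr \<sigma> * fact (n1 ds) powr \<sigma> * fact (n2 ds) powr s)"
proof -
  obtain C where C: "C \<ge> 0" and bd: "\<And>x. ennreal x \<le> GS_norm s \<sigma> h \<Phi> \<Longrightarrow> x \<le> C"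
    using ennreal_bound[OF fin] by blast
  show ?thesis
  proof (intro exI[of _ C] conjI allI impI C)
    fix ms ds :: "('a \<times> 'a) list" and X :: "'a \<times> 'a" assume ms: "set ms \<subseteq> Basis" and ds: "set ds \<subseteq> Basis"
    obtain \<alpha>1 \<alpha>2 where m: "(\<Prod>m\<leftarrow>ms. X \<bullet> m) = mpower (fst X) \<alpha>1 * mpower (snd X) \<alpha>2"
      "mlength \<alpha>1 = n1 ms" "mlength \<alpha>2 = n2 ms" using prod_list_mpower[OF ms] by blast
    obtain \<beta>1 \<beta>2 where d: "dd ds \<Phi> = mixed_deriv \<beta>1 \<beta>2 \<Phi>" "mlength \<beta>1 = n1 ds" "mlength \<beta>2 = n2 ds"
      using dd_mixed_deriv[OF \<Phi> ds] by blast
    let ?N = "\<bar>\<Prod>m\<leftarrow>ms. X \<bullet> m\<bar> * norm (dd ds \<Phi> X)"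
    let ?D = "h ^ (n1 ms + n2 ms + n1 ds + n2 ds) * mfact \<alpha>1 powr s * mfact \<alpha>2 powr \<sigma> * mfact \<beta>1 powr \<sigma> * mfact \<beta>2 powr s"
    have D: "?D > 0" using h by (intro mult_pos_pos) auto
    have "ennreal (\<bar>mpower (fst X) \<alpha>1 * mpower (snd X) \<alpha>2\<bar> * norm (mixed_deriv \<beta>1 \<beta>2 \<Phi> (fst X, snd X)) /
        (h ^ (mlength \<alpha>1 + mlength \<alpha>2 + mlength \<beta>1 + mlength \<beta>2) *
          mfact \<alpha>1 powr s * mfact \<alpha>2 powr \<sigma> * mfact \<beta>1 powr \<sigma> * mfact \<beta>2 powr s)) \<le> GS_norm s \<sigma> h \<Phi>"
      unfolding GS_norm_def
      apply (rule order_trans[OF _ SUP_upper[of "fst X"]], rule order_trans[OF _ SUP_upper[of "snd X"]])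
      apply (rule order_trans[OF _ SUP_upper[of "\<alpha>1"]], rule order_trans[OF _ SUP_upper[of "\<alpha>2"]])
      apply (rule order_trans[OF _ SUP_upper[of "\<beta>1"]], rule order_trans[OF _ SUP_upper[of "\<beta>2"]])
      by auto
    then have "?N / ?D \<le> C" using bd m d by simp
    then have "?N \<le> C * ?D" using D by (simp add: divide_le_eq)
    also have "\<dots> \<le> C * (h ^ (length ms + length ds) * fact (n1 ms) powr s * fact (n2 ms) powr \<sigma> * fact (n1 ds) powr \<sigma> * fact (n2 ds) powr s)"
    proof (intro mult_left_mono C)
      have *: "mfact \<alpha> powr r \<le> fact (mlength \<alpha>) powr r" "mfact \<alpha> powr r \<ge> 0" if "r \<ge> 0" for \<alpha> :: "'a \<Rightarrow> nat" and r
        using that mfact_le[of \<alpha>] mfact_ge_1[of \<alpha>] by (auto intro!: powr_mono2)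
      have e: "n1 ms + n2 ms + n1 ds + n2 ds = length ms + length ds" using n1_add_n2[of ms] n1_add_n2[of ds] by simp
      show "?D \<le> h ^ (length ms + length ds) * fact (n1 ms) powr s * fact (n2 ms) powr \<sigma> * fact (n1 ds) powr \<sigma> * fact (n2 ds) powr s"
        unfolding e unfolding m(2,3)[symmetric] d(2,3)[symmetric] using h s
        by (intro mult_mono * mult_nonneg_nonneg order_refl zero_le_power) auto
    qed
    finally show "?N \<le> C * (h ^ (length ms + length ds) * fact (n1 ms) powr s * fact (n2 ms) powr \<sigma> * fact (n1 ds) powr \<sigma> * fact (n2 ds) powr s)" .
  qed
qed

text \<open>The seminorms see only derivatives followed by multiplications, so a general word must
  be normally ordered first. A contraction pairs \<open>Mul v\<close> with \<open>Der v\<close>,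
  which belong to different exponents; \<open>k\<close> contractions thus free a factor
  \<open>k!\<close> in each of the two factorial weights to pay for the growth of the
  coefficients.\<close>

lemma GS_words:
  fixes \<Phi> :: "'a::euclidean_space \<times> 'a \<Rightarrow> complex"
  assumes s: "s > 0" "\<sigma> > 0" "s + \<sigma> \<ge> 1" and \<Phi>: "\<Phi> \<in> GS s \<sigma>"
  shows "\<exists>C\<ge>0. \<exists>h\<ge>1. \<forall>a b. \<forall>ws\<in>words a b. \<forall>X.
    norm (act ws \<Phi> X) \<le> C * h ^ (a + b) * fact a powr s * fact b powr \<sigma>"
proof -
  obtain h0 where h0: "h0 > 0" "GS_norm s \<sigma> h0 \<Phi> < \<infinity>" and sm: "C_infinity \<Phi>"
    using \<Phi> by (auto simp: GS_def)
  obtain C where C: "C \<ge> 0" and bd: "\<And>ms ds X. set ms \<subseteq> Basis \<Longrightarrow> set ds \<subseteq> Basis \<Longrightarrow> \<bar>\<Prod>m\<leftarrow>ms. X \<bullet> m\<bar> * norm (dd ds \<Phi> X) \<le>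
    C * (h0 ^ (length ms + length ds) * fact (n1 ms) powr s * fact (n2 ms) powr \<sigma> * fact (n1 ds) powr \<sigma> * fact (n2 ds) powr s)"
    using GS_norm_bound[OF _ _ h0(1) sm h0(2)] s by (metis less_imp_le)
  define h where "h = max 1 h0"
  have h: "h \<ge> 1" "h0 \<le> h" by (auto simp: h_def)
  show ?thesis
  \<comment> \<open>One factor 2 comes from the binomial coefficient in the number of contractions,
    the other from the \<open>2 ^ npos ws\<close> of normal ordering.\<close>
  proof (rule exI[of _ C], intro conjI C, rule exI[of _ "4 * h"], intro conjI allI ballI)
    show "4 * h \<ge> 1" using h by simp
    fix a b and ws :: "('a \<times> 'a) letter list" and X assume ws: "ws \<in> words a b"
    let ?B = "C * (2 * h) ^ (a + b) * fact a powr s * fact b powr \<sigma>"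
    have len: "npos ws + nder ws = a + b"
    proof -
      have "npos ws + nder ws = length ws" for ws :: "('a \<times> 'a) letter list"
      proof (induction ws)
        case (Cons l ws) then show ?case by (cases l) (auto simp: npos_def nder_def)
      qed (simp add: npos_def nder_def)
      then show ?thesis using ws cs_ct_length[of ws] by (auto simp: words_def)
    qed
    have "norm (act ws \<Phi> X) \<le> 2 ^ npos ws * ?B"
    proof (rule act_normal_order[OF sm])
      show "vec_of ` set ws \<subseteq> Basis" using ws by (simp add: words_def)
      fix k :: nat and ms ds :: "('a \<times> 'a) list"
      assume A: "set ms \<subseteq> Basis" "set ds \<subseteq> Basis" "n1 ms + n2 ds + k = cs ws" "n2 ms + n1 ds + k = ct ws"
        "length ds + k = nder ws" "length ms + k = npos ws"
      have a: "a = (n1 ms + n2 ds) + k" and b: "b = (n2 ms + n1 ds) + k" using A ws by (auto simp: words_def)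
      let ?q = "nder ws"
      have k: "k \<le> ?q" "?q \<le> a + b" using A len by auto
      have f1: "fact ?q / fact (?q - k) \<le> 2 ^ (a + b) * (fact k powr s * fact k powr \<sigma> :: real)"
      proof -
        have "fact ?q / fact (?q - k) = (fact k * real (?q choose k))"
          using k(1) by (simp add: binomial_fact)
        also have "\<dots> \<le> fact k * 2 ^ ?q"
        proof (intro mult_left_mono)
          have "real (?q choose k) \<le> real (2 ^ ?q)" using binomial_le_pow2[of ?q k] by (simp only: of_nat_le_iff)
          then show "real (?q choose k) \<le> 2 ^ ?q" by simp
        qed simp
        also have "\<dots> \<le> fact k * 2 ^ (a + b)"
          using k(2) by (intro mult_left_mono power_increasing) auto
        \<comment> \<open>The place where \<open>s + \<sigma> \<ge> 1\<close> enters: the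
          coefficient \<open>k!\<close> is dominated by the two freed weights.\<close>
        also have "\<dots> \<le> (fact k powr (s + \<sigma>)) * 2 ^ (a + b)"
          using s powr_mono[of 1 "s + \<sigma>" "fact k :: real"] fact_ge_1[of k, where 'a = real]
          by (intro mult_right_mono) auto
        finally show ?thesis by (simp add: powr_add mult_ac)
      qed
      have f2: "norm (act (map Mul ms) (dd ds \<Phi>) X) \<le> C * (h ^ (a + b) * fact (n1 ms + n2 ds) powr s * fact (n2 ms + n1 ds) powr \<sigma>)"
      proof -
        have "norm (act (map Mul ms) (dd ds \<Phi>) X) = \<bar>\<Prod>m\<leftarrow>ms. X \<bullet> m\<bar> * norm (dd ds \<Phi> X)"
          by (simp add: act_Mul norm_mult prod_list_norm)
        also have "\<dots> \<le> C * (h0 ^ (length ms + length ds) * fact (n1 ms) powr s * fact (n2 ms) powr \<sigma> * fact (n1 ds) powr \<sigma> * fact (n2 ds) powr s)"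
          by (rule bd[OF A(1,2)])
        also have "\<dots> = C * (h0 ^ (length ms + length ds) * (fact (n1 ms) powr s * fact (n2 ds) powr s) * (fact (n2 ms) powr \<sigma> * fact (n1 ds) powr \<sigma>))"
          by (simp add: mult_ac)
        also have "\<dots> \<le> C * (h ^ (a + b) * fact (n1 ms + n2 ds) powr s * fact (n2 ms + n1 ds) powr \<sigma>)"
        proof (intro mult_left_mono[OF _ C] mult_mono fact_powr_mult_le)
          have "h0 ^ (length ms + length ds) \<le> h ^ (length ms + length ds)" using h h0 by (intro power_mono) auto
          also have "\<dots> \<le> h ^ (a + b)"
            using h a b n1_add_n2[of ms] n1_add_n2[of ds] by (intro power_increasing) auto
          finally show "h0 ^ (length ms + length ds) \<le> h ^ (a + b)" .
        qed (use s h in auto)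
        finally show ?thesis .
      qed
      have "fact ?q / fact (?q - k) * norm (act (map Mul ms) (dd ds \<Phi>) X) \<le>
          (2 ^ (a + b) * (fact k powr s * fact k powr \<sigma>)) * (C * (h ^ (a + b) * fact (n1 ms + n2 ds) powr s * fact (n2 ms + n1 ds) powr \<sigma>))"
        by (intro mult_mono f1 f2) auto
      also have "\<dots> = C * (2 * h) ^ (a + b) * (fact (n1 ms + n2 ds) powr s * fact k powr s) * (fact (n2 ms + n1 ds) powr \<sigma> * fact k powr \<sigma>)"
        by (simp add: power_mult_distrib mult_ac)
      also have "\<dots> \<le> ?B"
        unfolding a b using C h s
        by (intro mult_mono order_refl fact_powr_mult_le mult_nonneg_nonneg) auto
      finally show "fact ?q / fact (?q - k) * norm (act (map Mul ms) (dd ds \<Phi>) X) \<le> ?B" .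
    qed
    also have "\<dots> \<le> 2 ^ (a + b) * ?B"
      using C h len by (intro mult_right_mono power_increasing) auto
    also have "\<dots> = C * (4 * h) ^ (a + b) * fact a powr s * fact b powr \<sigma>"
    proof -
      have "2 ^ (a + b) * (2 * h) ^ (a + b) = (2 * (2 * h)) ^ (a + b)" by (rule power_mult_distrib[symmetric])
      also have "2 * (2 * h) = 4 * h" by simp
      finally have "2 ^ (a + b) * (2 * h) ^ (a + b) = (4 * h) ^ (a + b)" .
      then have "2 ^ (a + b) * (2 * h) ^ (a + b) * (C * fact a powr s * fact b powr \<sigma>) = (4 * h) ^ (a + b) * (C * fact a powr s * fact b powr \<sigma>)"
        by (simp only:)
      then show ?thesis by (simp only: mult_ac)
    qed
    finally show "norm (act ws \<Phi> X) \<le> C * (4 * h) ^ (a + b) * fact a powr s * fact b powr \<sigma>" .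
  qed
qed

text \<open>A membership criterion that avoids computing iterated derivatives. \<open>Q a b\<close>
  holds the functions reachable by \<open>a\<close> letters of exponent \<open>s\<close> and
  \<open>b\<close> of exponent \<open>\<sigma>\<close>. Each letter splits a member into two, so a
  word of length \<open>n\<close> produces at most \<open>2 ^ n\<close> terms, a geometric
  loss.\<close>

lemma GS_intro:
  fixes f :: "'a::euclidean_space \<times> 'a \<Rightarrow> complex"
  assumes s: "s > 0" "\<sigma> > 0" and f: "f \<in> Q 0 0" and C: "C \<ge> 0" and h: "h > 0"
    and diff: "\<And>a b g. g \<in> Q a b \<Longrightarrow> g differentiable_on UNIV"
    and step: "\<And>a b g l. g \<in> Q a b \<Longrightarrow> vec_of l \<in> Basis \<Longrightarrow>
      \<exists>g1\<in>Q (if ty l then Suc a else a) (if ty l then b else Suc b).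
      \<exists>g2\<in>Q (if ty l then Suc a else a) (if ty l then b else Suc b). act1 l g = (\<lambda>X. g1 X + g2 X)"
    and bd: "\<And>a b g X. g \<in> Q a b \<Longrightarrow> norm (g X) \<le> C * h ^ (a + b) * fact a powr s * fact b powr \<sigma>"
  shows "f \<in> GS s \<sigma>"
proof -
  have sm: "C_infinity g" if "g \<in> Q a b" for g a b
  proof (rule C_infinity_coinduct[of g "\<Union>a b. Q a b"])
    fix g d assume "g \<in> (\<Union>a b. Q a b)" "d \<in> (Basis :: ('a \<times> 'a) set)"
    then show "\<exists>g1\<in>\<Union>a b. Q a b. \<exists>g2\<in>\<Union>a b. Q a b. pderivative d g = (\<lambda>X. g1 X + g2 X)"
      using step[of g _ _ "Der d"] by fastforce
  qed (use that diff in auto)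
  have W: "norm (act ws g X) \<le> 2 ^ length ws * (C * h ^ (a + cs ws + (b + ct ws)) * fact (a + cs ws) powr s * fact (b + ct ws) powr \<sigma>)"
    if "vec_of ` set ws \<subseteq> Basis" "g \<in> Q a b" for ws g a b X
    using that
  proof (induction ws arbitrary: g a b rule: rev_induct)
    case Nil
    then show ?case using bd by auto
  next
    case (snoc l ws)
    let ?a = "if ty l then Suc a else a" and ?b = "if ty l then b else Suc b"
    obtain g1 g2 where g: "g1 \<in> Q ?a ?b" "g2 \<in> Q ?a ?b" "act1 l g = (\<lambda>X. g1 X + g2 X)"
      using step[of g a b l] snoc.prems by auto
    let ?B = "2 ^ length ws * (C * h ^ (?a + cs ws + (?b + ct ws)) * fact (?a + cs ws) powr s * fact (?b + ct ws) powr \<sigma>)"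
    have "act (ws @ [l]) g X = act ws g1 X + act ws g2 X"
      using act_add[OF sm[OF g(1)] sm[OF g(2)]] g(3) by simp
    moreover have "norm (act ws g1 X) \<le> ?B" "norm (act ws g2 X) \<le> ?B"
      using snoc g by auto
    ultimately have "norm (act (ws @ [l]) g X) \<le> ?B + ?B"
      using norm_triangle_le[OF add_mono[of "norm (act ws g1 X)" ?B "norm (act ws g2 X)" ?B]] by (simp only:)
    then show ?case by (simp add: mult_ac del: fact_Suc split: if_splits)
  qed
  define K where "K = (2::real) ^ DIM('a)"
  have K: "K \<ge> 1" by (simp add: K_def)
  \<comment> \<open>Covers, for both exponents, the loss in splitting the factorial of a sum of two
    lengths into the factorials of the two multi-indices.\<close>
  define c where "c = max 1 (2 powr s) * max 1 (2 powr \<sigma>) * K powr s * K powr \<sigma>"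
  have c: "2 powr s * K powr s \<le> c" "2 powr \<sigma> * K powr \<sigma> \<le> c" "c > 0"
  proof -
    have k: "K powr s \<ge> 1" "K powr \<sigma> \<ge> 1" "2 powr s \<ge> 1" "2 powr \<sigma> \<ge> 1" using s K by (auto intro!: ge_one_powr_ge_zero)
    then have c: "c = (2 powr s * K powr s) * (2 powr \<sigma> * K powr \<sigma>)" by (simp add: c_def max_def mult_ac)
    have k2: "2 powr s * K powr s \<ge> 1" "2 powr \<sigma> * K powr \<sigma> \<ge> 1"
      using mult_mono[of 1 "2 powr s" 1 "K powr s"] mult_mono[of 1 "2 powr \<sigma>" 1 "K powr \<sigma>"] k by auto
    show "2 powr s * K powr s \<le> c" using mult_left_mono[OF k2(2), of "2 powr s * K powr s"] k2 unfolding c by auto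
    show "2 powr \<sigma> * K powr \<sigma> \<le> c" using mult_right_mono[OF k2(1), of "2 powr \<sigma> * K powr \<sigma>"] k2 unfolding c by auto
    show "c > 0" using k2 unfolding c by (intro mult_pos_pos) auto
  qed
  have split: "fact (mlength \<alpha> + mlength \<beta>) powr r \<le> c ^ (mlength \<alpha> + mlength \<beta>) * (mfact \<alpha> powr r * mfact \<beta> powr r)"
    if r: "r > 0" "2 powr r * K powr r \<le> c" for \<alpha> \<beta> :: "'a \<Rightarrow> nat" and r
  proof -
    have m: "fact (mlength \<alpha>) powr r \<le> (K powr r) ^ mlength \<alpha> * mfact \<alpha> powr r" for \<alpha> :: "'a \<Rightarrow> nat"
    proof -
      have "fact (mlength \<alpha>) powr r \<le> (K ^ mlength \<alpha> * mfact \<alpha>) powr r"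
        using fact_mlength_le[of \<alpha>] r by (intro powr_mono2) (auto simp: K_def)
      also have "\<dots> = (K powr r) ^ mlength \<alpha> * mfact \<alpha> powr r"
        using K mfact_ge_1[of \<alpha>] by (simp add: powr_mult powr_realpow[symmetric] powr_powr mult.commute)
      finally show ?thesis .
    qed
    have "fact (mlength \<alpha> + mlength \<beta>) powr r \<le> (2 powr r) ^ (mlength \<alpha> + mlength \<beta>) * (fact (mlength \<alpha>) powr r * fact (mlength \<beta>) powr r)"
      using r by (intro fact_powr_add_le) auto
    also have "\<dots> \<le> (2 powr r) ^ (mlength \<alpha> + mlength \<beta>) * (((K powr r) ^ mlength \<alpha> * mfact \<alpha> powr r) * ((K powr r) ^ mlength \<beta> * mfact \<beta> powr r))"
      by (intro mult_left_mono mult_mono m) auto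
    also have "\<dots> = (2 powr r * K powr r) ^ (mlength \<alpha> + mlength \<beta>) * (mfact \<alpha> powr r * mfact \<beta> powr r)"
      by (simp add: power_mult_distrib power_add mult_ac)
    also have "\<dots> \<le> c ^ (mlength \<alpha> + mlength \<beta>) * (mfact \<alpha> powr r * mfact \<beta> powr r)"
      using r by (intro mult_right_mono power_mono) auto
    finally show ?thesis .
  qed
  \<comment> \<open>The 2 counts the summands produced by each letter, \<open>c\<close> the passage
    from lengths to multi-indices.\<close>
  define H where "H = 2 * h * c"
  have H: "H > 0" using h c by (simp add: H_def)
  have "GS_norm s \<sigma> H f \<le> ennreal C"
    unfolding GS_norm_def
  proof (intro SUP_least ennreal_leI)
    fix x \<xi> :: 'a and \<alpha>1 \<alpha>2 \<beta>1 \<beta>2 :: "'a \<Rightarrow> nat"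
    let ?ms = "mlist (\<lambda>b. (b, 0)) \<alpha>1 basis_list @ mlist (\<lambda>b. (0, b)) \<alpha>2 basis_list"
    let ?ds = "mlist (\<lambda>b. (b, 0)) \<beta>1 basis_list @ mlist (\<lambda>b. (0, b)) \<beta>2 basis_list"
    let ?ws = "map Mul ?ms @ map Der ?ds"
    note L = mixed_deriv_list[of \<alpha>1 \<alpha>2] mixed_deriv_list[of \<beta>1 \<beta>2]
    have c1: "cs ?ws = mlength \<alpha>1 + mlength \<beta>2" and c2: "ct ?ws = mlength \<alpha>2 + mlength \<beta>1"
      and c3: "vec_of ` set ?ws \<subseteq> Basis" and c4: "length ?ws = mlength \<alpha>1 + mlength \<beta>2 + (mlength \<alpha>2 + mlength \<beta>1)"
      using L by (simp_all only: map_append[symmetric] cs_ct_simps cs_ct_map length_append length_map set_append image_Un set_map image_image vec_of.simps) auto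
    let ?n = "mlength \<alpha>1 + mlength \<beta>2 + (mlength \<alpha>2 + mlength \<beta>1)"
    let ?M = "mfact \<alpha>1 powr s * mfact \<alpha>2 powr \<sigma> * mfact \<beta>1 powr \<sigma> * mfact \<beta>2 powr s"
    have "\<bar>mpower x \<alpha>1 * mpower \<xi> \<alpha>2\<bar> * norm (mixed_deriv \<beta>1 \<beta>2 f (x, \<xi>)) = norm (act ?ws f (x, \<xi>))"
    proof -
      have "norm (act ?ws f (x, \<xi>)) = \<bar>\<Prod>m\<leftarrow>?ms. (x, \<xi>) \<bullet> m\<bar> * norm (dd ?ds f (x, \<xi>))"
        by (simp only: act_simps(3) act_Mul act_Der norm_mult prod_list_norm)
      moreover have "(\<Prod>m\<leftarrow>?ms. (x, \<xi>) \<bullet> m) = mpower x \<alpha>1 * mpower \<xi> \<alpha>2"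
        using mpower_prod_list(1)[of "(x, \<xi>)" \<alpha>1] mpower_prod_list(2)[of "(x, \<xi>)" \<alpha>2] by simp
      ultimately show ?thesis by (simp only: mixed_deriv_dd)
    qed
    also have "\<dots> \<le> 2 ^ ?n * (C * h ^ ?n * fact (mlength \<alpha>1 + mlength \<beta>2) powr s * fact (mlength \<alpha>2 + mlength \<beta>1) powr \<sigma>)"
      using W[OF c3 f, of "(x, \<xi>)"] unfolding c1 c2 c4 by simp
    also have "\<dots> \<le> 2 ^ ?n * (C * h ^ ?n * (c ^ (mlength \<alpha>1 + mlength \<beta>2) * (mfact \<alpha>1 powr s * mfact \<beta>2 powr s)) *
        (c ^ (mlength \<alpha>2 + mlength \<beta>1) * (mfact \<alpha>2 powr \<sigma> * mfact \<beta>1 powr \<sigma>)))"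
      using C h c s by (intro mult_left_mono mult_mono split) auto
    also have "\<dots> = C * (H ^ ?n * ?M)"
      by (simp add: H_def power_mult_distrib power_add mult_ac)
    finally have le: "\<bar>mpower x \<alpha>1 * mpower \<xi> \<alpha>2\<bar> * norm (mixed_deriv \<beta>1 \<beta>2 f (x, \<xi>)) \<le> C * (H ^ ?n * ?M)" .
    have "H ^ ?n * ?M > 0"
      using H by (intro mult_pos_pos zero_less_power) auto
    moreover have "H ^ (mlength \<alpha>1 + mlength \<alpha>2 + mlength \<beta>1 + mlength \<beta>2) * mfact \<alpha>1 powr s * mfact \<alpha>2 powr \<sigma> * mfact \<beta>1 powr \<sigma> * mfact \<beta>2 powr s = H ^ ?n * ?M"
      by (simp add: mult_ac add_ac)
    ultimately show "\<bar>mpower x \<alpha>1 * mpower \<xi> \<alpha>2\<bar> * norm (mixed_deriv \<beta>1 \<beta>2 f (x, \<xi>)) /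
        (H ^ (mlength \<alpha>1 + mlength \<alpha>2 + mlength \<beta>1 + mlength \<beta>2) *
          mfact \<alpha>1 powr s * mfact \<alpha>2 powr \<sigma> * mfact \<beta>1 powr \<sigma> * mfact \<beta>2 powr s) \<le> C"
      using le by (simp only: divide_le_eq if_True)
  qed
  then have "GS_norm s \<sigma> H f < \<infinity>" by (rule le_less_trans) simp
  then show ?thesis using sm[OF f] H by (auto simp: GS_def)
qed

subsection \<open>Derivatives and integrals\<close>

lemma norm_pderivative_le:
  fixes B :: real
  assumes "f differentiable (at X)" "\<And>b. b \<in> Basis \<Longrightarrow> norm (pderivative b f X) \<le> B"
  shows "norm (pderivative v f X) \<le> DIM('v) * B * norm (v :: 'v::euclidean_space)"
proof -
  have "norm (pderivative v f X) \<le> (\<Sum>b\<in>(Basis :: 'v set). norm v * B)"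
  proof (subst pderivative_Basis[OF assms(1)], rule sum_norm_le)
    fix b :: 'v assume "b \<in> Basis"
    then show "norm (of_real (v \<bullet> b) * pderivative b f X) \<le> norm v * B"
      unfolding norm_mult norm_of_real using assms(2)[of b] by (intro mult_mono) (auto simp: Basis_le_norm)
  qed
  then show ?thesis by (simp add: mult_ac)
qed

text \<open>Near \<open>X0\<close> the mean value inequality bounds the increments of
  \<open>K\<close> by \<open>DIM('v) * g w\<close> times \<open>norm (X - X0)\<close>, and the
  linear term obeys the same bound. So twice this function of \<open>w\<close> dominates the
  remainder quotients, whose pointwise limit is zero.\<close>

lemma has_derivative_integral:
  fixes K :: "'v::euclidean_space \<Rightarrow> 'w::euclidean_space \<Rightarrow> complex"
  assumes diff: "\<And>X w. (\<lambda>X. K X w) differentiable (at X)"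
    and int: "\<And>X. integrable lborel (K X)"
    and meas: "\<And>X v. (\<lambda>w. pderivative v (\<lambda>X. K X w) X) \<in> borel_measurable borel"
    and dom: "\<exists>\<delta>>0. \<exists>g. integrable lborel g \<and>
      (\<forall>X\<in>ball X0 \<delta>. \<forall>w. \<forall>b\<in>Basis. norm (pderivative b (\<lambda>X. K X w) X) \<le> g w)"
  shows "((\<lambda>X. LINT w|lborel. K X w) has_derivative
      (\<lambda>v. LINT w|lborel. pderivative v (\<lambda>X. K X w) X0)) (at X0)"
    and "integrable lborel (\<lambda>w. pderivative v (\<lambda>X. K X w) X0)"
proof -
  obtain \<delta> g where \<delta>: "\<delta> > 0" and g: "integrable lborel g"
    and b: "\<And>X w b. X \<in> ball X0 \<delta> \<Longrightarrow> b \<in> Basis \<Longrightarrow> norm (pderivative b (\<lambda>X. K X w) X) \<le> g w"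
    using dom by blast
  let ?D = "\<lambda>v X w. pderivative v (\<lambda>X. K X w) X"
  let ?n = "real DIM('v)"
  have g0: "g w \<ge> 0" for w
    using b[of X0 "SOME b. b \<in> Basis" w] \<delta> some_in_eq[of "Basis :: 'v set"] order_trans[OF norm_ge_zero] by force
  have bd: "norm (?D v X w) \<le> ?n * g w * norm v" if "X \<in> ball X0 \<delta>" for X v w
    by (rule norm_pderivative_le[OF diff b[OF that]])
  have Di: "integrable lborel (?D v X0)" for v
  proof (rule Bochner_Integration.integrable_bound)
    show "integrable lborel (\<lambda>w. ?n * g w * norm v)" using g by simp
    show "AE w in lborel. norm (?D v X0 w) \<le> norm (?n * g w * norm v)"
      using bd[of X0] \<delta> g0 by (intro AE_I2) (auto simp: abs_mult)
  qed (use meas in simp)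
  then show "integrable lborel (\<lambda>w. pderivative v (\<lambda>X. K X w) X0)" .
  have lin: "linear (\<lambda>v. LINT w|lborel. ?D v X0 w)"
  proof
    fix u v :: 'v and c :: real
    show "(LINT w|lborel. ?D (u + v) X0 w) = (LINT w|lborel. ?D u X0 w) + (LINT w|lborel. ?D v X0 w)"
      using Di linear_add[OF linear_pderivative[OF diff]] by simp
    show "(LINT w|lborel. ?D (c *\<^sub>R u) X0 w) = c *\<^sub>R (LINT w|lborel. ?D u X0 w)"
      using linear_cmul[OF linear_pderivative[OF diff]] by simp
  qed
  show "((\<lambda>X. LINT w|lborel. K X w) has_derivative (\<lambda>v. LINT w|lborel. ?D v X0 w)) (at X0)"
    unfolding has_derivative_iff_norm
  proof (intro conjI)
    show "bounded_linear (\<lambda>v. LINT w|lborel. ?D v X0 w)" using lin by (simp add: linear_conv_bounded_linear)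
    let ?R = "\<lambda>X w. (K X w - K X0 w - ?D (X - X0) X0 w) /\<^sub>R norm (X - X0)"
    have R: "norm ((LINT w|lborel. K X w) - (LINT w|lborel. K X0 w) - (LINT w|lborel. ?D (X - X0) X0 w)) / norm (X - X0) =
        norm (LINT w|lborel. ?R X w)" for X
      using int Di by (simp add: divide_inverse mult.commute)
    show "((\<lambda>X. norm ((LINT w|lborel. K X w) - (LINT w|lborel. K X0 w) - (LINT w|lborel. ?D (X - X0) X0 w)) / norm (X - X0)) \<longlongrightarrow> 0) (at X0)"
      unfolding R tendsto_at_iff_sequentially
    proof (intro allI impI)
      fix S :: "nat \<Rightarrow> 'v" assume S: "\<forall>i. S i \<in> UNIV - {X0}" and lim: "S \<longlonglongrightarrow> X0"
      have "\<forall>\<^sub>F i in sequentially. S i \<in> ball X0 \<delta>"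
        using lim \<delta> by (auto simp: tendsto_iff dist_commute)
      then obtain N where N: "\<And>i. i \<ge> N \<Longrightarrow> S i \<in> ball X0 \<delta>" by (auto simp: eventually_sequentially)
      have "(\<lambda>i. LINT w|lborel. ?R (S (i + N)) w) \<longlonglongrightarrow> (LINT w|(lborel :: 'w measure). 0)"
      proof (rule integral_dominated_convergence[where w = "\<lambda>w. 2 * (?n * g w)"])
        show "integrable lborel (\<lambda>w. 2 * (?n * g w))" using g by simp
        show "(\<lambda>w. ?R (S (i + N)) w) \<in> borel_measurable lborel" for i
          using borel_measurable_integrable[OF int] borel_measurable_integrable[OF Di] by (intro borel_measurable_scaleR borel_measurable_diff) auto
        show "AE w in lborel. (\<lambda>i. ?R (S (i + N)) w) \<longlonglongrightarrow> 0"
        proof (intro AE_I2)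
          fix w
          have "((\<lambda>X. norm (K X w - K X0 w - ?D (X - X0) X0 w) / norm (X - X0)) \<longlongrightarrow> 0) (at X0)"
            using has_derivative_pderivative[OF diff[of w X0]] unfolding has_derivative_iff_norm by blast
          then have "(\<lambda>i. norm (K (S i) w - K X0 w - ?D (S i - X0) X0 w) / norm (S i - X0)) \<longlonglongrightarrow> 0"
            using S lim unfolding tendsto_at_iff_sequentially o_def by blast
          then have "(\<lambda>i. norm (?R (S i) w)) \<longlonglongrightarrow> 0" by (simp add: divide_inverse mult.commute)
          then show "(\<lambda>i. ?R (S (i + N)) w) \<longlonglongrightarrow> 0"
            by (intro LIMSEQ_ignore_initial_segment) (rule tendsto_norm_zero_cancel)
        qed
        show "AE w in lborel. norm (?R (S (i + N)) w) \<le> 2 * (?n * g w)" for i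
        proof (intro AE_I2)
          fix w
          let ?X = "S (i + N)"
          have X: "?X \<in> ball X0 \<delta>" "?X \<noteq> X0" using N[of "i + N"] S by auto
          have "norm (K ?X w - K X0 w) \<le> ?n * g w * norm (?X - X0)"
          proof (rule differentiable_bound[of "ball X0 \<delta>" "\<lambda>X. K X w" "\<lambda>X v. ?D v X w"])
            show "((\<lambda>X. K X w) has_derivative (\<lambda>v. ?D v X w)) (at X within ball X0 \<delta>)" for X
              using has_derivative_pderivative[OF diff] has_derivative_at_withinI by blast
            show "onorm (\<lambda>v. ?D v X w) \<le> ?n * g w" if "X \<in> ball X0 \<delta>" for X
              using bd[OF that] by (intro onorm_le)
          qed (use X \<delta> in auto)
          moreover have "norm (?D (?X - X0) X0 w) \<le> ?n * g w * norm (?X - X0)" using bd[of X0] \<delta> by simp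
          ultimately have "norm (K ?X w - K X0 w - ?D (?X - X0) X0 w) \<le> 2 * (?n * g w) * norm (?X - X0)"
            using norm_triangle_ineq4[of "K ?X w - K X0 w" "?D (?X - X0) X0 w"] by (simp add: algebra_simps)
          then show "norm (?R ?X w) \<le> 2 * (?n * g w)"
            using X(2) by (simp add: divide_inverse[symmetric] divide_le_eq mult.commute[of "inverse _"])
        qed
      qed simp
      then have "(\<lambda>i. norm (LINT w|lborel. ?R (S (i + N)) w)) \<longlonglongrightarrow> 0"
        using tendsto_norm_zero[of "\<lambda>i. LINT w|lborel. ?R (S (i + N)) w"] by (simp only: integral_zero)
      then show "((\<lambda>X. norm (LINT w|lborel. ?R X w)) \<circ> S) \<longlonglongrightarrow> 0"
        unfolding o_def by (rule LIMSEQ_offset)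
    qed
  qed
qed

lemma continuous_on_integral_dominated:
  fixes K :: "'v::euclidean_space \<Rightarrow> 'w::euclidean_space \<Rightarrow> complex"
  assumes cont: "\<And>w. continuous_on UNIV (\<lambda>X. K X w)"
    and meas: "\<And>X. K X \<in> borel_measurable borel"
    and dom: "\<And>X0. \<exists>\<delta>>0. \<exists>g. integrable lborel g \<and> (\<forall>X\<in>ball X0 \<delta>. \<forall>w. norm (K X w) \<le> g w)"
  shows "continuous_on UNIV (\<lambda>X. LINT w|lborel. K X w)"
  unfolding continuous_on_sequentially
proof (intro ballI allI impI)
  fix X0 :: 'v and S assume "(\<forall>n. S n \<in> UNIV) \<and> S \<longlonglongrightarrow> X0"
  then have lim: "S \<longlonglongrightarrow> X0" by simp
  obtain \<delta> g where \<delta>: "\<delta> > 0" and g: "integrable lborel g" and b: "\<And>X w. X \<in> ball X0 \<delta> \<Longrightarrow> norm (K X w) \<le> g w"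
    using dom by metis
  have "\<forall>\<^sub>F i in sequentially. S i \<in> ball X0 \<delta>"
    using lim \<delta> by (auto simp: tendsto_iff dist_commute)
  then obtain N where N: "\<And>i. i \<ge> N \<Longrightarrow> S i \<in> ball X0 \<delta>" by (auto simp: eventually_sequentially)
  have "(\<lambda>i. LINT w|lborel. K (S (i + N)) w) \<longlonglongrightarrow> (LINT w|lborel. K X0 w)"
  proof (rule integral_dominated_convergence[where w = g])
    show "AE w in lborel. (\<lambda>i. K (S (i + N)) w) \<longlonglongrightarrow> K X0 w"
    proof (intro AE_I2)
      fix w
      have "(\<lambda>i. K (S i) w) \<longlonglongrightarrow> K X0 w"
        using continuous_on_tendsto_compose[OF cont lim] by simp
      then show "(\<lambda>i. K (S (i + N)) w) \<longlonglongrightarrow> K X0 w" by (rule LIMSEQ_ignore_initial_segment)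
    qed
  qed (use g meas b N in auto)
  then show "((\<lambda>X. LINT w|lborel. K X w) \<circ> S) \<longlonglongrightarrow> (LINT w|lborel. K X0 w)"
    unfolding o_def by (rule LIMSEQ_offset)
qed

text \<open>Without pointwise decay of \<open>f\<close> no boundary term can be evaluated. Instead
  the increment \<open>f (X + v) - f X\<close> is integrated over all \<open>X\<close>: it gives
  zero by translation invariance, and the integral of the derivative by the fundamental theorem and
  Fubini.\<close>

lemma integral_pderivative_zero:
  fixes f :: "'v::euclidean_space \<Rightarrow> complex"
  assumes f: "C_infinity f" and i0: "integrable lborel f" and i1: "integrable lborel (pderivative v f)"
  shows "(LINT X|lborel. pderivative v f X) = 0"
proof -
  let ?g = "pderivative v f"
  have gc: "continuous_on S ?g" for S by (intro C_infinity_continuous_on C_infinity_pderivative f)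
  have [measurable]: "f \<in> borel_measurable borel" "?g \<in> borel_measurable borel"
    by (intro C_infinity_borel C_infinity_pderivative f)+
  have ftc: "(LINT t|lborel. indicator {0..1} t *\<^sub>R ?g (X + t *\<^sub>R v)) = f (X + v) - f X" for X
  proof -
    have "((\<lambda>t. ?g (X + t *\<^sub>R v)) has_integral (f (X + 1 *\<^sub>R v) - f (X + 0 *\<^sub>R v))) {0..1}"
      by (rule fundamental_theorem_of_calculus)
         (auto intro!: has_vector_derivative_at_within has_vector_derivative_pderivative C_infinity_differentiable f)
    moreover have "set_integrable lborel {0..1} (\<lambda>t. ?g (X + t *\<^sub>R v))"
      by (intro borel_integrable_atLeastAtMost' continuous_on_compose2[OF gc[of UNIV]] continuous_intros) auto
    ultimately show ?thesis
      using set_borel_integral_eq_integral(2)[of "{0..1}" "\<lambda>t. ?g (X + t *\<^sub>R v)"]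
      by (simp add: integral_unique set_lebesgue_integral_def)
  qed
  have sh: "(LINT X|lborel. ?g (X + t *\<^sub>R v)) = (LINT X|lborel. ?g X)"
    "(LINT X|lborel. norm (?g (X + t *\<^sub>R v))) = (LINT X|lborel. norm (?g X))" for t
    by (rule integral_lborel_shift(2), measurable)+
  have "integrable (lborel \<Otimes>\<^sub>M lborel) (\<lambda>(t, X). indicator {0..1} t *\<^sub>R ?g (X + t *\<^sub>R v))"
  proof (rule lborel_pair.Fubini_integrable)
    show "(\<lambda>(t, X). indicator {0..1} t *\<^sub>R ?g (X + t *\<^sub>R v)) \<in> borel_measurable (lborel \<Otimes>\<^sub>M lborel)" by measurable
    show "integrable lborel (\<lambda>t. LINT X|lborel. norm (case (t, X) of (t, X) \<Rightarrow> indicator {0..1::real} t *\<^sub>R ?g (X + t *\<^sub>R v)))"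
      using sh(2) by simp
    show "AE t in lborel. integrable lborel (\<lambda>X. case (t, X) of (t, X) \<Rightarrow> indicator {0..1::real} t *\<^sub>R ?g (X + t *\<^sub>R v))"
      using integrable_lborel_shift(2)[OF i1] by (intro AE_I2) simp
  qed
  then have "(LINT X|lborel. LINT t|lborel. indicator {0..1} t *\<^sub>R ?g (X + t *\<^sub>R v)) =
      (LINT t|lborel. LINT X|lborel. indicator {0..1::real} t *\<^sub>R ?g (X + t *\<^sub>R v))"
    by (rule lborel_pair.Fubini_integral)
  also have "\<dots> = (LINT X|lborel. ?g X)" by (simp add: sh(1))
  finally have "(LINT X|lborel. ?g X) = (LINT X|lborel. f (X + v) - f X)" by (simp only: ftc)
  also have "\<dots> = 0"
    using i0 integrable_lborel_shift(2)[OF i0] integral_lborel_shift(2)[of f v] by simp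
  finally show ?thesis .
qed

lemma integral_by_parts:
  fixes f g :: "'v::euclidean_space \<Rightarrow> complex"
  assumes f: "C_infinity f" and g: "C_infinity g" and i: "integrable lborel (\<lambda>X. f X * g X)"
    "integrable lborel (\<lambda>X. pderivative v f X * g X)" "integrable lborel (\<lambda>X. f X * pderivative v g X)"
  shows "(LINT X|lborel. pderivative v f X * g X) = - (LINT X|lborel. f X * pderivative v g X)"
proof -
  have e: "pderivative v (\<lambda>X. f X * g X) = (\<lambda>X. pderivative v f X * g X + f X * pderivative v g X)"
    using f g by (auto simp: pderivative_mult C_infinity_differentiable)
  have "(LINT X|lborel. pderivative v (\<lambda>X. f X * g X) X) = 0"
    by (rule integral_pderivative_zero) (use f g i in \<open>auto simp: e C_infinity_mult\<close>)
  then show ?thesis using i by (simp add: e add_eq_0_iff)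
qed

lemma FT_dd:
  fixes g :: "'v::euclidean_space \<Rightarrow> complex"
  assumes g: "C_infinity g" and i: "\<And>ds. set ds \<subseteq> Basis \<Longrightarrow> integrable lborel (dd ds g)" and ds: "set ds \<subseteq> Basis"
  shows "FT (dd ds g) B = (\<Prod>v\<leftarrow>ds. \<i> * of_real (B \<bullet> v)) * FT g B"
  using ds
proof (induction ds)
  case (Cons v ds)
  have e: "- \<i> * of_real (B \<bullet> X) = \<i> * of_real (- B \<bullet> X)" for X by simp
  let ?u = "\<lambda>X. exp (\<i> * of_real (- B \<bullet> X))"
  have um: "?u \<in> borel_measurable borel" by (intro C_infinity_borel C_infinity_exp_inner)
  have ui: "integrable lborel (\<lambda>X. ?u X * dd es g X)" if "set es \<subseteq> Basis" for es
    by (rule integrable_unimodular[OF i[OF that] um]) simp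
  have "(LINT X|lborel. pderivative v ?u X * dd ds g X) = - (LINT X|lborel. ?u X * pderivative v (dd ds g) X)"
  proof (rule integral_by_parts)
    have "integrable lborel (\<lambda>X. (\<i> * of_real (- B \<bullet> v)) * (?u X * dd ds g X))"
      using ui[of ds] Cons.prems by (intro integrable_mult_right) auto
    then show "integrable lborel (\<lambda>X. pderivative v ?u X * dd ds g X)"
      by (simp only: pderivative_exp_inner mult.assoc)
    show "C_infinity ?u" by (rule C_infinity_exp_inner)
    show "C_infinity (dd ds g)" by (rule C_infinity_dd[OF g])
    show "integrable lborel (\<lambda>X. ?u X * dd ds g X)" using ui[of ds] Cons.prems by simp
    show "integrable lborel (\<lambda>X. ?u X * pderivative v (dd ds g) X)" using ui[of "v # ds"] Cons.prems by simp
  qed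
  moreover have "(LINT X|lborel. pderivative v ?u X * dd ds g X) = (\<i> * of_real (- B \<bullet> v)) * (LINT X|lborel. ?u X * dd ds g X)"
    by (simp only: pderivative_exp_inner mult.assoc integral_mult_right_zero)
  ultimately have "(LINT X|lborel. ?u X * dd (v # ds) g X) = (\<i> * of_real (B \<bullet> v)) * (LINT X|lborel. ?u X * dd ds g X)"
    by (simp only: dd_Cons) (metis (no_types, lifting) add.inverse_inverse inner_minus_left minus_mult_right minus_mult_left of_real_minus)
  then show ?case using Cons by (simp add: FT_def e mult.assoc)
qed simp

subsection \<open>A polynomial weight\<close>

text \<open>A product over coordinates rather than a power of \<open>1 + (norm X)\<^sup>2\<close>:
  its reciprocal is integrable in every dimension, and it factorises over products
  (\<open>wt_Pair\<close>).\<close>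

definition wt :: "'v::euclidean_space \<Rightarrow> real" where
  "wt X = (\<Prod>b\<in>Basis. 1 + (X \<bullet> b)\<^sup>2)"

lemma wt_ge_1: "wt X \<ge> 1"
  unfolding wt_def by (intro prod_ge_1) auto

lemma wt_pos [simp]: "wt X > 0" "wt X \<noteq> 0" "wt X \<ge> 0" "\<bar>wt X\<bar> = wt X"
  using wt_ge_1[of X] by auto

lemma wt_minus [simp]: "wt (- X) = wt X"
  by (simp add: wt_def)

lemma continuous_on_wt: "continuous_on S wt"
  unfolding wt_def[abs_def] by (intro continuous_intros)

lemma wt_measurable [measurable]: "wt \<in> borel_measurable borel"
  by (intro borel_measurable_continuous_onI continuous_on_wt)

lemma wt_Pair: "wt (x, y) = wt x * wt y"
proof -
  have "wt (x, y) = (\<Prod>b\<in>(\<lambda>u. (u, 0)) ` Basis. 1 + ((x, y) \<bullet> b)\<^sup>2) * (\<Prod>b\<in>(\<lambda>v. (0, v)) ` Basis. 1 + ((x, y) \<bullet> b)\<^sup>2)"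
    unfolding wt_def Basis_prod_def by (rule prod.union_disjoint) auto
  then show ?thesis by (simp add: wt_def prod.reindex inj_on_def)
qed

text \<open>Peetre's inequality, coordinate by coordinate; each coordinate contributes a factor
  2.\<close>

lemma wt_add_le: "wt (X + Y) \<le> 2 ^ DIM('v) * (wt X * wt (Y :: 'v::euclidean_space))"
proof -
  have "wt (X + Y) \<le> (\<Prod>b\<in>(Basis :: 'v set). 2 * ((1 + (X \<bullet> b)\<^sup>2) * (1 + (Y \<bullet> b)\<^sup>2)))"
    unfolding wt_def
  proof (intro prod_mono conjI)
    fix b :: 'v
    have "1 + (p + q)\<^sup>2 \<le> 2 * ((1 + p\<^sup>2) * (1 + q\<^sup>2))" for p q :: real
    proof -
      have "2 * ((1 + p\<^sup>2) * (1 + q\<^sup>2)) - (1 + (p + q)\<^sup>2) = (p - q)\<^sup>2 + 1 + 2 * (p * q)\<^sup>2"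
        by (simp add: power2_eq_square algebra_simps)
      moreover have "(p - q)\<^sup>2 + 1 + 2 * (p * q)\<^sup>2 \<ge> 0" by simp
      ultimately show ?thesis by linarith
    qed
    then show "1 + ((X + Y) \<bullet> b)\<^sup>2 \<le> 2 * ((1 + (X \<bullet> b)\<^sup>2) * (1 + (Y \<bullet> b)\<^sup>2))"
      by (simp add: inner_add_left)
  qed simp
  then show ?thesis by (simp add: wt_def prod.distrib)
qed

lemma wt_shift_le: "1 / wt (X - Y) \<le> 2 ^ DIM('v) * (wt X / wt (Y :: 'v::euclidean_space))"
proof -
  have "wt Y \<le> 2 ^ DIM('v) * (wt X * wt (X - Y))"
    using wt_add_le[of X "Y - X"] wt_minus[of "X - Y"] by simp
  then show ?thesis by (simp add: divide_simps mult_ac)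
qed

lemma integrable_inverse_wt: "integrable lborel (\<lambda>X :: 'v::euclidean_space. 1 / wt X)"
proof -
  have "set_integrable lborel (einterval (-\<infinity>) \<infinity>) (\<lambda>x. inverse (1 + x\<^sup>2))"
    by (rule integrable_inverse_1_plus_square)
  then have "integrable lborel (\<lambda>x :: real. inverse (1 + x\<^sup>2))"
    by (simp add: set_integrable_def)
  from lborel_integral_prod_Basis(1)[of "\<lambda>b :: 'v. \<lambda>x. inverse (1 + x\<^sup>2)", OF this]
  show ?thesis by (simp add: wt_def prod_inversef[symmetric] inverse_eq_divide prod_dividef)
qed

lemma integrable_wt_bound:
  fixes f :: "'v::euclidean_space \<Rightarrow> complex"
  assumes [measurable]: "f \<in> borel_measurable borel" and b: "\<And>X. norm (f X) \<le> C / wt X"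
  shows "integrable lborel f"
proof (rule Bochner_Integration.integrable_bound)
  show "integrable lborel (\<lambda>X :: 'v. C * (1 / wt X))" by (intro integrable_mult_right integrable_inverse_wt)
  show "AE X in lborel. norm (f X) \<le> norm (C * (1 / wt X))"
  proof (intro AE_I2)
    fix X
    have "norm (f X) \<le> C * (1 / wt X)" using b[of X] by simp
    also have "\<dots> \<le> norm (C * (1 / wt X))" by (simp only: real_norm_def abs_ge_self)
    finally show "norm (f X) \<le> norm (C * (1 / wt X))" .
  qed
qed simp

subsection \<open>Rapid decay\<close>

text \<open>The Schwartz space. Stating it with words makes invariance under multiplications and
  derivatives immediate.\<close>

definition sch :: "('a::euclidean_space \<times> 'a \<Rightarrow> complex) set" where
  "sch = {g. C_infinity g \<and> (\<forall>ws. vec_of ` set ws \<subseteq> Basis \<longrightarrow> (\<exists>B. \<forall>X. norm (act ws g X) \<le> B))}"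

lemma sch_C_infinity: "g \<in> sch \<Longrightarrow> C_infinity g"
  by (simp add: sch_def)

lemma sch_act: "(g :: ('a::euclidean_space \<times> 'a) \<Rightarrow> complex) \<in> sch \<Longrightarrow> vec_of ` set vs \<subseteq> Basis \<Longrightarrow> act vs g \<in> sch"
  unfolding sch_def
proof (intro CollectI conjI allI impI)
  fix ws :: "('a \<times> 'a) letter list" assume "g \<in> {g. C_infinity g \<and> (\<forall>ws. vec_of ` set ws \<subseteq> Basis \<longrightarrow> (\<exists>B. \<forall>X. norm (act ws g X) \<le> B))}"
    "vec_of ` set vs \<subseteq> Basis" "vec_of ` set ws \<subseteq> Basis"
  moreover from this have "vec_of ` set (ws @ vs) \<subseteq> Basis" by auto
  ultimately have "\<exists>B. \<forall>X. norm (act (ws @ vs) g X) \<le> B" by blast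
  then show "\<exists>B. \<forall>X. norm (act ws (act vs g) X) \<le> B" by simp
qed (auto intro: C_infinity_act)

lemma sch_act1: "g \<in> sch \<Longrightarrow> vec_of l \<in> Basis \<Longrightarrow> act1 l g \<in> sch"
  using sch_act[of g "[l]"] by simp

text \<open>Each factor \<open>1 + (X \<bullet> b)\<^sup>2\<close> is the choice between no letter
  and two letters \<open>Mul b\<close>. Expanding gives \<open>2 ^ length bs\<close> words with at
  most \<open>2 * length bs\<close> additional letters.\<close>

lemma prod_list_act_bound:
  assumes "set bs \<subseteq> Basis"
    and "\<And>ws. vec_of ` set ws \<subseteq> Basis \<Longrightarrow> length ws \<le> 2 * length bs \<Longrightarrow> norm (act ws g X) \<le> B"
  shows "(\<Prod>b\<leftarrow>bs. 1 + (X \<bullet> b)\<^sup>2) * norm (g X) \<le> 2 ^ length bs * B"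
  using assms
proof (induction bs arbitrary: g)
  case Nil
  then show ?case using Nil(2)[of "[]"] by simp
next
  case (Cons b bs)
  let ?P = "\<Prod>b\<leftarrow>bs. 1 + (X \<bullet> b)\<^sup>2" and ?g = "act [Mul b, Mul b] g"
  have "?P * norm (g X) \<le> 2 ^ length bs * B"
    using Cons by auto
  moreover have "?P * norm (?g X) \<le> 2 ^ length bs * B"
  proof (rule Cons.IH)
    fix ws :: "'a letter list" assume "vec_of ` set ws \<subseteq> Basis" "length ws \<le> 2 * length bs"
    then show "norm (act ws ?g X) \<le> B"
      using Cons.prems(1) Cons.prems(2)[of "ws @ [Mul b, Mul b]"] by simp
  qed (use Cons.prems in auto)
  moreover have "norm (?g X) = (X \<bullet> b)\<^sup>2 * norm (g X)"
    by (simp add: norm_mult power2_eq_square flip: mult.assoc)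
  ultimately show ?case by (simp add: algebra_simps)
qed

lemma wt_prod_list: "wt X ^ N = (\<Prod>b\<leftarrow>concat (replicate N basis_list). 1 + (X \<bullet> b)\<^sup>2)"
proof -
  have "(\<Prod>b\<leftarrow>basis_list. 1 + (X \<bullet> b)\<^sup>2) = wt X"
    unfolding wt_def using basis_list prod.distinct_set_conv_list by metis
  then show ?thesis by (induction N) auto
qed

lemma sch_decay:
  assumes "g \<in> sch"
  shows "\<exists>B\<ge>0. \<forall>X. wt X ^ N * norm (g X) \<le> B"
proof -
  let ?bs = "concat (replicate N basis_list) :: ('a \<times> 'a) list"
  \<comment> \<open>Only finitely many words occur, so the sum of their bounds is a common
    bound.\<close>
  let ?W = "{ws :: ('a \<times> 'a) letter list. set ws \<subseteq> Mul ` Basis \<union> Der ` Basis \<and> length ws \<le> 2 * length ?bs}"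
  have fin: "finite ?W" by (intro finite_lists_length_le) auto
  have "\<forall>ws\<in>?W. \<exists>B. \<forall>X. norm (act ws g X) \<le> B"
    using assms unfolding sch_def by fastforce
  from bchoice[OF this] obtain B where B: "\<And>ws X. ws \<in> ?W \<Longrightarrow> norm (act ws g X) \<le> B ws" by blast
  let ?B = "\<Sum>ws\<in>?W. \<bar>B ws\<bar>"
  have "wt X ^ N * norm (g X) \<le> 2 ^ length ?bs * ?B" for X
    unfolding wt_prod_list
  proof (rule prod_list_act_bound)
    fix ws :: "('a \<times> 'a) letter list" assume v: "vec_of ` set ws \<subseteq> Basis" and "length ws \<le> 2 * length ?bs"
    moreover have "l \<in> Mul ` Basis \<union> Der ` Basis" if "l \<in> set ws" for l
      using v that by (cases l) auto
    ultimately have ws: "ws \<in> ?W" by auto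
    have "norm (act ws g X) \<le> \<bar>B ws\<bar>" using B[OF ws, of X] by linarith
    also have "\<dots> \<le> ?B" using fin ws by (intro member_le_sum) auto
    finally show "norm (act ws g X) \<le> ?B" .
  qed (auto simp: basis_list)
  moreover have "2 ^ length ?bs * ?B \<ge> 0" by (auto intro!: mult_nonneg_nonneg sum_nonneg)
  ultimately show ?thesis by blast
qed

lemma sch_decay1:
  assumes "g \<in> sch"
  shows "\<exists>B\<ge>0. \<forall>X. norm (g X) \<le> B / wt X" "\<exists>B\<ge>0. \<forall>X. norm (g X) \<le> B" "integrable lborel g"
proof -
  show 1: "\<exists>B\<ge>0. \<forall>X. norm (g X) \<le> B / wt X"
    using sch_decay[OF assms, of 1] by (simp add: le_divide_eq mult.commute)
  show "\<exists>B\<ge>0. \<forall>X. norm (g X) \<le> B" using sch_decay[OF assms, of 0] by simp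
  show "integrable lborel g"
    using 1 integrable_wt_bound C_infinity_borel sch_C_infinity[OF assms] by blast
qed

lemma GS_subset_sch:
  assumes "s > 0" "\<sigma> > 0" "s + \<sigma> \<ge> 1" "\<Phi> \<in> GS s \<sigma>"
  shows "\<Phi> \<in> sch"
proof -
  obtain C h where "\<And>a b ws X. ws \<in> words a b \<Longrightarrow> norm (act ws \<Phi> X) \<le> C * h ^ (a + b) * fact a powr s * fact b powr \<sigma>"
    using GS_words[OF assms] by metis
  moreover have "ws \<in> words (cs ws) (ct ws)" if "vec_of ` set ws \<subseteq> Basis" for ws :: "('a \<times> 'a) letter list"
    using that by (simp add: words_def)
  ultimately show ?thesis using assms(4) unfolding sch_def GS_def by blast
qed

text \<open>Multiplication by \<open>wt X\<close> adds at most a fixed number \<open>?L\<close> of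
  letters. Replacing the factorial of \<open>i + a\<close> by that of \<open>a\<close>, with
  \<open>i\<close> at most \<open>?L\<close>, costs a constant and a geometric factor, so the growth
  type in \<open>a\<close> and \<open>b\<close> is unchanged.\<close>

lemma GS_words_wt:
  fixes \<Phi> :: "'a::euclidean_space \<times> 'a \<Rightarrow> complex"
  assumes s: "s > 0" "\<sigma> > 0" "s + \<sigma> \<ge> 1" and \<Phi>: "\<Phi> \<in> GS s \<sigma>"
  shows "\<exists>C\<ge>0. \<exists>h\<ge>1. \<forall>a b. \<forall>ws\<in>words a b. \<forall>X.
    norm (act ws \<Phi> X) \<le> C * h ^ (a + b) * fact a powr s * fact b powr \<sigma> / wt X"
proof -
  obtain C h where C: "C \<ge> 0" and h: "h \<ge> 1"
    and bd: "\<And>a b ws X. ws \<in> words a b \<Longrightarrow> norm (act ws \<Phi> X) \<le> C * h ^ (a + b) * fact a powr s * fact b powr \<sigma>"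
    using GS_words[OF assms] by metis
  let ?bs = "concat (replicate 1 basis_list) :: ('a \<times> 'a) list"
  let ?L = "2 * length ?bs"
  let ?c = "2 powr s * 2 powr \<sigma>"
  have c12: "2 powr s \<ge> 1" "2 powr \<sigma> \<ge> 1"
    using s by (auto intro!: ge_one_powr_ge_zero)
  then have "?c \<ge> 1" using mult_mono[of 1 "2 powr s" 1 "2 powr \<sigma>"] by simp
  note c = c12 this
  let ?C = "2 ^ length ?bs * (C * h ^ ?L * (?c ^ ?L * (fact ?L powr s * fact ?L powr \<sigma>)))"
  show ?thesis
  proof (rule exI[of _ ?C], intro conjI, goal_cases)
    case 1
    show ?case using C h by (intro mult_nonneg_nonneg) auto
  next
    case 2
    show ?case
    proof (rule exI[of _ "h * ?c"], intro conjI allI ballI)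
      show "1 \<le> h * ?c" using mult_mono[of 1 h 1 ?c] h c by auto
      fix a b X and ws :: "('a \<times> 'a) letter list" assume ws: "ws \<in> words a b"
      let ?B = "C * h ^ ?L * (?c ^ ?L * (fact ?L powr s * fact ?L powr \<sigma>)) * ((h * ?c) ^ (a + b) * fact a powr s * fact b powr \<sigma>)"
      have "wt X ^ 1 * norm (act ws \<Phi> X) \<le> 2 ^ length ?bs * ?B"
        unfolding wt_prod_list
      proof (rule prod_list_act_bound)
        fix vs :: "('a \<times> 'a) letter list" assume v: "vec_of ` set vs \<subseteq> Basis" and len: "length vs \<le> ?L"
        define i j where "i = cs vs" and "j = ct vs"
        have ij: "i \<le> ?L" "j \<le> ?L" "i + j \<le> ?L" using cs_ct_length[of vs] len by (auto simp: i_def j_def)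
        have "vs @ ws \<in> words (i + a) (j + b)"
          using v ws by (intro words_append) (auto simp: words_def i_def j_def)
        from bd[OF this] have "norm (act (vs @ ws) \<Phi> X) \<le>
            C * h ^ (i + a + (j + b)) * fact (i + a) powr s * fact (j + b) powr \<sigma>" .
        also have "\<dots> \<le> C * h ^ (?L + (a + b)) * ((2 powr s) ^ (?L + (a + b)) * (fact ?L powr s * fact a powr s)) *
            ((2 powr \<sigma>) ^ (?L + (a + b)) * (fact ?L powr \<sigma> * fact b powr \<sigma>))"
        proof -
          have *: "fact (i + a) powr r \<le> (2 powr r) ^ (?L + (a + b)) * (fact ?L powr r * fact a powr r)"
            if "r > 0" "2 powr r \<ge> 1" "i \<le> ?L" for r :: real and i a b
          proof -
            have "fact (i + a) powr r \<le> (2 powr r) ^ (i + a) * (fact i powr r * fact a powr r)"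
              using that by (intro fact_powr_add_le) auto
            also have "\<dots> \<le> (2 powr r) ^ (?L + (a + b)) * (fact ?L powr r * fact a powr r)"
              using that by (intro mult_mono power_increasing fact_powr_mono) auto
            finally show ?thesis .
          qed
          have "fact (i + a) powr s \<le> (2 powr s) ^ (?L + (a + b)) * (fact ?L powr s * fact a powr s)"
            using s c ij by (intro *) auto
          moreover have "fact (j + b) powr \<sigma> \<le> (2 powr \<sigma>) ^ (?L + (a + b)) * (fact ?L powr \<sigma> * fact b powr \<sigma>)"
            using *[of \<sigma> j b a] s c ij by (simp add: add.commute[of a])
          moreover have "h ^ (i + a + (j + b)) \<le> h ^ (?L + (a + b))" using h ij by (intro power_increasing) auto
          ultimately show ?thesis using C h by (intro mult_mono mult_left_mono) auto
        qed
        also have "\<dots> = ?B"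
          by (simp add: power_add power_mult_distrib mult_ac)
        finally show "norm (act vs (act ws \<Phi>) X) \<le> ?B" by simp
      qed (auto simp: basis_list)
      then show "norm (act ws \<Phi> X) \<le> ?C * (h * ?c) ^ (a + b) * fact a powr s * fact b powr \<sigma> / wt X"
        by (simp add: le_divide_eq mult_ac)
    qed
  qed
qed

subsection \<open>Translations and modulations\<close>

text \<open>A letter applied to a shifted and modulated function is the same letter on
  \<open>\<Phi>\<close> plus a scalar multiple of the old function, the scalar being a coordinate of
  \<open>A\<close> or \<open>B\<close>.\<close>

lemma GS_translate_modulate:
  fixes \<Phi> :: "'a::euclidean_space \<times> 'a \<Rightarrow> complex"
  assumes s: "s > 0" "\<sigma> > 0" "s + \<sigma> \<ge> 1" and \<Phi>: "\<Phi> \<in> GS s \<sigma>"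
  shows "(\<lambda>X. exp (\<i> * of_real (B \<bullet> X)) * \<Phi> (X - A)) \<in> GS s \<sigma>"
proof -
  obtain C h where C: "C \<ge> 0" and h: "h \<ge> 1"
    and bd: "\<And>a b ws X. ws \<in> words a b \<Longrightarrow> norm (act ws \<Phi> X) \<le> C * h ^ (a + b) * fact a powr s * fact b powr \<sigma>"
    using GS_words[OF assms] by metis
  have sm: "C_infinity \<Phi>" using \<Phi> by (simp add: GS_def)
  define K where "K = 1 + norm A + norm B"
  have K: "K \<ge> 1" "norm A \<le> K" "norm B \<le> K" by (auto simp: K_def)
  let ?e = "\<lambda>X. exp (\<i> * of_real (B \<bullet> X))"
  let ?g = "\<lambda>c ws X. c * (?e X * act ws \<Phi> (X - A))"
  \<comment> \<open>The scalar terms consume a letter without lengthening the word, hence the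
    inequalities between the counts; \<open>K ^ (a + b)\<close> accounts for the scalars.\<close>
  define Q where "Q a b = {?g c ws | c ws. norm c \<le> K ^ (a + b) \<and> (\<exists>a'\<le>a. \<exists>b'\<le>b. ws \<in> words a' b')}" for a b
  have Q_I: "?g c ws \<in> Q a b" if "norm c \<le> K ^ (a + b)" "a' \<le> a" "b' \<le> b" "ws \<in> words a' b'" for c ws a b a' b'
    unfolding Q_def using that by blast
  have smg: "C_infinity (?g c ws)" for c ws
    by (intro C_infinity_mult C_infinity_const C_infinity_exp_inner C_infinity_shift C_infinity_act sm)
  have "(\<lambda>X. ?e X * \<Phi> (X - A)) \<in> GS s \<sigma>"
  proof (rule GS_intro[where Q = Q and C = C and h = "K * h"])
    show "(\<lambda>X. ?e X * \<Phi> (X - A)) \<in> Q 0 0"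
      using Q_I[of 1 0 0 0 0 "[]"] by simp
    fix a b g assume "g \<in> Q a b"
    then obtain c ws a' b' where g: "g = ?g c ws" and c: "norm c \<le> K ^ (a + b)"
      and w: "a' \<le> a" "b' \<le> b" "ws \<in> words a' b'" by (auto simp: Q_def)
    show "g differentiable_on UNIV" unfolding g by (rule C_infinity_differentiable_on[OF smg])
    show "norm (g X) \<le> C * (K * h) ^ (a + b) * fact a powr s * fact b powr \<sigma>" for X
    proof -
      have "norm (g X) = norm c * norm (act ws \<Phi> (X - A))" by (simp add: g norm_mult)
      also have "\<dots> \<le> K ^ (a + b) * (C * h ^ (a' + b') * fact a' powr s * fact b' powr \<sigma>)"
        using c w K by (intro mult_mono bd) auto
      also have "\<dots> \<le> K ^ (a + b) * (C * h ^ (a + b) * fact a powr s * fact b powr \<sigma>)"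
        using C K h w s by (intro mult_left_mono mult_mono power_increasing fact_powr_mono) auto
      finally show ?thesis by (simp add: power_mult_distrib mult_ac)
    qed
    fix l :: "('a \<times> 'a) letter" assume l: "vec_of l \<in> Basis"
    let ?a = "if ty l then Suc a else a" and ?b = "if ty l then b else Suc b"
    let ?a' = "if ty l then Suc a' else a'" and ?b' = "if ty l then b' else Suc b'"
    have ab: "?a + ?b = Suc (a + b)" by simp
    have 1: "?g c (l # ws) \<in> Q ?a ?b"
    proof (rule Q_I)
      have "norm c \<le> 1 * K ^ (a + b)" using c by simp
      also have "\<dots> \<le> K * K ^ (a + b)" using K by (intro mult_right_mono) auto
      finally show "norm c \<le> K ^ (?a + ?b)" unfolding ab by simp
      show "l # ws \<in> words ?a' ?b'" using words_Cons[OF w(3) l] .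
    qed (use w in auto)
    have 2: "?g (c * d) ws \<in> Q ?a ?b" if "norm d \<le> K" for d
    proof (rule Q_I)
      show "norm (c * d) \<le> K ^ (?a + ?b)" unfolding ab norm_mult
        using mult_mono[OF c that] K by (simp add: mult.commute)
    qed (use w in auto)
    show "\<exists>g1\<in>Q ?a ?b. \<exists>g2\<in>Q ?a ?b. act1 l g = (\<lambda>X. g1 X + g2 X)"
    proof (cases l)
      case (Mul v)
      have "act1 l g = (\<lambda>X. ?g c (l # ws) X + ?g (c * of_real (A \<bullet> v)) ws X)"
        by (auto simp: Mul g inner_diff_left algebra_simps)
      moreover have "norm (of_real (A \<bullet> v) :: complex) \<le> K"
        using Basis_le_norm[of v A] l K unfolding Mul by simp
      ultimately show ?thesis by (intro bexI[OF _ 1] bexI[OF _ 2])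
    next
      case (Der v)
      have "act1 l g X = ?g c (l # ws) X + ?g (c * (\<i> * of_real (B \<bullet> v))) ws X" for X
      proof -
        have "act1 l g X = c * pderivative v (\<lambda>X. ?e X * act ws \<Phi> (X - A)) X"
          unfolding Der g act1.simps
          by (intro pderivative_cmult C_infinity_differentiable C_infinity_mult C_infinity_exp_inner C_infinity_shift C_infinity_act sm)
        also have "pderivative v (\<lambda>X. ?e X * act ws \<Phi> (X - A)) X =
            pderivative v ?e X * act ws \<Phi> (X - A) + ?e X * pderivative v (\<lambda>X. act ws \<Phi> (X - A)) X"
          by (intro pderivative_mult C_infinity_differentiable C_infinity_exp_inner C_infinity_shift C_infinity_act sm)
        finally show ?thesis
          by (simp add: Der pderivative_exp_inner pderivative_shift C_infinity_act sm algebra_simps)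
      qed
      then have "act1 l g = (\<lambda>X. ?g c (l # ws) X + ?g (c * (\<i> * of_real (B \<bullet> v))) ws X)" by blast
      moreover have "norm (\<i> * of_real (B \<bullet> v)) \<le> K"
        using Basis_le_norm[of v B] l K unfolding Der by (simp add: norm_mult)
      ultimately show ?thesis by (intro bexI[OF _ 1] bexI[OF _ 2])
    qed
  qed (use s C K h in auto)
  then show ?thesis .
qed

subsection \<open>The transform of a test function and its right inverse\<close>

text \<open>Points of \<open>\<real>\<^bsup>4d\<^esup>\<close> are grouped as \<open>((x, y), (\<xi>, \<eta>))\<close>. The window is translated by \<open>PP\<close>, the pair
  \<open>(x, \<xi>)\<close>, and modulated by \<open>TT\<close>, the pair \<open>(\<eta>, y)\<close>.\<close>

definition PP :: "('a::euclidean_space \<times> 'a) \<times> ('a \<times> 'a) \<Rightarrow> 'a \<times> 'a" where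
  "PP w = (fst (fst w), fst (snd w))"

definition TT :: "('a::euclidean_space \<times> 'a) \<times> ('a \<times> 'a) \<Rightarrow> 'a \<times> 'a" where
  "TT w = (snd (snd w), snd (fst w))"

text \<open>\<open>PA\<close> and \<open>TA\<close> are the transposes of the projections
  \<open>PP\<close> and \<open>TT\<close>, and every point is \<open>PA p + TA t\<close> with
  \<open>p\<close> its position and \<open>t\<close> its frequency.\<close>

definition PA :: "'a::euclidean_space \<times> 'a \<Rightarrow> ('a \<times> 'a) \<times> ('a \<times> 'a)" where
  "PA Z = ((fst Z, 0), (snd Z, 0))"

definition TA :: "'a::euclidean_space \<times> 'a \<Rightarrow> ('a \<times> 'a) \<times> ('a \<times> 'a)" where
  "TA Z = ((0, snd Z), (0, fst Z))"

lemma PT_simps [simp]: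
  "PP (PA Z) = Z" "PP (TA Z) = 0" "TT (PA Z) = 0" "TT (TA Z) = Z"
  "PP (w + w') = PP w + PP w'" "TT (w + w') = TT w + TT w'" "PP (r *\<^sub>R w) = r *\<^sub>R PP w" "TT (r *\<^sub>R w) = r *\<^sub>R TT w"
  "PP ((x, y), (\<xi>, \<eta>)) = (x, \<xi>)" "TT ((x, y), (\<xi>, \<eta>)) = (\<eta>, y)"
  by (simp_all add: PP_def TT_def PA_def TA_def zero_prod_def)

lemma inner_TT: "Z \<bullet> TT w = w \<bullet> TA Z" and inner_PP: "Z \<bullet> PP w = w \<bullet> PA Z"
  by (simp_all add: TT_def TA_def PP_def PA_def inner_prod_def inner_commute)

lemma bounded_linear_PT: "bounded_linear PP" "bounded_linear TT"
  by (auto intro!: linear_conv_bounded_linear[THEN iffD1] linearI)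

lemma PT_measurable [measurable]: "PP \<in> borel_measurable borel" "TT \<in> borel_measurable borel"
  by (intro borel_measurable_continuous_onI linear_continuous_on bounded_linear_PT)+

lemma cnj_measurable [measurable]: "cnj \<in> borel_measurable borel"
  by (intro borel_measurable_continuous_onI continuous_on_cnj continuous_on_id)

text \<open>The exchange of components under \<open>TA\<close> is what preserves letter types:
  \<open>Mul d\<close> and \<open>Der (TA d)\<close> carry the same exponent, as do
  \<open>Der d\<close> and \<open>Mul (TA d)\<close>.\<close>

lemma Basis_PT:
  assumes "d \<in> Basis"
  shows "PA d \<in> Basis" "TA d \<in> Basis" "snd (PA d) = 0 \<longleftrightarrow> snd d = 0" "snd (TA d) = 0 \<longleftrightarrow> snd d \<noteq> 0"
  using assms by (auto simp: PA_def TA_def Basis_prod_def zero_prod_def)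

lemma Basis_PT_cases:
  assumes "D \<in> (Basis :: (('a::euclidean_space \<times> 'a) \<times> ('a \<times> 'a)) set)"
  obtains d where "D = PA d" "d \<in> Basis" | d where "D = TA d" "d \<in> Basis"
proof -
  have "(\<exists>d\<in>Basis. D = PA d) \<or> (\<exists>d\<in>Basis. D = TA d)"
    using assms by (auto simp: PA_def TA_def Basis_prod_def zero_prod_def image_iff bex_Un)
  then show ?thesis using that by blast
qed

definition qker :: "('a::euclidean_space \<times> 'a \<Rightarrow> complex) \<Rightarrow> 'a \<times> 'a \<Rightarrow> ('a \<times> 'a) \<times> ('a \<times> 'a) \<Rightarrow> complex" where
  "qker \<phi> Z w = cnj (\<phi> (Z - PP w)) * exp (\<i> * of_real (- Z \<bullet> TT w))"

text \<open>The operator \<open>Q\<close> of the overview; \<open>STFT_qop\<close> connects it with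
  the transform of a distribution.\<close>

definition qop :: "('a::euclidean_space \<times> 'a \<Rightarrow> complex) \<Rightarrow> (('a \<times> 'a) \<times> ('a \<times> 'a) \<Rightarrow> complex) \<Rightarrow> 'a \<times> 'a \<Rightarrow> complex" where
  "qop \<phi> \<Psi> Z = (LINT w|lborel. qker \<phi> Z w * \<Psi> w)"

lemma C_infinity_linear_exp:
  fixes L :: "'w::euclidean_space \<Rightarrow> 'v::euclidean_space"
  assumes "bounded_linear L"
  shows "C_infinity (\<lambda>w. exp (\<i> * of_real (Z \<bullet> L w)))"
  using C_infinity_affine[OF C_infinity_exp_inner[of Z] assms, of 0] by simp

lemma pderivative_linear_exp:
  fixes L :: "'w::euclidean_space \<Rightarrow> 'v::euclidean_space"
  assumes "bounded_linear L"
  shows "pderivative v (\<lambda>w. exp (\<i> * of_real (Z \<bullet> L w))) w = \<i> * of_real (Z \<bullet> L v) * exp (\<i> * of_real (Z \<bullet> L w))"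
  using pderivative_affine[of "\<lambda>X. exp (\<i> * of_real (Z \<bullet> X))" 0 L w v] assms
  by (simp add: C_infinity_exp_inner C_infinity_differentiable pderivative_exp_inner)

lemma C_infinity_reflect:
  assumes "C_infinity f" "bounded_linear L"
  shows "C_infinity (\<lambda>w. f (Z - L w))" "pderivative v (\<lambda>w. f (Z - L w)) w = - pderivative (L v) f (Z - L w)"
proof -
  have bl: "bounded_linear (\<lambda>w. - L w)" using assms(2) by (rule bounded_linear_minus)
  show "C_infinity (\<lambda>w. f (Z - L w))" using C_infinity_affine[OF assms(1) bl, of Z] by simp
  have "pderivative v (\<lambda>w. f (Z - L w)) w = pderivative (- L v) f (Z - L w)"
    using pderivative_affine[of f Z "\<lambda>w. - L w" w v] C_infinity_differentiable[OF assms(1)] bl by simp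
  then show "pderivative v (\<lambda>w. f (Z - L w)) w = - pderivative (L v) f (Z - L w)"
    using linear_neg[OF linear_pderivative[OF C_infinity_differentiable[OF assms(1)]]] by simp
qed

section \<open>The operator \<open>Q\<close> for windows with bounded first derivatives\<close>

context
  fixes \<phi> :: "'a::euclidean_space \<times> 'a \<Rightarrow> complex" and M :: real
  assumes sm: "C_infinity \<phi>" and M: "\<And>X. norm (\<phi> X) \<le> M" "\<And>b X. b \<in> Basis \<Longrightarrow> norm (pderivative b \<phi> X) \<le> M"
begin

lemma window_bound_nonneg: "M \<ge> 0"
  using M(1)[of 0] norm_ge_zero order_trans by blast

lemma integrable_bounded_sch:
  assumes "\<Psi> \<in> sch" "u \<in> borel_measurable borel" "\<And>w. norm (u w) \<le> M"
  shows "integrable lborel (\<lambda>w. u w * \<Psi> w)"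
proof -
  obtain B where B: "B \<ge> 0" "\<And>w. norm (\<Psi> w) \<le> B / wt w" using sch_decay1(1)[OF assms(1)] by blast
  have [measurable]: "\<Psi> \<in> borel_measurable borel" by (rule C_infinity_borel[OF sch_C_infinity[OF assms(1)]])
  note assms(2)[measurable]
  show ?thesis
  proof (rule integrable_wt_bound)
    show "norm (u w * \<Psi> w) \<le> (M * B) / wt w" for w
      using mult_mono[OF assms(3)[of w] B(2)[of w]] window_bound_nonneg by (simp add: norm_mult)
  qed measurable
qed

lemma window_measurable [measurable]:
  "\<phi> \<in> borel_measurable borel" "pderivative v \<phi> \<in> borel_measurable borel"
  by (intro C_infinity_borel C_infinity_pderivative sm)+

lemma qker_bounded: "norm (qker \<phi> Z w) \<le> M"
  using M(1) by (simp add: qker_def norm_mult)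

lemma qker_measurable: "qker \<phi> Z \<in> borel_measurable borel"
  unfolding qker_def[abs_def] by measurable

lemma integrable_qker: "\<Psi> \<in> sch \<Longrightarrow> integrable lborel (\<lambda>w. qker \<phi> Z w * \<Psi> w)"
  by (rule integrable_bounded_sch) (auto intro: qker_bounded qker_measurable)

lemma qop_bound:
  assumes "\<And>w. norm (\<Psi> w) \<le> B / wt w" "\<Psi> \<in> sch"
  shows "norm (qop \<phi> \<Psi> Z) \<le> M * B * (LINT w|lborel. 1 / wt (w :: ('a \<times> 'a) \<times> ('a \<times> 'a)))"
proof -
  have "norm (qop \<phi> \<Psi> Z) \<le> (LINT w|lborel. M * B * (1 / wt (w :: ('a \<times> 'a) \<times> ('a \<times> 'a))))"
    unfolding qop_def
  proof (rule Bochner_Integration.integral_norm_bound_integral)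
    show "integrable lborel (\<lambda>w. qker \<phi> Z w * \<Psi> w)" by (rule integrable_qker[OF assms(2)])
    show "integrable lborel (\<lambda>w :: ('a \<times> 'a) \<times> ('a \<times> 'a). M * B * (1 / wt w))"
      by (intro integrable_mult_right integrable_inverse_wt)
    show "norm (qker \<phi> Z w * \<Psi> w) \<le> M * B * (1 / wt w)" for w
      using mult_mono[OF qker_bounded[of Z w] assms(1)[of w]] window_bound_nonneg by (simp add: norm_mult)
  qed
  also have "\<dots> = M * B * (LINT w|lborel. 1 / wt (w :: ('a \<times> 'a) \<times> ('a \<times> 'a)))"
    by (rule integral_mult_right_zero)
  finally show ?thesis .
qed

lemma qker_w:
  "C_infinity (\<lambda>w. cnj (\<phi> (Z - PP w)))" "C_infinity (\<lambda>w. exp (\<i> * of_real (- Z \<bullet> TT w)))"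
  "C_infinity (qker \<phi> Z)"
  "pderivative (PA d) (\<lambda>w. cnj (\<phi> (Z - PP w))) w = - cnj (pderivative d \<phi> (Z - PP w))"
  "pderivative (PA d) (\<lambda>w. exp (\<i> * of_real (- Z \<bullet> TT w))) w = 0"
  "pderivative (TA d) (qker \<phi> Z) w = - \<i> * of_real (Z \<bullet> d) * qker \<phi> Z w"
proof -
  show 1: "C_infinity (\<lambda>w. cnj (\<phi> (Z - PP w)))"
    by (rule C_infinity_cnj[OF C_infinity_reflect(1)[OF sm bounded_linear_PT(1)]])
  show 2: "C_infinity (\<lambda>w. exp (\<i> * of_real (- Z \<bullet> TT w)))"
    by (rule C_infinity_linear_exp[OF bounded_linear_PT(2)])
  show "C_infinity (qker \<phi> Z)" unfolding qker_def[abs_def] by (intro C_infinity_mult 1 2)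
  have 3: "pderivative v (\<lambda>w. cnj (\<phi> (Z - PP w))) w = - cnj (pderivative (PP v) \<phi> (Z - PP w))" for v
    using pderivative_cnj[OF C_infinity_differentiable[OF C_infinity_reflect(1)[OF sm bounded_linear_PT(1), of Z]], of v w]
    by (simp add: C_infinity_reflect(2)[OF sm bounded_linear_PT(1)])
  then show "pderivative (PA d) (\<lambda>w. cnj (\<phi> (Z - PP w))) w = - cnj (pderivative d \<phi> (Z - PP w))" by simp
  note 4 = pderivative_linear_exp[OF bounded_linear_PT(2), of _ "- Z"]
  show "pderivative (PA d) (\<lambda>w. exp (\<i> * of_real (- Z \<bullet> TT w))) w = 0"
    by (subst 4) simp
  have "pderivative 0 \<phi> X = 0" for X
    using linear_0[OF linear_pderivative[OF C_infinity_differentiable[OF sm]]] .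
  then show "pderivative (TA d) (qker \<phi> Z) w = - \<i> * of_real (Z \<bullet> d) * qker \<phi> Z w"
    unfolding qker_def[abs_def] pderivative_mult[OF C_infinity_differentiable[OF 1] C_infinity_differentiable[OF 2]] 3
    by (subst 4) simp
qed

text \<open>A coordinate of \<open>Z\<close> is brought down by differentiating the exponential in
  the dual frequency, and integration by parts moves that derivative to \<open>\<Psi>\<close>. The
  window does not depend on the frequency.\<close>

lemma qop_Mul:
  assumes \<Psi>: "\<Psi> \<in> sch" and d: "d \<in> Basis"
  shows "of_real (Z \<bullet> d) * qop \<phi> \<Psi> Z = - \<i> * qop \<phi> (act1 (Der (TA d)) \<Psi>) Z"
proof -
  have i: "integrable lborel (\<lambda>w. qker \<phi> Z w * \<Psi> w)" "integrable lborel (\<lambda>w. qker \<phi> Z w * pderivative (TA d) \<Psi> w)"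
    using integrable_qker[OF \<Psi>] integrable_qker[OF sch_act1[OF \<Psi>, of "Der (TA d)"]] Basis_PT[OF d] by auto
  have "(LINT w|lborel. pderivative (TA d) (qker \<phi> Z) w * \<Psi> w) = - (LINT w|lborel. qker \<phi> Z w * pderivative (TA d) \<Psi> w)"
  proof (rule integral_by_parts[OF qker_w(3) sch_C_infinity[OF \<Psi>] i(1) _ i(2)])
    show "integrable lborel (\<lambda>w. pderivative (TA d) (qker \<phi> Z) w * \<Psi> w)"
      unfolding qker_w(6) using integrable_mult_right[OF i(1), of "- \<i> * of_real (Z \<bullet> d)"] by (simp add: mult.assoc)
  qed
  then have "- \<i> * of_real (Z \<bullet> d) * qop \<phi> \<Psi> Z = - qop \<phi> (act1 (Der (TA d)) \<Psi>) Z"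
    unfolding qker_w(6) qop_def by (simp add: mult.assoc)
  then have "\<i> * (- \<i> * of_real (Z \<bullet> d) * qop \<phi> \<Psi> Z) = \<i> * (- qop \<phi> (act1 (Der (TA d)) \<Psi>) Z)" by simp
  then show ?thesis by (simp add: mult.assoc[symmetric])
qed

text \<open>The derivative falls on the window and on the exponential. The window depends on
  \<open>Z - PP w\<close>, so its derivative in \<open>Z\<close> is minus a derivative in the
  position, which goes over to \<open>\<Psi>\<close> by parts. Iterating never requires a second
  derivative of the window.\<close>

lemma qop_Der:
  assumes \<Psi>: "\<Psi> \<in> sch" and d: "d \<in> Basis"
  shows "pderivative d (qop \<phi> \<Psi>) Z = qop \<phi> (act1 (Der (PA d)) \<Psi>) Z + - \<i> * qop \<phi> (act1 (Mul (TA d)) \<Psi>) Z"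
    and "(qop \<phi> \<Psi>) differentiable (at Z)"
proof -
  let ?K = "\<lambda>Z w. qker \<phi> Z w * \<Psi> w"
  let ?e = "\<lambda>Z w. exp (\<i> * of_real (- Z \<bullet> TT w))"
  have [measurable]: "\<Psi> \<in> borel_measurable borel" by (rule C_infinity_borel[OF sch_C_infinity[OF \<Psi>]])
  have k1: "C_infinity (\<lambda>Z. cnj (\<phi> (Z - PP w)))" for w by (intro C_infinity_cnj C_infinity_shift sm)
  have e': "?e Z w = exp (\<i> * of_real (- TT w \<bullet> Z))" for Z w by (simp add: inner_commute)
  have k2: "C_infinity (\<lambda>Z. ?e Z w)" for w unfolding e' by (rule C_infinity_exp_inner)
  have kd: "pderivative v (\<lambda>Z. ?K Z w) Z =
      cnj (pderivative v \<phi> (Z - PP w)) * (?e Z w * \<Psi> w) - \<i> * (qker \<phi> Z w * (of_real (v \<bullet> TT w) * \<Psi> w))" for v Z w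
  proof -
    have 1: "pderivative v (\<lambda>Z. cnj (\<phi> (Z - PP w))) Z = cnj (pderivative v \<phi> (Z - PP w))"
      using pderivative_cnj[OF C_infinity_differentiable[OF C_infinity_shift[OF sm]]] by (simp add: pderivative_shift[OF sm])
    have 2: "pderivative v (\<lambda>Z. ?e Z w) Z = \<i> * of_real (- TT w \<bullet> v) * ?e Z w"
      unfolding e' by (rule pderivative_exp_inner)
    have "pderivative v (\<lambda>Z. ?K Z w) Z = pderivative v (\<lambda>Z. \<Psi> w * (cnj (\<phi> (Z - PP w)) * ?e Z w)) Z"
      by (simp add: qker_def[abs_def] mult_ac)
    also have "\<dots> = \<Psi> w * pderivative v (\<lambda>Z. cnj (\<phi> (Z - PP w)) * ?e Z w) Z"
      by (intro pderivative_cmult C_infinity_differentiable C_infinity_mult k1 k2)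
    also have "pderivative v (\<lambda>Z. cnj (\<phi> (Z - PP w)) * ?e Z w) Z =
        cnj (pderivative v \<phi> (Z - PP w)) * ?e Z w + cnj (\<phi> (Z - PP w)) * (\<i> * of_real (- TT w \<bullet> v) * ?e Z w)"
      unfolding pderivative_mult[OF C_infinity_differentiable[OF k1] C_infinity_differentiable[OF k2]] 1 2 by (rule refl)
    finally show ?thesis
      by (simp add: qker_def inner_commute[of v] algebra_simps)
  qed
  have smK: "C_infinity (\<lambda>Z. ?K Z w)" for w
    unfolding qker_def by (intro C_infinity_mult C_infinity_const k1 k2)
  obtain B0 where B0: "B0 \<ge> 0" "\<And>w. norm (\<Psi> w) \<le> B0 / wt w" using sch_decay1(1)[OF \<Psi>] by blast
  have "\<forall>b\<in>Basis. \<exists>B. \<forall>w. norm (act1 (Mul (TA b)) \<Psi> w) \<le> B / wt w"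
  proof
    fix b :: "'a \<times> 'a" assume "b \<in> Basis"
    then have "act1 (Mul (TA b)) \<Psi> \<in> sch" by (intro sch_act1[OF \<Psi>]) (simp add: Basis_PT)
    from sch_decay1(1)[OF this] show "\<exists>B. \<forall>w. norm (act1 (Mul (TA b)) \<Psi> w) \<le> B / wt w" by blast
  qed
  from bchoice[OF this] obtain B1 where B1: "\<And>b w. b \<in> Basis \<Longrightarrow> norm (act1 (Mul (TA b)) \<Psi> w) \<le> B1 b / wt w" by blast
  define S1 where "S1 = (\<Sum>b\<in>(Basis :: ('a \<times> 'a) set). \<bar>B1 b\<bar>)"
  define B where "B = B0 + S1"
  have bound: "norm (pderivative b (\<lambda>Z. ?K Z w) Z) \<le> M * B * (1 / wt w)" if b: "b \<in> Basis" for b Z w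
  proof -
    have 1: "norm (cnj (pderivative b \<phi> (Z - PP w)) * (?e Z w * \<Psi> w)) \<le> M * (B0 / wt w)"
      using mult_mono[OF M(2)[OF b, of "Z - PP w"] B0(2)[of w]] window_bound_nonneg by (simp add: norm_mult)
    have "norm (of_real (b \<bullet> TT w) * \<Psi> w) \<le> B1 b / wt w" using B1[OF b, of w] by (simp add: inner_TT)
    also have "\<dots> \<le> S1 / wt w"
    proof (rule divide_right_mono)
      have "\<bar>B1 b\<bar> \<le> S1" unfolding S1_def by (rule member_le_sum[OF b]) auto
      then show "B1 b \<le> S1" by linarith
    qed simp
    finally have 2: "norm (\<i> * (qker \<phi> Z w * (of_real (b \<bullet> TT w) * \<Psi> w))) \<le> M * (S1 / wt w)"
      using mult_mono[OF qker_bounded[of Z w], of "norm (of_real (b \<bullet> TT w) * \<Psi> w)" "S1 / wt w"] window_bound_nonneg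
      by (simp add: norm_mult)
    have "M * (B0 / wt w) + M * (S1 / wt w) = M * B * (1 / wt w)"
      by (simp add: B_def field_simps)
    then show ?thesis
      unfolding kd using norm_triangle_le_diff[OF add_mono[OF 1 2]] by simp
  qed
  have hd: "((\<lambda>Z. LINT w|lborel. ?K Z w) has_derivative (\<lambda>v. LINT w|lborel. pderivative v (\<lambda>Z. ?K Z w) Z)) (at Z)"
  proof (rule has_derivative_integral(1))
    show "(\<lambda>w. pderivative v (\<lambda>Z. ?K Z w) X) \<in> borel_measurable borel" for X v
      unfolding kd using qker_measurable[of X, measurable] by measurable
    show "\<exists>\<delta>>0. \<exists>g. integrable lborel g \<and> (\<forall>X\<in>ball Z \<delta>. \<forall>w. \<forall>b\<in>Basis. norm (pderivative b (\<lambda>X. ?K X w) X) \<le> g w)"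
      using bound by (intro exI[of _ "1::real"] conjI exI[of _ "\<lambda>w. M * B * (1 / wt w)"] integrable_mult_right integrable_inverse_wt) auto
    show "(\<lambda>Z. ?K Z w) differentiable (at X)" for X w by (rule C_infinity_differentiable[OF smK])
    show "integrable lborel (?K X)" for X by (rule integrable_qker[OF \<Psi>])
  qed
  then show "(qop \<phi> \<Psi>) differentiable (at Z)" unfolding qop_def[abs_def] by (rule differentiableI)
  let ?p = "\<lambda>w. cnj (\<phi> (Z - PP w))" and ?g = "\<lambda>w. ?e Z w * \<Psi> w"
  have PA: "PA d \<in> Basis" by (rule Basis_PT(1)[OF d])
  have g: "C_infinity ?g" by (intro C_infinity_mult qker_w(2) sch_C_infinity \<Psi>)
  have gd: "pderivative (PA d) ?g w = ?e Z w * pderivative (PA d) \<Psi> w" for w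
    using pderivative_mult[OF C_infinity_differentiable[OF qker_w(2)] C_infinity_differentiable[OF sch_C_infinity[OF \<Psi>]], of "PA d" Z w]
    by (simp only: qker_w(5)) simp
  have i1: "integrable lborel (\<lambda>w. cnj (pderivative d \<phi> (Z - PP w)) * ?g w)"
  proof -
    have "integrable lborel (\<lambda>w. (cnj (pderivative d \<phi> (Z - PP w)) * ?e Z w) * \<Psi> w)"
      by (rule integrable_bounded_sch[OF \<Psi>]) (measurable, simp add: norm_mult M(2)[OF d])
    then show ?thesis by (simp only: mult.assoc)
  qed
  have i2: "integrable lborel (\<lambda>w. qker \<phi> Z w * act1 (Mul (TA d)) \<Psi> w)"
    by (rule integrable_qker[OF sch_act1[OF \<Psi>]]) (simp add: Basis_PT[OF d])
  have "(LINT w|lborel. pderivative (PA d) ?p w * ?g w) = - (LINT w|lborel. ?p w * pderivative (PA d) ?g w)"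
  proof (rule integral_by_parts[OF qker_w(1) g])
    show "integrable lborel (\<lambda>w. ?p w * ?g w)" using integrable_qker[OF \<Psi>, of Z] by (simp add: qker_def mult.assoc)
    show "integrable lborel (\<lambda>w. pderivative (PA d) ?p w * ?g w)"
      unfolding qker_w(4) using i1 by simp
    show "integrable lborel (\<lambda>w. ?p w * pderivative (PA d) ?g w)"
      unfolding gd using integrable_qker[OF sch_act1[OF \<Psi>, of "Der (PA d)"], of Z] PA by (simp add: qker_def mult.assoc)
  qed
  then have parts: "(LINT w|lborel. cnj (pderivative d \<phi> (Z - PP w)) * ?g w) = qop \<phi> (act1 (Der (PA d)) \<Psi>) Z"
    unfolding qker_w(4) gd by (simp add: qop_def qker_def mult.assoc)
  have "pderivative d (qop \<phi> \<Psi>) Z = (LINT w|lborel. pderivative d (\<lambda>Z. ?K Z w) Z)"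
    unfolding qop_def[abs_def] by (rule pderivative_eqI[OF hd])
  also have "\<dots> = (LINT w|lborel. cnj (pderivative d \<phi> (Z - PP w)) * ?g w - \<i> * (qker \<phi> Z w * act1 (Mul (TA d)) \<Psi> w))"
    unfolding kd by (simp add: inner_TT)
  also have "\<dots> = (LINT w|lborel. cnj (pderivative d \<phi> (Z - PP w)) * ?g w) - (LINT w|lborel. \<i> * (qker \<phi> Z w * act1 (Mul (TA d)) \<Psi> w))"
    by (rule Bochner_Integration.integral_diff[OF i1 integrable_mult_right[OF i2]])
  also have "\<dots> = (LINT w|lborel. cnj (pderivative d \<phi> (Z - PP w)) * ?g w) - \<i> * (LINT w|lborel. qker \<phi> Z w * act1 (Mul (TA d)) \<Psi> w)"
    by (simp only: integral_mult_right_zero)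
  finally show "pderivative d (qop \<phi> \<Psi>) Z = qop \<phi> (act1 (Der (PA d)) \<Psi>) Z + - \<i> * qop \<phi> (act1 (Mul (TA d)) \<Psi>) Z"
    unfolding parts by (simp add: qop_def)
qed

text \<open>A letter on \<open>qop \<phi> \<Psi>\<close> becomes one or two letters of the same type
  on \<open>\<Psi>\<close>, one in each term, so the word bounds of \<open>\<Psi>\<close> transfer
  with the same counts. Their factor \<open>1 / wt w\<close> makes the integrals converge.\<close>

lemma qop_GS:
  assumes s: "s > 0" "\<sigma> > 0" "s + \<sigma> \<ge> 1" and \<Psi>: "\<Psi> \<in> GS s \<sigma>"
  shows "qop \<phi> \<Psi> \<in> GS s \<sigma>"
proof -
  obtain C h where C: "C \<ge> 0" and h: "h \<ge> 1"
    and bd: "\<And>a b ws X. ws \<in> words a b \<Longrightarrow> norm (act ws \<Psi> X) \<le> C * h ^ (a + b) * fact a powr s * fact b powr \<sigma> / wt X"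
    using GS_words_wt[OF assms] by metis
  let ?I = "LINT w|lborel. 1 / wt (w :: ('a \<times> 'a) \<times> ('a \<times> 'a))"
  have I: "?I \<ge> 0" by (intro integral_nonneg_AE) auto
  have sc: "act ws \<Psi> \<in> sch" if "ws \<in> words a b" for ws a b
    using sch_act[OF GS_subset_sch[OF assms]] that by (auto simp: words_def)
  let ?g = "\<lambda>c ws Z. c * qop \<phi> (act ws \<Psi>) Z"
  define Q where "Q a b = {?g c ws | c ws. norm c \<le> 1 \<and> ws \<in> words a b}" for a b
  have Q_I: "?g c ws \<in> Q a b" if "norm c \<le> 1" "ws \<in> words a b" for c ws a b
    unfolding Q_def using that by blast
  show ?thesis
  proof (rule GS_intro[where Q = Q and C = "M * C * ?I" and h = h])
    show "qop \<phi> \<Psi> \<in> Q 0 0" using Q_I[of 1 "[]" 0 0] by simp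
    show "M * C * ?I \<ge> 0" using window_bound_nonneg C I by simp
    fix a b g assume "g \<in> Q a b"
    then obtain c ws where g: "g = ?g c ws" and c: "norm c \<le> 1" and ws: "ws \<in> words a b" by (auto simp: Q_def)
    have df: "qop \<phi> (act ws \<Psi>) differentiable (at X)" for X using qop_Der(2)[OF sc[OF ws]] nonempty_Basis by blast
    then show "g differentiable_on UNIV" unfolding g differentiable_on_def by simp
    show "norm (g Z) \<le> M * C * ?I * h ^ (a + b) * fact a powr s * fact b powr \<sigma>" for Z
    proof -
      have "norm (g Z) \<le> 1 * norm (qop \<phi> (act ws \<Psi>) Z)" unfolding g norm_mult using c by (intro mult_right_mono) auto
      also have "\<dots> \<le> M * (C * h ^ (a + b) * fact a powr s * fact b powr \<sigma>) * ?I"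
        using qop_bound[OF bd[OF ws] sc[OF ws]] by simp
      finally show ?thesis by (simp add: mult_ac)
    qed
    fix l :: "('a \<times> 'a) letter" assume l: "vec_of l \<in> Basis"
    let ?a = "if ty l then Suc a else a" and ?b = "if ty l then b else Suc b"
    show "\<exists>g1\<in>Q ?a ?b. \<exists>g2\<in>Q ?a ?b. act1 l g = (\<lambda>X. g1 X + g2 X)"
    proof (cases l)
      case (Mul d)
      then have d: "d \<in> Basis" using l by simp
      have 1: "?g (c * - \<i>) (Der (TA d) # ws) \<in> Q ?a ?b"
        using words_Cons[OF ws, of "Der (TA d)"] Basis_PT[OF d] c by (intro Q_I) (auto simp: norm_mult Mul)
      \<comment> \<open>A zero summand, since \<open>GS_intro\<close> asks for two terms.\<close>
      have 2: "?g 0 (Der (TA d) # ws) \<in> Q ?a ?b"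
        using words_Cons[OF ws, of "Der (TA d)"] Basis_PT[OF d] by (intro Q_I) (auto simp: Mul)
      have "act1 l g = (\<lambda>Z. ?g (c * - \<i>) (Der (TA d) # ws) Z + ?g 0 (Der (TA d) # ws) Z)"
      proof
        fix Z
        have "act1 l g Z = c * (of_real (Z \<bullet> d) * qop \<phi> (act ws \<Psi>) Z)" by (simp add: Mul g mult_ac)
        then show "act1 l g Z = ?g (c * - \<i>) (Der (TA d) # ws) Z + ?g 0 (Der (TA d) # ws) Z"
          unfolding qop_Mul[OF sc[OF ws] d] by simp
      qed
      then show ?thesis by (intro bexI[OF _ 1] bexI[OF _ 2])
    next
      case (Der d)
      then have d: "d \<in> Basis" using l by simp
      have 1: "?g c (Der (PA d) # ws) \<in> Q ?a ?b"
        using words_Cons[OF ws, of "Der (PA d)"] Basis_PT[OF d] c by (intro Q_I) (auto simp: Der)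
      have 2: "?g (c * - \<i>) (Mul (TA d) # ws) \<in> Q ?a ?b"
        using words_Cons[OF ws, of "Mul (TA d)"] Basis_PT[OF d] c by (intro Q_I) (auto simp: norm_mult Der)
      have "act1 l g = (\<lambda>Z. ?g c (Der (PA d) # ws) Z + ?g (c * - \<i>) (Mul (TA d) # ws) Z)"
      proof
        fix Z
        have "act1 l g Z = c * pderivative d (qop \<phi> (act ws \<Psi>)) Z"
          unfolding Der g act1.simps by (rule pderivative_cmult[OF df])
        then show "act1 l g Z = ?g c (Der (PA d) # ws) Z + ?g (c * - \<i>) (Mul (TA d) # ws) Z"
          unfolding qop_Der(1)[OF sc[OF ws] d] by (simp add: algebra_simps)
      qed
      then show ?thesis by (intro bexI[OF _ 1] bexI[OF _ 2])
    qed
  qed (use s h in auto)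
qed

end

section \<open>Integration over positions and frequencies in turn\<close>

lemma prod_Basis_prod:
  "(\<Prod>b\<in>(Basis :: ('a::euclidean_space \<times> 'b::euclidean_space) set). f b) = (\<Prod>u\<in>Basis. f (u, 0)) * (\<Prod>v\<in>Basis. f (0, v))"
proof -
  have "(\<Prod>b\<in>(Basis :: ('a \<times> 'b) set). f b) = (\<Prod>b\<in>(\<lambda>u. (u, 0)) ` Basis. f b) * (\<Prod>b\<in>(\<lambda>v. (0, v)) ` Basis. f b)"
    unfolding Basis_prod_def by (rule prod.union_disjoint) auto
  then show ?thesis by (simp add: prod.reindex inj_on_def)
qed

lemma wt_PA_TA: "wt (PA p + TA t) = wt p * wt t"
  by (cases p, cases t) (simp add: PA_def TA_def wt_Pair mult_ac)

lemma PA_TA_measurable [measurable]: "(\<lambda>(p, t). PA p + TA t) \<in> borel_measurable borel"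
  unfolding PA_def TA_def case_prod_unfold by (intro borel_measurable_continuous_onI continuous_intros)

text \<open>The map permutes coordinates, so the preimage of a box is a box with the same side
  lengths.\<close>

lemma lborel_PT: "distr lborel borel (\<lambda>(p, t). PA p + TA t) = (lborel :: (('a::euclidean_space \<times> 'a) \<times> ('a \<times> 'a)) measure)"
proof (rule lborel_eqI[symmetric])
  fix l u :: "('a \<times> 'a) \<times> ('a \<times> 'a)"
  assume le: "\<And>b. b \<in> Basis \<Longrightarrow> l \<bullet> b \<le> u \<bullet> b"
  let ?L = "(PP l, TT l)" and ?U = "(PP u, TT u)"
  have pre: "(\<lambda>(p, t). PA p + TA t) -` box l u = box ?L ?U"
    by (auto simp: box_def Basis_prod_def ball_Un PA_def TA_def PP_def TT_def inner_prod_def)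
  have le': "\<And>b. b \<in> Basis \<Longrightarrow> ?L \<bullet> b \<le> ?U \<bullet> b"
  proof -
    fix b :: "('a \<times> 'a) \<times> ('a \<times> 'a)" assume "b \<in> Basis"
    then consider d where "b = (d, 0)" "d \<in> Basis" | d where "b = (0, d)" "d \<in> Basis"
      by (auto simp: Basis_prod_def[where 'a = "'a \<times> 'a" and 'b = "'a \<times> 'a"])
    then show "?L \<bullet> b \<le> ?U \<bullet> b"
    proof cases
      case 1
      then show ?thesis using le[of "PA d"] Basis_PT[OF 1(2)] inner_PP[of d l] inner_PP[of d u] by (simp add: inner_commute)
    next
      case 2
      then show ?thesis using le[of "TA d"] Basis_PT[OF 2(2)] inner_TT[of d l] inner_TT[of d u] by (simp add: inner_commute)
    qed
  qed
  have "emeasure (distr lborel borel (\<lambda>(p, t). PA p + TA t)) (box l u) = emeasure lborel (box ?L ?U)"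
    by (subst emeasure_distr) (auto simp: pre)
  also have "\<dots> = (\<Prod>b\<in>Basis. (?U - ?L) \<bullet> b)"
    by (rule emeasure_lborel_box[OF le'])
  also have "(\<Prod>b\<in>Basis. (?U - ?L) \<bullet> b) = (\<Prod>b\<in>Basis. (u - l) \<bullet> b)"
    by (simp add: prod_Basis_prod PP_def TT_def zero_prod_def inner_prod_def mult_ac)
  finally show "emeasure (distr lborel borel (\<lambda>(p, t). PA p + TA t)) (box l u) = (\<Prod>b\<in>Basis. (u - l) \<bullet> b)" .
qed simp

lemma integral_PT:
  fixes g :: "('a::euclidean_space \<times> 'a) \<times> ('a \<times> 'a) \<Rightarrow> complex"
  assumes "integrable lborel g"
  shows "integrable (lborel \<Otimes>\<^sub>M lborel) (\<lambda>(p, t). g (PA p + TA t))"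
    and "(LINT w|lborel. g w) = (LINT p|lborel. LINT t|lborel. g (PA p + TA t))"
proof -
  have [measurable]: "g \<in> borel_measurable borel" using borel_measurable_integrable[OF assms] by simp
  have PTm: "(\<lambda>(p, t). PA p + TA t) \<in> lborel \<rightarrow>\<^sub>M (borel :: (('a \<times> 'a) \<times> ('a \<times> 'a)) measure)" by simp
  have "integrable (distr lborel borel (\<lambda>(p, t). PA p + TA t)) g" unfolding lborel_PT by (rule assms)
  then have "integrable lborel (\<lambda>q. g (case q of (p, t) \<Rightarrow> PA p + TA t))"
    by (subst (asm) integrable_distr_eq[OF PTm]) auto
  then show i: "integrable (lborel \<Otimes>\<^sub>M lborel) (\<lambda>(p, t). g (PA p + TA t))"
    unfolding lborel_prod by (simp add: case_prod_unfold)
  have "(LINT w|lborel. g w) = integral\<^sup>L (distr lborel borel (\<lambda>(p, t). PA p + TA t)) g" unfolding lborel_PT ..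
  also have "\<dots> = (LINT q|lborel. g (case q of (p, t) \<Rightarrow> PA p + TA t))"
    by (subst integral_distr[OF PTm]) auto
  also have "\<dots> = integral\<^sup>L (lborel \<Otimes>\<^sub>M lborel) (\<lambda>(p, t). g (PA p + TA t))"
    unfolding lborel_prod by (simp add: case_prod_unfold)
  also have "\<dots> = (LINT p|lborel. LINT t|lborel. g (PA p + TA t))"
    using lborel_pair.integral_fst[OF i] by simp
  finally show "(LINT w|lborel. g w) = (LINT p|lborel. LINT t|lborel. g (PA p + TA t))" .
qed

section \<open>The right inverse \<open>S\<close> of \<open>Q\<close>\<close>

definition sker :: "('a::euclidean_space \<times> 'a \<Rightarrow> complex) \<Rightarrow> ('a \<times> 'a) \<times> ('a \<times> 'a) \<Rightarrow> 'a \<times> 'a \<Rightarrow> complex" where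
  "sker \<theta> X w = \<theta> (w - PP X) * exp (\<i> * of_real (w \<bullet> TT X))"

text \<open>The operator \<open>S\<close> of the overview. At a fixed position \<open>p\<close> it
  is, as a function of the frequency \<open>t\<close>, the Fourier transform at \<open>- t\<close>
  of \<open>\<Phi>\<close> times the translate of \<open>\<theta>\<close> by
  \<open>p\<close>.\<close>

definition sop :: "('a::euclidean_space \<times> 'a \<Rightarrow> complex) \<Rightarrow> ('a \<times> 'a \<Rightarrow> complex) \<Rightarrow> ('a \<times> 'a) \<times> ('a \<times> 'a) \<Rightarrow> complex" where
  "sop \<theta> \<Phi> X = (LINT w|lborel. sker \<theta> X w * \<Phi> w)"

lemma sker_C_infinity:
  assumes "C_infinity \<theta>"
  shows "C_infinity (\<lambda>w. \<theta> (w - PP X))" "C_infinity (\<lambda>w. exp (\<i> * of_real (w \<bullet> TT X)))"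
    "C_infinity (sker \<theta> X)" "C_infinity (\<lambda>X. \<theta> (w - PP X))" "C_infinity (\<lambda>X. exp (\<i> * of_real (w \<bullet> TT X)))"
proof -
  show 1: "C_infinity (\<lambda>w. \<theta> (w - PP X))" by (rule C_infinity_shift[OF assms])
  show 2: "C_infinity (\<lambda>w. exp (\<i> * of_real (w \<bullet> TT X)))"
    using C_infinity_exp_inner[of "TT X"] by (simp add: inner_commute)
  show "C_infinity (sker \<theta> X)" unfolding sker_def[abs_def] by (intro C_infinity_mult 1 2)
  show "C_infinity (\<lambda>X. \<theta> (w - PP X))" by (rule C_infinity_reflect(1)[OF assms bounded_linear_PT(1)])
  show "C_infinity (\<lambda>X. exp (\<i> * of_real (w \<bullet> TT X)))" by (rule C_infinity_linear_exp[OF bounded_linear_PT(2)])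
qed

lemma sch_bounds:
  assumes "g \<in> sch"
  shows "\<exists>B\<ge>0. \<forall>w. norm (g w) \<le> B \<and> norm (g w) \<le> B / wt w \<and>
    (\<forall>b\<in>Basis. norm (act1 (Mul b) g w) \<le> B / wt w \<and> norm (act1 (Der b) g w) \<le> B)"
proof -
  let ?L = "Mul ` Basis \<union> Der ` Basis :: ('a \<times> 'a) letter set"
  have "\<forall>l\<in>?L. \<exists>B. \<forall>w. norm (act1 l g w) \<le> B / wt w"
  proof
    fix l :: "('a \<times> 'a) letter" assume "l \<in> ?L"
    then have "act1 l g \<in> sch" by (intro sch_act1[OF assms]) auto
    from sch_decay1(1)[OF this] show "\<exists>B. \<forall>w. norm (act1 l g w) \<le> B / wt w" by blast
  qed
  from bchoice[OF this] obtain B where B: "\<And>l w. l \<in> ?L \<Longrightarrow> norm (act1 l g w) \<le> B l / wt w" by blast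
  obtain B0 where B0: "B0 \<ge> 0" "\<And>w. norm (g w) \<le> B0 / wt w" using sch_decay1(1)[OF assms] by blast
  let ?S = "\<Sum>l\<in>?L. \<bar>B l\<bar>"
  let ?B = "B0 + ?S"
  have S: "?S \<ge> 0" by (intro sum_nonneg) auto
  have 1: "norm (g w) \<le> ?B / wt w" for w
    using B0(2)[of w] divide_right_mono[of B0 ?B "wt w"] S by simp
  have 2: "norm (act1 l g w) \<le> ?B / wt w" if "l \<in> ?L" for l w
  proof -
    have "\<bar>B l\<bar> \<le> ?S" by (rule member_le_sum[OF that]) auto
    then have "B l \<le> ?B" using B0(1) by linarith
    then show ?thesis using B[OF that, of w] divide_right_mono[of "B l" ?B "wt w"] by simp
  qed
  have 3: "?B / wt w \<le> ?B" for w :: "'a \<times> 'a"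
  proof -
    have "?B / wt w \<le> ?B / 1" using wt_ge_1[of w] B0(1) S by (intro divide_left_mono) auto
    then show ?thesis by simp
  qed
  show ?thesis
  proof (intro exI[of _ ?B] conjI allI ballI)
    fix w
    show "norm (g w) \<le> ?B" using 1[of w] 3[of w] by linarith
    fix b :: "'a \<times> 'a" assume "b \<in> Basis"
    note that = this
    show "norm (act1 (Der b) g w) \<le> ?B"
      by (rule order_trans[OF 2 3]) (use that in auto)
    show "norm (act1 (Mul b) g w) \<le> ?B / wt w"
      by (rule 2) (use that in auto)
  qed (use 1 B0(1) S in auto)
qed

lemma integrable_bounded_mult_sch:
  assumes "\<Psi> \<in> sch" "u \<in> borel_measurable borel" "\<And>w. norm (u w) \<le> M"
  shows "integrable lborel (\<lambda>w. u w * \<Psi> w)"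
proof -
  obtain B where B: "B \<ge> 0" "\<And>w. norm (\<Psi> w) \<le> B / wt w" using sch_decay1(1)[OF assms(1)] by blast
  have M: "M \<ge> 0" using assms(3)[of 0] norm_ge_zero order_trans by blast
  have [measurable]: "\<Psi> \<in> borel_measurable borel" by (rule C_infinity_borel[OF sch_C_infinity[OF assms(1)]])
  note assms(2)[measurable]
  show ?thesis
  proof (rule integrable_wt_bound)
    show "norm (u w * \<Psi> w) \<le> (M * B) / wt w" for w
      using mult_mono[OF assms(3)[of w] B(2)[of w]] M by (simp add: norm_mult)
  qed measurable
qed

lemma sker_bounded:
  assumes "\<And>w. norm (\<theta> w) \<le> M"
  shows "norm (sker \<theta> X w) \<le> M"
  using assms by (simp add: sker_def norm_mult)

lemma integrable_sker:
  assumes "\<theta> \<in> sch" "\<Phi> \<in> sch"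
  shows "integrable lborel (\<lambda>w. sker \<theta> X w * \<Phi> w)"
proof -
  obtain M where "\<And>w. norm (\<theta> w) \<le> M" using sch_decay1(2)[OF assms(1)] by blast
  then show ?thesis
    by (intro integrable_bounded_mult_sch[OF assms(2), of _ M] sker_bounded C_infinity_borel sker_C_infinity(3) sch_C_infinity assms)
qed

lemma sop_bound:
  fixes \<theta> \<Phi> :: "'a::euclidean_space \<times> 'a \<Rightarrow> complex"
  assumes "\<theta> \<in> sch" "\<Phi> \<in> sch" "\<And>w. norm (\<theta> w) \<le> A" "\<And>w. norm (\<Phi> w) \<le> B / wt w"
  shows "norm (sop \<theta> \<Phi> X) \<le> A * B * (LINT w|lborel. 1 / wt (w :: 'a \<times> 'a))"
proof -
  have A: "A \<ge> 0" using assms(3)[of 0] norm_ge_zero order_trans by blast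
  have "norm (sop \<theta> \<Phi> X) \<le> (LINT w|lborel. A * B * (1 / wt (w :: 'a \<times> 'a)))"
    unfolding sop_def
  proof (rule Bochner_Integration.integral_norm_bound_integral)
    show "integrable lborel (\<lambda>w. sker \<theta> X w * \<Phi> w)" by (rule integrable_sker[OF assms(1,2)])
    show "integrable lborel (\<lambda>w :: 'a \<times> 'a. A * B * (1 / wt w))"
      by (intro integrable_mult_right integrable_inverse_wt)
    show "norm (sker \<theta> X w * \<Phi> w) \<le> A * B * (1 / wt w)" for w
      using mult_mono[OF sker_bounded[where X = X and w = w, OF assms(3)] assms(4)[of w]] A by (simp add: norm_mult)
  qed
  also have "\<dots> = A * B * (LINT w|lborel. 1 / wt (w :: 'a \<times> 'a))"
    by (rule integral_mult_right_zero)
  finally show ?thesis .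
qed

context
  fixes \<theta> \<Phi> :: "'a::euclidean_space \<times> 'a \<Rightarrow> complex"
  assumes \<theta>: "\<theta> \<in> sch" and \<Phi>: "\<Phi> \<in> sch"
begin

text \<open>A position coordinate is that of \<open>w\<close> minus that of \<open>w - PP X\<close>;
  the first multiplies \<open>\<Phi>\<close>, the second \<open>\<theta>\<close>.\<close>

lemma sop_Mul_PA:
  assumes "e \<in> Basis"
  shows "of_real (X \<bullet> PA e) * sop \<theta> \<Phi> X = sop \<theta> (act1 (Mul e) \<Phi>) X + - 1 * sop (act1 (Mul e) \<theta>) \<Phi> X"
proof -
  have i: "integrable lborel (\<lambda>w. sker \<theta> X w * act1 (Mul e) \<Phi> w)" "integrable lborel (\<lambda>w. sker (act1 (Mul e) \<theta>) X w * \<Phi> w)"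
    using assms by (intro integrable_sker sch_act1 \<theta> \<Phi>; simp)+
  have "of_real (X \<bullet> PA e) * (sker \<theta> X w * \<Phi> w) = sker \<theta> X w * act1 (Mul e) \<Phi> w - sker (act1 (Mul e) \<theta>) X w * \<Phi> w" for w
    by (simp add: sker_def inner_PP[symmetric] inner_commute[of e] inner_diff_left algebra_simps)
  then have "of_real (X \<bullet> PA e) * sop \<theta> \<Phi> X = (LINT w|lborel. sker \<theta> X w * act1 (Mul e) \<Phi> w - sker (act1 (Mul e) \<theta>) X w * \<Phi> w)"
    unfolding sop_def by (simp only: integral_mult_right_zero[symmetric])
  also have "\<dots> = sop \<theta> (act1 (Mul e) \<Phi>) X - sop (act1 (Mul e) \<theta>) \<Phi> X"
    unfolding sop_def by (rule Bochner_Integration.integral_diff[OF i])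
  finally show ?thesis by simp
qed

text \<open>A frequency coordinate is a derivative of the exponential; by parts it falls on both
  factors, \<open>\<theta>\<close> and \<open>\<Phi>\<close>.\<close>

lemma sop_Mul_TA:
  assumes e: "e \<in> Basis"
  shows "of_real (X \<bullet> TA e) * sop \<theta> \<Phi> X = \<i> * sop (act1 (Der e) \<theta>) \<Phi> X + \<i> * sop \<theta> (act1 (Der e) \<Phi>) X"
proof -
  let ?e = "\<lambda>w. exp (\<i> * of_real (w \<bullet> TT X))" and ?g = "\<lambda>w. \<theta> (w - PP X) * \<Phi> w"
  note sm = sch_C_infinity[OF \<theta>] sch_C_infinity[OF \<Phi>]
  have i: "integrable lborel (\<lambda>w. sker (act1 (Der e) \<theta>) X w * \<Phi> w)" "integrable lborel (\<lambda>w. sker \<theta> X w * act1 (Der e) \<Phi> w)"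
    using e by (intro integrable_sker sch_act1 \<theta> \<Phi>; simp)+
  have i0: "integrable lborel (\<lambda>w. sker \<theta> X w * \<Phi> w)" by (rule integrable_sker[OF \<theta> \<Phi>])
  have ed: "pderivative e ?e w = \<i> * of_real (X \<bullet> TA e) * ?e w" for w
    using pderivative_exp_inner[of e "TT X" w] by (simp add: inner_commute inner_TT)
  have gd: "pderivative e ?g w = pderivative e \<theta> (w - PP X) * \<Phi> w + \<theta> (w - PP X) * pderivative e \<Phi> w" for w
    using pderivative_mult[OF C_infinity_differentiable[OF sker_C_infinity(1)[OF sm(1)]] C_infinity_differentiable[OF sm(2)]]
    by (simp add: pderivative_shift[OF sm(1)])
  have eg: "?e w * pderivative e ?g w = sker (act1 (Der e) \<theta>) X w * \<Phi> w + sker \<theta> X w * act1 (Der e) \<Phi> w" for w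
    unfolding gd by (simp add: sker_def algebra_simps)
  have "(LINT w|lborel. pderivative e ?e w * ?g w) = - (LINT w|lborel. ?e w * pderivative e ?g w)"
  proof (rule integral_by_parts)
    show "C_infinity ?e" by (rule sker_C_infinity(2)[OF sm(1)])
    show "C_infinity ?g" by (intro C_infinity_mult sker_C_infinity(1) sm)
    show "integrable lborel (\<lambda>w. ?e w * ?g w)" using i0 by (simp add: sker_def mult_ac)
    show "integrable lborel (\<lambda>w. pderivative e ?e w * ?g w)"
      unfolding ed using integrable_mult_right[OF i0, of "\<i> * of_real (X \<bullet> TA e)"] by (simp add: sker_def mult_ac)
    show "integrable lborel (\<lambda>w. ?e w * pderivative e ?g w)"
      unfolding eg by (intro Bochner_Integration.integrable_add i)
  qed
  moreover have "(LINT w|lborel. pderivative e ?e w * ?g w) = \<i> * (of_real (X \<bullet> TA e) * sop \<theta> \<Phi> X)"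
    unfolding ed sop_def integral_mult_right_zero[symmetric] by (simp add: sker_def mult_ac)
  moreover have "(LINT w|lborel. ?e w * pderivative e ?g w) = sop (act1 (Der e) \<theta>) \<Phi> X + sop \<theta> (act1 (Der e) \<Phi>) X"
    unfolding eg sop_def by (rule Bochner_Integration.integral_add[OF i])
  ultimately have "\<i> * (\<i> * (of_real (X \<bullet> TA e) * sop \<theta> \<Phi> X)) = \<i> * - (sop (act1 (Der e) \<theta>) \<Phi> X + sop \<theta> (act1 (Der e) \<Phi>) X)"
    by simp
  moreover have "P = \<i> * a + \<i> * b" if "\<i> * (\<i> * P) = \<i> * - (a + b)" for P a b :: complex
  proof -
    have "P = - (\<i> * (\<i> * P))" by (simp flip: mult.assoc)
    also have "\<dots> = \<i> * a + \<i> * b" unfolding that by (simp add: algebra_simps)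
    finally show ?thesis .
  qed
  ultimately show ?thesis by blast
qed

text \<open>A position derivative hits only \<open>\<theta>\<close>; a frequency derivative brings
  down a coordinate of \<open>w\<close>, which is given to \<open>\<Phi>\<close>. Both rules keep
  the type of the letter.\<close>

lemma sop_Der:
  shows "(sop \<theta> \<Phi>) differentiable (at X)"
    and "e \<in> Basis \<Longrightarrow> pderivative (PA e) (sop \<theta> \<Phi>) X = - 1 * sop (act1 (Der e) \<theta>) \<Phi> X"
    and "e \<in> Basis \<Longrightarrow> pderivative (TA e) (sop \<theta> \<Phi>) X = \<i> * sop \<theta> (act1 (Mul e) \<Phi>) X"
proof -
  note sm = sch_C_infinity[OF \<theta>] sch_C_infinity[OF \<Phi>]
  let ?K = "\<lambda>X w. sker \<theta> X w * \<Phi> w"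
  let ?e = "\<lambda>X w. exp (\<i> * of_real (w \<bullet> TT X))"
  have [measurable]: "\<Phi> \<in> borel_measurable borel" "\<theta> \<in> borel_measurable borel" "pderivative v \<theta> \<in> borel_measurable borel" for v
    by (intro C_infinity_borel C_infinity_pderivative sm)+
  obtain M where M: "M \<ge> 0" "\<And>w. norm (\<theta> w) \<le> M" "\<And>b w. b \<in> Basis \<Longrightarrow> norm (act1 (Der b) \<theta> w) \<le> M"
    using sch_bounds[OF \<theta>] by blast
  obtain B where B': "B \<ge> 0 \<and> (\<forall>w. norm (\<Phi> w) \<le> B \<and> norm (\<Phi> w) \<le> B / wt w \<and>
      (\<forall>b\<in>Basis. norm (act1 (Mul b) \<Phi> w) \<le> B / wt w \<and> norm (act1 (Der b) \<Phi> w) \<le> B))"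
    using sch_bounds[OF \<Phi>] ..
  have B: "B \<ge> 0" "\<And>w. norm (\<Phi> w) \<le> B / wt w" "\<And>b w. b \<in> Basis \<Longrightarrow> norm (act1 (Mul b) \<Phi> w) \<le> B / wt w"
    using conjunct1[OF B'] spec[OF conjunct2[OF B']] by blast+
  have smK: "C_infinity (\<lambda>X. ?K X w)" for w
    unfolding sker_def
    by (intro C_infinity_mult C_infinity_const sker_C_infinity(4)[OF sm(1)] sker_C_infinity(5)[OF sm(1)])
  have kd: "pderivative v (\<lambda>X. ?K X w) X =
      - (sker (act1 (Der (PP v)) \<theta>) X w * \<Phi> w) + \<i> * (sker \<theta> X w * (of_real (w \<bullet> TT v) * \<Phi> w))" for v X w
  proof -
    have "pderivative v (\<lambda>X. ?K X w) X = pderivative v (\<lambda>X. \<Phi> w * (\<theta> (w - PP X) * ?e X w)) X"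
      by (simp add: sker_def[abs_def] mult_ac)
    also have "\<dots> = \<Phi> w * pderivative v (\<lambda>X. \<theta> (w - PP X) * ?e X w) X"
      by (intro pderivative_cmult C_infinity_differentiable C_infinity_mult
          sker_C_infinity(4)[OF sm(1)] sker_C_infinity(5)[OF sm(1)])
    also have "pderivative v (\<lambda>X. \<theta> (w - PP X) * ?e X w) X =
        - pderivative (PP v) \<theta> (w - PP X) * ?e X w + \<theta> (w - PP X) * (\<i> * of_real (w \<bullet> TT v) * ?e X w)"
      unfolding pderivative_mult[OF C_infinity_differentiable[OF sker_C_infinity(4)[OF sm(1)]] C_infinity_differentiable[OF sker_C_infinity(5)[OF sm(1)]]]
        C_infinity_reflect(2)[OF sm(1) bounded_linear_PT(1)] pderivative_linear_exp[OF bounded_linear_PT(2)] by (rule refl)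
    finally show ?thesis by (simp add: sker_def algebra_simps)
  qed
  have z: "pderivative 0 \<theta> = (\<lambda>X. 0)"
    using linear_0[OF linear_pderivative[OF C_infinity_differentiable[OF sm(1)]]] by blast
  have kdP: "pderivative (PA d) (\<lambda>X. ?K X w) X = - 1 * (sker (act1 (Der d) \<theta>) X w * \<Phi> w)" for d X w
    unfolding kd by simp
  have kdT: "pderivative (TA d) (\<lambda>X. ?K X w) X = \<i> * (sker \<theta> X w * act1 (Mul d) \<Phi> w)" for d X w
    unfolding kd by (simp add: z sker_def)
  have bound: "norm (pderivative D (\<lambda>X. ?K X w) X) \<le> M * B * (1 / wt w)" if D: "D \<in> Basis" for D X w
    using D
  proof (cases rule: Basis_PT_cases)
    case (1 d)
    then show ?thesis
      using mult_mono[OF sker_bounded[where X = X and w = w, OF M(3)[OF 1(2)]] B(2)[of w]] M(1)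
      unfolding 1(1) kdP norm_mult by simp
  next
    case (2 d)
    then show ?thesis
      using mult_mono[OF sker_bounded[where X = X and w = w, OF M(2)] B(3)[OF 2(2), of w]] M(1)
      unfolding 2(1) kdT norm_mult by simp
  qed
  have hd: "((\<lambda>X. LINT w|lborel. ?K X w) has_derivative (\<lambda>v. LINT w|lborel. pderivative v (\<lambda>X. ?K X w) X)) (at X)"
  proof (rule has_derivative_integral(1))
    have "sker \<theta> X \<in> borel_measurable borel" "sker (act1 (Der v) \<theta>) X \<in> borel_measurable borel" for X v
      by (intro C_infinity_borel sker_C_infinity(3) C_infinity_act1 sm)+
    note this[measurable]
    show "(\<lambda>w. pderivative v (\<lambda>X. ?K X w) Y) \<in> borel_measurable borel" for Y v
      unfolding kd by measurable
    show "\<exists>\<delta>>0. \<exists>g. integrable lborel g \<and> (\<forall>Y\<in>ball X \<delta>. \<forall>w. \<forall>b\<in>Basis. norm (pderivative b (\<lambda>X. ?K X w) Y) \<le> g w)"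
      using bound by (intro exI[of _ "1::real"] conjI exI[of _ "\<lambda>w. M * B * (1 / wt w)"] integrable_mult_right integrable_inverse_wt) auto
    show "(\<lambda>X. ?K X w) differentiable (at Y)" for Y w by (rule C_infinity_differentiable[OF smK])
    show "integrable lborel (?K Y)" for Y by (rule integrable_sker[OF \<theta> \<Phi>])
  qed
  then show "(sop \<theta> \<Phi>) differentiable (at X)" unfolding sop_def[abs_def] by (rule differentiableI)
  have pd: "pderivative v (sop \<theta> \<Phi>) X = (LINT w|lborel. pderivative v (\<lambda>X. ?K X w) X)" for v
    unfolding sop_def[abs_def] by (rule pderivative_eqI[OF hd])
  show "pderivative (PA e) (sop \<theta> \<Phi>) X = - 1 * sop (act1 (Der e) \<theta>) \<Phi> X" if "e \<in> Basis"
    unfolding pd kdP sop_def by (rule integral_mult_right_zero)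
  show "pderivative (TA e) (sop \<theta> \<Phi>) X = \<i> * sop \<theta> (act1 (Mul e) \<Phi>) X" if "e \<in> Basis"
    unfolding pd kdT sop_def by (rule integral_mult_right_zero)
qed

end

text \<open>Every letter ends up on \<open>\<theta>\<close> or on \<open>\<Phi>\<close>, with its
  type preserved. The two sets of counts add up to those of the word, and products of factorials are
  at most factorials of sums.\<close>

lemma sop_GS:
  fixes \<theta> \<Phi> :: "'a::euclidean_space \<times> 'a \<Rightarrow> complex"
  assumes s: "s > 0" "\<sigma> > 0" "s + \<sigma> \<ge> 1" and \<theta>: "\<theta> \<in> GS s \<sigma>" and \<Phi>: "\<Phi> \<in> GS s \<sigma>"
  shows "sop \<theta> \<Phi> \<in> GS s \<sigma>"
proof -
  obtain C1 h1 where C1: "C1 \<ge> 0" and h1: "h1 \<ge> 1"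
    and bd1: "\<And>a b ws X. ws \<in> words a b \<Longrightarrow> norm (act ws \<theta> X) \<le> C1 * h1 ^ (a + b) * fact a powr s * fact b powr \<sigma>"
    using GS_words[OF s \<theta>] by metis
  obtain C2 h2 where C2: "C2 \<ge> 0" and h2: "h2 \<ge> 1"
    and bd2: "\<And>a b ws X. ws \<in> words a b \<Longrightarrow> norm (act ws \<Phi> X) \<le> C2 * h2 ^ (a + b) * fact a powr s * fact b powr \<sigma> / wt X"
    using GS_words_wt[OF s \<Phi>] by metis
  define h where "h = max h1 h2"
  have h: "h \<ge> 1" "h1 \<le> h" "h2 \<le> h" using h1 by (auto simp: h_def)
  let ?I = "LINT w|lborel. 1 / wt (w :: 'a \<times> 'a)"
  have I: "?I \<ge> 0" by (intro integral_nonneg_AE) auto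
  have sc1: "act ws \<theta> \<in> sch" and sc2: "act ws \<Phi> \<in> sch" if "ws \<in> words a b" for ws a b
    using sch_act[OF GS_subset_sch[OF s \<theta>]] sch_act[OF GS_subset_sch[OF s \<Phi>]] that by (auto simp: words_def)
  let ?g = "\<lambda>c ws vs X. c * sop (act ws \<theta>) (act vs \<Phi>) X"
  define Q where "Q a b = {?g c ws vs | c ws vs. norm c \<le> 1 \<and>
    (\<exists>a1 b1 a2 b2. ws \<in> words a1 b1 \<and> vs \<in> words a2 b2 \<and> a = a1 + a2 \<and> b = b1 + b2)}" for a b
  have Q_I: "?g c ws vs \<in> Q a b" if "norm c \<le> 1" "ws \<in> words a1 b1" "vs \<in> words a2 b2" "a = a1 + a2" "b = b1 + b2"
    for c ws vs a b a1 b1 a2 b2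
    unfolding Q_def using that by blast
  show ?thesis
  proof (rule GS_intro[where Q = Q and C = "C1 * C2 * ?I" and h = h])
    show "sop \<theta> \<Phi> \<in> Q 0 0" using Q_I[of 1 "[]" 0 0 "[]" 0 0] by simp
    show "C1 * C2 * ?I \<ge> 0" using C1 C2 I by simp
    fix a b g assume "g \<in> Q a b"
    then obtain c ws vs a1 b1 a2 b2 where g: "g = ?g c ws vs" and c: "norm c \<le> 1"
      and ws: "ws \<in> words a1 b1" and vs: "vs \<in> words a2 b2" and ab: "a = a1 + a2" "b = b1 + b2"
      unfolding Q_def by blast
    note sc = sc1[OF ws] sc2[OF vs]
    have df: "sop (act ws \<theta>) (act vs \<Phi>) differentiable (at X)" for X by (rule sop_Der(1)[OF sc])
    then show "g differentiable_on UNIV" unfolding g differentiable_on_def by simp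
    show "norm (g Z) \<le> C1 * C2 * ?I * h ^ (a + b) * fact a powr s * fact b powr \<sigma>" for Z
    proof -
      have "norm (g Z) \<le> 1 * norm (sop (act ws \<theta>) (act vs \<Phi>) Z)" unfolding g norm_mult using c by (intro mult_right_mono) auto
      also have "\<dots> \<le> (C1 * h1 ^ (a1 + b1) * fact a1 powr s * fact b1 powr \<sigma>) * (C2 * h2 ^ (a2 + b2) * fact a2 powr s * fact b2 powr \<sigma>) * ?I"
        using sop_bound[OF sc bd1[OF ws] bd2[OF vs]] by simp
      also have "\<dots> = C1 * C2 * ?I * ((h1 ^ (a1 + b1) * h2 ^ (a2 + b2)) * (fact a1 powr s * fact a2 powr s) * (fact b1 powr \<sigma> * fact b2 powr \<sigma>))"
        by (simp add: mult_ac)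
      also have "\<dots> \<le> C1 * C2 * ?I * (h ^ (a + b) * fact a powr s * fact b powr \<sigma>)"
      proof (intro mult_left_mono mult_mono)
        have "h1 ^ (a1 + b1) * h2 ^ (a2 + b2) \<le> h ^ (a1 + b1) * h ^ (a2 + b2)"
          using h1 h2 h by (intro mult_mono power_mono) auto
        also have "\<dots> = h ^ (a + b)" by (simp add: ab power_add mult_ac)
        finally show "h1 ^ (a1 + b1) * h2 ^ (a2 + b2) \<le> h ^ (a + b)" .
      qed (use ab s C1 C2 I h in \<open>auto intro: fact_powr_mult_le\<close>)
      finally show ?thesis by (simp add: mult_ac)
    qed
    fix l :: "(('a \<times> 'a) \<times> ('a \<times> 'a)) letter" assume l: "vec_of l \<in> Basis"
    let ?a = "if ty l then Suc a else a" and ?b = "if ty l then b else Suc b"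
    note W1 = words_Cons[OF ws] and W2 = words_Cons[OF vs]
    have st: "\<exists>g1\<in>Q ?a ?b. \<exists>g2\<in>Q ?a ?b. act1 l g = (\<lambda>X. g1 X + g2 X)"
      if d: "d \<in> Basis" and k: "k \<in> {Mul d, Der d}" and k': "k' \<in> {Mul d, Der d}" and ty: "ty k = ty l" "ty k' = ty l"
        and n: "norm c1 \<le> 1" "norm c2 \<le> 1"
        and eq: "\<And>X. act1 l g X = c * (c1 * sop (act (k # ws) \<theta>) (act vs \<Phi>) X + c2 * sop (act ws \<theta>) (act (k' # vs) \<Phi>) X)"
      for d k k' c1 c2
    proof -
      have 1: "?g (c * c1) (k # ws) vs \<in> Q ?a ?b"
        using W1[of k] vs d k ty c n ab by (intro Q_I[OF _ W1[of k] vs]) (auto simp: norm_mult intro: mult_le_one)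
      have 2: "?g (c * c2) ws (k' # vs) \<in> Q ?a ?b"
        using d k' ty c n ab by (intro Q_I[OF _ ws W2[of k']]) (auto simp: norm_mult intro: mult_le_one)
      have "act1 l g = (\<lambda>X. ?g (c * c1) (k # ws) vs X + ?g (c * c2) ws (k' # vs) X)"
        unfolding eq[abs_def] by (simp add: algebra_simps)
      then show ?thesis by (intro bexI[OF _ 1] bexI[OF _ 2])
    qed
    show "\<exists>g1\<in>Q ?a ?b. \<exists>g2\<in>Q ?a ?b. act1 l g = (\<lambda>X. g1 X + g2 X)"
    proof (cases l)
      case (Mul D)
      then have D: "D \<in> Basis" using l by simp
      have m: "act1 l g X = c * (of_real (X \<bullet> D) * sop (act ws \<theta>) (act vs \<Phi>) X)" for X by (simp add: Mul g mult_ac)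
      from D show ?thesis
      proof (cases rule: Basis_PT_cases)
        case (1 d)
        show ?thesis
        proof (rule st[of d "Mul d" "Mul d" "- 1" 1])
          show "act1 l g X = c * (- 1 * sop (act (Mul d # ws) \<theta>) (act vs \<Phi>) X + 1 * sop (act ws \<theta>) (act (Mul d # vs) \<Phi>) X)" for X
            unfolding m 1(1) sop_Mul_PA[OF sc 1(2)] act_simps by (simp del: act1.simps)
        qed (use 1 Basis_PT[OF 1(2)] in \<open>auto simp: Mul\<close>)
      next
        case (2 d)
        show ?thesis
        proof (rule st[of d "Der d" "Der d" "\<i>" "\<i>"])
          show "act1 l g X = c * (\<i> * sop (act (Der d # ws) \<theta>) (act vs \<Phi>) X + \<i> * sop (act ws \<theta>) (act (Der d # vs) \<Phi>) X)" for X
            unfolding m 2(1) sop_Mul_TA[OF sc 2(2)] act_simps by (rule refl)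
        qed (use 2 Basis_PT[OF 2(2)] in \<open>auto simp: Mul\<close>)
      qed
    next
      case (Der D)
      then have D: "D \<in> Basis" using l by simp
      have m: "act1 l g X = c * pderivative D (sop (act ws \<theta>) (act vs \<Phi>)) X" for X
        unfolding Der g act1.simps by (rule pderivative_cmult[OF df])
      from D show ?thesis
      proof (cases rule: Basis_PT_cases)
        case (1 d)
        show ?thesis
        proof (rule st[of d "Der d" "Der d" "- 1" 0])
          show "act1 l g X = c * (- 1 * sop (act (Der d # ws) \<theta>) (act vs \<Phi>) X + 0 * sop (act ws \<theta>) (act (Der d # vs) \<Phi>) X)" for X
            unfolding m 1(1) sop_Der(2)[OF sc 1(2)] act_simps by (simp del: act1.simps)
        qed (use 1 Basis_PT[OF 1(2)] in \<open>auto simp: Der\<close>)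
      next
        case (2 d)
        show ?thesis
        proof (rule st[of d "Mul d" "Mul d" 0 "\<i>"])
          show "act1 l g X = c * (0 * sop (act (Mul d # ws) \<theta>) (act vs \<Phi>) X + \<i> * sop (act ws \<theta>) (act (Mul d # vs) \<Phi>) X)" for X
            unfolding m 2(1) sop_Der(3)[OF sc 2(2)] act_simps by (simp del: act1.simps)
        qed (use 2 Basis_PT[OF 2(2)] in \<open>auto simp: Der\<close>)
      qed
    qed
  qed (use s h in auto)
qed

text \<open>Integrating over frequencies first, the exponential in \<open>Q\<close> inverts the
  Fourier transform contained in \<open>S\<close> and returns \<open>\<Phi>\<close> at
  \<open>Z\<close> times a translate of \<open>\<theta>\<close>. The remaining integral over
  positions is the pairing of the conjugate window with \<open>\<theta>\<close>, which does not
  depend on \<open>Z\<close>.\<close>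

lemma qop_sop:
  fixes \<phi> \<theta> \<Phi> :: "'a::euclidean_space \<times> 'a \<Rightarrow> complex"
  assumes s: "s > 0" "\<sigma> > 0" "s + \<sigma> \<ge> 1" and \<theta>: "\<theta> \<in> GS s \<sigma>" and \<Phi>: "\<Phi> \<in> GS s \<sigma>"
    and sm: "C_infinity \<phi>" and M: "\<And>X. norm (\<phi> X) \<le> M" "\<And>b X. b \<in> Basis \<Longrightarrow> norm (pderivative b \<phi> X) \<le> M"
  shows "qop \<phi> (sop \<theta> \<Phi>) Z = of_real ((2 * pi) ^ DIM('a \<times> 'a)) * (LINT p|lborel. cnj (\<phi> p) * \<theta> p) * \<Phi> Z"
proof -
  note sc = GS_subset_sch[OF s \<theta>] GS_subset_sch[OF s \<Phi>] GS_subset_sch[OF s sop_GS[OF s \<theta> \<Phi>]]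
  note smc = sc[THEN sch_C_infinity]
  have [measurable]: "\<phi> \<in> borel_measurable borel" "\<theta> \<in> borel_measurable borel" "\<Phi> \<in> borel_measurable borel"
    by (intro C_infinity_borel sm smc)+
  let ?D = "complex_of_real ((2 * pi) ^ DIM('a \<times> 'a))"
  obtain B where B: "\<And>w. norm (sop \<theta> \<Phi> w) \<le> B / wt w" using sch_decay1(1)[OF sc(3)] by blast
  obtain A1 where A1: "A1 \<ge> 0" "\<And>w. norm (\<theta> w) \<le> A1" using sch_decay1(2)[OF sc(1)] by blast
  obtain A2 where A2: "A2 \<ge> 0" "\<And>w. norm (\<Phi> w) \<le> A2" using sch_decay1(2)[OF sc(2)] by blast
  have inner: "(LINT t|lborel. exp (\<i> * of_real (- Z \<bullet> t)) * sop \<theta> \<Phi> (PA p + TA t)) = ?D * (\<theta> (Z - p) * \<Phi> Z)" for p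
  proof -
    let ?g = "\<lambda>w. \<theta> (w - p) * \<Phi> w"
    have g: "C_infinity ?g" by (intro C_infinity_mult C_infinity_shift smc)
    have gi: "integrable lborel ?g"
      by (rule integrable_bounded_mult_sch[OF sc(2), of _ A1]) (use A1 in auto)
    have sF: "sop \<theta> \<Phi> (PA p + TA t) = FT ?g (- t)" for t
      unfolding sop_def FT_def by (simp add: sker_def inner_commute mult_ac)
    have FTm: "FT ?g \<in> borel_measurable borel" by (rule FT_borel_measurable[OF C_infinity_borel[OF g]])
    have FTi: "integrable lborel (FT ?g)"
    proof (rule integrable_wt_bound[OF FTm])
      show "norm (FT ?g t) \<le> (B / wt p) / wt t" for t
        using B[of "PA p + TA (- t)"] sF[of "- t"] by (simp add: wt_PA_TA)
    qed
    have "(LINT t|lborel. exp (\<i> * of_real (- Z \<bullet> t)) * FT ?g (- t)) = (LINT t|lborel. FT ?g t * exp (\<i> * of_real (t \<bullet> Z)))"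
      using integral_lborel_shift(3)[of "\<lambda>t. FT ?g t * exp (\<i> * of_real (t \<bullet> Z))" 0] FTm
      by (simp add: inner_commute mult.commute)
    also have "\<dots> = ?D * ?g Z"
    proof (rule fourier_inversion[OF gi C_infinity_continuous_on[OF g] _ FTi])
      show "norm (?g X) \<le> A1 * A2" for X
        unfolding norm_mult by (intro mult_mono A1 A2) auto
    qed
    finally show ?thesis unfolding sF .
  qed
  have i: "integrable lborel (\<lambda>w. qker \<phi> Z w * sop \<theta> \<Phi> w)" by (rule integrable_qker[OF sm M sc(3)])
  have "qop \<phi> (sop \<theta> \<Phi>) Z = (LINT p|lborel. LINT t|lborel. qker \<phi> Z (PA p + TA t) * sop \<theta> \<Phi> (PA p + TA t))"
    unfolding qop_def by (rule integral_PT(2)[OF i])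
  also have "\<dots> = (LINT p|lborel. cnj (\<phi> (Z - p)) * (LINT t|lborel. exp (\<i> * of_real (- Z \<bullet> t)) * sop \<theta> \<Phi> (PA p + TA t)))"
    by (simp add: qker_def mult.assoc)
  also have "\<dots> = (LINT p|lborel. (?D * \<Phi> Z) * (cnj (\<phi> (Z - p)) * \<theta> (Z - p)))"
    unfolding inner by (simp add: mult_ac)
  also have "\<dots> = ?D * \<Phi> Z * (LINT p|lborel. cnj (\<phi> (Z - p)) * \<theta> (Z - p))"
    by (rule integral_mult_right_zero)
  also have "(LINT p|lborel. cnj (\<phi> (Z - p)) * \<theta> (Z - p)) = (LINT p|lborel. cnj (\<phi> p) * \<theta> p)"
    by (rule integral_lborel_shift(3)) measurable
  finally show ?thesis by (simp add: mult_ac)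
qed

subsection \<open>Test functions separate measurable functions\<close>

lemma GS_separating:
  fixes g h :: "'a::euclidean_space \<times> 'a \<Rightarrow> complex"
  assumes s: "s > 0" "\<sigma> > 0" "s + \<sigma> \<ge> 1" and g: "g \<in> GS s \<sigma>" "g X0 \<noteq> 0"
    and hm: "h \<in> borel_measurable borel"
    and h: "\<And>\<Psi>. \<Psi> \<in> GS s \<sigma> \<Longrightarrow> integrable lborel (\<lambda>X. h X * \<Psi> X) \<and> (LINT X|lborel. h X * \<Psi> X) = 0"
  shows "AE X in lborel. h X = 0"
proof -
  have gc: "continuous_on UNIV g" using g(1) by (intro C_infinity_continuous_on) (simp add: GS_def)
  have k: "AE X in lborel. h X * g (X - A) = 0" for A :: "'a \<times> 'a"
  proof (rule FT_zero_imp_AE_zero)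
    show "integrable lborel (\<lambda>X. h X * g (X - A))"
      using h[OF GS_translate_modulate[OF s g(1), of 0 A]] by simp
    show "FT (\<lambda>X. h X * g (X - A)) B = 0" for B
      using h[OF GS_translate_modulate[OF s g(1), of "- B" A]] by (simp add: FT_def mult_ac)
  qed
  \<comment> \<open>Countably many translations suffice: those that make \<open>g (X - A)\<close>
    non-zero form a non-empty open set, which meets a dense set.\<close>
  obtain D :: "('a \<times> 'a) set" where D: "countable D" "\<And>U. open U \<Longrightarrow> U \<noteq> {} \<Longrightarrow> \<exists>d\<in>D. d \<in> U"
    using countable_dense_exists by blast
  have "AE X in lborel. \<forall>A\<in>D. h X * g (X - A) = 0"
    using AE_ball_countable[OF D(1), of "\<lambda>X A. h X * g (X - A) = 0" lborel] k by blast
  then show ?thesis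
  proof (rule AE_mp, intro AE_I2 impI)
    fix X assume z: "\<forall>A\<in>D. h X * g (X - A) = 0"
    let ?U = "{A. g (X - A) \<noteq> 0}"
    have "continuous_on UNIV (\<lambda>A. g (X - A))"
      by (rule continuous_on_compose2[OF gc]) (auto intro!: continuous_intros)
    then have "open ?U" using open_Collect_neq[OF _ continuous_on_const] by blast
    moreover have "X - X0 \<in> ?U" using g(2) by simp
    ultimately obtain A where "A \<in> D" "g (X - A) \<noteq> 0" using D(2)[of ?U] by blast
    then show "h X = 0" using z by auto
  qed
qed

subsection \<open>Factorial bounds and exponential decay\<close>

text \<open>A single term of the exponential series, \<open>u ^ m / fact m \<le> exp u\<close>,
  raised to the power \<open>s\<close>; the choice of \<open>u\<close> turns \<open>exp u\<close>
  into the desired weight.\<close>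

lemma power_le_exp_powr:
  fixes t r s :: real
  assumes t: "t \<ge> 0" and r: "r > 0" and s: "s > 0"
  shows "t ^ m \<le> ((s / r) powr s) ^ m * fact m powr s * exp (r * t powr (1 / s))"
proof -
  define u where "u = (r / s) * t powr (1 / s)"
  have u: "u \<ge> 0" using r s by (simp add: u_def)
  have us: "u powr s = (r / s) powr s * t"
    unfolding u_def using r s t by (subst powr_mult) (auto simp: powr_powr)
  have "u ^ m / fact m \<le> exp u"
  proof -
    have "(\<Sum>k\<in>{m}. u ^ k /\<^sub>R fact k) \<le> (\<Sum>k. u ^ k /\<^sub>R fact k)"
      using u by (intro sum_le_suminf summable_exp_generic) auto
    then show ?thesis by (simp add: exp_def divide_inverse mult.commute)
  qed
  then have "u ^ m \<le> fact m * exp u" by (simp add: divide_le_eq mult.commute)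
  then have "(u ^ m) powr s \<le> (fact m * exp u) powr s"
    using s u by (intro powr_mono2) auto
  moreover have "(u ^ m) powr s = ((r / s) powr s * t) ^ m"
  proof (cases "u = 0")
    case True
    then show ?thesis using us s by (cases m) auto
  next
    case False
    then have "(u ^ m) powr s = (u powr s) ^ m"
      using u by (simp add: powr_realpow[symmetric] powr_powr mult.commute)
    then show ?thesis by (simp add: us)
  qed
  moreover have "(fact m * exp u) powr s = fact m powr s * exp (r * t powr (1 / s))"
    using s by (simp add: powr_mult exp_powr_real u_def)
  ultimately have le: "((r / s) powr s) ^ m * t ^ m \<le> fact m powr s * exp (r * t powr (1 / s))"
    by (simp add: power_mult_distrib)
  have inv: "((s / r) powr s) ^ m * ((r / s) powr s) ^ m = 1"
    using r s by (simp add: power_mult_distrib[symmetric] powr_mult[symmetric])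
  have "t ^ m = (((s / r) powr s) ^ m * ((r / s) powr s) ^ m) * t ^ m" by (simp add: inv)
  also have "\<dots> = ((s / r) powr s) ^ m * (((r / s) powr s) ^ m * t ^ m)" by simp
  also have "\<dots> \<le> ((s / r) powr s) ^ m * (fact m powr s * exp (r * t powr (1 / s)))"
    using le by (intro mult_left_mono) auto
  finally show ?thesis by (simp add: mult.assoc)
qed

text \<open>The converse passage: the power \<open>1 / s\<close> of the moment bounds, divided by
  \<open>fact m\<close> and weighted by \<open>2 ^ m\<close> in the denominator, sums to an
  exponential series on the left and a geometric series on the right. The weight halves the
  exponent, hence \<open>s / 2\<close> in the rate.\<close>

lemma exp_decay_of_moments:
  fixes t A C h s :: real
  assumes t: "t \<ge> 0" and A: "A \<ge> 0" and C: "C \<ge> 0" and h: "h > 0" and s: "s > 0"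
    and bd: "\<And>m. t ^ m * A \<le> C * h ^ m * fact m powr s"
  shows "A \<le> C * 2 powr s * exp (- ((s / 2) * h powr (- 1 / s)) * t powr (1 / s))"
proof -
  define u where "u = (t / h) powr (1 / s)"
  have u: "u \<ge> 0" by (simp add: u_def)
  have uht: "h powr (- 1 / s) * t powr (1 / s) = u"
    using t h by (simp add: u_def powr_divide powr_minus_divide)
  have us: "u powr s = t / h" using t h s by (simp add: u_def powr_powr)
  have trm: "A powr (1 / s) * ((u / 2) ^ m / fact m) \<le> C powr (1 / s) * (1 / 2) ^ m" for m
  proof -
    have "(t / h) ^ m * A \<le> C * fact m powr s"
      using bd[of m] h by (simp add: power_divide divide_le_eq mult_ac)
    then have "((t / h) ^ m * A) powr (1 / s) \<le> (C * fact m powr s) powr (1 / s)"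
      using t h A s by (intro powr_mono2) auto
    moreover have "((t / h) ^ m * A) powr (1 / s) = u ^ m * A powr (1 / s)"
    proof -
      have "((t / h) ^ m) powr (1 / s) = u ^ m"
      proof (cases "t = 0")
        case True
        then show ?thesis by (cases m) (auto simp: u_def)
      next
        case False
        then show ?thesis using t h by (simp add: u_def powr_realpow[symmetric] powr_powr mult.commute)
      qed
      then show ?thesis using t h A by (simp add: powr_mult)
    qed
    moreover have "(C * fact m powr s) powr (1 / s) = C powr (1 / s) * fact m"
      using C s by (simp add: powr_mult powr_powr)
    ultimately have "u ^ m * A powr (1 / s) \<le> C powr (1 / s) * fact m" by simp
    then have "u ^ m * A powr (1 / s) / fact m \<le> C powr (1 / s)" by (simp add: divide_le_eq)
    then have "(1 / 2) ^ m * (u ^ m * A powr (1 / s) / fact m) \<le> (1 / 2) ^ m * C powr (1 / s)"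
      by (intro mult_left_mono) auto
    then show ?thesis by (simp add: power_divide mult_ac)
  qed
  have "A powr (1 / s) * exp (u / 2) \<le> C powr (1 / s) * 2"
  proof (rule sums_le[OF trm])
    have "(\<lambda>m. (u / 2) ^ m / fact m) = (\<lambda>m. (u / 2) ^ m /\<^sub>R fact m)"
      by (rule ext) (simp add: field_simps)
    then have "(\<lambda>m. (u / 2) ^ m / fact m) sums exp (u / 2)"
      using exp_converges[of "u / 2"] by (simp only:)
    then show "(\<lambda>m. A powr (1 / s) * ((u / 2) ^ m / fact m)) sums (A powr (1 / s) * exp (u / 2))"
      by (rule sums_mult)
    have "(\<lambda>m. (1 / 2 :: real) ^ m) sums 2" using geometric_sums[of "1 / 2 :: real"] by simp
    then show "(\<lambda>m. C powr (1 / s) * (1 / 2) ^ m) sums (C powr (1 / s) * 2)" by (rule sums_mult)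
  qed
  then have "(A powr (1 / s) * exp (u / 2)) powr s \<le> (C powr (1 / s) * 2) powr s"
    using s by (intro powr_mono2) auto
  then have le: "A * exp (s / 2 * u) \<le> C * 2 powr s"
    using A C s by (simp add: powr_mult powr_powr exp_powr_real mult.commute)
  have "A = A * exp (s / 2 * u) * exp (- (s / 2 * u))" by (simp add: mult.assoc flip: exp_add)
  also have "\<dots> \<le> C * 2 powr s * exp (- (s / 2 * u))" using le by (intro mult_right_mono) auto
  finally show ?thesis by (simp add: uht[symmetric] mult.assoc)
qed

lemma exp_decay_of_moments2:
  fixes t v A C h k s \<sigma> :: real
  assumes t: "t \<ge> 0" "v \<ge> 0" and A: "A \<ge> 0" and C: "C \<ge> 0" and h: "h > 0" "k > 0" and s: "s > 0" "\<sigma> > 0"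
    and bd: "\<And>m n. t ^ m * v ^ n * A \<le> C * (h ^ m * fact m powr s) * (k ^ n * fact n powr \<sigma>)"
  shows "A \<le> C * 2 powr s * 2 powr \<sigma> * (exp (- ((s / 2) * h powr (- 1 / s)) * t powr (1 / s)) *
    exp (- ((\<sigma> / 2) * k powr (- 1 / \<sigma>)) * v powr (1 / \<sigma>)))"
proof -
  let ?e = "exp (- ((s / 2) * h powr (- 1 / s)) * t powr (1 / s))"
  have 1: "v ^ n * A \<le> C * 2 powr s * ?e * k ^ n * fact n powr \<sigma>" for n
  proof -
    have "v ^ n * A \<le> C * (k ^ n * fact n powr \<sigma>) * 2 powr s * ?e"
    proof (rule exp_decay_of_moments)
      show "t ^ m * (v ^ n * A) \<le> C * (k ^ n * fact n powr \<sigma>) * h ^ m * fact m powr s" for m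
        using bd[of m n] by (simp add: mult_ac)
    qed (use t A C h s in auto)
    then show ?thesis by (simp add: mult_ac)
  qed
  have "A \<le> (C * 2 powr s * ?e) * 2 powr \<sigma> * exp (- ((\<sigma> / 2) * k powr (- 1 / \<sigma>)) * v powr (1 / \<sigma>))"
    by (rule exp_decay_of_moments[OF t(2) A _ h(2) s(2) 1]) (use C in auto)
  then show ?thesis by (simp add: mult_ac)
qed

lemma powr_add_le:
  fixes a b p :: real
  assumes "a \<ge> 0" "b \<ge> 0" "p > 0"
  shows "(a + b) powr p \<le> 2 powr p * (a powr p + b powr p)"
proof -
  have "(a + b) powr p \<le> (2 * max a b) powr p" using assms by (intro powr_mono2) auto
  also have "\<dots> = 2 powr p * max a b powr p" using assms by (simp add: powr_mult)
  also have "\<dots> \<le> 2 powr p * (a powr p + b powr p)" by (intro mult_left_mono) (auto simp: max_def)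
  finally show ?thesis .
qed

lemma norm_powr_add_le:
  fixes x y :: "'a::real_normed_vector"
  assumes "p > 0"
  shows "norm (x + y) powr p \<le> 2 powr p * (norm x powr p + norm y powr p)"
proof -
  have "norm (x + y) powr p \<le> (norm x + norm y) powr p"
    using assms by (intro powr_mono2 norm_triangle_ineq) auto
  also have "\<dots> \<le> 2 powr p * (norm x powr p + norm y powr p)" using assms by (intro powr_add_le) auto
  finally show ?thesis .
qed

lemma norm_le_DIM_component:
  fixes x :: "'a::euclidean_space"
  shows "\<exists>b\<in>Basis. norm x \<le> DIM('a) * \<bar>x \<bullet> b\<bar>"
proof -
  have "finite ((\<lambda>b. \<bar>x \<bullet> b\<bar>) ` (Basis :: 'a set))" "(\<lambda>b. \<bar>x \<bullet> b\<bar>) ` (Basis :: 'a set) \<noteq> {}" by auto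
  then have "Max ((\<lambda>b. \<bar>x \<bullet> b\<bar>) ` (Basis :: 'a set)) \<in> (\<lambda>b. \<bar>x \<bullet> b\<bar>) ` Basis" by (rule Max_in)
  then obtain b :: 'a where b: "b \<in> Basis" "Max ((\<lambda>b. \<bar>x \<bullet> b\<bar>) ` (Basis :: 'a set)) = \<bar>x \<bullet> b\<bar>" by (rule imageE) auto
  have "norm x \<le> (\<Sum>b\<in>Basis. \<bar>x \<bullet> b\<bar>)" by (rule norm_le_l1)
  also have "\<dots> \<le> (\<Sum>c\<in>(Basis :: 'a set). \<bar>x \<bullet> b\<bar>)"
  proof (rule sum_mono)
    fix c :: 'a assume "c \<in> Basis"
    then show "\<bar>x \<bullet> c\<bar> \<le> \<bar>x \<bullet> b\<bar>" unfolding b(2)[symmetric] by (intro Max_ge) auto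
  qed
  finally show ?thesis using b by (intro bexI[of _ b]) auto
qed

lemma exp_minus_mono: "r \<le> c \<Longrightarrow> n \<ge> 0 \<Longrightarrow> exp (- c * n) \<le> exp (- r * (n :: real))"
  by (simp add: mult_right_mono)

lemma Basis_cases:
  assumes "d \<in> (Basis :: ('a::euclidean_space \<times> 'b::euclidean_space) set)"
  obtains v where "d = (v, 0)" "v \<in> Basis" | v where "d = (0, v)" "v \<in> Basis" "v \<noteq> 0"
  using assms unfolding Basis_prod_def by (auto simp: nonzero_Basis)

subsection \<open>Bounds on all derivatives\<close>

definition Wt :: "real \<Rightarrow> real \<Rightarrow> ('a::euclidean_space \<times> 'a) list \<Rightarrow> real" where
  "Wt s \<sigma> ds = fact (n1 ds) powr \<sigma> * fact (n2 ds) powr s"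

lemma Wt_nonneg [simp]: "Wt s \<sigma> ds \<ge> 0"
  by (simp add: Wt_def)

lemma Wt_splits:
  assumes "s > 0" "\<sigma> > 0" "(as, bs) \<in> set (splits ds)"
  shows "Wt s \<sigma> as * Wt s \<sigma> bs \<le> Wt s \<sigma> ds"
proof -
  have "Wt s \<sigma> as * Wt s \<sigma> bs = (fact (n1 as) powr \<sigma> * fact (n1 bs) powr \<sigma>) * (fact (n2 as) powr s * fact (n2 bs) powr s)"
    by (simp add: Wt_def mult_ac)
  also have "\<dots> \<le> fact (n1 as + n1 bs) powr \<sigma> * fact (n2 as + n2 bs) powr s"
    using assms by (intro mult_mono fact_powr_mult_le) auto
  finally show ?thesis using splits_n[OF assms(3)] by (simp add: Wt_def)
qed

text \<open>Gevrey bounds at a single point, so that the amplitude \<open>A\<close> may grow or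
  decay with \<open>X\<close> while \<open>h\<close> stays fixed.\<close>

definition dbound :: "real \<Rightarrow> real \<Rightarrow> real \<Rightarrow> real \<Rightarrow> ('a::euclidean_space \<times> 'a \<Rightarrow> complex) \<Rightarrow> 'a \<times> 'a \<Rightarrow> bool" where
  "dbound s \<sigma> h A f X \<longleftrightarrow> (\<forall>ds. set ds \<subseteq> Basis \<longrightarrow> norm (dd ds f X) \<le> A * h ^ length ds * Wt s \<sigma> ds)"

lemma dboundD: "dbound s \<sigma> h A f X \<Longrightarrow> set ds \<subseteq> Basis \<Longrightarrow> norm (dd ds f X) \<le> A * h ^ length ds * Wt s \<sigma> ds"
  by (simp add: dbound_def)

lemma dbound_nonneg: "dbound s \<sigma> h A f X \<Longrightarrow> A \<ge> 0"
  using order_trans[OF norm_ge_zero dboundD[of s \<sigma> h A f X "[]"]] by (simp add: Wt_def)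

lemma dbound_mono:
  assumes "dbound s \<sigma> h A f X" "A \<le> A'" "0 \<le> h" "h \<le> h'"
  shows "dbound s \<sigma> h' A' f X"
  unfolding dbound_def
proof (intro allI impI)
  fix ds :: "('a \<times> 'a) list" assume "set ds \<subseteq> Basis"
  then have "norm (dd ds f X) \<le> A * h ^ length ds * Wt s \<sigma> ds" by (rule dboundD[OF assms(1)])
  also have "\<dots> \<le> A' * h' ^ length ds * Wt s \<sigma> ds"
    using assms dbound_nonneg[OF assms(1)] by (intro mult_right_mono mult_mono power_mono) auto
  finally show "norm (dd ds f X) \<le> A' * h' ^ length ds * Wt s \<sigma> ds" .
qed

lemma norm_sum_list_le:
  fixes B :: real
  shows "(\<And>x. x \<in> set xs \<Longrightarrow> norm (F x :: complex) \<le> B) \<Longrightarrow> norm (\<Sum>x\<leftarrow>xs. F x) \<le> length xs * B"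
proof (induction xs)
  case (Cons x xs)
  then have "norm (F x) \<le> B" "norm (\<Sum>x\<leftarrow>xs. F x) \<le> length xs * B" by auto
  then show ?case using norm_triangle_ineq[of "F x" "\<Sum>x\<leftarrow>xs. F x"] by (simp add: algebra_simps)
qed simp

text \<open>The Leibniz rule has \<open>2 ^ length ds\<close> terms, each within the product of the
  bounds because the weights are submultiplicative under splitting; the number of terms doubles
  \<open>h\<close>.\<close>

lemma dbound_mult:
  assumes s: "s > 0" "\<sigma> > 0" and f: "C_infinity f" "dbound s \<sigma> h A f X" and g: "C_infinity g" "dbound s \<sigma> h B g X" and h: "h \<ge> 0"
  shows "dbound s \<sigma> (2 * h) (A * B) (\<lambda>X. f X * g X) X"
  unfolding dbound_def
proof (intro allI impI)
  fix ds :: "('a \<times> 'a) list" assume ds: "set ds \<subseteq> Basis"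
  note AB = dbound_nonneg[OF f(2)] dbound_nonneg[OF g(2)]
  have key: "norm (case p of (as, bs) \<Rightarrow> dd as f X * dd bs g X) \<le> A * B * h ^ length ds * Wt s \<sigma> ds"
    if p: "p \<in> set (splits ds)" for p
  proof -
    obtain as bs where pe: "p = (as, bs)" by (cases p)
    then have sp: "(as, bs) \<in> set (splits ds)" using p by simp
    have "norm (dd as f X * dd bs g X) \<le> (A * h ^ length as * Wt s \<sigma> as) * (B * h ^ length bs * Wt s \<sigma> bs)"
      unfolding norm_mult using splits_n[OF sp] ds h AB by (intro mult_mono dboundD[OF f(2)] dboundD[OF g(2)]) auto
    also have "\<dots> = A * B * (h ^ length as * h ^ length bs) * (Wt s \<sigma> as * Wt s \<sigma> bs)" by (simp add: mult_ac)
    also have "\<dots> \<le> A * B * (h ^ length as * h ^ length bs) * Wt s \<sigma> ds"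
      using AB h Wt_splits[OF s sp] by (intro mult_left_mono) auto
    also have "h ^ length as * h ^ length bs = h ^ length ds" using splits_n(3)[OF sp] by (simp flip: power_add)
    finally show ?thesis by (simp add: pe)
  qed
  have "norm (dd ds (\<lambda>X. f X * g X) X) \<le> length (splits ds) * (A * B * h ^ length ds * Wt s \<sigma> ds)"
    unfolding dd_mult[OF f(1) g(1)] by (rule norm_sum_list_le[OF key])
  then show "norm (dd ds (\<lambda>X. f X * g X) X) \<le> A * B * (2 * h) ^ length ds * Wt s \<sigma> ds"
    by (simp add: length_splits power_mult_distrib mult_ac)
qed

lemma dbound_cnj: "C_infinity f \<Longrightarrow> dbound s \<sigma> h A f X \<Longrightarrow> dbound s \<sigma> h A (\<lambda>X. cnj (f X)) X"
  by (simp add: dbound_def dd_cnj)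

lemma dbound_shift: "C_infinity f \<Longrightarrow> dbound s \<sigma> h A f (X - Y) \<Longrightarrow> dbound s \<sigma> h A (\<lambda>X. f (X - Y)) X"
  by (simp add: dbound_def dd_shift)

lemma dbound_cmult: "C_infinity f \<Longrightarrow> dbound s \<sigma> h A f X \<Longrightarrow> dbound s \<sigma> h (norm c * A) (\<lambda>X. c * f X) X"
  by (simp add: dbound_def dd_cmult norm_mult mult.assoc mult_left_mono)

text \<open>The maximum over \<open>t\<close> of \<open>t\<^sup>n exp (- r t\<^bsup>1/s\<^esup>)\<close> is at most \<open>((s / r) powr s)\<^sup>n n!\<^sup>s\<close>.\<close>

definition hh :: "real \<Rightarrow> real \<Rightarrow> real \<Rightarrow> real" where
  "hh s \<sigma> r = max ((s / r) powr s) ((\<sigma> / r) powr \<sigma>)"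

lemma hh_pos: "s > 0 \<Longrightarrow> \<sigma> > 0 \<Longrightarrow> r > 0 \<Longrightarrow> hh s \<sigma> r > 0"
  by (simp add: hh_def max_def)

text \<open>For the projective version: a large decay rate buys Gevrey bounds with an arbitrarily
  small constant.\<close>

lemma hh_small:
  assumes "s > 0" "\<sigma> > 0" "h > 0"
  shows "\<exists>r0>0. \<forall>r\<ge>r0. hh s \<sigma> r \<le> h"
proof -
  have *: "\<exists>r0>0. \<forall>r\<ge>r0. (s / r) powr s \<le> h" if "s > 0" for s
  proof (intro exI[of _ "s / h powr (1 / s)"] conjI allI impI)
    show p: "s / h powr (1 / s) > 0" using assms that by simp
    fix r assume r: "s / h powr (1 / s) \<le> r"
    with p have r0: "r > 0" by linarith
    from r have "s / r \<le> h powr (1 / s)" using assms that r0 by (simp add: divide_le_eq mult.commute)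
    then have "(s / r) powr s \<le> (h powr (1 / s)) powr s" using that r0 by (intro powr_mono2) auto
    then show "(s / r) powr s \<le> h" using that assms by (simp add: powr_powr)
  qed
  obtain r1 r2 where "r1 > 0" "\<forall>r\<ge>r1. (s / r) powr s \<le> h" "r2 > 0" "\<forall>r\<ge>r2. (\<sigma> / r) powr \<sigma> \<le> h"
    using *[OF assms(1)] *[OF assms(2)] by metis
  then show ?thesis by (intro exI[of _ "max r1 r2"]) (auto simp: hh_def)
qed

text \<open>Derivatives of a character are monomials in its frequency;
  \<open>power_le_exp_powr\<close> trades these for factorials at the price of an exponential weight
  with freely chosen rate \<open>r\<close>.\<close>

lemma dbound_exp:
  assumes s: "s > 0" "\<sigma> > 0" and r: "r > 0"
  shows "dbound s \<sigma> (hh s \<sigma> r) (exp (r * (norm (fst B) powr (1 / \<sigma>) + norm (snd B) powr (1 / s))))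
    (\<lambda>X. exp (\<i> * of_real (B \<bullet> X))) X"
  unfolding dbound_def
proof (intro allI impI)
  fix ds :: "('a \<times> 'a) list" assume ds: "set ds \<subseteq> Basis"
  have "norm (\<Prod>v\<leftarrow>ds. \<i> * complex_of_real (B \<bullet> v)) \<le> norm (fst B) ^ n1 ds * norm (snd B) ^ n2 ds"
    using ds
  proof (induction ds)
    case (Cons v ds)
    then have IH: "norm (\<Prod>v\<leftarrow>ds. \<i> * complex_of_real (B \<bullet> v)) \<le> norm (fst B) ^ n1 ds * norm (snd B) ^ n2 ds"
      and v: "v \<in> Basis" by auto
    from v show ?case
    proof (cases rule: Basis_cases)
      case (1 b)
      then have "\<bar>B \<bullet> v\<bar> \<le> norm (fst B)" using Basis_le_norm[of b "fst B"] by (simp add: inner_prod_def)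
      from mult_mono[OF this IH] show ?thesis using 1 by (simp add: norm_mult mult_ac)
    next
      case (2 b)
      then have "\<bar>B \<bullet> v\<bar> \<le> norm (snd B)" using Basis_le_norm[of b "snd B"] by (simp add: inner_prod_def)
      from mult_mono[OF this IH] show ?thesis using 2 by (simp add: norm_mult mult_ac)
    qed
  qed simp
  then have "norm (dd ds (\<lambda>X. exp (\<i> * complex_of_real (B \<bullet> X))) X) \<le> norm (fst B) ^ n1 ds * norm (snd B) ^ n2 ds"
    by (simp add: dd_exp_inner norm_mult)
  also have "\<dots> \<le> (hh s \<sigma> r ^ n1 ds * fact (n1 ds) powr \<sigma> * exp (r * norm (fst B) powr (1 / \<sigma>))) *
      (hh s \<sigma> r ^ n2 ds * fact (n2 ds) powr s * exp (r * norm (snd B) powr (1 / s)))"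
  proof (intro mult_mono)
    show "norm (fst B) ^ n1 ds \<le> hh s \<sigma> r ^ n1 ds * fact (n1 ds) powr \<sigma> * exp (r * norm (fst B) powr (1 / \<sigma>))"
      by (rule order_trans[OF power_le_exp_powr[OF _ r s(2)]])
         (auto simp: hh_def intro!: mult_right_mono power_mono)
    show "norm (snd B) ^ n2 ds \<le> hh s \<sigma> r ^ n2 ds * fact (n2 ds) powr s * exp (r * norm (snd B) powr (1 / s))"
      by (rule order_trans[OF power_le_exp_powr[OF _ r s(1)]])
         (auto simp: hh_def intro!: mult_right_mono power_mono)
  qed (use hh_pos[OF s r] in auto)
  also have "\<dots> = exp (r * (norm (fst B) powr (1 / \<sigma>) + norm (snd B) powr (1 / s))) * hh s \<sigma> r ^ length ds * Wt s \<sigma> ds"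
    by (simp add: Wt_def n1_add_n2[symmetric] power_add exp_add distrib_left mult_ac)
  finally show "norm (dd ds (\<lambda>X. exp (\<i> * complex_of_real (B \<bullet> X))) X) \<le>
      exp (r * (norm (fst B) powr (1 / \<sigma>) + norm (snd B) powr (1 / s))) * hh s \<sigma> r ^ length ds * Wt s \<sigma> ds" .
qed

definition ew :: "real \<Rightarrow> real \<Rightarrow> 'a::euclidean_space \<times> 'a \<Rightarrow> real" where
  "ew s \<sigma> X = norm (fst X) powr (1 / s) + norm (snd X) powr (1 / \<sigma>)"

lemma ew_nonneg [simp]: "ew s \<sigma> X \<ge> 0"
  by (simp add: ew_def)

text \<open>Both parameters of the window are kept visible: \<open>GS\<close> provides some pair
  \<open>h\<close>, \<open>r\<close> and \<open>GS_proj\<close> every pair, so the two versions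
  share all lemmas. Bounds on words would demand \<open>s + \<sigma> \<ge> 1\<close>, which the
  exponents of the window need not satisfy.\<close>

definition expdec :: "real \<Rightarrow> real \<Rightarrow> real \<Rightarrow> real \<Rightarrow> ('a::euclidean_space \<times> 'a \<Rightarrow> complex) \<Rightarrow> bool" where
  "expdec s \<sigma> h r \<phi> \<longleftrightarrow> C_infinity \<phi> \<and> (\<exists>C\<ge>0. \<forall>X. dbound s \<sigma> h (C * exp (- r * ew s \<sigma> X)) \<phi> X)"

text \<open>A norm is at most the dimension times the largest coordinate, so monomials in one
  coordinate of each variable control the moments; their bounds turn into exponential decay of every
  derivative by \<open>exp_decay_of_moments2\<close>.\<close>

lemma expdec_of_GS_norm:
  fixes \<phi> :: "'a::euclidean_space \<times> 'a \<Rightarrow> complex" and h :: real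
  assumes s: "s > 0" "\<sigma> > 0" and h: "h > 0" and sm: "C_infinity \<phi>" and fin: "GS_norm s \<sigma> h \<phi> < \<infinity>"
    and r: "r \<le> (s / 2) * (real DIM('a) * h) powr (- 1 / s)" "r \<le> (\<sigma> / 2) * (real DIM('a) * h) powr (- 1 / \<sigma>)"
  shows "expdec s \<sigma> h r \<phi>"
proof -
  obtain C where C: "C \<ge> 0" and bd: "\<And>ms ds X. set ms \<subseteq> Basis \<Longrightarrow> set ds \<subseteq> Basis \<Longrightarrow> \<bar>\<Prod>m\<leftarrow>ms. X \<bullet> m\<bar> * norm (dd ds \<phi> X) \<le>
    C * (h ^ (length ms + length ds) * fact (n1 ms) powr s * fact (n2 ms) powr \<sigma> * fact (n1 ds) powr \<sigma> * fact (n2 ds) powr s)"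
    using GS_norm_bound[OF _ _ h sm fin] s by (metis less_imp_le)
  let ?D = "real DIM('a)"
  let ?C = "C * 2 powr s * 2 powr \<sigma>"
  have "norm (dd ds \<phi> X) \<le> ?C * exp (- r * ew s \<sigma> X) * h ^ length ds * Wt s \<sigma> ds" if ds: "set ds \<subseteq> Basis" for ds X
  proof -
    obtain x \<xi> where X: "X = (x, \<xi>)" by (cases X)
    obtain b1 b2 where b: "b1 \<in> Basis" "norm x \<le> ?D * \<bar>x \<bullet> b1\<bar>" "b2 \<in> Basis" "norm \<xi> \<le> ?D * \<bar>\<xi> \<bullet> b2\<bar>"
      using norm_le_DIM_component by metis
    have b2: "b2 \<noteq> 0" using b by auto
    have A: "norm x ^ m * norm \<xi> ^ n * norm (dd ds \<phi> X) \<le>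
        (C * h ^ length ds * Wt s \<sigma> ds) * ((?D * h) ^ m * fact m powr s) * ((?D * h) ^ n * fact n powr \<sigma>)" for m n
    proof -
      let ?ms = "replicate m (b1, 0) @ replicate n (0, b2)"
      have nn: "n1 ?ms = m" "n2 ?ms = n" "length ?ms = m + n" "set ?ms \<subseteq> Basis"
        using b b2 by (auto simp: n1_def n2_def filter_replicate Basis_prod_def)
      have pr: "\<bar>\<Prod>v\<leftarrow>?ms. X \<bullet> v\<bar> = \<bar>x \<bullet> b1\<bar> ^ m * \<bar>\<xi> \<bullet> b2\<bar> ^ n"
        by (simp add: X abs_mult power_abs prod_list_replicate)
      have "norm x ^ m * norm \<xi> ^ n * norm (dd ds \<phi> X) \<le> (?D * \<bar>x \<bullet> b1\<bar>) ^ m * (?D * \<bar>\<xi> \<bullet> b2\<bar>) ^ n * norm (dd ds \<phi> X)"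
        using b by (intro mult_right_mono mult_mono power_mono) auto
      also have "\<dots> = ?D ^ (m + n) * (\<bar>\<Prod>v\<leftarrow>?ms. X \<bullet> v\<bar> * norm (dd ds \<phi> X))"
        unfolding pr by (simp add: power_mult_distrib power_add mult_ac)
      also have "\<dots> \<le> ?D ^ (m + n) * (C * (h ^ (m + n + length ds) * fact m powr s * fact n powr \<sigma> * fact (n1 ds) powr \<sigma> * fact (n2 ds) powr s))"
        using bd[OF nn(4) ds, of X] unfolding nn(1-3) by (intro mult_left_mono) auto
      also have "\<dots> = (C * h ^ length ds * Wt s \<sigma> ds) * ((?D * h) ^ m * fact m powr s) * ((?D * h) ^ n * fact n powr \<sigma>)"
        by (simp add: Wt_def power_add power_mult_distrib mult_ac)
      finally show ?thesis .
    qed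
    have "norm (dd ds \<phi> X) \<le> C * h ^ length ds * Wt s \<sigma> ds * 2 powr s * 2 powr \<sigma> *
      (exp (- ((s / 2) * (?D * h) powr (- 1 / s)) * norm x powr (1 / s)) *
       exp (- ((\<sigma> / 2) * (?D * h) powr (- 1 / \<sigma>)) * norm \<xi> powr (1 / \<sigma>)))"
      by (rule exp_decay_of_moments2[OF _ _ _ _ _ _ s A]) (use C h s in auto)
    also have "\<dots> \<le> C * h ^ length ds * Wt s \<sigma> ds * 2 powr s * 2 powr \<sigma> *
      (exp (- r * norm x powr (1 / s)) * exp (- r * norm \<xi> powr (1 / \<sigma>)))"
      using C h by (intro mult_left_mono mult_mono exp_minus_mono r) auto
    also have "\<dots> = ?C * exp (- r * ew s \<sigma> X) * h ^ length ds * Wt s \<sigma> ds"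
      by (simp add: ew_def X exp_add[symmetric] algebra_simps)
    finally show ?thesis .
  qed
  then show ?thesis
    unfolding expdec_def dbound_def using C sm by (intro conjI exI[of _ ?C]) auto
qed

lemma expdec_mono:
  assumes "expdec s \<sigma> h r \<phi>" "r' \<le> r" "0 \<le> h" "h \<le> h'"
  shows "expdec s \<sigma> h' r' \<phi>"
proof -
  obtain C where C: "C \<ge> 0" "\<And>X. dbound s \<sigma> h (C * exp (- r * ew s \<sigma> X)) \<phi> X" "C_infinity \<phi>"
    using assms(1) by (auto simp: expdec_def)
  have "dbound s \<sigma> h' (C * exp (- r' * ew s \<sigma> X)) \<phi> X" for X
    using C assms by (intro dbound_mono[OF C(2)] mult_left_mono) (auto intro: mult_right_mono)
  then show ?thesis unfolding expdec_def using C by blast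
qed

lemma GS_expdec:
  fixes \<phi> :: "'a::euclidean_space \<times> 'a \<Rightarrow> complex"
  assumes s: "s > 0" "\<sigma> > 0" and "\<phi> \<in> GS s \<sigma>"
  shows "\<exists>h>0. \<exists>r>0. expdec s \<sigma> h r \<phi>"
proof -
  obtain h where h: "h > 0" "GS_norm s \<sigma> h \<phi> < \<infinity>" "C_infinity \<phi>" using assms(3) by (auto simp: GS_def)
  let ?r = "min ((s / 2) * (real DIM('a) * h) powr (- 1 / s)) ((\<sigma> / 2) * (real DIM('a) * h) powr (- 1 / \<sigma>))"
  have "?r > 0" using s h by (simp add: min_def)
  moreover have "expdec s \<sigma> h ?r \<phi>" by (rule expdec_of_GS_norm[OF s h(1,3,2)]) auto
  ultimately show ?thesis using h(1) by blast
qed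

lemma GS_proj_expdec:
  fixes \<phi> :: "'a::euclidean_space \<times> 'a \<Rightarrow> complex"
  assumes s: "s > 0" "\<sigma> > 0" and \<phi>: "\<phi> \<in> GS_proj s \<sigma>" and h: "h > 0" and r: "r > 0"
  shows "expdec s \<sigma> h r \<phi>"
proof -
  let ?D = "real DIM('a)"
  \<comment> \<open>The value of \<open>h\<close> at which the decay rate
    \<open>(s / 2) * (?D * h) powr (- 1 / s)\<close> equals \<open>r\<close>.\<close>
  define k where "k s = (s / (2 * r)) powr s / ?D" for s
  have k: "k s > 0" if "s > 0" for s using that r by (simp add: k_def)
  have kr: "r \<le> (s / 2) * (?D * h') powr (- 1 / s)" if "s > 0" "0 < h'" "h' \<le> k s" for s h'
  proof -
    have "?D * h' \<le> (s / (2 * r)) powr s" using that by (simp add: k_def le_divide_eq mult.commute)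
    then have "((s / (2 * r)) powr s) powr (- 1 / s) \<le> (?D * h') powr (- 1 / s)"
      using that by (intro powr_mono2') auto
    then have "2 * r / s \<le> (?D * h') powr (- 1 / s)" using that r by (simp add: powr_powr powr_minus_divide)
    then show ?thesis using that by (simp add: divide_le_eq field_simps)
  qed
  define h' where "h' = min h (min (k s) (k \<sigma>))"
  have h': "h' > 0" "h' \<le> h" "h' \<le> k s" "h' \<le> k \<sigma>" using h k s by (auto simp: h'_def)
  have "expdec s \<sigma> h' r \<phi>"
    by (rule expdec_of_GS_norm[OF s h'(1) _ _ kr[OF s(1) h'(1,3)] kr[OF s(2) h'(1,4)]])
       (use \<phi> h' in \<open>auto simp: GS_proj_def\<close>)
  then show ?thesis by (rule expdec_mono) (use h' in auto)
qed

lemma GS_proj_subset_GS: "GS_proj s \<sigma> \<subseteq> GS s \<sigma>"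
  unfolding GS_proj_def GS_def using zero_less_one by blast

subsection \<open>Gevrey bounds\<close>

lemma gevrey_sup_dbound:
  fixes f :: "'a::euclidean_space \<times> 'a \<Rightarrow> complex"
  assumes s: "s > 0" "\<sigma> > 0" and h: "h > 0" and f: "C_infinity f" and fin: "gevrey_sup \<sigma> s h K f < \<infinity>"
  shows "\<exists>C\<ge>0. \<forall>X\<in>K. dbound s \<sigma> h C f X"
proof -
  obtain C where C: "C \<ge> 0" and bd: "\<And>x. ennreal x \<le> gevrey_sup \<sigma> s h K f \<Longrightarrow> x \<le> C"
    using ennreal_bound[OF fin] by blast
  have "norm (dd ds f X) \<le> C * h ^ length ds * Wt s \<sigma> ds" if X: "X \<in> K" and ds: "set ds \<subseteq> Basis" for X ds
  proof -
    obtain \<alpha> \<beta> where d: "dd ds f = mixed_deriv \<alpha> \<beta> f" "mlength \<alpha> = n1 ds" "mlength \<beta> = n2 ds"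
      using dd_mixed_deriv[OF f ds] by blast
    let ?D = "h ^ (mlength \<alpha> + mlength \<beta>) * mfact \<alpha> powr \<sigma> * mfact \<beta> powr s"
    have D: "?D > 0" using h by (intro mult_pos_pos) auto
    have "ennreal (norm (mixed_deriv \<alpha> \<beta> f X) / ?D) \<le> gevrey_sup \<sigma> s h K f"
      unfolding gevrey_sup_def
      apply (rule order_trans[OF _ SUP_upper[of "\<alpha>"]], rule order_trans[OF _ SUP_upper[of "\<beta>"]])
      apply (rule order_trans[OF _ SUP_upper[OF X]])
      by auto
    then have "norm (mixed_deriv \<alpha> \<beta> f X) / ?D \<le> C" using bd by simp
    then have "norm (dd ds f X) \<le> C * ?D" using D d by (simp add: divide_le_eq)
    also have "\<dots> \<le> C * (h ^ length ds * fact (n1 ds) powr \<sigma> * fact (n2 ds) powr s)"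
    proof -
      have *: "mfact \<alpha> powr r \<le> fact (mlength \<alpha>) powr r" if "r > 0" for \<alpha> :: "'a \<Rightarrow> nat" and r
        using that mfact_le[of \<alpha>] mfact_ge_1[of \<alpha>] by (intro powr_mono2) auto
      have "mlength \<alpha> + mlength \<beta> = length ds" using d n1_add_n2[of ds] by simp
      then show ?thesis
        using *[OF s(2), of \<alpha>] *[OF s(1), of \<beta>] d(2,3) C h by (intro mult_left_mono mult_mono) auto
    qed
    finally show ?thesis by (simp add: Wt_def mult_ac)
  qed
  then show ?thesis unfolding dbound_def using C by blast
qed

text \<open>The geometric loss of \<open>fact_mlength_le\<close> for the exponents \<open>s\<close>
  and \<open>\<sigma>\<close>. Each factor is at least 1 for positive exponents, so the product
  serves both.\<close>

definition cc :: "real \<Rightarrow> real \<Rightarrow> 'a::euclidean_space itself \<Rightarrow> real" where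
  "cc s \<sigma> _ = (2 ^ DIM('a)) powr s * (2 ^ DIM('a)) powr \<sigma>"

lemma cc_pos: "cc s \<sigma> TYPE('a::euclidean_space) > 0"
  by (simp add: cc_def)

lemma gevrey_sup_finite:
  fixes f :: "'a::euclidean_space \<times> 'a \<Rightarrow> complex"
  assumes s: "s > 0" "\<sigma> > 0" and h: "h > 0" and bd: "\<And>X. X \<in> K \<Longrightarrow> dbound s \<sigma> h C f X" and C: "C \<ge> 0"
  shows "gevrey_sup \<sigma> s (h * cc s \<sigma> TYPE('a)) K f < \<infinity>"
proof -
  let ?K = "(2::real) ^ DIM('a)" and ?c = "cc s \<sigma> TYPE('a)"
  have k: "?K powr s \<ge> 1" "?K powr \<sigma> \<ge> 1" using s by (auto intro!: ge_one_powr_ge_zero)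
  have kc: "?K powr s \<le> ?c" "?K powr \<sigma> \<le> ?c"
    using k mult_left_mono[OF k(2), of "?K powr s"] mult_right_mono[OF k(1), of "?K powr \<sigma>"] by (auto simp: cc_def)
  have m: "fact (mlength \<alpha>) powr r \<le> ?c ^ mlength \<alpha> * mfact \<alpha> powr r" if r: "r > 0" "?K powr r \<le> ?c" for \<alpha> :: "'a \<Rightarrow> nat" and r
  proof -
    have "fact (mlength \<alpha>) powr r \<le> (?K ^ mlength \<alpha> * mfact \<alpha>) powr r"
      using fact_mlength_le[of \<alpha>] r by (intro powr_mono2) auto
    also have "\<dots> = (?K powr r) ^ mlength \<alpha> * mfact \<alpha> powr r"
    proof -
      have "(?K ^ mlength \<alpha>) powr r = (?K powr r) ^ mlength \<alpha>"
        by (subst (1 2) powr_realpow[symmetric]) (simp_all add: powr_powr mult.commute)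
      then show ?thesis using mfact_ge_1[of \<alpha>] by (simp add: powr_mult)
    qed
    also have "\<dots> \<le> ?c ^ mlength \<alpha> * mfact \<alpha> powr r"
      using r by (intro mult_right_mono power_mono) auto
    finally show ?thesis .
  qed
  have "gevrey_sup \<sigma> s (h * ?c) K f \<le> ennreal C"
    unfolding gevrey_sup_def
  proof (intro SUP_least ennreal_leI)
    fix \<alpha> \<beta> :: "'a \<Rightarrow> nat" and X assume X: "X \<in> K"
    let ?ds = "mlist (\<lambda>b. (b, 0)) \<alpha> basis_list @ mlist (\<lambda>b. (0, b)) \<beta> basis_list"
    note L = mixed_deriv_list[of \<alpha> \<beta>]
    let ?D = "(h * ?c) ^ (mlength \<alpha> + mlength \<beta>) * mfact \<alpha> powr \<sigma> * mfact \<beta> powr s"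
    have "norm (mixed_deriv \<alpha> \<beta> f X) \<le> C * h ^ length ?ds * Wt s \<sigma> ?ds"
      unfolding mixed_deriv_dd by (rule dboundD[OF bd[OF X] L(1)])
    also have "\<dots> = C * h ^ (mlength \<alpha> + mlength \<beta>) * (fact (mlength \<alpha>) powr \<sigma> * fact (mlength \<beta>) powr s)"
      unfolding Wt_def L(2-4) ..
    also have "\<dots> \<le> C * h ^ (mlength \<alpha> + mlength \<beta>) * ((?c ^ mlength \<alpha> * mfact \<alpha> powr \<sigma>) * (?c ^ mlength \<beta> * mfact \<beta> powr s))"
      using C h s kc cc_pos[of s \<sigma>, where 'a = 'a] by (intro mult_left_mono mult_mono m) auto
    also have "\<dots> = C * ?D" by (simp add: power_mult_distrib power_add mult_ac)
    finally have le: "norm (mixed_deriv \<alpha> \<beta> f X) \<le> C * ?D" .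
    have "?D > 0" using h cc_pos[of s \<sigma>, where 'a = 'a] by (intro mult_pos_pos zero_less_power) auto
    then show "norm (mixed_deriv \<alpha> \<beta> f X) / ?D \<le> C" using le by (simp only: divide_le_eq if_True)
  qed
  then show ?thesis by (rule le_less_trans) simp
qed

subsection \<open>Integrable majorants\<close>

lemma exp_le_inverse_wt:
  assumes r: "r > 0" and s: "s > 0"
  shows "\<exists>B>0. \<forall>x :: 'a::euclidean_space. exp (- r * norm x powr (1 / s)) \<le> B / (wt x)\<^sup>2"
proof -
  let ?D = "DIM('a)"
  \<comment> \<open>\<open>wt x\<close> grows like \<open>norm x\<close> to the power
    \<open>2 * ?D\<close> at most, so its square needs the power \<open>4 * ?D\<close>;
    \<open>c\<close> is the constant of \<open>power_le_exp_powr\<close> for it.\<close>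
  define c where "c = ((s / r) powr s) ^ (4 * ?D) * fact (4 * ?D) powr s"
  have c: "c \<ge> 0" by (simp add: c_def)
  let ?B = "2 ^ (2 * ?D) * (1 + c)"
  have "(wt x)\<^sup>2 \<le> ?B * exp (r * norm x powr (1 / s))" for x :: 'a
  proof -
    have "wt x \<le> (\<Prod>b\<in>(Basis :: 'a set). 1 + (norm x)\<^sup>2)"
      unfolding wt_def
    proof (intro prod_mono conjI)
      fix b :: 'a assume "b \<in> Basis"
      then have "\<bar>x \<bullet> b\<bar>\<^sup>2 \<le> (norm x)\<^sup>2" by (intro power_mono Basis_le_norm) auto
      then show "1 + (x \<bullet> b)\<^sup>2 \<le> 1 + (norm x)\<^sup>2" by simp
    qed simp
    then have "(wt x)\<^sup>2 \<le> ((1 + (norm x)\<^sup>2) ^ ?D)\<^sup>2" by (intro power_mono) auto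
    also have "\<dots> = (1 + (norm x)\<^sup>2) ^ (2 * ?D)" by (simp add: power_mult[symmetric] mult.commute)
    also have "\<dots> \<le> (2 * max 1 ((norm x)\<^sup>2)) ^ (2 * ?D)" by (intro power_mono) auto
    also have "\<dots> = 2 ^ (2 * ?D) * (max 1 ((norm x)\<^sup>2)) ^ (2 * ?D)" by (rule power_mult_distrib)
    also have "\<dots> \<le> 2 ^ (2 * ?D) * (1 + norm x ^ (4 * ?D))"
    proof (rule mult_left_mono)
      have "((norm x)\<^sup>2) ^ (2 * ?D) = norm x ^ (4 * ?D)" by (simp add: power_mult[symmetric])
      then show "(max 1 ((norm x)\<^sup>2)) ^ (2 * ?D) \<le> 1 + norm x ^ (4 * ?D)" by (simp add: max_def)
    qed simp
    also have "\<dots> \<le> 2 ^ (2 * ?D) * (exp (r * norm x powr (1 / s)) + c * exp (r * norm x powr (1 / s)))"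
      using power_le_exp_powr[OF norm_ge_zero r s, of x "4 * ?D"] r
      by (intro mult_left_mono add_mono) (auto simp: c_def)
    finally show ?thesis by (simp add: algebra_simps)
  qed
  then have "exp (- r * norm x powr (1 / s)) \<le> ?B / (wt x)\<^sup>2" for x :: 'a
    by (simp add: exp_minus field_simps)
  moreover have "?B > 0" using c by (intro mult_pos_pos) auto
  ultimately show ?thesis by blast
qed

lemma exp_ew_le_inverse_wt:
  assumes "r > 0" "s > 0" "\<sigma> > 0"
  shows "\<exists>B>0. \<forall>X :: 'a::euclidean_space \<times> 'a. exp (- r * ew s \<sigma> X) \<le> B / (wt X)\<^sup>2"
proof -
  obtain B1 where B1: "B1 > 0" "\<And>x :: 'a. exp (- r * norm x powr (1 / s)) \<le> B1 / (wt x)\<^sup>2"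
    using exp_le_inverse_wt[OF assms(1,2)] by blast
  obtain B2 where B2: "B2 > 0" "\<And>x :: 'a. exp (- r * norm x powr (1 / \<sigma>)) \<le> B2 / (wt x)\<^sup>2"
    using exp_le_inverse_wt[OF assms(1,3)] by blast
  have "exp (- r * ew s \<sigma> X) \<le> B1 * B2 / (wt X)\<^sup>2" for X :: "'a \<times> 'a"
  proof -
    have "exp (- r * ew s \<sigma> X) = exp (- r * norm (fst X) powr (1 / s)) * exp (- r * norm (snd X) powr (1 / \<sigma>))"
      by (simp add: ew_def exp_add[symmetric] algebra_simps)
    also have "\<dots> \<le> (B1 / (wt (fst X))\<^sup>2) * (B2 / (wt (snd X))\<^sup>2)"
      using B1 B2 by (intro mult_mono) (auto simp: less_imp_le)
    also have "\<dots> = B1 * B2 / (wt X)\<^sup>2" by (cases X) (simp add: wt_Pair power_mult_distrib)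
    finally show ?thesis .
  qed
  then show ?thesis using B1(1) B2(1) by (intro exI[of _ "B1 * B2"]) auto
qed

lemma inverse_wt_sq_le: "1 / (wt X)\<^sup>2 \<le> 1 / wt X"
proof -
  have "wt X * 1 \<le> wt X * wt X" by (intro mult_left_mono wt_ge_1) auto
  then show ?thesis by (intro divide_left_mono) (auto simp: power2_eq_square)
qed

text \<open>The shift \<open>uu (w - AZ (z, \<zeta>))\<close> decays in \<open>\<eta>\<close>, \<open>x - y\<close>, \<open>z - x\<close> and \<open>\<zeta> - \<xi>\<close>, so that it is an
  integrable majorant in \<open>w\<close> whose integral does not depend on \<open>(z, \<zeta>)\<close>.\<close>

definition uu :: "('a::euclidean_space \<times> 'a) \<times> ('a \<times> 'a) \<Rightarrow> real" where
  "uu w = 1 / (wt (snd (snd w)) * wt (fst (fst w) - snd (fst w)) * (wt (fst (fst w)))\<^sup>2 * (wt (fst (snd w)))\<^sup>2)"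

definition AZ :: "'a::euclidean_space \<times> 'a \<Rightarrow> ('a \<times> 'a) \<times> ('a \<times> 'a)" where
  "AZ Z = ((fst Z, fst Z), (snd Z, 0))"

lemma uu_AZ:
  "uu (((x, y), (\<xi>, \<eta>)) - AZ (z, \<zeta>)) = 1 / (wt \<eta> * wt (x - y) * (wt (z - x))\<^sup>2 * (wt (\<zeta> - \<xi>))\<^sup>2)"
  using wt_minus[of "z - x"] wt_minus[of "\<zeta> - \<xi>"] by (simp add: uu_def AZ_def)

lemma uu_nonneg: "uu w \<ge> 0"
  by (simp add: uu_def)

lemma uu_measurable [measurable]: "uu \<in> borel_measurable borel"
  unfolding uu_def[abs_def]
  by (intro borel_measurable_continuous_onI continuous_intros continuous_on_compose2[OF continuous_on_wt[of UNIV]]) auto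

text \<open>Replacing \<open>wt (x - y)\<close> by \<open>wt y\<close> costs a factor
  \<open>wt x\<close>. This is why \<open>uu\<close> contains the square of the weight of
  \<open>z - x\<close>: one power pays this cost, the other keeps integrability in
  \<open>x\<close>.\<close>

lemma uu_shift_le:
  fixes w :: "('a::euclidean_space \<times> 'a) \<times> ('a \<times> 'a)"
  shows "uu (w - AZ Z) \<le> (2 ^ DIM('a)) ^ 4 * ((wt (fst Z))\<^sup>2 * wt (snd Z)) / wt w"
proof -
  obtain x y \<xi> \<eta> where w: "w = ((x, y), (\<xi>, \<eta>))" by (metis prod.collapse)
  obtain z \<zeta> where Z: "Z = (z, \<zeta>)" by (cases Z)
  let ?k = "2 ^ DIM('a) :: real"
  have 1: "(1 / wt (z - x))\<^sup>2 \<le> (?k * (wt z / wt x))\<^sup>2" by (intro power_mono wt_shift_le) auto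
  have 2: "1 / wt (x - y) \<le> ?k * (wt x / wt y)" by (rule wt_shift_le)
  have 3: "1 / (wt (\<zeta> - \<xi>))\<^sup>2 \<le> ?k * (wt \<zeta> / wt \<xi>)"
    by (rule order_trans[OF inverse_wt_sq_le wt_shift_le])
  have "uu (w - AZ Z) = (1 / wt \<eta>) * (1 / wt (x - y)) * (1 / wt (z - x))\<^sup>2 * (1 / (wt (\<zeta> - \<xi>))\<^sup>2)"
    unfolding w Z uu_AZ by (simp add: power_divide)
  also have "\<dots> \<le> (1 / wt \<eta>) * (?k * (wt x / wt y)) * (?k * (wt z / wt x))\<^sup>2 * (?k * (wt \<zeta> / wt \<xi>))"
    by (intro mult_mono 1 2 3 order_refl mult_nonneg_nonneg) auto
  also have "\<dots> = ?k ^ 4 * ((wt z)\<^sup>2 * wt \<zeta>) / wt w"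
    by (simp add: w wt_Pair power2_eq_square power4_eq_xxxx field_simps)
  finally show ?thesis by (simp add: Z)
qed

lemma integrable_real_wt_bound:
  fixes f :: "'v::euclidean_space \<Rightarrow> real"
  assumes [measurable]: "f \<in> borel_measurable borel" and b: "\<And>X. \<bar>f X\<bar> \<le> C / wt X"
  shows "integrable lborel f"
proof -
  have "integrable lborel (\<lambda>X. complex_of_real (f X))"
    by (rule integrable_wt_bound[of _ C]) (use b in auto)
  from integrable_Re[OF this] show ?thesis by simp
qed

lemma integrable_uu: "integrable lborel (uu :: ('a::euclidean_space \<times> 'a) \<times> ('a \<times> 'a) \<Rightarrow> real)"
proof (rule integrable_real_wt_bound)
  have AZ0: "AZ 0 = (0 :: ('a \<times> 'a) \<times> ('a \<times> 'a))" by (simp add: AZ_def zero_prod_def)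
  have wt0: "wt (0 :: 'a) = 1" by (simp add: wt_def)
  show "\<bar>uu w\<bar> \<le> (2 ^ DIM('a)) ^ 4 / wt w" for w :: "('a \<times> 'a) \<times> ('a \<times> 'a)"
    using uu_shift_le[of w 0] uu_nonneg[of w] by (simp add: AZ0 wt0)
qed simp

lemma uu_shift_integral:
  fixes Z :: "'a::euclidean_space \<times> 'a"
  shows "integrable lborel (\<lambda>w. uu (w - AZ Z))"
    and "(LINT w|lborel. uu (w - AZ Z)) = integral\<^sup>L lborel (uu :: ('a \<times> 'a) \<times> ('a \<times> 'a) \<Rightarrow> real)"
  by (rule integrable_lborel_shift(1)[OF integrable_uu]) (rule integral_lborel_shift(1)[OF uu_measurable])

lemma continuous_bounded_cball:
  fixes f :: "'v::euclidean_space \<Rightarrow> real"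
  assumes "continuous_on UNIV f"
  shows "\<exists>L\<ge>0. \<forall>X\<in>cball X0 r. f X \<le> L"
proof -
  have "compact (f ` cball X0 r)"
    by (intro compact_continuous_image continuous_on_subset[OF assms] compact_cball) auto
  then obtain L where L: "\<forall>t\<in>f ` cball X0 r. norm t \<le> L"
    using compact_imp_bounded bounded_iff by meson
  have "f X \<le> max L 0" if "X \<in> cball X0 r" for X
  proof -
    have "norm (f X) \<le> L" using L that by blast
    then show ?thesis by simp
  qed
  then show ?thesis by (intro exI[of _ "max L 0"]) auto
qed

text \<open>A majorant that is the same for all \<open>Z\<close> near \<open>Z0\<close>, as
  dominated convergence requires.\<close>

lemma uu_locally_dominated:
  fixes Z0 :: "'a::euclidean_space \<times> 'a"
  shows "\<exists>L\<ge>0. \<forall>Z\<in>ball Z0 1. \<forall>w. uu (w - AZ Z) \<le> L * (1 / wt w)"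
proof -
  let ?f = "\<lambda>Z :: 'a \<times> 'a. (2 ^ DIM('a)) ^ 4 * ((wt (fst Z))\<^sup>2 * wt (snd Z)) :: real"
  have "continuous_on UNIV ?f"
    by (intro continuous_intros continuous_on_compose2[OF continuous_on_wt[of UNIV]]) auto
  from continuous_bounded_cball[OF this, of Z0 1] obtain L where L: "L \<ge> 0" "\<forall>Z\<in>cball Z0 1. ?f Z \<le> L" by blast
  have "uu (w - AZ Z) \<le> L * (1 / wt w)" if Z: "Z \<in> ball Z0 1" for Z w
  proof -
    have "Z \<in> cball Z0 1" using Z by auto
    then have "?f Z / wt w \<le> L / wt w" using L(2) by (intro divide_right_mono) auto
    then show ?thesis using uu_shift_le[of w Z] by simp
  qed
  then show ?thesis using L(1) by blast
qed

subsection \<open>The transform of bounded functions\<close>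

text \<open>The transform of a function, without the factor \<open>(2 * pi)\<close> to the power
  minus the dimension; that factor is restored in \<open>stf_is_function\<close>.\<close>

definition stf :: "('a::euclidean_space \<times> 'a \<Rightarrow> complex) \<Rightarrow> ('a \<times> 'a \<Rightarrow> complex) \<Rightarrow> ('a \<times> 'a) \<times> ('a \<times> 'a) \<Rightarrow> complex" where
  "stf \<phi> f w = (LINT Z|lborel. f Z * qker \<phi> Z w)"

lemma expdec_bounds:
  fixes \<phi> :: "'a::euclidean_space \<times> 'a \<Rightarrow> complex"
  assumes s: "s > 0" "\<sigma> > 0" and r: "r > 0" and \<phi>: "expdec s \<sigma> h r \<phi>"
  shows "\<exists>B>0. \<forall>X. norm (\<phi> X) \<le> B / (wt X)\<^sup>2"
    and "\<exists>M\<ge>0. (\<forall>X. norm (\<phi> X) \<le> M) \<and> (\<forall>b\<in>Basis. \<forall>X. norm (pderivative b \<phi> X) \<le> M)"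
proof -
  obtain C where C: "C \<ge> 0" "\<And>X. dbound s \<sigma> h (C * exp (- r * ew s \<sigma> X)) \<phi> X" using \<phi> by (auto simp: expdec_def)
  obtain B where B: "B > 0" "\<And>X :: 'a \<times> 'a. exp (- r * ew s \<sigma> X) \<le> B / (wt X)\<^sup>2"
    using exp_ew_le_inverse_wt[OF r s] by blast
  have 0: "norm (\<phi> X) \<le> C * exp (- r * ew s \<sigma> X)" for X
    using dboundD[OF C(2), of "[]" X] by (simp add: Wt_def)
  have "norm (\<phi> X) \<le> ((C + 1) * B) / (wt X)\<^sup>2" for X
  proof -
    have "C * exp (- r * ew s \<sigma> X) \<le> (C + 1) * (B / (wt X)\<^sup>2)" using C B by (intro mult_mono) auto
    then show ?thesis using 0[of X] by simp
  qed
  then show "\<exists>B>0. \<forall>X. norm (\<phi> X) \<le> B / (wt X)\<^sup>2"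
    using C(1) B(1) by (intro exI[of _ "(C + 1) * B"]) auto
  have e1: "exp (- r * ew s \<sigma> X) \<le> 1" for X :: "'a \<times> 'a" using r by simp
  have "norm (pderivative b \<phi> X) \<le> C * \<bar>h\<bar>" if b: "b \<in> Basis" for b X
  proof -
    have "Wt s \<sigma> [b] = 1" by (simp add: Wt_def)
    then have "norm (pderivative b \<phi> X) \<le> C * exp (- r * ew s \<sigma> X) * h"
      using dboundD[OF C(2), of "[b]" X] b by simp
    also have "\<dots> \<le> C * exp (- r * ew s \<sigma> X) * \<bar>h\<bar>" using C by (intro mult_left_mono) auto
    also have "\<dots> \<le> C * 1 * \<bar>h\<bar>" using C e1[of X] by (intro mult_right_mono mult_left_mono) auto
    finally show ?thesis by simp
  qed
  moreover have "norm (\<phi> X) \<le> C" for X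
    using 0[of X] mult_left_mono[OF e1[of X] C(1)] by simp
  ultimately have "(\<forall>X. norm (\<phi> X) \<le> max C (C * \<bar>h\<bar>)) \<and> (\<forall>b\<in>Basis. \<forall>X. norm (pderivative b \<phi> X) \<le> max C (C * \<bar>h\<bar>))"
    by (meson max.coboundedI1 max.coboundedI2)
  then show "\<exists>M\<ge>0. (\<forall>X. norm (\<phi> X) \<le> M) \<and> (\<forall>b\<in>Basis. \<forall>X. norm (pderivative b \<phi> X) \<le> M)"
    using C(1) by (intro exI[of _ "max C (C * \<bar>h\<bar>)"]) auto
qed

context
  fixes \<phi> f :: "'a::euclidean_space \<times> 'a \<Rightarrow> complex" and B Mf :: real
  assumes sm: "C_infinity \<phi>" and B: "\<And>X. norm (\<phi> X) \<le> B / wt X"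
    and fm: "f \<in> borel_measurable borel" and fb: "\<And>X. norm (f X) \<le> Mf"
begin

lemma function_bound_nonneg: "Mf \<ge> 0"
  using fb[of 0] norm_ge_zero order_trans by blast

lemma window_wt_nonneg: "B \<ge> 0"
proof -
  have "0 \<le> B / wt (0 :: 'a \<times> 'a)" using B[of 0] norm_ge_zero order_trans by blast
  from mult_nonneg_nonneg[OF this wt_pos(3)[of "0 :: 'a \<times> 'a"]] show ?thesis by simp
qed

lemma phi_measurable: "\<phi> \<in> borel_measurable borel"
  by (rule C_infinity_borel[OF sm])

text \<open>Peetre's inequality separates the moving window into a weight in \<open>w\<close>,
  bounded on a ball, and an integrable weight in \<open>Z\<close>.\<close>

lemma stf_continuous: "continuous_on UNIV (stf \<phi> f)"
  unfolding stf_def[abs_def]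
proof (rule continuous_on_integral_dominated)
  note phi_measurable[measurable] fm[measurable]
  have "C_infinity (\<lambda>w. cnj (\<phi> (Z - PP w)) * exp (\<i> * of_real (- Z \<bullet> TT w)))" for Z
    by (intro C_infinity_mult C_infinity_cnj[OF C_infinity_reflect(1)[OF sm bounded_linear_PT(1)]]
        C_infinity_linear_exp[OF bounded_linear_PT(2)])
  then have "C_infinity (\<lambda>w. f Z * qker \<phi> Z w)" for Z
    unfolding qker_def by (intro C_infinity_cmult)
  then show "continuous_on UNIV (\<lambda>w. f Z * qker \<phi> Z w)" for Z by (rule C_infinity_continuous_on)
  show "(\<lambda>Z. f Z * qker \<phi> Z w) \<in> borel_measurable borel" for w
    unfolding qker_def by measurable
  fix w0 :: "('a \<times> 'a) \<times> ('a \<times> 'a)"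
  let ?g = "\<lambda>w. 2 ^ DIM('a \<times> 'a) * wt (PP w) :: real"
  have "continuous_on UNIV ?g"
    by (intro continuous_intros continuous_on_compose2[OF continuous_on_wt[of UNIV]] linear_continuous_on bounded_linear_PT) auto
  from continuous_bounded_cball[OF this, of w0 1] obtain L where L: "\<And>w. w \<in> cball w0 1 \<Longrightarrow> ?g w \<le> L" by blast
  have "norm (f Z * qker \<phi> Z w) \<le> Mf * (B * L) * (1 / wt Z)" if w: "w \<in> ball w0 1" for w Z
  proof -
    have "norm (qker \<phi> Z w) \<le> B / wt (Z - PP w)" using B by (simp add: qker_def norm_mult)
    also have "\<dots> = B * (1 / wt (PP w - Z))" using wt_minus[of "Z - PP w"] by simp
    also have "\<dots> \<le> B * (?g w / wt Z)"
      using wt_shift_le[of "PP w" Z] window_wt_nonneg by (intro mult_left_mono) auto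
    also have "\<dots> \<le> B * (L / wt Z)"
      using L[of w] w window_wt_nonneg by (intro mult_left_mono divide_right_mono) auto
    finally have "norm (qker \<phi> Z w) \<le> B * L * (1 / wt Z)" by simp
    from mult_mono[OF fb[of Z] this function_bound_nonneg] show ?thesis by (simp add: norm_mult mult.assoc)
  qed
  then show "\<exists>\<delta>>0. \<exists>g. integrable lborel g \<and> (\<forall>w\<in>ball w0 \<delta>. \<forall>Z. norm (f Z * qker \<phi> Z w) \<le> g Z)"
    by (intro exI[of _ "1::real"] conjI exI[of _ "\<lambda>Z. Mf * (B * L) * (1 / wt Z)"] integrable_mult_right integrable_inverse_wt) auto
qed

lemma integrable_phi: "integrable lborel \<phi>"
  by (rule integrable_wt_bound[OF phi_measurable B])

text \<open>Fubini, with absolute convergence from the bound on \<open>f\<close>, the integrability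
  of \<open>\<Psi>\<close>, and the fact that all translates of the window have the same integral of
  the modulus.\<close>

lemma stf_test:
  assumes \<Psi>: "\<Psi> \<in> sch"
  shows "integrable lborel (\<lambda>w. stf \<phi> f w * \<Psi> w)"
    and "(LINT w|lborel. stf \<phi> f w * \<Psi> w) = (LINT Z|lborel. f Z * qop \<phi> \<Psi> Z)"
proof -
  note phi_measurable[measurable] fm[measurable]
  have [measurable]: "\<Psi> \<in> borel_measurable borel" by (rule C_infinity_borel[OF sch_C_infinity[OF \<Psi>]])
  let ?K = "\<lambda>w Z. f Z * qker \<phi> Z w * \<Psi> w"
  let ?G = "\<lambda>w Z. Mf * (norm (\<phi> (Z - PP w)) * norm (\<Psi> w))"
  have i\<phi>: "integrable lborel (\<lambda>Z. norm (\<phi> (Z - A)))" for A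
    by (rule integrable_lborel_shift(1)[OF integrable_norm[OF integrable_phi]])
  have i\<phi>': "(LINT Z|lborel. norm (\<phi> (Z - A))) = (LINT Z|lborel. norm (\<phi> Z))" for A
    by (rule integral_lborel_shift(1)) measurable
  have G: "integrable (lborel \<Otimes>\<^sub>M lborel) (\<lambda>(w, Z). ?G w Z)"
  proof (rule lborel_pair.Fubini_integrable)
    show "(\<lambda>(w, Z). ?G w Z) \<in> borel_measurable (lborel \<Otimes>\<^sub>M lborel)" by measurable
    have "(LINT Z|lborel. norm (?G w Z)) = (Mf * (LINT Z|lborel. norm (\<phi> Z))) * norm (\<Psi> w)" for w
    proof -
      have "(LINT Z|lborel. norm (?G w Z)) = (LINT Z|lborel. (Mf * norm (\<Psi> w)) * norm (\<phi> (Z - PP w)))"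
        using function_bound_nonneg by (simp add: abs_mult mult_ac)
      also have "\<dots> = (Mf * norm (\<Psi> w)) * (LINT Z|lborel. norm (\<phi> (Z - PP w)))" by (rule integral_mult_right_zero)
      finally show ?thesis unfolding i\<phi>' by (simp add: mult_ac)
    qed
    then show "integrable lborel (\<lambda>w. LINT Z|lborel. norm (case (w, Z) of (w, Z) \<Rightarrow> ?G w Z))"
      using integrable_norm[OF sch_decay1(3)[OF \<Psi>]] by simp
    show "AE w in lborel. integrable lborel (\<lambda>Z. case (w, Z) of (w, Z) \<Rightarrow> ?G w Z)"
    proof (intro AE_I2)
      fix w
      have "integrable lborel (\<lambda>Z. (Mf * norm (\<Psi> w)) * norm (\<phi> (Z - PP w)))"
        by (intro integrable_mult_right i\<phi>)
      then show "integrable lborel (\<lambda>Z. case (w, Z) of (w, Z) \<Rightarrow> ?G w Z)" by (simp add: mult_ac)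
    qed
  qed
  have K: "integrable (lborel \<Otimes>\<^sub>M lborel) (\<lambda>(w, Z). ?K w Z)"
  proof (rule Bochner_Integration.integrable_bound[OF G])
    show "(\<lambda>(w, Z). ?K w Z) \<in> borel_measurable (lborel \<Otimes>\<^sub>M lborel)"
      unfolding qker_def by measurable
    show "AE x in lborel \<Otimes>\<^sub>M lborel. norm (case x of (w, Z) \<Rightarrow> ?K w Z) \<le> norm (case x of (w, Z) \<Rightarrow> ?G w Z)"
    proof (intro AE_I2, clarify)
      fix w Z
      have "norm (?K w Z) = norm (f Z) * (norm (\<phi> (Z - PP w)) * norm (\<Psi> w))"
        by (simp add: qker_def norm_mult)
      also have "\<dots> \<le> ?G w Z" by (intro mult_right_mono fb) auto
      also have "\<dots> \<le> norm (?G w Z)" by simp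
      finally show "norm (?K w Z) \<le> norm (?G w Z)" .
    qed
  qed
  have e: "(LINT Z|lborel. ?K w Z) = stf \<phi> f w * \<Psi> w" for w
    unfolding stf_def by simp
  show "integrable lborel (\<lambda>w. stf \<phi> f w * \<Psi> w)"
    using lborel_pair.integrable_fst[OF K] by (simp only: e)
  have "(LINT w|lborel. stf \<phi> f w * \<Psi> w) = (LINT w|lborel. LINT Z|lborel. ?K w Z)" by (simp only: e)
  also have "\<dots> = (LINT Z|lborel. LINT w|lborel. ?K w Z)"
    using lborel_pair.Fubini_integral[OF K] by simp
  also have "\<dots> = (LINT Z|lborel. f Z * qop \<phi> \<Psi> Z)"
    unfolding qop_def by (simp add: mult.assoc)
  finally show "(LINT w|lborel. stf \<phi> f w * \<Psi> w) = (LINT Z|lborel. f Z * qop \<phi> \<Psi> Z)" .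
qed

lemma stf_FT: "stf \<phi> f w = FT (\<lambda>Z. f Z * cnj (\<phi> (Z - PP w))) (TT w)"
  unfolding stf_def FT_def qker_def by (intro Bochner_Integration.integral_cong refl) (simp add: inner_commute mult_ac)

end

subsection \<open>From Gevrey regularity to decay of the transform\<close>

lemma exp_powr_norm_shift:
  fixes x y :: "'a::real_normed_vector"
  assumes "p > 0" "r \<ge> 0"
  shows "exp (r * norm (x + y) powr p) \<le> exp (r * 2 powr p * norm x powr p) * exp (r * 2 powr p * norm y powr p)"
proof -
  have "r * norm (x + y) powr p \<le> r * (2 powr p * (norm x powr p + norm y powr p))"
    using assms by (intro mult_left_mono norm_powr_add_le)
  then show ?thesis by (simp add: exp_add[symmetric] algebra_simps)
qed

text \<open>Translating a point into the cells multiplies \<open>f\<close> by a character in the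
  second variable with frequency \<open>k\<close>. Its derivatives cost
  \<open>exp (r * norm k powr (1 / s))\<close>, and \<open>norm k\<close> exceeds the norm of the
  first variable by at most the radius of the cell. The modulus itself is unchanged, whence the
  global bound.\<close>

lemma quasi_periodic_dbound:
  fixes E :: "'n::finite \<Rightarrow> real ^ 'n"
  assumes s: "s > 0" "\<sigma> > 0" and E: "is_basis E" and f: "C_infinity f" and qp: "quasi_periodic E f" and h: "h > 0" and r: "r > 0"
    and bd: "\<And>X. X \<in> cell E \<times> cell (dual_basis E) \<Longrightarrow> dbound s \<sigma> h C f X"
  shows "\<exists>A\<ge>0. \<forall>X. dbound s \<sigma> (2 * max h (hh s \<sigma> r)) (A * exp (r * 2 powr (1 / s) * norm (fst X) powr (1 / s))) f X"
    and "norm (f X) \<le> C"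
proof -
  let ?p = "1 / s" and ?H = "max h (hh s \<sigma> r)"
  have H: "?H > 0" using h by simp
  obtain R where R: "R > 0" "\<And>x. x \<in> cell E \<Longrightarrow> norm x \<le> R" using bounded_cell[of E] by blast
  have dec: "\<exists>x0\<in>cell E. \<exists>k\<in>lattice_of E. \<exists>\<xi>0\<in>cell (dual_basis E). \<exists>\<kappa>\<in>lattice_of (dual_basis E). X = (x0 + k, \<xi>0 + \<kappa>)"
    for X :: "(real ^ 'n) \<times> (real ^ 'n)"
    using cell_lattice_decomposition[OF is_basis_coords[OF E], of "fst X"]
      cell_lattice_decomposition[OF dual_basis(2)[OF E], of "snd X"] by (metis prod.collapse)
  have feq: "f (y + k, \<eta> + \<kappa>) = exp (\<i> * of_real ((0, k) \<bullet> (y, \<eta>))) * f (y, \<eta>)"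
    if "k \<in> lattice_of E" "\<kappa> \<in> lattice_of (dual_basis E)" for y \<eta> k \<kappa>
    using qp that unfolding quasi_periodic_def by simp
  show "norm (f X) \<le> C"
  proof -
    obtain x0 k \<xi>0 \<kappa> where X: "x0 \<in> cell E" "k \<in> lattice_of E" "\<xi>0 \<in> cell (dual_basis E)"
      "\<kappa> \<in> lattice_of (dual_basis E)" "X = (x0 + k, \<xi>0 + \<kappa>)" using dec[of X] by blast
    have "norm (f X) = norm (f (x0, \<xi>0))" unfolding X(5) feq[OF X(2,4)] by (simp add: norm_mult)
    also have "\<dots> \<le> C" using dboundD[OF bd, of "(x0, \<xi>0)" "[]"] X by (simp add: Wt_def)
    finally show ?thesis .
  qed
  have C: "C \<ge> 0" using order_trans[OF norm_ge_zero \<open>norm (f X) \<le> C\<close>] .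
  let ?A = "exp (r * 2 powr ?p * R powr ?p) * C"
  have "dbound s \<sigma> (2 * ?H) (?A * exp (r * 2 powr ?p * norm (fst X) powr ?p)) f X" for X
  proof -
    obtain x0 k \<xi>0 \<kappa> where X: "x0 \<in> cell E" "k \<in> lattice_of E" "\<xi>0 \<in> cell (dual_basis E)"
      "\<kappa> \<in> lattice_of (dual_basis E)" "X = (x0 + k, \<xi>0 + \<kappa>)" using dec[of X] by blast
    \<comment> \<open>Removing \<open>\<kappa>\<close> before \<open>k\<close> makes the phase a
      function of the shifted point alone, so \<open>f\<close> is a translate of
      \<open>?G\<close>.\<close>
    let ?B = "(0, k) :: (real ^ 'n) \<times> (real ^ 'n)" and ?Y = "(k, \<kappa>)"
    let ?G = "\<lambda>X. exp (\<i> * of_real (?B \<bullet> X)) * f X"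
    have G: "C_infinity ?G" by (intro C_infinity_mult C_infinity_exp_inner f)
    have fG: "f = (\<lambda>X. ?G (X - ?Y))"
    proof
      fix Z :: "(real ^ 'n) \<times> (real ^ 'n)"
      show "f Z = ?G (Z - ?Y)"
        using feq[OF X(2,4), of "fst Z - k" "snd Z - \<kappa>"] by (cases Z) simp
    qed
    have XY: "X - ?Y = (x0, \<xi>0)" by (simp add: X(5))
    have "norm (fst ?B) powr (1 / \<sigma>) + norm (snd ?B) powr ?p = norm k powr ?p" by simp
    then have "exp (r * (norm (fst ?B) powr (1 / \<sigma>) + norm (snd ?B) powr ?p)) \<le> exp (r * norm k powr ?p)"
      by (simp only: order_refl)
    from dbound_mono[OF dbound_exp[OF s r] this less_imp_le[OF hh_pos[OF s r]] max.cobounded2[of _ h]]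
    have "dbound s \<sigma> ?H (exp (r * norm k powr ?p)) (\<lambda>X. exp (\<i> * of_real (?B \<bullet> X))) (X - ?Y)" .
    moreover have "X - ?Y \<in> cell E \<times> cell (dual_basis E)" using XY X(1,3) by simp
    from dbound_mono[OF bd[OF this] order_refl less_imp_le[OF h] max.cobounded1]
    have "dbound s \<sigma> ?H C f (X - ?Y)" .
    ultimately have "dbound s \<sigma> (2 * ?H) (exp (r * norm k powr ?p) * C) ?G (X - ?Y)"
      using H by (intro dbound_mult s C_infinity_exp_inner f) auto
    then have "dbound s \<sigma> (2 * ?H) (exp (r * norm k powr ?p) * C) (\<lambda>X. ?G (X - ?Y)) X"
      by (rule dbound_shift[OF G])
    then have d: "dbound s \<sigma> (2 * ?H) (exp (r * norm k powr ?p) * C) f X"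
      by (simp only: fG[symmetric])
    have "exp (r * norm k powr ?p) \<le> exp (r * 2 powr ?p * norm (fst X) powr ?p) * exp (r * 2 powr ?p * norm (- x0) powr ?p)"
      using exp_powr_norm_shift[of ?p r "fst X" "- x0"] s r by (simp add: X(5))
    also have "\<dots> \<le> exp (r * 2 powr ?p * norm (fst X) powr ?p) * exp (r * 2 powr ?p * R powr ?p)"
      using R(2)[OF X(1)] r s by (intro mult_left_mono) (auto intro!: mult_left_mono powr_mono2)
    finally have "exp (r * norm k powr ?p) * C \<le> ?A * exp (r * 2 powr ?p * norm (fst X) powr ?p)"
      using C by (simp add: mult_ac mult_left_mono)
    then show ?thesis by (rule dbound_mono[OF d]) (use H in auto)
  qed
  then show "\<exists>A\<ge>0. \<forall>X. dbound s \<sigma> (2 * ?H) (A * exp (r * 2 powr ?p * norm (fst X) powr ?p)) f X"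
    using C by (intro exI[of _ ?A]) auto
qed

text \<open>Powers of \<open>\<eta>\<close> and \<open>y\<close> times the transform are Fourier
  transforms of derivatives of \<open>f\<close> times the shifted window. The growth of
  \<open>f\<close> in \<open>z\<close> is split between \<open>z - x\<close>, where half of the
  decay of the window absorbs it, and \<open>x\<close>, which is bounded; the other half of the
  decay gives integrability.\<close>

lemma stf_bound_near:
  fixes \<phi> f :: "'a::euclidean_space \<times> 'a \<Rightarrow> complex"
  assumes s: "s > 0" "\<sigma> > 0" and f: "C_infinity f" and H: "H > 0" and r: "r > 0" "r1 > 0" and A1: "A1 \<ge> 0"
    and fd: "\<And>X. dbound s \<sigma> H (A1 * exp (r * 2 powr (1 / s) * norm (fst X) powr (1 / s))) f X"
    and \<phi>: "expdec s \<sigma> H r1 \<phi>" and rr: "r * 2 powr (1 / s) * 2 powr (1 / s) \<le> r1 / 2" and R: "R \<ge> 0"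
  shows "\<exists>C>0. \<forall>x \<xi> \<eta> y. norm x \<le> R \<longrightarrow> norm (stf \<phi> f ((x, y), (\<xi>, \<eta>))) \<le>
    C * (exp (- (\<sigma> / 2 * (real DIM('a) * (2 * H)) powr (- 1 / \<sigma>)) * norm \<eta> powr (1 / \<sigma>)) *
         exp (- (s / 2 * (real DIM('a) * (2 * H)) powr (- 1 / s)) * norm y powr (1 / s)))"
proof -
  let ?p = "1 / s" and ?D = "real DIM('a)" and ?c = "2 powr (1 / s)"
  obtain C1 where C1: "C1 \<ge> 0" "\<And>X. dbound s \<sigma> H (C1 * exp (- r1 * ew s \<sigma> X)) \<phi> X" and sm: "C_infinity \<phi>"
    using \<phi> by (auto simp: expdec_def)
  obtain B2 where B2: "B2 > 0" "\<And>X :: 'a \<times> 'a. exp (- (r1 / 2) * ew s \<sigma> X) \<le> B2 / (wt X)\<^sup>2"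
    using exp_ew_le_inverse_wt[of "r1 / 2" s \<sigma>] r s by auto
  let ?A = "A1 * C1 * exp (r * ?c * ?c * R powr ?p) * B2"
  have A: "?A \<ge> 0" using A1 C1 B2 by auto
  let ?I = "LINT Z|lborel. 1 / wt (Z :: 'a \<times> 'a)"
  have I: "?I \<ge> 0" by (intro integral_nonneg_AE) auto
  let ?C3 = "?A * ?I"
  have est: "norm \<eta> ^ m * norm y ^ n * norm (stf \<phi> f ((x, y), (\<xi>, \<eta>))) \<le>
      ?C3 * ((?D * (2 * H)) ^ m * fact m powr \<sigma>) * ((?D * (2 * H)) ^ n * fact n powr s)"
    if x: "norm x \<le> R" for x \<xi> \<eta> y :: 'a and m n
  proof -
    let ?w = "((x, y), (\<xi>, \<eta>))"
    let ?P = "(x, \<xi>)"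
    let ?g = "\<lambda>Z. f Z * cnj (\<phi> (Z - ?P))"
    have smp: "C_infinity (\<lambda>Z. cnj (\<phi> (Z - ?P)))" by (intro C_infinity_cnj C_infinity_shift sm)
    have g: "C_infinity ?g" by (intro C_infinity_mult f smp)
    have gd: "dbound s \<sigma> (2 * H) (?A / wt (Z - ?P)) ?g Z" for Z
    proof -
      let ?a = "A1 * exp (r * ?c * norm (fst Z) powr ?p)" and ?b = "C1 * exp (- r1 * ew s \<sigma> (Z - ?P))"
      have "dbound s \<sigma> H ?b (\<lambda>Z. cnj (\<phi> (Z - ?P))) Z"
        by (intro dbound_cnj dbound_shift C_infinity_shift sm C1)
      then have d: "dbound s \<sigma> (2 * H) (?a * ?b) ?g Z"
        using H by (intro dbound_mult s f smp fd) auto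
      have "exp (r * ?c * norm (fst Z) powr ?p) \<le>
          exp (r * ?c * ?c * norm (fst Z - x) powr ?p) * exp (r * ?c * ?c * norm x powr ?p)"
        using exp_powr_norm_shift[of ?p "r * ?c" "fst Z - x" x] s r by simp
      also have "\<dots> \<le> exp ((r1 / 2) * ew s \<sigma> (Z - ?P)) * exp (r * ?c * ?c * R powr ?p)"
      proof (intro mult_mono)
        \<comment> \<open>One factor \<open>?c\<close> stems from the growth of \<open>f\<close>,
          the other from splitting \<open>z\<close> into \<open>z - x\<close> and \<open>x\<close>;
          the assumption \<open>rr\<close> is tailored to their product.\<close>
        have "r * ?c * ?c * norm (fst Z - x) powr ?p \<le> (r1 / 2) * norm (fst Z - x) powr ?p"
          using rr by (intro mult_right_mono) auto
        also have "\<dots> \<le> (r1 / 2) * ew s \<sigma> (Z - ?P)" using r by (intro mult_left_mono) (auto simp: ew_def)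
        finally show "exp (r * ?c * ?c * norm (fst Z - x) powr ?p) \<le> exp ((r1 / 2) * ew s \<sigma> (Z - ?P))" by simp
        show "exp (r * ?c * ?c * norm x powr ?p) \<le> exp (r * ?c * ?c * R powr ?p)"
          using x r s by (auto intro!: mult_left_mono powr_mono2)
      qed auto
      finally have "?a * ?b \<le> (A1 * (exp ((r1 / 2) * ew s \<sigma> (Z - ?P)) * exp (r * ?c * ?c * R powr ?p))) * ?b"
        using A1 C1 by (intro mult_right_mono mult_left_mono) auto
      also have "\<dots> = (A1 * C1 * exp (r * ?c * ?c * R powr ?p)) * exp (- (r1 / 2) * ew s \<sigma> (Z - ?P))"
        by (simp add: exp_add[symmetric] mult_ac)
      also have "\<dots> \<le> (A1 * C1 * exp (r * ?c * ?c * R powr ?p)) * (B2 * (1 / wt (Z - ?P)))"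
      proof (intro mult_left_mono)
        have "B2 * (1 / (wt (Z - ?P))\<^sup>2) \<le> B2 * (1 / wt (Z - ?P))"
          using B2(1) by (intro mult_left_mono inverse_wt_sq_le) auto
        then show "exp (- (r1 / 2) * ew s \<sigma> (Z - ?P)) \<le> B2 * (1 / wt (Z - ?P))"
          using B2(2)[of "Z - ?P"] by simp
      qed (use A1 C1 in auto)
      finally show ?thesis by (intro dbound_mono[OF d]) (use H in auto)
    qed
    have iw: "integrable lborel (\<lambda>Z. c * (1 / wt (Z - ?P)))" "(LINT Z|lborel. c * (1 / wt (Z - ?P))) = c * ?I" for c
      using integrable_lborel_shift(1)[OF integrable_inverse_wt, of ?P]
        integral_lborel_shift(1)[of "\<lambda>Z :: 'a \<times> 'a. 1 / wt Z" ?P]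
      by (simp_all only: integral_mult_right_zero integrable_mult_right) measurable
    have db: "norm (dd ds ?g Z) \<le> (?A * (2 * H) ^ length ds * Wt s \<sigma> ds) * (1 / wt (Z - ?P))" if "set ds \<subseteq> Basis" for ds Z
      using dboundD[OF gd that] by (simp add: mult_ac)
    have di: "integrable lborel (dd ds ?g)" if ds: "set ds \<subseteq> Basis" for ds
    proof (rule Bochner_Integration.integrable_bound[OF iw(1)])
      show "dd ds ?g \<in> borel_measurable lborel" using C_infinity_borel[OF C_infinity_dd[OF g]] by simp
      show "AE Z in lborel. norm (dd ds ?g Z) \<le> norm ((?A * (2 * H) ^ length ds * Wt s \<sigma> ds) * (1 / wt (Z - ?P)))"
        using order_trans[OF db[OF ds] abs_ge_self] by (intro AE_I2) (simp only: real_norm_def)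
    qed
    obtain b1 b2 where b: "b1 \<in> Basis" "norm \<eta> \<le> ?D * \<bar>\<eta> \<bullet> b1\<bar>" "b2 \<in> Basis" "norm y \<le> ?D * \<bar>y \<bullet> b2\<bar>"
      using norm_le_DIM_component[of \<eta>] norm_le_DIM_component[of y] by blast
    have b2: "b2 \<noteq> 0" using b by auto
    let ?ds = "replicate m (b1, 0) @ replicate n (0, b2)"
    have nn: "n1 ?ds = m" "n2 ?ds = n" "length ?ds = m + n" "set ?ds \<subseteq> Basis"
      using b b2 by (auto simp: n1_def n2_def filter_replicate Basis_prod_def)
    have "norm (FT (dd ?ds ?g) (\<eta>, y)) \<le> (LINT Z|lborel. (?A * (2 * H) ^ length ?ds * Wt s \<sigma> ?ds) * (1 / wt (Z - ?P)))"
      unfolding FT_def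
    proof (rule Bochner_Integration.integral_norm_bound_integral)
      show "integrable lborel (\<lambda>Z. exp (- \<i> * of_real ((\<eta>, y) \<bullet> Z)) * dd ?ds ?g Z)"
        by (rule integrable_unimodular[OF di[OF nn(4)]]) auto
      show "integrable lborel (\<lambda>Z. (?A * (2 * H) ^ length ?ds * Wt s \<sigma> ?ds) * (1 / wt (Z - ?P)))" by (rule iw(1))
      show "norm (exp (- \<i> * of_real ((\<eta>, y) \<bullet> Z)) * dd ?ds ?g Z) \<le> (?A * (2 * H) ^ length ?ds * Wt s \<sigma> ?ds) * (1 / wt (Z - ?P))" for Z
        using db[OF nn(4), of Z] by (simp add: norm_mult)
    qed
    then have F: "norm (FT (dd ?ds ?g) (\<eta>, y)) \<le> ?C3 * (2 * H) ^ (m + n) * (fact m powr \<sigma> * fact n powr s)"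
      unfolding iw(2) Wt_def nn(1-3) by (simp add: mult_ac)
    have pr: "norm (\<Prod>v\<leftarrow>?ds. \<i> * complex_of_real ((\<eta>, y) \<bullet> v)) = \<bar>\<eta> \<bullet> b1\<bar> ^ m * \<bar>y \<bullet> b2\<bar> ^ n"
      by (simp add: prod_list_replicate norm_mult norm_power)
    have st: "stf \<phi> f ?w = FT ?g (\<eta>, y)"
      unfolding stf_def FT_def qker_def
      by (intro Bochner_Integration.integral_cong refl) (simp add: inner_prod_def inner_commute algebra_simps)
    have "norm \<eta> ^ m * norm y ^ n * norm (stf \<phi> f ?w) \<le> (?D * \<bar>\<eta> \<bullet> b1\<bar>) ^ m * (?D * \<bar>y \<bullet> b2\<bar>) ^ n * norm (FT ?g (\<eta>, y))"
      unfolding st using b by (intro mult_right_mono mult_mono power_mono) auto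
    also have "\<dots> = ?D ^ (m + n) * norm ((\<Prod>v\<leftarrow>?ds. \<i> * complex_of_real ((\<eta>, y) \<bullet> v)) * FT ?g (\<eta>, y))"
      unfolding norm_mult pr by (simp add: power_mult_distrib power_add mult_ac)
    also have "\<dots> = ?D ^ (m + n) * norm (FT (dd ?ds ?g) (\<eta>, y))"
      by (subst FT_dd[OF g _ nn(4)]) (simp_all only: di)
    also have "\<dots> \<le> ?D ^ (m + n) * (?C3 * (2 * H) ^ (m + n) * (fact m powr \<sigma> * fact n powr s))"
      using F by (intro mult_left_mono) auto
    also have "\<dots> = ?C3 * ((?D * (2 * H)) ^ m * fact m powr \<sigma>) * ((?D * (2 * H)) ^ n * fact n powr s)"
      by (simp add: power_mult_distrib power_add mult_ac)
    finally show ?thesis .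
  qed
  \<comment> \<open>The added 1 ensures a positive constant even if the estimate gives zero.\<close>
  let ?C = "?C3 * 2 powr \<sigma> * 2 powr s + 1"
  have C3: "?C3 \<ge> 0" using A I by simp
  have Cp: "?C > 0"
    by (intro add_nonneg_pos mult_nonneg_nonneg[OF mult_nonneg_nonneg[OF C3]]) auto
  have "norm (stf \<phi> f ((x, y), (\<xi>, \<eta>))) \<le> ?C *
    (exp (- (\<sigma> / 2 * (?D * (2 * H)) powr (- 1 / \<sigma>)) * norm \<eta> powr (1 / \<sigma>)) *
     exp (- (s / 2 * (?D * (2 * H)) powr (- 1 / s)) * norm y powr (1 / s)))" if x: "norm x \<le> R" for x \<xi> \<eta> y :: 'a
  proof -
    have "norm (stf \<phi> f ((x, y), (\<xi>, \<eta>))) \<le> ?C3 * 2 powr \<sigma> * 2 powr s *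
      (exp (- (\<sigma> / 2 * (?D * (2 * H)) powr (- 1 / \<sigma>)) * norm \<eta> powr (1 / \<sigma>)) *
       exp (- (s / 2 * (?D * (2 * H)) powr (- 1 / s)) * norm y powr (1 / s)))"
      by (rule exp_decay_of_moments2[OF _ _ _ C3 _ _ s(2,1) est[OF x]]) (use H in auto)
    also have "\<dots> \<le> ?C *
      (exp (- (\<sigma> / 2 * (?D * (2 * H)) powr (- 1 / \<sigma>)) * norm \<eta> powr (1 / \<sigma>)) *
       exp (- (s / 2 * (?D * (2 * H)) powr (- 1 / s)) * norm y powr (1 / s)))"
      by (intro mult_right_mono) auto
    finally show ?thesis .
  qed
  then show ?thesis using Cp by blast
qed

text \<open>Translating the integration variable by \<open>k\<close> produces the phase of
  quasi-periodicity with frequency \<open>k\<close> in the second variable, which the shift of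
  \<open>y\<close> by \<open>k\<close> cancels. Only a phase independent of \<open>Z\<close>
  remains.\<close>

lemma stf_lattice:
  fixes E :: "'n::finite \<Rightarrow> real ^ 'n"
  assumes qp: "quasi_periodic E f" and k: "k \<in> lattice_of E"
    and [measurable]: "f \<in> borel_measurable borel" "\<phi> \<in> borel_measurable borel"
  shows "norm (stf \<phi> f ((x + k, y + k), (\<xi>, \<eta>))) = norm (stf \<phi> f ((x, y), (\<xi>, \<eta>)))"
proof -
  let ?w = "((x + k, y + k), (\<xi>, \<eta>))" and ?c = "exp (\<i> * complex_of_real (- (k \<bullet> \<eta>)))"
  have m: "(\<lambda>Z. f Z * qker \<phi> Z ?w) \<in> borel_measurable borel" unfolding qker_def by measurable
  have "stf \<phi> f ?w = (LINT Z|lborel. f (Z + (k, 0)) * qker \<phi> (Z + (k, 0)) ?w)"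
    unfolding stf_def by (rule integral_lborel_shift(2)[OF m, symmetric])
  also have "\<dots> = (LINT Z|lborel. ?c * (f Z * qker \<phi> Z ((x, y), (\<xi>, \<eta>))))"
  proof (intro Bochner_Integration.integral_cong refl)
    fix Z :: "(real ^ 'n) \<times> (real ^ 'n)"
    obtain z \<zeta> where Z: "Z = (z, \<zeta>)" by (cases Z)
    have 1: "f (Z + (k, 0)) = exp (\<i> * of_real (k \<bullet> \<zeta>)) * f Z"
      using qp k by (simp add: Z quasi_periodic_def)
    have 2: "exp (\<i> * of_real (k \<bullet> \<zeta>)) * exp (\<i> * of_real (- (Z + (k, 0)) \<bullet> TT ?w)) =
        ?c * exp (\<i> * of_real (- Z \<bullet> TT ((x, y), (\<xi>, \<eta>))))"
      unfolding exp_add[symmetric] by (rule arg_cong[of _ _ exp])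
        (simp add: Z PT_simps inner_prod_def inner_add_left inner_add_right inner_commute[of \<zeta> k] algebra_simps)
    have 3: "Z + (k, 0) - PP ?w = Z - PP ((x, y), (\<xi>, \<eta>))" by (simp add: Z PT_simps)
    have "(e1 * a) * (b * e2) = c * (a * (b * e3))" if "e1 * e2 = c * e3" for a b c e1 e2 e3 :: complex
      using arg_cong[OF that, of "\<lambda>t. t * (a * b)"] by (simp only: mult_ac)
    from this[OF 2] show "f (Z + (k, 0)) * qker \<phi> (Z + (k, 0)) ?w = ?c * (f Z * qker \<phi> Z ((x, y), (\<xi>, \<eta>)))"
      unfolding qker_def 1 3 .
  qed
  also have "\<dots> = ?c * stf \<phi> f ((x, y), (\<xi>, \<eta>))"
    unfolding stf_def by (rule integral_mult_right_zero)
  finally show ?thesis by (simp add: norm_mult)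
qed

text \<open>Since \<open>k\<close> is within \<open>R\<close> of \<open>x\<close>, the distances of
  \<open>y\<close> to \<open>k\<close> and to \<open>x\<close> are comparable; the quasi-triangle
  inequality for powers divides the rate by \<open>2 powr p\<close>.\<close>

lemma exp_lattice_shift:
  fixes x y k :: "'a::real_normed_vector"
  assumes "p > 0" "\<rho> > 0" "R \<ge> 0" "a \<ge> 0" "norm (x - k) \<le> R"
  shows "exp (- \<rho> * (a + norm (y - k) powr p)) \<le> exp (\<rho> * R powr p) * exp (- (\<rho> / 2 powr p) * (a + norm (x - y) powr p))"
proof -
  have "norm (x - y) powr p \<le> 2 powr p * (norm (x - k) powr p + norm (k - y) powr p)"
    using norm_powr_add_le[of p "x - k" "k - y"] assms by simp
  also have "\<dots> \<le> 2 powr p * (R powr p + norm (y - k) powr p)"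
    using assms by (intro mult_left_mono add_mono powr_mono2) (auto simp: norm_minus_commute)
  finally have "norm (x - y) powr p / 2 powr p \<le> R powr p + norm (y - k) powr p"
    by (simp add: divide_le_eq mult.commute)
  moreover have "a / 2 powr p \<le> a" using assms ge_one_powr_ge_zero[of 2 p] by (simp add: divide_le_eq mult_le_cancel_left1)
  ultimately have "(a + norm (x - y) powr p) / 2 powr p \<le> a + (R powr p + norm (y - k) powr p)"
    by (simp add: add_divide_distrib)
  then have "\<rho> * ((a + norm (x - y) powr p) / 2 powr p) \<le> \<rho> * (a + (R powr p + norm (y - k) powr p))"
    using assms by (intro mult_left_mono) auto
  then show ?thesis by (simp add: exp_add[symmetric] algebra_simps add_divide_distrib)
qed

subsection \<open>Reconstruction from the transform\<close>

text \<open>Synthesis: a superposition of shifted and modulated copies of \<open>\<theta>\<close>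
  with coefficients \<open>V\<close>. It is the transpose of \<open>sop \<theta>\<close>
  (\<open>rec_test\<close>).\<close>

definition rec :: "('a::euclidean_space \<times> 'a \<Rightarrow> complex) \<Rightarrow> (('a \<times> 'a) \<times> ('a \<times> 'a) \<Rightarrow> complex) \<Rightarrow> 'a \<times> 'a \<Rightarrow> complex" where
  "rec \<theta> V Z = (LINT w|lborel. V w * sker \<theta> w Z)"

definition vdecay :: "real \<Rightarrow> real \<Rightarrow> real \<Rightarrow> real \<Rightarrow> (('a::euclidean_space \<times> 'a) \<times> ('a \<times> 'a) \<Rightarrow> complex) \<Rightarrow> bool" where
  "vdecay s \<sigma> r C V \<longleftrightarrow> (\<forall>x y \<xi> \<eta>. norm (V ((x, y), (\<xi>, \<eta>))) \<le> C * exp (- r * (norm \<eta> powr (1 / \<sigma>) + norm (x - y) powr (1 / s))))"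

lemma vdecay_wt:
  fixes V :: "('a::euclidean_space \<times> 'a) \<times> ('a \<times> 'a) \<Rightarrow> complex"
  assumes s: "s > 0" "\<sigma> > 0" and r: "r > 0" and C: "C \<ge> 0"
  shows "\<exists>K\<ge>0. \<forall>V :: ('a \<times> 'a) \<times> ('a \<times> 'a) \<Rightarrow> complex. vdecay s \<sigma> r C V \<longrightarrow>
    (\<forall>x y \<xi> \<eta>. norm (V ((x, y), (\<xi>, \<eta>))) \<le> K / (wt \<eta> * wt (x - y)))"
proof -
  obtain B1 where B1: "B1 > 0" "\<And>x :: 'a. exp (- r * norm x powr (1 / \<sigma>)) \<le> B1 / (wt x)\<^sup>2"
    using exp_le_inverse_wt[OF r s(2)] by blast
  obtain B2 where B2: "B2 > 0" "\<And>x :: 'a. exp (- r * norm x powr (1 / s)) \<le> B2 / (wt x)\<^sup>2"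
    using exp_le_inverse_wt[OF r s(1)] by blast
  have le: "B / (wt x)\<^sup>2 \<le> B / wt x" if "B > 0" for B and x :: 'a
    using mult_left_mono[OF inverse_wt_sq_le[of x], of B] that by simp
  have "norm (V ((x, y), (\<xi>, \<eta>))) \<le> (C * B1 * B2) / (wt \<eta> * wt (x - y))" if "vdecay s \<sigma> r C V"
    for x y \<xi> \<eta> :: 'a and V
  proof -
    have "norm (V ((x, y), (\<xi>, \<eta>))) \<le> C * (exp (- r * norm \<eta> powr (1 / \<sigma>)) * exp (- r * norm (x - y) powr (1 / s)))"
      using that by (simp add: vdecay_def exp_add[symmetric] algebra_simps)
    also have "\<dots> \<le> C * ((B1 / wt \<eta>) * (B2 / wt (x - y)))"
      using B1 B2 C by (intro mult_left_mono mult_mono order_trans[OF B1(2) le] order_trans[OF B2(2) le]) auto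
    finally show ?thesis by simp
  qed
  then show ?thesis using C B1(1) B2(1) by (intro exI[of _ "C * B1 * B2"]) auto
qed

lemma rec_majorant:
  fixes \<theta> :: "'a::euclidean_space \<times> 'a \<Rightarrow> complex"
  assumes V: "\<And>x y \<xi> \<eta>. norm (V ((x, y), (\<xi>, \<eta>))) \<le> K / (wt \<eta> * wt (x - y))"
    and \<theta>: "\<And>X. norm (\<theta> X) \<le> B / (wt X)\<^sup>2" and "K \<ge> 0"
  shows "norm (V w * sker \<theta> w Z) \<le> K * B * uu (w - AZ Z)"
proof -
  obtain x y \<xi> \<eta> where w: "w = ((x, y), (\<xi>, \<eta>))" by (metis prod.collapse)
  obtain z \<zeta> where Z: "Z = (z, \<zeta>)" by (cases Z)
  have "norm (sker \<theta> w Z) \<le> B / (wt (z - x) * wt (\<zeta> - \<xi>))\<^sup>2"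
    using \<theta>[of "(z - x, \<zeta> - \<xi>)"] by (simp add: sker_def norm_mult w Z wt_Pair)
  then have "norm (V w * sker \<theta> w Z) \<le> (K / (wt \<eta> * wt (x - y))) * (B / (wt (z - x) * wt (\<zeta> - \<xi>))\<^sup>2)"
    unfolding norm_mult w using assms(3) by (intro mult_mono V) auto
  also have "\<dots> = K * B * uu (w - AZ Z)"
    unfolding w Z uu_AZ by (simp add: power_mult_distrib)
  finally show ?thesis .
qed

context
  fixes \<theta> :: "'a::euclidean_space \<times> 'a \<Rightarrow> complex" and V :: "('a \<times> 'a) \<times> ('a \<times> 'a) \<Rightarrow> complex" and K B :: real
  assumes Vm: "V \<in> borel_measurable borel"
    and V: "\<And>x y \<xi> \<eta>. norm (V ((x, y), (\<xi>, \<eta>))) \<le> K / (wt \<eta> * wt (x - y))"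
    and \<theta>: "\<And>X. norm (\<theta> X) \<le> B / (wt X)\<^sup>2" and sm: "C_infinity \<theta>" and K: "K \<ge> 0"
begin

lemma kernel_bound_nonneg: "K * B \<ge> 0"
proof -
  have "0 \<le> B / (wt (0 :: 'a \<times> 'a))\<^sup>2" using \<theta>[of 0] norm_ge_zero order_trans by blast
  from mult_nonneg_nonneg[OF this, of "(wt (0 :: 'a \<times> 'a))\<^sup>2"] K show ?thesis by simp
qed

lemma sker_measurable_w: "(\<lambda>w. V w * sker \<theta> w Z) \<in> borel_measurable borel"
proof -
  note Vm[measurable]
  have [measurable]: "\<theta> \<in> borel_measurable borel" by (rule C_infinity_borel[OF sm])
  show ?thesis unfolding sker_def by measurable
qed

lemma rec_integrable: "integrable lborel (\<lambda>w. V w * sker \<theta> w Z)"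
proof (rule Bochner_Integration.integrable_bound[OF integrable_mult_right[OF uu_shift_integral(1), of "K * B"]])
  show "AE w in lborel. norm (V w * sker \<theta> w Z) \<le> norm (K * B * uu (w - AZ Z))"
    using order_trans[OF rec_majorant[OF V \<theta> K] abs_ge_self] by (intro AE_I2) (simp only: real_norm_def)
qed (use sker_measurable_w in simp)

lemma rec_bounded: "norm (rec \<theta> V Z) \<le> K * B * integral\<^sup>L lborel (uu :: ('a \<times> 'a) \<times> ('a \<times> 'a) \<Rightarrow> real)"
proof -
  have "norm (rec \<theta> V Z) \<le> (LINT w|lborel. K * B * uu (w - AZ Z))"
    unfolding rec_def
    by (rule Bochner_Integration.integral_norm_bound_integral[OF rec_integrable])
       (intro integrable_mult_right uu_shift_integral(1), rule rec_majorant[OF V \<theta> K])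
  then show ?thesis by (simp only: integral_mult_right_zero uu_shift_integral(2))
qed

lemma rec_continuous: "continuous_on UNIV (rec \<theta> V)"
  unfolding rec_def[abs_def]
proof (rule continuous_on_integral_dominated)
  show "continuous_on UNIV (\<lambda>Z. V w * sker \<theta> w Z)" for w
    by (intro C_infinity_continuous_on C_infinity_cmult sker_C_infinity(3) sm)
  show "(\<lambda>w. V w * sker \<theta> w Z) \<in> borel_measurable borel" for Z by (rule sker_measurable_w)
  fix Z0 :: "'a \<times> 'a"
  obtain L where L: "L \<ge> 0" "\<And>Z w. Z \<in> ball Z0 1 \<Longrightarrow> uu (w - AZ Z) \<le> L * (1 / wt w)" using uu_locally_dominated by blast
  have "norm (V w * sker \<theta> w Z) \<le> K * B * L * (1 / wt w)" if "Z \<in> ball Z0 1" for Z w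
    using order_trans[OF rec_majorant[OF V \<theta> K] mult_left_mono[OF L(2)[OF that] kernel_bound_nonneg]] by simp
  then show "\<exists>\<delta>>0. \<exists>g. integrable lborel g \<and> (\<forall>Z\<in>ball Z0 \<delta>. \<forall>w. norm (V w * sker \<theta> w Z) \<le> g w)"
    by (intro exI[of _ "1::real"] conjI exI[of _ "\<lambda>w. K * B * L * (1 / wt w)"] integrable_mult_right integrable_inverse_wt) auto
qed

lemma rec_test:
  assumes \<Phi>: "\<Phi> \<in> sch"
  shows "integrable lborel (\<lambda>Z. rec \<theta> V Z * \<Phi> Z)"
    and "(LINT Z|lborel. rec \<theta> V Z * \<Phi> Z) = (LINT w|lborel. V w * sop \<theta> \<Phi> w)"
proof -
  note Vm[measurable]
  have [measurable]: "\<theta> \<in> borel_measurable borel" "\<Phi> \<in> borel_measurable borel"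
    by (intro C_infinity_borel sm sch_C_infinity[OF \<Phi>])+
  have [measurable]: "AZ \<in> borel_measurable (borel :: ('a \<times> 'a) measure)"
    unfolding AZ_def[abs_def] by (intro borel_measurable_continuous_onI continuous_intros)
  let ?F = "\<lambda>Z w. V w * sker \<theta> w Z * \<Phi> Z"
  let ?G = "\<lambda>Z w. (K * B) * (uu (w - AZ Z) * norm (\<Phi> Z))"
  have G: "integrable (lborel \<Otimes>\<^sub>M lborel) (\<lambda>(Z, w). ?G Z w)"
  proof (rule lborel_pair.Fubini_integrable)
    show "(\<lambda>(Z, w). ?G Z w) \<in> borel_measurable (lborel \<Otimes>\<^sub>M lborel)" by measurable
    have "(LINT w|lborel. norm (?G Z w)) = (K * B * integral\<^sup>L lborel (uu :: ('a \<times> 'a) \<times> ('a \<times> 'a) \<Rightarrow> real)) * norm (\<Phi> Z)" for Z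
    proof -
      have "(LINT w|lborel. norm (?G Z w)) = (LINT w|lborel. (K * B * norm (\<Phi> Z)) * uu (w - AZ Z))"
      proof (intro Bochner_Integration.integral_cong refl)
        fix w :: "('a \<times> 'a) \<times> ('a \<times> 'a)"
        have "?G Z w \<ge> 0" by (intro mult_nonneg_nonneg kernel_bound_nonneg uu_nonneg norm_ge_zero)
        then show "norm (?G Z w) = (K * B * norm (\<Phi> Z)) * uu (w - AZ Z)" by (simp add: mult_ac)
      qed
      also have "\<dots> = (K * B * norm (\<Phi> Z)) * (LINT w|lborel. uu (w - AZ Z))" by (rule integral_mult_right_zero)
      finally show ?thesis unfolding uu_shift_integral(2) by (simp add: mult_ac)
    qed
    then show "integrable lborel (\<lambda>Z. LINT w|lborel. norm (case (Z, w) of (Z, w) \<Rightarrow> ?G Z w))"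
      using integrable_norm[OF sch_decay1(3)[OF \<Phi>]] by simp
    show "AE Z in lborel. integrable lborel (\<lambda>w. case (Z, w) of (Z, w) \<Rightarrow> ?G Z w)"
    proof (intro AE_I2)
      fix Z
      have "integrable lborel (\<lambda>w. (K * B * norm (\<Phi> Z)) * uu (w - AZ Z))"
        by (intro integrable_mult_right uu_shift_integral(1))
      then show "integrable lborel (\<lambda>w. case (Z, w) of (Z, w) \<Rightarrow> ?G Z w)" by (simp add: mult_ac)
    qed
  qed
  have F: "integrable (lborel \<Otimes>\<^sub>M lborel) (\<lambda>(Z, w). ?F Z w)"
  proof (rule Bochner_Integration.integrable_bound[OF G])
    show "(\<lambda>(Z, w). ?F Z w) \<in> borel_measurable (lborel \<Otimes>\<^sub>M lborel)"
      unfolding sker_def by measurable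
    show "AE x in lborel \<Otimes>\<^sub>M lborel. norm (case x of (Z, w) \<Rightarrow> ?F Z w) \<le> norm (case x of (Z, w) \<Rightarrow> ?G Z w)"
    proof (intro AE_I2, clarify)
      fix a b and w
      let ?Z = "(a, b) :: 'a \<times> 'a"
      have "norm (?F ?Z w) \<le> (K * B * uu (w - AZ ?Z)) * norm (\<Phi> ?Z)"
        unfolding norm_mult[of _ "\<Phi> _"] by (intro mult_right_mono rec_majorant[OF V \<theta> K]) auto
      also have "\<dots> \<le> norm (?G ?Z w)" by (simp add: mult.assoc)
      finally show "norm (?F ?Z w) \<le> norm (?G ?Z w)" .
    qed
  qed
  have e: "(LINT w|lborel. ?F Z w) = rec \<theta> V Z * \<Phi> Z" for Z
    unfolding rec_def by simp
  show "integrable lborel (\<lambda>Z. rec \<theta> V Z * \<Phi> Z)"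
    using lborel_pair.integrable_fst[OF F] by (simp only: e)
  have "(LINT Z|lborel. rec \<theta> V Z * \<Phi> Z) = (LINT Z|lborel. LINT w|lborel. ?F Z w)" by (simp only: e)
  also have "\<dots> = (LINT w|lborel. LINT Z|lborel. ?F Z w)"
    using lborel_pair.Fubini_integral[OF F] by simp
  also have "\<dots> = (LINT w|lborel. V w * sop \<theta> \<Phi> w)"
    unfolding sop_def by (simp add: mult.assoc)
  finally show "(LINT Z|lborel. rec \<theta> V Z * \<Phi> Z) = (LINT w|lborel. V w * sop \<theta> \<Phi> w)" .
qed

end

subsection \<open>Smoothness of the reconstruction\<close>

lemma has_derivative_integral_wt:
  fixes K :: "'v::euclidean_space \<Rightarrow> 'w::euclidean_space \<Rightarrow> complex"
  assumes sm: "\<And>w. C_infinity (\<lambda>X. K X w)"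
    and meas: "\<And>X. K X \<in> borel_measurable borel" "\<And>X b. b \<in> Basis \<Longrightarrow> (\<lambda>w. pderivative b (\<lambda>X. K X w) X) \<in> borel_measurable borel"
    and dom: "\<And>X0. \<exists>L. \<forall>X\<in>ball X0 1. \<forall>w. norm (K X w) \<le> L / wt w"
      "\<And>X0 b. b \<in> Basis \<Longrightarrow> \<exists>L. \<forall>X\<in>ball X0 1. \<forall>w. norm (pderivative b (\<lambda>X. K X w) X) \<le> L / wt w"
  shows "((\<lambda>X. LINT w|lborel. K X w) has_derivative
      (\<lambda>v. LINT w|lborel. pderivative v (\<lambda>X. K X w) X0)) (at X0)"
proof (rule has_derivative_integral(1))
  show "(\<lambda>X. K X w) differentiable (at X)" for X w by (rule C_infinity_differentiable[OF sm])
  show "integrable lborel (K X)" for X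
  proof -
    obtain L where "\<And>w. norm (K X w) \<le> L / wt w" using dom(1)[of X] centre_in_ball[of X 1] zero_less_one by blast
    from integrable_wt_bound[OF meas(1) this] show ?thesis .
  qed
  show "(\<lambda>w. pderivative v (\<lambda>X. K X w) X) \<in> borel_measurable borel" for X v
  proof -
    have "(\<lambda>w. \<Sum>b\<in>Basis. of_real (v \<bullet> b) * pderivative b (\<lambda>X. K X w) X) \<in> borel_measurable borel"
      by (intro borel_measurable_sum borel_measurable_times meas(2)) auto
    then show ?thesis
      by (subst pderivative_Basis[OF C_infinity_differentiable[OF sm]])
  qed
  have "\<forall>b\<in>Basis. \<exists>L. \<forall>X\<in>ball X0 1. \<forall>w. norm (pderivative b (\<lambda>X. K X w) X) \<le> L / wt w" using dom(2) by blast
  from bchoice[OF this] obtain L where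
    L: "\<And>b X w. b \<in> Basis \<Longrightarrow> X \<in> ball X0 1 \<Longrightarrow> norm (pderivative b (\<lambda>X. K X w) X) \<le> L b / wt w" by blast
  have "norm (pderivative b (\<lambda>X. K X w) X) \<le> (\<Sum>b\<in>Basis. \<bar>L b\<bar>) * (1 / wt w)"
    if "b \<in> Basis" "X \<in> ball X0 1" for b X w
  proof -
    have "L b \<le> (\<Sum>b\<in>Basis. \<bar>L b\<bar>)"
      using member_le_sum[of b Basis "\<lambda>b. \<bar>L b\<bar>"] that by simp
    then have "L b / wt w \<le> (\<Sum>b\<in>Basis. \<bar>L b\<bar>) / wt w" by (intro divide_right_mono) auto
    then show ?thesis using L[OF that, of w] by simp
  qed
  then show "\<exists>\<delta>>0. \<exists>g. integrable lborel g \<and>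
      (\<forall>X\<in>ball X0 \<delta>. \<forall>w. \<forall>b\<in>Basis. norm (pderivative b (\<lambda>X. K X w) X) \<le> g w)"
    by (intro exI[of _ "1::real"] conjI exI[of _ "\<lambda>w. (\<Sum>b\<in>Basis. \<bar>L b\<bar>) * (1 / wt w)"]
        integrable_mult_right integrable_inverse_wt) auto
qed

text \<open>The integrals of all iterated derivatives form a family closed under differentiation, so
  smoothness and the formula for derivatives come out of one closure argument.\<close>

lemma C_infinity_integral:
  fixes K :: "'v::euclidean_space \<Rightarrow> 'w::euclidean_space \<Rightarrow> complex"
  assumes sm: "\<And>w. C_infinity (\<lambda>X. K X w)"
    and meas: "\<And>ds X. set ds \<subseteq> Basis \<Longrightarrow> (\<lambda>w. dd ds (\<lambda>X. K X w) X) \<in> borel_measurable borel"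
    and dom: "\<And>ds X0. set ds \<subseteq> Basis \<Longrightarrow> \<exists>L. \<forall>X\<in>ball X0 1. \<forall>w. norm (dd ds (\<lambda>X. K X w) X) \<le> L / wt w"
  shows "C_infinity (\<lambda>X. LINT w|lborel. K X w)"
    and "set ds \<subseteq> Basis \<Longrightarrow> dd ds (\<lambda>X. LINT w|lborel. K X w) = (\<lambda>X. LINT w|lborel. dd ds (\<lambda>X. K X w) X)"
proof -
  let ?J = "\<lambda>ds X. LINT w|lborel. dd ds (\<lambda>X. K X w) X"
  have d: "(?J ds has_derivative (\<lambda>v. LINT w|lborel. pderivative v (dd ds (\<lambda>X. K X w)) X0)) (at X0)"
    if ds: "set ds \<subseteq> Basis" for ds X0
  proof -
    have "((\<lambda>X. LINT w|lborel. dd ds (\<lambda>X. K X w) X) has_derivative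
       (\<lambda>v. LINT w|lborel. pderivative v (\<lambda>X. dd ds (\<lambda>X. K X w) X) X0)) (at X0)"
    proof (rule has_derivative_integral_wt[where K = "\<lambda>X w. dd ds (\<lambda>X. K X w) X"])
      show "C_infinity (\<lambda>X. dd ds (\<lambda>X. K X w) X)" for w by (rule C_infinity_dd[OF sm])
      show "(\<lambda>w. dd ds (\<lambda>X. K X w) X) \<in> borel_measurable borel" for X by (rule meas[OF ds])
      show "(\<lambda>w. pderivative b (\<lambda>X. dd ds (\<lambda>X. K X w) X) X) \<in> borel_measurable borel" if "b \<in> Basis" for X b
        using meas[of "b # ds"] ds that by simp
      show "\<exists>L. \<forall>X\<in>ball X0 1. \<forall>w. norm (dd ds (\<lambda>X. K X w) X) \<le> L / wt w" for X0 by (rule dom[OF ds])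
      show "\<exists>L. \<forall>X\<in>ball X0 1. \<forall>w. norm (pderivative b (\<lambda>X. dd ds (\<lambda>X. K X w) X) X) \<le> L / wt w" if "b \<in> Basis" for X0 b
        using dom[of "b # ds"] ds that by simp
    qed
    then show ?thesis .
  qed
  have pd: "pderivative b (?J ds) = ?J (b # ds)" if "set ds \<subseteq> Basis" for b ds
    using pderivative_eqI[OF d[OF that]] by (intro ext) simp
  show "set ds \<subseteq> Basis \<Longrightarrow> dd ds (\<lambda>X. LINT w|lborel. K X w) = ?J ds"
  proof (induction ds)
    case (Cons b ds)
    then have "dd (b # ds) (\<lambda>X. LINT w|lborel. K X w) = pderivative b (?J ds)" by simp
    also have "\<dots> = ?J (b # ds)" by (rule pd) (use Cons in simp)
    finally show ?case .
  qed simp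
  let ?A = "?J ` {ds. set ds \<subseteq> Basis}"
  show "C_infinity (\<lambda>X. LINT w|lborel. K X w)"
  proof (rule C_infinity_coinduct1[of _ ?A])
    show "(\<lambda>X. LINT w|lborel. K X w) \<in> ?A" by (rule image_eqI[of _ _ "[]"]) simp_all
    fix g assume "g \<in> ?A"
    then obtain ds where g: "g = ?J ds" and ds: "set ds \<subseteq> Basis" by blast
    show "g differentiable_on UNIV"
      unfolding g differentiable_on_def using d[OF ds] by (auto simp: differentiable_def)
    fix b :: 'v assume b: "b \<in> Basis"
    have "pderivative b g = ?J (b # ds)" unfolding g by (rule pd[OF ds])
    moreover have "b # ds \<in> {ds. set ds \<subseteq> Basis}" using b ds by simp
    ultimately show "pderivative b g \<in> ?A" by (rule image_eqI)
  qed
qed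

text \<open>The derivatives act in \<open>Z\<close> while measurability concerns \<open>w\<close>;
  the Leibniz expansion makes the dependence on \<open>w\<close> explicit.\<close>

lemma sker_dd_measurable:
  assumes sm: "C_infinity \<theta>" and Vm[measurable]: "V \<in> borel_measurable borel"
  shows "(\<lambda>w. dd ds (\<lambda>Z. V w * sker \<theta> w Z) Z) \<in> borel_measurable borel"
proof -
  have *: "dd ds (\<lambda>Z. V w * sker \<theta> w Z) Z =
    V w * (\<Sum>p\<leftarrow>splits ds. dd (fst p) \<theta> (Z - PP w) *
      ((\<Prod>v\<leftarrow>snd p. \<i> * of_real (TT w \<bullet> v)) * exp (\<i> * of_real (TT w \<bullet> Z))))" for w
  proof -
    have "sker \<theta> w = (\<lambda>Z. \<theta> (Z - PP w) * exp (\<i> * of_real (TT w \<bullet> Z)))"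
      by (simp add: sker_def fun_eq_iff inner_commute)
    moreover have "dd ds (\<lambda>Z. \<theta> (Z - PP w) * exp (\<i> * of_real (TT w \<bullet> Z))) Z =
      (\<Sum>p\<leftarrow>splits ds. dd (fst p) \<theta> (Z - PP w) * ((\<Prod>v\<leftarrow>snd p. \<i> * of_real (TT w \<bullet> v)) * exp (\<i> * of_real (TT w \<bullet> Z))))"
      by (subst dd_mult[OF C_infinity_shift[OF sm] C_infinity_exp_inner])
         (simp only: dd_shift[OF sm] dd_exp_inner case_prod_unfold)
    ultimately show ?thesis
      using dd_cmult[OF sker_C_infinity(3)[OF sm], of ds "V w" w] by simp
  qed
  have [measurable]: "dd as \<theta> \<in> borel_measurable borel" for as by (rule C_infinity_borel[OF C_infinity_dd[OF sm]])
  have pr: "(\<lambda>w. \<Prod>v\<leftarrow>vs. \<i> * of_real (TT w \<bullet> v)) \<in> borel_measurable borel" for vs by (induction vs) simp_all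
  have "(\<lambda>w. \<Sum>p\<leftarrow>ps. dd (fst p) \<theta> (Z - PP w) *
      ((\<Prod>v\<leftarrow>snd p. \<i> * of_real (TT w \<bullet> v)) * exp (\<i> * of_real (TT w \<bullet> Z)))) \<in> borel_measurable borel" for ps
  proof (induction ps)
    case (Cons p ps)
    note Cons[measurable] pr[measurable]
    show ?case unfolding list.map sum_list.Cons by measurable
  qed simp
  from borel_measurable_times[OF Vm this] show ?thesis unfolding * .
qed

text \<open>Differentiating the modulation costs \<open>exp (\<rho> * ...)\<close> in
  \<open>\<eta>\<close> and \<open>y\<close>. By \<open>\<rho>\<close> half of the decay of
  \<open>V\<close> and half of that of the window pay for this, the other halves provide
  \<open>uu\<close>, and what cannot be paid is the growth in the first variable of
  \<open>Z\<close>.\<close>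

lemma rec_dbound_kernel:
  fixes \<phi> :: "'a::euclidean_space \<times> 'a \<Rightarrow> complex" and V :: "('a \<times> 'a) \<times> ('a \<times> 'a) \<Rightarrow> complex"
  assumes s: "s > 0" "\<sigma> > 0" and h: "h > 0" and r: "r > 0" "r0 > 0" "\<rho> > 0" and C: "C \<ge> 0"
    and V: "vdecay s \<sigma> r C V" and \<phi>: "expdec s \<sigma> h r0 \<phi>"
    and \<rho>: "\<rho> * (2 powr (1 / s) * 2 powr (1 / s)) \<le> r / 2" "\<rho> * (2 powr (1 / s) * 2 powr (1 / s)) \<le> r0 / 2"
  shows "\<exists>K\<ge>0. \<forall>Z w. dbound s \<sigma> (2 * max h (hh s \<sigma> \<rho>))
    (K * exp (\<rho> * (2 powr (1 / s) * 2 powr (1 / s)) * norm (fst Z) powr (1 / s)) * uu (w - AZ Z))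
    (\<lambda>Z. V w * sker \<phi> w Z) Z"
proof -
  let ?p = "1 / s" and ?c = "2 powr (1 / s) * 2 powr (1 / s) :: real" and ?H = "max h (hh s \<sigma> \<rho>)"
  obtain C1 where C1: "C1 \<ge> 0" "\<And>X. dbound s \<sigma> h (C1 * exp (- r0 * ew s \<sigma> X)) \<phi> X" and sm: "C_infinity \<phi>"
    using \<phi> by (auto simp: expdec_def)
  have r2: "r / 2 > 0" "r0 / 2 > 0" using r by auto
  obtain B1 where B1: "B1 > 0" "\<And>x :: 'a. exp (- (r / 2) * norm x powr (1 / \<sigma>)) \<le> B1 / (wt x)\<^sup>2"
    using exp_le_inverse_wt[OF r2(1) s(2)] by blast
  obtain B2 where B2: "B2 > 0" "\<And>x :: 'a. exp (- (r / 2) * norm x powr ?p) \<le> B2 / (wt x)\<^sup>2"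
    using exp_le_inverse_wt[OF r2(1) s(1)] by blast
  obtain B3 where B3: "B3 > 0" "\<And>X :: 'a \<times> 'a. exp (- (r0 / 2) * ew s \<sigma> X) \<le> B3 / (wt X)\<^sup>2"
    using exp_ew_le_inverse_wt[OF r2(2) s] by blast
  let ?K = "C * C1 * (B1 * B2 * B3)"
  have "dbound s \<sigma> (2 * ?H) (?K * exp (\<rho> * ?c * norm (fst Z) powr ?p) * uu (w - AZ Z)) (\<lambda>Z. V w * sker \<phi> w Z) Z" for Z w
  proof -
    obtain x y \<xi> \<eta> where w: "w = ((x, y), (\<xi>, \<eta>))" by (metis prod.collapse)
    obtain z \<zeta> where Z: "Z = (z, \<zeta>)" by (cases Z)
    let ?P = "(x, \<xi>)" and ?T = "(\<eta>, y)"
    let ?n = "norm \<eta> powr (1 / \<sigma>)" and ?xy = "norm (x - y) powr ?p" and ?zx = "norm (z - x) powr ?p" and ?z = "norm z powr ?p"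
    let ?e1 = "exp (- r0 * ew s \<sigma> (Z - ?P))" and ?e2 = "exp (\<rho> * (?n + norm y powr ?p))" and ?e3 = "exp (- r * (?n + ?xy))"
    have sk: "(\<lambda>Z. V w * sker \<phi> w Z) = (\<lambda>Z. V w * (\<phi> (Z - ?P) * exp (\<i> * of_real (?T \<bullet> Z))))"
      unfolding sker_def w PT_simps by (simp only: inner_commute)
    have "dbound s \<sigma> ?H (C1 * ?e1) (\<lambda>Z. \<phi> (Z - ?P)) Z"
      by (rule dbound_shift[OF sm dbound_mono[OF C1(2) order_refl less_imp_le[OF h] max.cobounded1]])
    moreover have "dbound s \<sigma> ?H ?e2 (\<lambda>Z. exp (\<i> * of_real (?T \<bullet> Z))) Z"
    proof -
      have "exp (\<rho> * (norm (fst ?T) powr (1 / \<sigma>) + norm (snd ?T) powr ?p)) \<le> ?e2" by simp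
      from dbound_mono[OF dbound_exp[OF s r(3)] this less_imp_le[OF hh_pos[OF s r(3)]] max.cobounded2[of _ h]]
      show ?thesis .
    qed
    moreover have "?H \<ge> 0" using h by simp
    ultimately have "dbound s \<sigma> (2 * ?H) ((C1 * ?e1) * ?e2) (\<lambda>Z. \<phi> (Z - ?P) * exp (\<i> * of_real (?T \<bullet> Z))) Z"
      by (intro dbound_mult s C_infinity_shift sm C_infinity_exp_inner)
    then have d: "dbound s \<sigma> (2 * ?H) (norm (V w) * ((C1 * ?e1) * ?e2)) (\<lambda>Z. V w * sker \<phi> w Z) Z"
      unfolding sk by (rule dbound_cmult[OF C_infinity_mult[OF C_infinity_shift[OF sm] C_infinity_exp_inner]])
    \<comment> \<open>The path from \<open>y\<close> over \<open>x\<close> to \<open>z\<close> uses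
      the quasi-triangle inequality twice, which is the origin of \<open>?c\<close>.\<close>
    have ye: "norm y powr ?p \<le> ?c * (?xy + ?zx + ?z)"
    proof -
      have "norm y powr ?p \<le> 2 powr ?p * (norm (y - x) powr ?p + norm x powr ?p)"
        using norm_powr_add_le[of ?p "y - x" x] s by simp
      also have "\<dots> \<le> 2 powr ?p * (2 powr ?p * ?xy + 2 powr ?p * (?zx + ?z))"
      proof (intro mult_left_mono add_mono)
        show "norm (y - x) powr ?p \<le> 2 powr ?p * ?xy"
          using ge_one_powr_ge_zero[of 2 ?p] s mult_right_mono[of 1 "2 powr ?p" ?xy] by (simp add: norm_minus_commute)
        show "norm x powr ?p \<le> 2 powr ?p * (?zx + ?z)"
          using norm_powr_add_le[of ?p "x - z" z] s by (simp add: norm_minus_commute)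
      qed auto
      finally show ?thesis by (simp add: algebra_simps)
    qed
    have c1: "?c \<ge> 1" using mult_mono[of 1 "2 powr ?p" 1 "2 powr ?p :: real"] ge_one_powr_ge_zero[of 2 ?p] s by simp
    have \<rho>n: "\<rho> * ?n \<le> (r / 2) * ?n"
    proof (rule mult_right_mono)
      show "\<rho> \<le> r / 2" using order_trans[OF mult_left_mono[OF c1 less_imp_le[OF r(3)]] \<rho>(1)] by simp
    qed simp
    have ewn: "?zx \<le> ew s \<sigma> (Z - ?P)" by (simp add: ew_def Z)
    have "\<rho> * (norm y powr ?p) \<le> \<rho> * (?c * (?xy + ?zx + ?z))" using ye r by (intro mult_left_mono) auto
    also have "\<dots> = (\<rho> * ?c) * ?xy + (\<rho> * ?c) * ?zx + \<rho> * ?c * ?z" by (simp add: algebra_simps)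
    also have "\<dots> \<le> (r / 2) * ?xy + (r0 / 2) * ew s \<sigma> (Z - ?P) + \<rho> * ?c * ?z"
      using \<rho> r2 ewn by (intro add_mono mult_mono order_refl) auto
    finally have ex: "- r * (?n + ?xy) + - r0 * ew s \<sigma> (Z - ?P) + \<rho> * (?n + norm y powr ?p) \<le>
        - (r / 2) * ?n + - (r / 2) * ?xy + - (r0 / 2) * ew s \<sigma> (Z - ?P) + \<rho> * ?c * ?z"
      using \<rho>n by (simp add: algebra_simps)
    have "norm (V w) * ((C1 * ?e1) * ?e2) \<le> (C * ?e3) * ((C1 * ?e1) * ?e2)"
      using V C1 by (intro mult_right_mono) (auto simp: vdecay_def w)
    also have "\<dots> = C * C1 * exp (- r * (?n + ?xy) + - r0 * ew s \<sigma> (Z - ?P) + \<rho> * (?n + norm y powr ?p))"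
      by (simp only: exp_add mult_ac)
    also have "\<dots> \<le> C * C1 * exp (- (r / 2) * ?n + - (r / 2) * ?xy + - (r0 / 2) * ew s \<sigma> (Z - ?P) + \<rho> * ?c * ?z)"
      using ex C C1 by (intro mult_left_mono) auto
    also have "\<dots> = C * C1 * ((exp (- (r / 2) * ?n) * exp (- (r / 2) * ?xy)) * exp (- (r0 / 2) * ew s \<sigma> (Z - ?P)) * exp (\<rho> * ?c * ?z))"
      by (simp only: exp_add)
    also have "\<dots> \<le> C * C1 * (((B1 / wt \<eta>) * (B2 / wt (x - y))) * (B3 / (wt (Z - ?P))\<^sup>2) * exp (\<rho> * ?c * ?z))"
    proof -
      have le: "B / (wt u)\<^sup>2 \<le> B / wt u" if "B > 0" for B and u :: 'a
        using mult_left_mono[OF inverse_wt_sq_le[of u], of B] that by simp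
      show ?thesis
        using C C1 B1(1) B2(1) B3
        by (intro mult_left_mono mult_right_mono mult_mono order_trans[OF B1(2) le] order_trans[OF B2(2) le]) auto
    qed
    also have "\<dots> = ?K * exp (\<rho> * ?c * norm (fst Z) powr ?p) * uu (w - AZ Z)"
      unfolding w Z uu_AZ by (simp add: wt_Pair power_mult_distrib)
    finally show ?thesis by (rule dbound_mono[OF d]) (use h in auto)
  qed
  moreover have "?K \<ge> 0" using C C1 B1 B2 B3 by simp
  ultimately show ?thesis by blast
qed

text \<open>Integration over \<open>w\<close> replaces \<open>uu\<close> by a constant, as its
  shifted integral does not depend on \<open>Z\<close>; the remaining growth in \<open>Z\<close> is
  bounded on compact sets. The same kernel bound with a locally uniform majorant justifies
  differentiating under the integral.\<close>

lemma rec_gevrey: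
  fixes \<phi> :: "'a::euclidean_space \<times> 'a \<Rightarrow> complex" and V :: "('a \<times> 'a) \<times> ('a \<times> 'a) \<Rightarrow> complex"
  assumes s: "s > 0" "\<sigma> > 0" and h: "h > 0" and r: "r > 0" "r0 > 0" "\<rho> > 0" and C: "C \<ge> 0"
    and Vm: "V \<in> borel_measurable borel" and V: "vdecay s \<sigma> r C V" and \<phi>: "expdec s \<sigma> h r0 \<phi>"
    and \<rho>: "\<rho> * (2 powr (1 / s) * 2 powr (1 / s)) \<le> r / 2" "\<rho> * (2 powr (1 / s) * 2 powr (1 / s)) \<le> r0 / 2"
  shows "C_infinity (rec \<phi> V)"
    and "compact S \<Longrightarrow> gevrey_sup \<sigma> s (2 * max h (hh s \<sigma> \<rho>) * cc s \<sigma> TYPE('a)) S (rec \<phi> V) < \<infinity>"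
proof -
  let ?c = "2 powr (1 / s) * 2 powr (1 / s) :: real" and ?H = "2 * max h (hh s \<sigma> \<rho>)"
  let ?e = "\<lambda>Z :: 'a \<times> 'a. exp (\<rho> * ?c * norm (fst Z) powr (1 / s))"
  let ?I = "integral\<^sup>L lborel (uu :: ('a \<times> 'a) \<times> ('a \<times> 'a) \<Rightarrow> real)"
  have sm: "C_infinity \<phi>" using \<phi> by (simp add: expdec_def)
  have H: "?H > 0" using h by simp
  have I: "?I \<ge> 0" by (intro integral_nonneg_AE AE_I2 uu_nonneg)
  obtain K where K: "K \<ge> 0" "\<And>Z w. dbound s \<sigma> ?H (K * ?e Z * uu (w - AZ Z)) (\<lambda>Z. V w * sker \<phi> w Z) Z"
    using rec_dbound_kernel[OF s h r C V \<phi> \<rho>] by blast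
  have e: "?e Z \<le> exp (\<rho> * ?c * R powr (1 / s))" if "norm Z \<le> R" for Z R
    using that norm_fst_le[of "fst Z" "snd Z"] s r order_trans[of "norm (fst Z)" "norm Z" R]
    by (auto intro!: mult_left_mono powr_mono2)
  note * = sker_dd_measurable[OF sm Vm]
  have dom: "\<exists>L. \<forall>Z\<in>ball Z0 1. \<forall>w. norm (dd ds (\<lambda>Z. V w * sker \<phi> w Z) Z) \<le> L / wt w"
    if ds: "set ds \<subseteq> Basis" for ds :: "('a \<times> 'a) list" and Z0
  proof -
    obtain L where L: "L \<ge> 0" "\<And>Z w. Z \<in> ball Z0 1 \<Longrightarrow> uu (w - AZ Z) \<le> L * (1 / wt w)" using uu_locally_dominated by blast
    let ?E = "exp (\<rho> * ?c * (norm Z0 + 1) powr (1 / s))"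
    have "norm (dd ds (\<lambda>Z. V w * sker \<phi> w Z) Z) \<le> (K * ?E * L * ?H ^ length ds * Wt s \<sigma> ds) / wt w"
      if Z: "Z \<in> ball Z0 1" for Z w
    proof -
      have "norm Z \<le> norm Z0 + 1" using Z norm_triangle_ineq2[of Z Z0] by (simp add: dist_norm norm_minus_commute)
      then have "K * ?e Z * uu (w - AZ Z) \<le> K * ?E * (L * (1 / wt w))"
        using K(1) L(2)[OF Z] by (intro mult_mono e uu_nonneg mult_nonneg_nonneg) auto
      then have "(K * ?e Z * uu (w - AZ Z)) * ?H ^ length ds * Wt s \<sigma> ds \<le> (K * ?E * (L * (1 / wt w))) * ?H ^ length ds * Wt s \<sigma> ds"
        using H by (intro mult_right_mono) auto
      then show ?thesis using dboundD[OF K(2) ds, of w Z] by simp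
    qed
    then show ?thesis by blast
  qed
  note sk = C_infinity_cmult[OF sker_C_infinity(3)[OF sm]]
  show smr: "C_infinity (rec \<phi> V)"
    unfolding rec_def[abs_def] by (rule C_infinity_integral(1)[OF sk * dom])
  have dd_rec: "dd ds (rec \<phi> V) = (\<lambda>Z. LINT w|lborel. dd ds (\<lambda>Z. V w * sker \<phi> w Z) Z)" if "set ds \<subseteq> Basis" for ds
    unfolding rec_def[abs_def] by (rule C_infinity_integral(2)[OF sk * dom that])
  have rb: "dbound s \<sigma> ?H (K * ?e Z * ?I) (rec \<phi> V) Z" for Z
    unfolding dbound_def
  proof (intro allI impI)
    fix ds :: "('a \<times> 'a) list" assume ds: "set ds \<subseteq> Basis"
    let ?k = "K * ?e Z * ?H ^ length ds * Wt s \<sigma> ds"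
    have "norm (dd ds (rec \<phi> V) Z) \<le> (LINT w|lborel. ?k * uu (w - AZ Z))"
      unfolding dd_rec[OF ds]
    proof (rule Bochner_Integration.integral_norm_bound_integral)
      obtain L where "\<And>w. norm (dd ds (\<lambda>Z. V w * sker \<phi> w Z) Z) \<le> L / wt w"
        using dom[OF ds, of Z] centre_in_ball[of Z 1] zero_less_one by blast
      from integrable_wt_bound[OF * this] show "integrable lborel (\<lambda>w. dd ds (\<lambda>Z. V w * sker \<phi> w Z) Z)" .
      show "integrable lborel (\<lambda>w. ?k * uu (w - AZ Z))" by (intro integrable_mult_right uu_shift_integral(1))
      show "norm (dd ds (\<lambda>Z. V w * sker \<phi> w Z) Z) \<le> ?k * uu (w - AZ Z)" for w
        using dboundD[OF K(2) ds, of w Z] by (simp add: mult_ac)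
    qed
    also have "\<dots> = ?k * ?I"
      by (simp only: integral_mult_right_zero uu_shift_integral(2))
    also have "\<dots> = K * ?e Z * ?I * ?H ^ length ds * Wt s \<sigma> ds" by (simp only: mult_ac)
    finally show "norm (dd ds (rec \<phi> V) Z) \<le> K * ?e Z * ?I * ?H ^ length ds * Wt s \<sigma> ds" .
  qed
  show "gevrey_sup \<sigma> s (?H * cc s \<sigma> TYPE('a)) S (rec \<phi> V) < \<infinity>" if S: "compact S"
  proof -
    obtain R where R: "\<And>Z. Z \<in> S \<Longrightarrow> norm Z \<le> R" using compact_imp_bounded[OF S] bounded_iff by blast
    let ?A = "K * exp (\<rho> * ?c * R powr (1 / s)) * ?I"
    have "dbound s \<sigma> ?H ?A (rec \<phi> V) Z" if "Z \<in> S" for Z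
      by (rule dbound_mono[OF rb mult_right_mono[OF mult_left_mono[OF e[OF R[OF that]] K(1)] I] less_imp_le[OF H] order_refl])
    from gevrey_sup_finite[OF s H this] show ?thesis using K I by simp
  qed
qed

subsection \<open>Continuous functions and null sets\<close>

lemma continuous_AE_le:
  fixes f g :: "'v::euclidean_space \<Rightarrow> real"
  assumes "continuous_on UNIV f" "continuous_on UNIV g" "AE x in lborel. f x \<le> g x"
  shows "f x \<le> g x"
proof (rule ccontr)
  assume n: "\<not> f x \<le> g x"
  let ?S = "{x. g x < f x}"
  have o: "open ?S" by (rule open_Collect_less[OF assms(2,1)])
  then have "{x \<in> space lborel. \<not> f x \<le> g x} \<in> sets lborel" by (simp add: not_le)
  from AE_iff_null[OF this] assms(3) have "?S \<in> null_sets lborel" by (simp add: not_le)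
  then have "negligible ?S" using negligible_iff_null_sets null_sets_completionI by blast
  moreover have "x \<in> ?S" using n by simp
  then have "?S \<noteq> {}" by blast
  from open_not_negligible[OF o this] have "\<not> negligible ?S" .
  ultimately show False by contradiction
qed

lemma continuous_AE_zero:
  fixes f :: "'v::euclidean_space \<Rightarrow> complex"
  assumes "continuous_on UNIV f" "AE x in lborel. f x = 0"
  shows "f x = 0"
proof -
  have "norm (f x) \<le> 0"
    by (rule continuous_AE_le[of "\<lambda>x. norm (f x)" "\<lambda>x. 0"]) (use assms in \<open>auto intro!: continuous_intros\<close>)
  then show ?thesis by simp
qed

subsection \<open>The transform of a distribution\<close>

lemma STFT_qop:
  fixes \<phi> :: "(real ^ 'n::finite) \<times> (real ^ 'n) \<Rightarrow> complex"
  shows "STFT \<phi> F \<Psi> = of_real (1 / (2 * pi) ^ CARD('n)) * F (qop \<phi> \<Psi>)"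
proof -
  have "(\<lambda>(z, \<zeta>). LINT ((x, y), (\<xi>, \<eta>))|lborel. cnj (\<phi> (z - x, \<zeta> - \<xi>)) * exp (- \<i> * of_real (z \<bullet> \<eta> + \<zeta> \<bullet> y)) * \<Psi> ((x, y), (\<xi>, \<eta>))) = qop \<phi> \<Psi>"
  proof (rule ext, clarify)
    fix z \<zeta> :: "real ^ 'n"
    show "(LINT ((x, y), (\<xi>, \<eta>))|lborel. cnj (\<phi> (z - x, \<zeta> - \<xi>)) * exp (- \<i> * of_real (z \<bullet> \<eta> + \<zeta> \<bullet> y)) * \<Psi> ((x, y), (\<xi>, \<eta>))) = qop \<phi> \<Psi> (z, \<zeta>)"
      unfolding qop_def
      by (intro Bochner_Integration.integral_cong refl)
         (simp add: qker_def PP_def TT_def inner_prod_def algebra_simps case_prod_unfold)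
  qed
  then show ?thesis by (simp only: STFT_def)
qed

lemma GS_dual_cmult:
  assumes "F \<in> GS_dual s \<sigma>" "\<Phi> \<in> GS s \<sigma>"
  shows "F (\<lambda>X. c * \<Phi> X) = c * F \<Phi>"
proof -
  have "F (\<lambda>X. c * \<Phi> X + 0 * \<Phi> X) = c * F \<Phi> + 0 * F \<Phi>"
    using assms unfolding GS_dual_def by blast
  then show ?thesis by simp
qed

lemma decay_rate_ge:
  fixes s D R H :: real
  assumes s: "s > 0" and D: "D > 0" and R: "R > 0" and H: "H > 0" and le: "D * (2 * H) \<le> (s / (2 * R)) powr s"
  shows "R \<le> s / 2 * (D * (2 * H)) powr (- 1 / s)"
proof -
  have "(D * (2 * H)) powr (1 / s) \<le> ((s / (2 * R)) powr s) powr (1 / s)"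
    using assms by (intro powr_mono2) auto
  also have "\<dots> = s / (2 * R)" using s R by (simp add: powr_powr)
  finally have *: "(D * (2 * H)) powr (1 / s) \<le> s / (2 * R)" .
  have p: "(D * (2 * H)) powr (1 / s) > 0" using D H by simp
  have "R * (D * (2 * H)) powr (1 / s) \<le> s / 2" using * R by (simp add: field_simps)
  then have "R \<le> (s / 2) / (D * (2 * H)) powr (1 / s)" using p by (simp add: le_divide_eq)
  then show ?thesis by (simp add: powr_minus_divide)
qed

text \<open>The smaller of the two rates that \<open>exp_decay_of_moments2\<close> yields when the
  moment constants are \<open>H\<close>.\<close>

definition decay_rate :: "real \<Rightarrow> real \<Rightarrow> real \<Rightarrow> real" where
  "decay_rate s \<sigma> H = min (\<sigma> / 2 * H powr (- 1 / \<sigma>)) (s / 2 * H powr (- 1 / s))"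

text \<open>The estimate with \<open>norm y\<close> holds while \<open>x\<close> stays in a ball
  containing the cell. For general \<open>x\<close> the modulus is invariant under shifting
  \<open>x\<close> and \<open>y\<close> by the same lattice vector; \<open>norm (y - k)\<close> is
  then traded for \<open>norm (x - y)\<close>.\<close>

lemma stf_vdecay:
  fixes E :: "'n::finite \<Rightarrow> real ^ 'n"
  assumes s: "s > 0" "\<sigma> > 0" and E: "is_basis E" and f: "C_infinity f" and qp: "quasi_periodic E f"
    and h: "h > 0" and r: "r > 0" "r1 > 0"
    and bd: "\<And>X. X \<in> cell E \<times> cell (dual_basis E) \<Longrightarrow> dbound s \<sigma> h C f X"
    and \<phi>: "expdec s \<sigma> (2 * max h (hh s \<sigma> r)) r1 \<phi>" and rr: "r * 2 powr (1 / s) * 2 powr (1 / s) \<le> r1 / 2"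
    and \<rho>: "0 < \<rho>" "\<rho> \<le> decay_rate s \<sigma> (real CARD('n) * (2 * (2 * max h (hh s \<sigma> r))))"
  shows "\<exists>C>0. vdecay s \<sigma> (\<rho> / 2 powr (1 / s)) C (stf \<phi> f)"
proof -
  let ?p = "1 / s" and ?H = "2 * max h (hh s \<sigma> r)"
  have H: "?H > 0" using h by simp
  obtain R where R: "R > 0" "\<And>x. x \<in> cell E \<Longrightarrow> norm x \<le> R" using bounded_cell[of E] by blast
  obtain A where A: "A \<ge> 0" "\<And>X. dbound s \<sigma> ?H (A * exp (r * 2 powr ?p * norm (fst X) powr ?p)) f X"
    using quasi_periodic_dbound(1)[OF s E f qp h r(1) bd] by blast
  obtain C1 where C1: "C1 > 0" "\<And>x \<xi> \<eta> y. norm x \<le> R \<Longrightarrow> norm (stf \<phi> f ((x, y), (\<xi>, \<eta>))) \<le>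
    C1 * (exp (- (\<sigma> / 2 * (real DIM(real ^ 'n) * (2 * ?H)) powr (- 1 / \<sigma>)) * norm \<eta> powr (1 / \<sigma>)) *
         exp (- (s / 2 * (real DIM(real ^ 'n) * (2 * ?H)) powr (- 1 / s)) * norm y powr ?p))"
    using stf_bound_near[OF s f H r A(1,2) \<phi> rr less_imp_le[OF R(1)]] by blast
  have le: "\<rho> \<le> \<sigma> / 2 * (real DIM(real ^ 'n) * (2 * ?H)) powr (- 1 / \<sigma>)"
    "\<rho> \<le> s / 2 * (real DIM(real ^ 'n) * (2 * ?H)) powr (- 1 / s)"
    using \<rho>(2) by (auto simp: decay_rate_def)
  have near: "norm (stf \<phi> f ((x, y), (\<xi>, \<eta>))) \<le> C1 * exp (- \<rho> * (norm \<eta> powr (1 / \<sigma>) + norm y powr ?p))"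
    if "norm x \<le> R" for x y \<xi> \<eta>
  proof -
    have "norm (stf \<phi> f ((x, y), (\<xi>, \<eta>))) \<le> C1 * (exp (- \<rho> * norm \<eta> powr (1 / \<sigma>)) * exp (- \<rho> * norm y powr ?p))"
      using C1(1) by (intro order_trans[OF C1(2)[OF that]] mult_left_mono mult_mono exp_minus_mono le) auto
    then show ?thesis by (simp add: exp_add[symmetric] algebra_simps)
  qed
  have fm: "f \<in> borel_measurable borel" by (rule C_infinity_borel[OF f])
  have \<phi>m: "\<phi> \<in> borel_measurable borel" using \<phi> by (intro C_infinity_borel) (simp add: expdec_def)
  have "norm (stf \<phi> f ((x, y), (\<xi>, \<eta>))) \<le> (C1 * exp (\<rho> * R powr ?p)) *
      exp (- (\<rho> / 2 powr ?p) * (norm \<eta> powr (1 / \<sigma>) + norm (x - y) powr ?p))" for x y \<xi> \<eta>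
  proof -
    obtain x0 k where xk: "x0 \<in> cell E" "k \<in> lattice_of E" "x = x0 + k"
      using cell_lattice_decomposition[OF is_basis_coords[OF E], of x] by blast
    have "norm (stf \<phi> f ((x, y), (\<xi>, \<eta>))) = norm (stf \<phi> f ((x0 + k, (y - k) + k), (\<xi>, \<eta>)))" by (simp add: xk(3))
    also have "\<dots> = norm (stf \<phi> f ((x0, y - k), (\<xi>, \<eta>)))" by (rule stf_lattice[OF qp xk(2) fm \<phi>m])
    also have "\<dots> \<le> C1 * exp (- \<rho> * (norm \<eta> powr (1 / \<sigma>) + norm (y - k) powr ?p))"
      by (rule near[OF R(2)[OF xk(1)]])
    also have "\<dots> \<le> C1 * (exp (\<rho> * R powr ?p) * exp (- (\<rho> / 2 powr ?p) * (norm \<eta> powr (1 / \<sigma>) + norm (x - y) powr ?p)))"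
    proof (intro mult_left_mono exp_lattice_shift)
      show "norm (x - k) \<le> R" using R(2)[OF xk(1)] xk(3) by simp
    qed (use s R \<rho> C1 in auto)
    finally show ?thesis by (simp only: mult.assoc)
  qed
  then show ?thesis unfolding vdecay_def using C1(1) by (intro exI[of _ "C1 * exp (\<rho> * R powr ?p)"]) auto
qed

lemma vdecay_cmult: "vdecay s \<sigma> r C V \<Longrightarrow> vdecay s \<sigma> r (norm c * C) (\<lambda>w. c * V w)"
  by (simp add: vdecay_def norm_mult mult.assoc mult_left_mono)

text \<open>On the bounded cell \<open>norm y\<close> and \<open>norm (x - y)\<close> are
  comparable; this is \<open>exp_lattice_shift\<close> with \<open>0\<close> as the point and
  \<open>x\<close> in the place of the lattice vector.\<close>

lemma vdecay_cell:
  fixes E :: "'n::finite \<Rightarrow> real ^ 'n"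
  assumes s: "s > 0" and r: "r > 0" and C: "C > 0" and V: "vdecay s \<sigma> r C V"
  shows "\<exists>C>0. \<forall>x\<in>cell E. \<forall>\<xi> \<eta> y. norm (V ((x, y), (\<xi>, \<eta>))) \<le>
    C * exp (- (r / 2 powr (1 / s)) * (norm \<eta> powr (1 / \<sigma>) + norm y powr (1 / s)))"
proof -
  obtain R where R: "R > 0" "\<And>x. x \<in> cell E \<Longrightarrow> norm x \<le> R" using bounded_cell[of E] by blast
  have "norm (V ((x, y), (\<xi>, \<eta>))) \<le> (C * exp (r * R powr (1 / s))) *
    exp (- (r / 2 powr (1 / s)) * (norm \<eta> powr (1 / \<sigma>) + norm y powr (1 / s)))" if x: "x \<in> cell E" for x y \<xi> \<eta>
  proof -
    have "norm (V ((x, y), (\<xi>, \<eta>))) \<le> C * exp (- r * (norm \<eta> powr (1 / \<sigma>) + norm (y - x) powr (1 / s)))"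
      using V by (simp add: vdecay_def norm_minus_commute)
    also have "\<dots> \<le> C * (exp (r * R powr (1 / s)) * exp (- (r / 2 powr (1 / s)) * (norm \<eta> powr (1 / \<sigma>) + norm (0 - y) powr (1 / s))))"
      by (intro mult_left_mono exp_lattice_shift) (use s r C R R(2)[OF x] in auto)
    finally show ?thesis by (simp add: mult.assoc)
  qed
  then show ?thesis using C by (intro exI[of _ "C * exp (r * R powr (1 / s))"]) auto
qed

section \<open>Windows with given decay against test functions of other exponents\<close>

context
  fixes \<phi> :: "(real ^ 'n::finite) \<times> (real ^ 'n) \<Rightarrow> complex" and s \<sigma> h0 r0 :: real
  assumes s: "s > 0" "\<sigma> > 0" and r0: "r0 > 0" and \<phi>: "expdec s \<sigma> h0 r0 \<phi>"
begin

lemma window_smooth: "C_infinity \<phi>"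
  using \<phi> by (simp add: expdec_def)

lemma window_bound: "\<exists>M\<ge>0. (\<forall>X. norm (\<phi> X) \<le> M) \<and> (\<forall>b\<in>Basis. \<forall>X. norm (pderivative b \<phi> X) \<le> M)"
  by (rule expdec_bounds(2)[OF s r0 \<phi>])

lemma window_wt: "\<exists>B. \<forall>X. norm (\<phi> X) \<le> B / (wt X)\<^sup>2 \<and> norm (\<phi> X) \<le> B / wt X"
proof -
  obtain B where B: "B > 0" "\<And>X. norm (\<phi> X) \<le> B / (wt X)\<^sup>2" using expdec_bounds(1)[OF s r0 \<phi>] by blast
  have "norm (\<phi> X) \<le> B / wt X" for X
    using order_trans[OF B(2), of X "B / wt X"] mult_left_mono[OF inverse_wt_sq_le[of X], of B] B(1) by simp
  then show ?thesis using B(2) by blast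
qed

context
  fixes s\<^sub>0 \<sigma>\<^sub>0 :: real
  assumes s0: "s\<^sub>0 > 0" "\<sigma>\<^sub>0 > 0" "s\<^sub>0 + \<sigma>\<^sub>0 \<ge> 1"
begin

lemma qop_in_GS: "\<Psi> \<in> GS s\<^sub>0 \<sigma>\<^sub>0 \<Longrightarrow> qop \<phi> \<Psi> \<in> GS s\<^sub>0 \<sigma>\<^sub>0"
  using window_bound qop_GS[OF window_smooth _ _ s0] by blast

text \<open>As \<open>qop \<phi> \<Psi>\<close> is again a test function, the pairing of
  \<open>F\<close> with it is an integral against \<open>f\<close>, and \<open>stf_test\<close>
  rewrites that as an integral against \<open>\<Psi>\<close>.\<close>

lemma stf_is_function:
  assumes F: "is_function s\<^sub>0 \<sigma>\<^sub>0 F f" and fb: "\<And>X. norm (f X) \<le> Mf"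
  shows "is_function s\<^sub>0 \<sigma>\<^sub>0 (STFT \<phi> F) (\<lambda>w. of_real (1 / (2 * pi) ^ CARD('n)) * stf \<phi> f w)"
    (is "is_function _ _ _ (\<lambda>w. ?c * _ w)")
  unfolding is_function_def
proof (intro conjI ballI)
  obtain B where B: "\<And>X. norm (\<phi> X) \<le> B / wt X" using window_wt by blast
  have fm: "f \<in> borel_measurable borel" using F by (simp add: is_function_def)
  have "stf \<phi> f \<in> borel_measurable borel"
    by (rule borel_measurable_continuous_onI[OF stf_continuous[OF window_smooth B fm fb]])
  then show "(\<lambda>w. ?c * stf \<phi> f w) \<in> borel_measurable borel" by simp
  fix \<Psi> :: "((real ^ 'n) \<times> (real ^ 'n)) \<times> ((real ^ 'n) \<times> (real ^ 'n)) \<Rightarrow> complex" assume \<Psi>: "\<Psi> \<in> GS s\<^sub>0 \<sigma>\<^sub>0"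
  note t = stf_test[OF window_smooth B fm fb GS_subset_sch[OF s0 \<Psi>]]
  have "integrable lborel (\<lambda>w. ?c * (stf \<phi> f w * \<Psi> w))" by (rule integrable_mult_right[OF t(1)])
  then show "integrable lborel (\<lambda>w. ?c * stf \<phi> f w * \<Psi> w)" by (simp only: mult.assoc)
  have "F (qop \<phi> \<Psi>) = (LINT Z|lborel. f Z * qop \<phi> \<Psi> Z)"
    using F qop_in_GS[OF \<Psi>] by (simp add: is_function_def)
  also have "\<dots> = (LINT w|lborel. stf \<phi> f w * \<Psi> w)" by (rule t(2)[symmetric])
  finally show "STFT \<phi> F \<Psi> = (LINT w|lborel. ?c * stf \<phi> f w * \<Psi> w)"
    unfolding STFT_qop by (simp only: mult.assoc integral_mult_right_zero)
qed

lemma exists_dual_window: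
  assumes \<phi>0: "\<phi> \<noteq> (\<lambda>_. 0)" and g: "(g :: (real ^ 'n) \<times> (real ^ 'n) \<Rightarrow> complex) \<in> GS s\<^sub>0 \<sigma>\<^sub>0" "g X0 \<noteq> 0"
  shows "\<exists>\<theta>\<in>GS s\<^sub>0 \<sigma>\<^sub>0. (LINT p|lborel. cnj (\<phi> p) * \<theta> p) \<noteq> 0"
proof (rule ccontr)
  assume n: "\<not> ?thesis"
  obtain M where M: "\<And>X. norm (\<phi> X) \<le> M" using window_bound by blast
  have c: "C_infinity (\<lambda>X. cnj (\<phi> X))" by (rule C_infinity_cnj[OF window_smooth])
  have "AE X in lborel. cnj (\<phi> X) = 0"
  proof (rule GS_separating[OF s0 g])
    show "(\<lambda>X. cnj (\<phi> X)) \<in> borel_measurable borel" by (rule C_infinity_borel[OF c])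
    fix \<Psi> :: "(real ^ 'n) \<times> (real ^ 'n) \<Rightarrow> complex" assume \<Psi>: "\<Psi> \<in> GS s\<^sub>0 \<sigma>\<^sub>0"
    have "integrable lborel (\<lambda>X. cnj (\<phi> X) * \<Psi> X)"
      by (rule integrable_bounded_mult_sch[OF GS_subset_sch[OF s0 \<Psi>] C_infinity_borel[OF c], of M]) (use M in simp)
    then show "integrable lborel (\<lambda>X. cnj (\<phi> X) * \<Psi> X) \<and> (LINT X|lborel. cnj (\<phi> X) * \<Psi> X) = 0"
      using n \<Psi> by blast
  qed
  from continuous_AE_zero[OF C_infinity_continuous_on[OF c] this] have "\<phi> X = 0" for X by simp
  with \<phi>0 show False by auto
qed

text \<open>Uniqueness of the transform as a function needs a non-zero test function in the doubled
  variables. \<open>sop \<theta> g\<close> is one, since \<open>Q\<close> maps it to a non-zero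
  multiple of \<open>g\<close>.\<close>

lemma GS_double_nontrivial:
  assumes \<phi>0: "\<phi> \<noteq> (\<lambda>_. 0)" and g: "(g :: (real ^ 'n) \<times> (real ^ 'n) \<Rightarrow> complex) \<in> GS s\<^sub>0 \<sigma>\<^sub>0" "g X0 \<noteq> 0"
  shows "\<exists>G\<in>GS s\<^sub>0 \<sigma>\<^sub>0. \<exists>w :: ((real ^ 'n) \<times> (real ^ 'n)) \<times> ((real ^ 'n) \<times> (real ^ 'n)). G w \<noteq> 0"
proof -
  obtain \<theta> where \<theta>: "\<theta> \<in> GS s\<^sub>0 \<sigma>\<^sub>0" "(LINT p|lborel. cnj (\<phi> p) * \<theta> p) \<noteq> 0"
    using exists_dual_window[OF assms] by blast
  obtain M where M: "\<And>X. norm (\<phi> X) \<le> M" "\<And>b X. b \<in> Basis \<Longrightarrow> norm (pderivative b \<phi> X) \<le> M" using window_bound by blast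
  have "qop \<phi> (sop \<theta> g) X0 \<noteq> 0"
    using qop_sop[OF s0 \<theta>(1) g(1) window_smooth M, of X0] \<theta>(2) g(2) by simp
  then have "sop \<theta> g \<noteq> (\<lambda>_. 0)" by (auto simp: qop_def)
  then show ?thesis using sop_GS[OF s0 \<theta>(1) g(1)] by (metis ext)
qed


end

end

subsection \<open>Recovering the distribution\<close>

lemma is_function_unique:
  fixes g V W :: "'a::euclidean_space \<times> 'a \<Rightarrow> complex"
  assumes s: "s > 0" "\<sigma> > 0" "s + \<sigma> \<ge> 1" and g: "g \<in> GS s \<sigma>" "g X0 \<noteq> 0"
    and V: "is_function s \<sigma> T V" and W: "is_function s \<sigma> T W"
  shows "AE X in lborel. V X = W X"
proof -
  have "AE X in lborel. V X - W X = 0"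
  proof (rule GS_separating[OF s g])
    show "(\<lambda>X. V X - W X) \<in> borel_measurable borel"
      by (intro borel_measurable_diff) (use V W in \<open>auto simp: is_function_def\<close>)
    fix \<Psi> :: "'a \<times> 'a \<Rightarrow> complex" assume "\<Psi> \<in> GS s \<sigma>"
    then show "integrable lborel (\<lambda>X. (V X - W X) * \<Psi> X) \<and> (LINT X|lborel. (V X - W X) * \<Psi> X) = 0"
      using V W by (simp add: is_function_def left_diff_distrib)
  qed
  then show ?thesis by simp
qed

lemma is_function_cong_AE:
  assumes V: "is_function s \<sigma> T V" and W: "W \<in> borel_measurable borel" and ae: "AE X in lborel. W X = V X"
  shows "is_function s \<sigma> T W"
  unfolding is_function_def
proof (intro conjI ballI W)
  fix \<Psi> :: "'a \<times> 'a \<Rightarrow> complex" assume \<Psi>: "\<Psi> \<in> GS s \<sigma>"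
  have i: "integrable lborel (\<lambda>X. V X * \<Psi> X)" and T: "T \<Psi> = (LINT X|lborel. V X * \<Psi> X)"
    using V \<Psi> by (auto simp: is_function_def)
  have \<Psi>m: "\<Psi> \<in> borel_measurable borel" using \<Psi> by (intro C_infinity_borel) (simp add: GS_def)
  have ae': "AE X in lborel. V X * \<Psi> X = W X * \<Psi> X" using ae by eventually_elim simp
  have m: "(\<lambda>X. V X * \<Psi> X) \<in> borel_measurable lborel" "(\<lambda>X. W X * \<Psi> X) \<in> borel_measurable lborel"
    using borel_measurable_integrable[OF i] borel_measurable_times[OF W \<Psi>m] by simp_all
  show "integrable lborel (\<lambda>X. W X * \<Psi> X)" using integrable_cong_AE[OF m ae'] i by blast
  show "T \<Psi> = (LINT X|lborel. W X * \<Psi> X)" unfolding T by (rule integral_cong_AE[OF m ae'])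
qed

text \<open>The transposed identities hold almost everywhere by separation, and everywhere by
  continuity of \<open>f\<close>.\<close>

lemma quasi_periodic_of_dist:
  fixes E :: "'n::finite \<Rightarrow> real ^ 'n" and f g :: "(real ^ 'n) \<times> (real ^ 'n) \<Rightarrow> complex"
  assumes s: "s > 0" "\<sigma> > 0" "s + \<sigma> \<ge> 1" and g: "g \<in> GS s \<sigma>" "g X0 \<noteq> 0"
    and F: "quasi_periodic_dist s \<sigma> E F" and f: "is_function s \<sigma> F f" and c: "continuous_on UNIV f"
  shows "quasi_periodic E f"
proof -
  have fm: "f \<in> borel_measurable borel" using f by (simp add: is_function_def)
  \<comment> \<open>One statement for both kinds of period: \<open>A = (k, 0)\<close>,
    \<open>B = (0, k)\<close> for \<open>E\<close>, and \<open>A = (0, k)\<close>,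
    \<open>B = 0\<close> for the dual basis.\<close>
  have key: "f (X + A) = exp (\<i> * of_real (B \<bullet> X)) * f X"
    if eq: "\<And>\<Psi>. \<Psi> \<in> GS s \<sigma> \<Longrightarrow> F (\<lambda>X. \<Psi> (X - A)) = F (\<lambda>X. exp (\<i> * of_real (B \<bullet> X)) * \<Psi> X)" for A B X
  proof -
    let ?e = "\<lambda>X. exp (\<i> * complex_of_real (B \<bullet> X))"
    have fA: "continuous_on UNIV (\<lambda>X. f (X + A))"
      by (rule continuous_on_compose2[OF c]) (auto intro!: continuous_intros)
    have "continuous_on UNIV (\<lambda>X. f (X + A) - ?e X * f X)"
      by (intro continuous_intros fA c)
    moreover have "AE X in lborel. f (X + A) - ?e X * f X = 0"
    proof (rule GS_separating[OF s g])
      show "(\<lambda>X. f (X + A) - ?e X * f X) \<in> borel_measurable borel"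
        by (intro borel_measurable_continuous_onI continuous_intros fA c)
      fix \<Psi> :: "(real ^ 'n) \<times> (real ^ 'n) \<Rightarrow> complex" assume \<Psi>: "\<Psi> \<in> GS s \<sigma>"
      have G: "(\<lambda>X. \<Psi> (X - A)) \<in> GS s \<sigma>" "(\<lambda>X. ?e X * \<Psi> X) \<in> GS s \<sigma>"
        using GS_translate_modulate[OF s \<Psi>, of 0 A] GS_translate_modulate[OF s \<Psi>, of B 0] by simp_all
      have i1: "integrable lborel (\<lambda>X. f X * \<Psi> (X - A))" and F1: "F (\<lambda>X. \<Psi> (X - A)) = (LINT X|lborel. f X * \<Psi> (X - A))"
        using f G(1) by (auto simp: is_function_def)
      have i2: "integrable lborel (\<lambda>X. f X * (?e X * \<Psi> X))" and F2: "F (\<lambda>X. ?e X * \<Psi> X) = (LINT X|lborel. f X * (?e X * \<Psi> X))"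
        using f G(2) by (auto simp: is_function_def)
      have i1': "integrable lborel (\<lambda>X. f (X + A) * \<Psi> X)" using integrable_lborel_shift(2)[OF i1, of A] by simp
      have "(LINT X|lborel. f (X + A) * \<Psi> X) = (LINT X|lborel. f X * \<Psi> (X - A))"
        using integral_lborel_shift(2)[of "\<lambda>X. f X * \<Psi> (X - A)" A] borel_measurable_integrable[OF i1] by simp
      also have "\<dots> = (LINT X|lborel. f X * (?e X * \<Psi> X))" using eq[OF \<Psi>] F1 F2 by simp
      finally have e: "(LINT X|lborel. f (X + A) * \<Psi> X) - (LINT X|lborel. f X * (?e X * \<Psi> X)) = 0" by simp
      have d: "(f (X + A) - ?e X * f X) * \<Psi> X = f (X + A) * \<Psi> X - f X * (?e X * \<Psi> X)" for X
        by (simp add: algebra_simps)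
      show "integrable lborel (\<lambda>X. (f (X + A) - ?e X * f X) * \<Psi> X) \<and> (LINT X|lborel. (f (X + A) - ?e X * f X) * \<Psi> X) = 0"
        unfolding d using Bochner_Integration.integrable_diff[OF i1' i2] Bochner_Integration.integral_diff[OF i1' i2] e by simp
    qed
    ultimately have "f (X + A) - ?e X * f X = 0" by (rule continuous_AE_zero)
    then show ?thesis by simp
  qed
  have sp: "(\<lambda>(x, \<xi>). \<Psi> (x - k, \<xi>)) = (\<lambda>X. \<Psi> (X - (k, 0)))" "(\<lambda>(x, \<xi>). \<Psi> (x, \<xi> - k)) = (\<lambda>X. \<Psi> (X - (0, k)))"
    "(\<lambda>(x, \<xi>). exp (\<i> * of_real (k \<bullet> \<xi>)) * \<Psi> (x, \<xi>)) = (\<lambda>X. exp (\<i> * of_real ((0, k) \<bullet> X)) * \<Psi> X)"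
    "\<Psi> = (\<lambda>X. exp (\<i> * of_real ((0, 0) \<bullet> X)) * \<Psi> X)"
    for \<Psi> :: "(real ^ 'n) \<times> (real ^ 'n) \<Rightarrow> complex" and k
    by (auto simp: fun_eq_iff inner_prod_def)
  show ?thesis
    unfolding quasi_periodic_def
  proof (intro conjI ballI allI)
    fix k x \<xi> assume k: "k \<in> lattice_of E"
    have "f ((x, \<xi>) + (k, 0)) = exp (\<i> * of_real ((0, k) \<bullet> (x, \<xi>))) * f (x, \<xi>)"
    proof (rule key)
      fix \<Psi> :: "(real ^ 'n) \<times> (real ^ 'n) \<Rightarrow> complex" assume "\<Psi> \<in> GS s \<sigma>"
      then have "F (\<lambda>(x, \<xi>). \<Psi> (x - k, \<xi>)) = F (\<lambda>(x, \<xi>). exp (\<i> * of_real (k \<bullet> \<xi>)) * \<Psi> (x, \<xi>))"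
        using F k by (simp add: quasi_periodic_dist_def)
      then show "F (\<lambda>X. \<Psi> (X - (k, 0))) = F (\<lambda>X. exp (\<i> * of_real ((0, k) \<bullet> X)) * \<Psi> X)"
        by (simp only: sp(1,3))
    qed
    then show "f (x + k, \<xi>) = exp (\<i> * of_real (k \<bullet> \<xi>)) * f (x, \<xi>)" by simp
  next
    fix k x \<xi> assume k: "k \<in> lattice_of (dual_basis E)"
    have "f ((x, \<xi>) + (0, k)) = exp (\<i> * of_real ((0, 0) \<bullet> (x, \<xi>))) * f (x, \<xi>)"
    proof (rule key)
      fix \<Psi> :: "(real ^ 'n) \<times> (real ^ 'n) \<Rightarrow> complex" assume "\<Psi> \<in> GS s \<sigma>"
      then have "F (\<lambda>(x, \<xi>). \<Psi> (x, \<xi> - k)) = F \<Psi>"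
        using F k by (simp add: quasi_periodic_dist_def)
      then show "F (\<lambda>X. \<Psi> (X - (0, k))) = F (\<lambda>X. exp (\<i> * of_real ((0, 0) \<bullet> X)) * \<Psi> X)"
        by (simp only: sp(2) sp(4)[symmetric])
    qed
    then show "f (x, \<xi> + k) = f (x, \<xi>)" by (simp add: zero_prod_def[symmetric])
  qed
qed

section \<open>From a decaying transform back to a Gevrey function\<close>

context
  fixes \<phi> :: "(real ^ 'n::finite) \<times> (real ^ 'n) \<Rightarrow> complex" and s \<sigma> h0 r0 :: real
  assumes s: "s > 0" "\<sigma> > 0" and r0: "r0 > 0" and \<phi>: "expdec s \<sigma> h0 r0 \<phi>" and \<phi>0: "\<phi> \<noteq> (\<lambda>_. 0)"
begin

lemma window_integrable:
  "integrable lborel (\<lambda>p. \<phi> p * cnj (\<phi> p))" "(LINT p|lborel. \<phi> p * cnj (\<phi> p)) \<noteq> 0"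
proof -
  have sm: "C_infinity \<phi>" using \<phi> by (simp add: expdec_def)
  obtain B where B: "\<And>X. norm (\<phi> X) \<le> B / wt X" using window_wt[OF s r0 \<phi>] by blast
  obtain M where M: "M \<ge> 0" "\<And>X. norm (\<phi> X) \<le> M" using window_bound[OF s r0 \<phi>] by blast
  have c: "C_infinity (\<lambda>p. \<phi> p * cnj (\<phi> p))" by (intro C_infinity_mult C_infinity_cnj sm)
  show i: "integrable lborel (\<lambda>p. \<phi> p * cnj (\<phi> p))"
  proof (rule integrable_wt_bound[OF C_infinity_borel[OF c]])
    show "norm (\<phi> X * cnj (\<phi> X)) \<le> (M * B) / wt X" for X
      using mult_mono[OF M(2)[of X] B[of X] M(1)] by (simp add: norm_mult)
  qed
  show "(LINT p|lborel. \<phi> p * cnj (\<phi> p)) \<noteq> 0"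
  proof
    assume z: "(LINT p|lborel. \<phi> p * cnj (\<phi> p)) = 0"
    have e: "Re (\<phi> p * cnj (\<phi> p)) = (norm (\<phi> p))\<^sup>2" for p by (simp add: complex_mult_cnj cmod_power2)
    have "integrable lborel (\<lambda>p. (norm (\<phi> p))\<^sup>2)" using integrable_Re[OF i] by (simp only: e)
    moreover have "(LINT p|lborel. (norm (\<phi> p))\<^sup>2) = 0"
      using integral_Re[OF i] z by (simp only: e zero_complex.simps)
    ultimately have "AE p in lborel. (norm (\<phi> p))\<^sup>2 = 0"
      using integral_nonneg_eq_0_iff_AE[of lborel "\<lambda>p. (norm (\<phi> p))\<^sup>2"] by simp
    then have "AE p in lborel. \<phi> p = 0" by simp
    from continuous_AE_zero[OF C_infinity_continuous_on[OF sm] this] \<phi>0 show False by auto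
  qed
qed

lemma rec_stf:
  assumes c: "continuous_on UNIV f" and fb: "\<And>X. norm (f X) \<le> Mf"
    and r: "r > 0" and C: "C \<ge> 0" and dec: "vdecay s \<sigma> r C (stf \<phi> f)"
  shows "rec \<phi> (stf \<phi> f) Z = of_real ((2 * pi) ^ DIM((real ^ 'n) \<times> (real ^ 'n))) * (LINT p|lborel. \<phi> p * cnj (\<phi> p)) * f Z"
    (is "_ = ?Q * ?N * _")
proof -
  have sm: "C_infinity \<phi>" using \<phi> by (simp add: expdec_def)
  have fm: "f \<in> borel_measurable borel" by (rule borel_measurable_continuous_onI[OF c])
  obtain B where B: "\<And>X. norm (\<phi> X) \<le> B / (wt X)\<^sup>2" "\<And>X. norm (\<phi> X) \<le> B / wt X" using window_wt[OF s r0 \<phi>] by blast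
  obtain K where K: "K \<ge> 0" "\<And>x y \<xi> \<eta>. norm (stf \<phi> f ((x, y), (\<xi>, \<eta>))) \<le> K / (wt \<eta> * wt (x - y))"
    using vdecay_wt[OF s r C] dec by blast
  have sc: "continuous_on UNIV (stf \<phi> f)" by (rule stf_continuous[OF sm B(2) fm fb])
  have sfm: "stf \<phi> f \<in> borel_measurable borel" by (rule borel_measurable_continuous_onI[OF sc])
  have inv: "(LINT t|lborel. stf \<phi> f (PA p + TA t) * exp (\<i> * of_real (t \<bullet> Z))) = ?Q * (f Z * cnj (\<phi> (Z - p)))" for p
  proof -
    let ?g = "\<lambda>Z. f Z * cnj (\<phi> (Z - p))"
    have F: "FT ?g = (\<lambda>t. stf \<phi> f (PA p + TA t))"
      by (rule ext) (simp add: stf_FT[OF sm B(2) fm fb])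
    have cs: "C_infinity (\<lambda>Z. cnj (\<phi> (Z - p)))" by (intro C_infinity_cnj C_infinity_shift sm)
    have gc: "continuous_on UNIV ?g" by (intro continuous_intros c C_infinity_continuous_on cs)
    obtain M where M: "M \<ge> 0" "\<And>X. norm (\<phi> X) \<le> M" using window_bound[OF s r0 \<phi>] by blast
    have Mf: "Mf \<ge> 0" using order_trans[OF norm_ge_zero fb[of 0]] .
    have gi: "integrable lborel ?g"
    proof (rule Bochner_Integration.integrable_bound)
      show "integrable lborel (\<lambda>Z. of_real Mf * \<phi> (Z - p))"
        by (intro integrable_mult_right integrable_lborel_shift(1) integrable_wt_bound[OF C_infinity_borel[OF sm] B(2)])
      show "?g \<in> borel_measurable lborel" using borel_measurable_continuous_onI[OF gc] by simp
      show "AE Z in lborel. norm (?g Z) \<le> norm (of_real Mf * \<phi> (Z - p))"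
        using fb Mf by (intro AE_I2) (auto simp: norm_mult intro!: mult_right_mono)
    qed
    have gb: "norm (?g X) \<le> Mf * M" for X using fb M Mf by (simp add: norm_mult mult_mono)
    have Fi: "integrable lborel (FT ?g)"
      unfolding F
    proof (rule integrable_wt_bound)
      show "(\<lambda>t. stf \<phi> f (PA p + TA t)) \<in> borel_measurable borel"
        unfolding F[symmetric] using borel_measurable_integrable[OF gi] by (intro FT_borel_measurable) simp
      fix t :: "(real ^ 'n) \<times> (real ^ 'n)"
      have "norm (stf \<phi> f (PA p + TA t)) \<le> K / (wt (fst t) * wt (fst p - snd t))"
        using K(2)[of "fst p" "snd t" "snd p" "fst t"] by (simp add: PA_def TA_def)
      also have "\<dots> = K * (1 / wt (fst t)) * (1 / wt (fst p - snd t))" by simp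
      \<comment> \<open>At a fixed position, Peetre's inequality converts decay in
        \<open>x - y\<close> into decay in \<open>y\<close>, so the Fourier transform is integrable
        over all frequencies.\<close>
      also have "\<dots> \<le> K * (1 / wt (fst t)) * (2 ^ DIM(real ^ 'n) * (wt (fst p) / wt (snd t)))"
        using K(1) by (intro mult_left_mono wt_shift_le) auto
      also have "\<dots> = (K * 2 ^ DIM(real ^ 'n) * wt (fst p)) / wt t" by (cases t) (simp add: wt_Pair)
      finally show "norm (stf \<phi> f (PA p + TA t)) \<le> (K * 2 ^ DIM(real ^ 'n) * wt (fst p)) / wt t" .
    qed
    from fourier_inversion[OF gi gc gb Fi, of Z] show ?thesis unfolding F .
  qed
  have ri: "integrable lborel (\<lambda>w. stf \<phi> f w * sker \<phi> w Z)"
    by (rule rec_integrable[OF sfm K(2) B(1) sm K(1)])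
  have "rec \<phi> (stf \<phi> f) Z = (LINT p|lborel. LINT t|lborel. stf \<phi> f (PA p + TA t) * sker \<phi> (PA p + TA t) Z)"
    unfolding rec_def by (rule integral_PT(2)[OF ri])
  also have "\<dots> = (LINT p|lborel. (?Q * f Z) * (\<phi> (Z - p) * cnj (\<phi> (Z - p))))"
  proof (intro Bochner_Integration.integral_cong refl)
    fix p
    have "(LINT t|lborel. stf \<phi> f (PA p + TA t) * sker \<phi> (PA p + TA t) Z) =
        (LINT t|lborel. \<phi> (Z - p) * (stf \<phi> f (PA p + TA t) * exp (\<i> * of_real (t \<bullet> Z))))"
      by (intro Bochner_Integration.integral_cong refl) (simp add: sker_def inner_commute mult_ac)
    also have "\<dots> = \<phi> (Z - p) * (?Q * (f Z * cnj (\<phi> (Z - p))))"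
      unfolding inv[symmetric] by (rule integral_mult_right_zero)
    finally show "(LINT t|lborel. stf \<phi> f (PA p + TA t) * sker \<phi> (PA p + TA t) Z) = (?Q * f Z) * (\<phi> (Z - p) * cnj (\<phi> (Z - p)))"
      by (simp only: mult_ac)
  qed
  also have "\<dots> = (?Q * f Z) * (LINT p|lborel. \<phi> (Z - p) * cnj (\<phi> (Z - p)))" by (rule integral_mult_right_zero)
  also have "(LINT p|lborel. \<phi> (Z - p) * cnj (\<phi> (Z - p))) = ?N"
    by (rule integral_lborel_shift(3)) (use borel_measurable_integrable[OF window_integrable(1)] in simp)
  finally show ?thesis by (simp only: mult_ac)
qed

text \<open>The pair \<open>h\<close>, \<open>r1\<close> describes the same window as the pair
  \<open>h0\<close>, \<open>r0\<close> of the context. It is left free because the projective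
  version takes \<open>h\<close> small and \<open>r1\<close> large while \<open>f\<close> stays
  fixed.\<close>

lemma gevrey_of_stf_decay:
  assumes c: "continuous_on UNIV f" and fb: "\<And>X. norm (f X) \<le> Mf"
    and h: "h > 0" and r: "r > 0" "r1 > 0" "\<rho> > 0" and C: "C \<ge> 0" and dec: "vdecay s \<sigma> r C (stf \<phi> f)"
    and \<phi>1: "expdec s \<sigma> h r1 \<phi>"
    and \<rho>: "\<rho> * (2 powr (1 / s) * 2 powr (1 / s)) \<le> r / 2" "\<rho> * (2 powr (1 / s) * 2 powr (1 / s)) \<le> r1 / 2"
  shows "C_infinity f"
    and "compact S \<Longrightarrow> gevrey_sup \<sigma> s (2 * max h (hh s \<sigma> \<rho>) * cc s \<sigma> TYPE(real ^ 'n)) S f < \<infinity>"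
proof -
  let ?N = "of_real ((2 * pi) ^ DIM((real ^ 'n) \<times> (real ^ 'n))) * (LINT p|lborel. \<phi> p * cnj (\<phi> p))"
  let ?k = "1 / ?N"
  have N: "?N \<noteq> 0" using window_integrable(2) by simp
  have sm: "C_infinity \<phi>" using \<phi> by (simp add: expdec_def)
  obtain B where B: "\<And>X. norm (\<phi> X) \<le> B / wt X" using window_wt[OF s r0 \<phi>] by blast
  have fm: "f \<in> borel_measurable borel" by (rule borel_measurable_continuous_onI[OF c])
  have sfm: "stf \<phi> f \<in> borel_measurable borel"
    by (rule borel_measurable_continuous_onI[OF stf_continuous[OF sm B fm fb]])
  let ?V = "\<lambda>w. ?k * stf \<phi> f w"
  have Vm: "?V \<in> borel_measurable borel" by (intro borel_measurable_times borel_measurable_const sfm)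
  have "rec \<phi> ?V Z = ?k * rec \<phi> (stf \<phi> f) Z" for Z
    unfolding rec_def by (simp only: mult.assoc integral_mult_right_zero)
  then have f: "rec \<phi> ?V = f"
    using N by (intro ext) (simp only: rec_stf[OF c fb r(1) C dec] mult.assoc[symmetric], simp)
  have C': "norm ?k * C \<ge> 0" using C by simp
  note g = rec_gevrey[OF s h r C' Vm vdecay_cmult[OF dec] \<phi>1 \<rho>, unfolded f]
  show "C_infinity f" by (rule g(1))
  show "compact S \<Longrightarrow> gevrey_sup \<sigma> s (2 * max h (hh s \<sigma> \<rho>) * cc s \<sigma> TYPE(real ^ 'n)) S f < \<infinity>" by (rule g(2))
qed

context
  fixes s\<^sub>0 \<sigma>\<^sub>0 :: real and g :: "(real ^ 'n) \<times> (real ^ 'n) \<Rightarrow> complex" and X0 F W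
  assumes s0: "s\<^sub>0 > 0" "\<sigma>\<^sub>0 > 0" "s\<^sub>0 + \<sigma>\<^sub>0 \<ge> 1" and g: "g \<in> GS s\<^sub>0 \<sigma>\<^sub>0" "g X0 \<noteq> 0"
    and F: "F \<in> GS_dual s\<^sub>0 \<sigma>\<^sub>0" and W: "is_function s\<^sub>0 \<sigma>\<^sub>0 (STFT \<phi> F) W"
begin

lemma dist_is_bounded_function:
  assumes r: "r > 0" and C: "C \<ge> 0" and dec: "vdecay s \<sigma> r C W"
  shows "\<exists>f Mf. is_function s\<^sub>0 \<sigma>\<^sub>0 F f \<and> continuous_on UNIV f \<and> (\<forall>X. norm (f X) \<le> Mf)"
proof -
  let ?c = "of_real (1 / (2 * pi) ^ CARD('n)) :: complex"
  let ?D = "of_real ((2 * pi) ^ DIM((real ^ 'n) \<times> (real ^ 'n))) :: complex"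
  obtain \<theta> where \<theta>: "\<theta> \<in> GS s\<^sub>0 \<sigma>\<^sub>0" "(LINT p|lborel. cnj (\<phi> p) * \<theta> p) \<noteq> 0"
    using exists_dual_window[OF s r0 \<phi> s0 \<phi>0 g] by blast
  let ?I = "LINT p|lborel. cnj (\<phi> p) * \<theta> p"
  \<comment> \<open>\<open>?D * ?I\<close> is the constant of \<open>qop_sop\<close>, and
    \<open>?c\<close> the normalisation of \<open>STFT\<close>.\<close>
  let ?Q = "?c * (?D * ?I)"
  have Q: "?Q \<noteq> 0" using \<theta>(2) by simp
  have sm: "C_infinity \<phi>" using \<phi> by (simp add: expdec_def)
  obtain M where M: "\<And>X. norm (\<phi> X) \<le> M" "\<And>b X. b \<in> Basis \<Longrightarrow> norm (pderivative b \<phi> X) \<le> M"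
    using window_bound[OF s r0 \<phi>] by blast
  have \<theta>s: "\<theta> \<in> sch" by (rule GS_subset_sch[OF s0 \<theta>(1)])
  obtain B where "\<And>X. wt X ^ 2 * norm (\<theta> X) \<le> B" using sch_decay[OF \<theta>s, of 2] by blast
  then have B: "norm (\<theta> X) \<le> B / (wt X)\<^sup>2" for X by (simp add: le_divide_eq mult.commute)
  obtain K where K: "K \<ge> 0" "\<And>x y \<xi> \<eta>. norm (W ((x, y), (\<xi>, \<eta>))) \<le> K / (wt \<eta> * wt (x - y))"
    using vdecay_wt[OF s r C] dec by blast
  have Wm: "W \<in> borel_measurable borel" using W by (simp add: is_function_def)
  note R = Wm K(2) B sch_C_infinity[OF \<theta>s] K(1)
  let ?f = "\<lambda>Z. (1 / ?Q) * rec \<theta> W Z"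
  have rc: "continuous_on UNIV (rec \<theta> W)" by (rule rec_continuous[OF R])
  have c: "continuous_on UNIV ?f" by (intro continuous_intros rc)
  have "is_function s\<^sub>0 \<sigma>\<^sub>0 F ?f"
    unfolding is_function_def
  proof (intro conjI ballI)
    show "?f \<in> borel_measurable borel" by (rule borel_measurable_continuous_onI[OF c])
    fix \<Phi> :: "(real ^ 'n) \<times> (real ^ 'n) \<Rightarrow> complex" assume \<Phi>: "\<Phi> \<in> GS s\<^sub>0 \<sigma>\<^sub>0"
    note t = rec_test[OF R GS_subset_sch[OF s0 \<Phi>]]
    show "integrable lborel (\<lambda>X. ?f X * \<Phi> X)"
      using integrable_mult_right[OF t(1), of "1 / ?Q"] by (simp only: mult.assoc)
    have "qop \<phi> (sop \<theta> \<Phi>) = (\<lambda>X. (?D * ?I) * \<Phi> X)"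
      by (rule ext) (rule qop_sop[OF s0 \<theta>(1) \<Phi> sm M])
    then have "STFT \<phi> F (sop \<theta> \<Phi>) = ?c * F (\<lambda>X. (?D * ?I) * \<Phi> X)" by (simp only: STFT_qop)
    also have "\<dots> = ?Q * F \<Phi>" unfolding GS_dual_cmult[OF F \<Phi>] by (simp only: mult.assoc)
    finally have "STFT \<phi> F (sop \<theta> \<Phi>) = ?Q * F \<Phi>" .
    moreover have "STFT \<phi> F (sop \<theta> \<Phi>) = (LINT w|lborel. W w * sop \<theta> \<Phi> w)"
      using W sop_GS[OF s0 \<theta>(1) \<Phi>] by (simp add: is_function_def)
    ultimately have "?Q * F \<Phi> = (LINT Z|lborel. rec \<theta> W Z * \<Phi> Z)" using t(2) by simp
    moreover have "x = (1 / q) * y" if "q \<noteq> 0" "q * x = y" for q x y :: complex using that by auto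
    ultimately have "F \<Phi> = (1 / ?Q) * (LINT Z|lborel. rec \<theta> W Z * \<Phi> Z)" using Q by blast
    then show "F \<Phi> = (LINT X|lborel. ?f X * \<Phi> X)" by (simp only: mult.assoc integral_mult_right_zero)
  qed
  moreover have "norm (?f X) \<le> norm (1 / ?Q) * (K * B * integral\<^sup>L lborel (uu :: ((real ^ 'n) \<times> (real ^ 'n)) \<times> ((real ^ 'n) \<times> (real ^ 'n)) \<Rightarrow> real))" for X
    unfolding norm_mult[of "1 / ?Q"] by (intro mult_left_mono rec_bounded[OF R]) simp
  ultimately show ?thesis using c by blast
qed

text \<open>\<open>W\<close> agrees with the normalised \<open>stf \<phi> f\<close> only almost
  everywhere. The latter and the majorant are continuous, so the estimate holds for
  \<open>stf \<phi> f\<close> at every point.\<close>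

lemma stf_vdecay_of_transform:
  assumes f: "is_function s\<^sub>0 \<sigma>\<^sub>0 F f" and c: "continuous_on UNIV f" and fb: "\<And>X. norm (f X) \<le> Mf"
    and C: "C \<ge> 0" and dec: "vdecay s \<sigma> r C W"
  shows "\<exists>C'\<ge>0. vdecay s \<sigma> r C' (stf \<phi> f)"
proof -
  let ?c = "1 / (2 * pi) ^ CARD('n) :: real"
  have sm: "C_infinity \<phi>" using \<phi> by (simp add: expdec_def)
  have fm: "f \<in> borel_measurable borel" by (rule borel_measurable_continuous_onI[OF c])
  obtain B where B: "\<And>X. norm (\<phi> X) \<le> B / wt X" using window_wt[OF s r0 \<phi>] by blast
  obtain G and w0 :: "((real ^ 'n) \<times> (real ^ 'n)) \<times> ((real ^ 'n) \<times> (real ^ 'n))" where G: "G \<in> GS s\<^sub>0 \<sigma>\<^sub>0" "G w0 \<noteq> 0"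
    using GS_double_nontrivial[OF s r0 \<phi> s0 \<phi>0 g] by blast
  let ?b = "\<lambda>w :: ((real ^ 'n) \<times> (real ^ 'n)) \<times> ((real ^ 'n) \<times> (real ^ 'n)).
    C * exp (- r * (norm (snd (snd w)) powr (1 / \<sigma>) + norm (fst (fst w) - snd (fst w)) powr (1 / s)))"
  have ae: "AE w in lborel. of_real ?c * stf \<phi> f w = W w"
    by (rule is_function_unique[OF s0 G stf_is_function[OF s r0 \<phi> s0 f fb] W])
  have "norm (of_real ?c * stf \<phi> f w) \<le> ?b w" for w
  proof (rule continuous_AE_le[of "\<lambda>w. norm (of_real ?c * stf \<phi> f w)" ?b])
    show "continuous_on UNIV (\<lambda>w. norm (of_real ?c * stf \<phi> f w))"
      by (intro continuous_intros stf_continuous[OF sm B fm fb])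
    show "continuous_on UNIV ?b" using s by (intro continuous_intros continuous_on_powr') auto
    show "AE w in lborel. norm (of_real ?c * stf \<phi> f w) \<le> ?b w"
      using ae
    proof eventually_elim
      case (elim w)
      obtain x y \<xi> \<eta> where w: "w = ((x, y), (\<xi>, \<eta>))" by (metis prod.collapse)
      show ?case unfolding elim using dec by (simp add: vdecay_def w)
    qed
  qed
  then have n: "?c * norm (stf \<phi> f w) \<le> ?b w" for w by (simp add: norm_mult norm_divide norm_power)
  have cp: "?c > 0" by simp
  have "vdecay s \<sigma> r (C / ?c) (stf \<phi> f)"
    unfolding vdecay_def
  proof (intro allI)
    fix x y \<xi> \<eta> :: "real ^ 'n"
    show "norm (stf \<phi> f ((x, y), (\<xi>, \<eta>))) \<le> (C / ?c) * exp (- r * (norm \<eta> powr (1 / \<sigma>) + norm (x - y) powr (1 / s)))"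
      using n[of "((x, y), (\<xi>, \<eta>))"] cp by (simp add: field_simps)
  qed
  then show ?thesis using C by (intro exI[of _ "C / ?c"]) auto
qed

end

end

subsection \<open>Quasi-periodicity of the transform\<close>

text \<open>The counterpart of \<open>stf_lattice\<close> on the side of test functions, for use
  while \<open>F\<close> is not yet known to be a function. Substituting \<open>w + ?S\<close>
  shifts positions and frequencies together.\<close>

lemma qop_lattice_shift:
  fixes \<phi> :: "(real ^ 'n::finite) \<times> (real ^ 'n) \<Rightarrow> complex" and k :: "real ^ 'n"
  assumes \<Psi>: "\<Psi> \<in> borel_measurable borel" and \<phi>: "\<phi> \<in> borel_measurable borel"
  shows "qop \<phi> (\<lambda>w. \<Psi> (w - ((k, k), (0, 0)))) (z, \<zeta>) =
    exp (\<i> * of_real (- (k \<bullet> \<zeta>))) * qop \<phi> (\<lambda>w. exp (\<i> * of_real (((0, 0), (0, - k)) \<bullet> w)) * \<Psi> w) (z - k, \<zeta>)"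
proof -
  let ?S = "((k, k), (0, 0)) :: ((real ^ 'n) \<times> (real ^ 'n)) \<times> ((real ^ 'n) \<times> (real ^ 'n))"
  let ?e = "\<lambda>w. exp (\<i> * complex_of_real (((0, 0), (0, - k)) \<bullet> w))" and ?c = "exp (\<i> * complex_of_real (- (k \<bullet> \<zeta>)))"
  note \<Psi>[measurable] \<phi>[measurable]
  have m: "(\<lambda>w. qker \<phi> (z, \<zeta>) w * \<Psi> (w - ?S)) \<in> borel_measurable borel" unfolding qker_def by measurable
  have "qop \<phi> (\<lambda>w. \<Psi> (w - ?S)) (z, \<zeta>) = (LINT w|lborel. qker \<phi> (z, \<zeta>) (w + ?S) * \<Psi> (w + ?S - ?S))"
    unfolding qop_def by (rule integral_lborel_shift(2)[OF m, symmetric])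
  also have "\<dots> = (LINT w|lborel. ?c * (qker \<phi> (z - k, \<zeta>) w * (?e w * \<Psi> w)))"
  proof (intro Bochner_Integration.integral_cong refl)
    fix w :: "((real ^ 'n) \<times> (real ^ 'n)) \<times> ((real ^ 'n) \<times> (real ^ 'n))"
    obtain x y \<xi> \<eta> where w: "w = ((x, y), (\<xi>, \<eta>))" by (metis prod.collapse)
    have 1: "exp (\<i> * of_real (- (z, \<zeta>) \<bullet> TT (w + ?S))) = ?c * (exp (\<i> * of_real (- (z - k, \<zeta>) \<bullet> TT w)) * ?e w)"
      unfolding exp_add[symmetric] by (rule arg_cong[of _ _ exp])
        (simp add: w inner_prod_def inner_add_right inner_diff_left inner_commute[of \<zeta> k] algebra_simps)
    have 2: "(z, \<zeta>) - PP (w + ?S) = (z - k, \<zeta>) - PP w" by (simp add: w)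
    have 3: "w + ?S - ?S = w" by simp
    have 4: "a * (c * (b * e)) * p = c * (a * b * (e * p))" for a b c e p :: complex by simp
    show "qker \<phi> (z, \<zeta>) (w + ?S) * \<Psi> (w + ?S - ?S) = ?c * (qker \<phi> (z - k, \<zeta>) w * (?e w * \<Psi> w))"
      unfolding qker_def 1 2 3 by (rule 4)
  qed
  also have "\<dots> = ?c * qop \<phi> (\<lambda>w. ?e w * \<Psi> w) (z - k, \<zeta>)"
    unfolding qop_def by (rule integral_mult_right_zero)
  finally show ?thesis .
qed

text \<open>Quasi-periodicity of \<open>W\<close> holds off a null set for each lattice vector, and
  the lattice is countable. With \<open>W\<close> set to zero on the union, a bound for
  \<open>W\<close> on the cell spreads to every point. The new representative is fixed before
  \<open>r\<close> and \<open>C\<close>, so it serves all rates at once.\<close>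

lemma transform_truncate:
  fixes E :: "'n::finite \<Rightarrow> real ^ 'n" and \<phi> g :: "(real ^ 'n) \<times> (real ^ 'n) \<Rightarrow> complex"
  assumes s: "s > 0" "\<sigma> > 0" and r0: "r0 > 0" and \<phi>: "expdec s \<sigma> h0 r0 \<phi>" and \<phi>0: "\<phi> \<noteq> (\<lambda>_. 0)"
    and s0: "s\<^sub>0 > 0" "\<sigma>\<^sub>0 > 0" "s\<^sub>0 + \<sigma>\<^sub>0 \<ge> 1" and g: "g \<in> GS s\<^sub>0 \<sigma>\<^sub>0" "g X0 \<noteq> 0"
    and E: "is_basis E" and F: "quasi_periodic_dist s\<^sub>0 \<sigma>\<^sub>0 E F" and W: "is_function s\<^sub>0 \<sigma>\<^sub>0 (STFT \<phi> F) W"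
  shows "\<exists>W'. is_function s\<^sub>0 \<sigma>\<^sub>0 (STFT \<phi> F) W' \<and> (\<forall>r>0. \<forall>C>0.
    (\<forall>x\<in>cell E. \<forall>\<xi> \<eta> y. norm (W ((x, y), (\<xi>, \<eta>))) \<le> C * exp (- r * (norm \<eta> powr (1 / \<sigma>) + norm y powr (1 / s)))) \<longrightarrow>
    (\<exists>C'>0. vdecay s \<sigma> (r / 2 powr (1 / s)) C' W'))"
proof -
  let ?p = "1 / s"
  let ?S = "\<lambda>k. ((k, k), (0, 0)) :: ((real ^ 'n) \<times> (real ^ 'n)) \<times> ((real ^ 'n) \<times> (real ^ 'n))"
  have sm: "C_infinity \<phi>" using \<phi> by (simp add: expdec_def)
  have \<phi>m: "\<phi> \<in> borel_measurable borel" by (rule C_infinity_borel[OF sm])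
  have Wm: "W \<in> borel_measurable borel" using W by (simp add: is_function_def)
  obtain G and w0 :: "((real ^ 'n) \<times> (real ^ 'n)) \<times> ((real ^ 'n) \<times> (real ^ 'n))" where G: "G \<in> GS s\<^sub>0 \<sigma>\<^sub>0" "G w0 \<noteq> 0"
    using GS_double_nontrivial[OF s r0 \<phi> s0 \<phi>0 g] by blast
  have qp: "AE w in lborel. norm (W (w + ?S k)) = norm (W w)" if k: "k \<in> lattice_of E" for k
  proof -
    let ?e = "\<lambda>w. exp (\<i> * complex_of_real (((0, 0), (0, - k)) \<bullet> w))"
    have [measurable]: "?e \<in> borel_measurable borel"
      by (intro borel_measurable_continuous_onI continuous_intros)
    have W1: "integrable lborel (\<lambda>w. W w * \<Psi> w)" and W2: "STFT \<phi> F \<Psi> = (LINT w|lborel. W w * \<Psi> w)"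
      if "\<Psi> \<in> GS s\<^sub>0 \<sigma>\<^sub>0" for \<Psi>
      using W that unfolding is_function_def by blast+
    have F': "F (\<lambda>(x, \<xi>). \<Phi> (x - k, \<xi>)) = F (\<lambda>(x, \<xi>). exp (\<i> * of_real (k \<bullet> \<xi>)) * \<Phi> (x, \<xi>))"
      if "\<Phi> \<in> GS s\<^sub>0 \<sigma>\<^sub>0" for \<Phi>
      using F that k unfolding quasi_periodic_dist_def by blast
    have "AE w in lborel. W (w + ?S k) - ?e w * W w = 0"
    proof (rule GS_separating[OF s0 G])
      note Wm[measurable]
      show "(\<lambda>w. W (w + ?S k) - ?e w * W w) \<in> borel_measurable borel" by measurable
      fix \<Psi> :: "((real ^ 'n) \<times> (real ^ 'n)) \<times> ((real ^ 'n) \<times> (real ^ 'n)) \<Rightarrow> complex" assume \<Psi>: "\<Psi> \<in> GS s\<^sub>0 \<sigma>\<^sub>0"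
      have GG: "(\<lambda>w. \<Psi> (w - ?S k)) \<in> GS s\<^sub>0 \<sigma>\<^sub>0" "(\<lambda>w. ?e w * \<Psi> w) \<in> GS s\<^sub>0 \<sigma>\<^sub>0"
        using GS_translate_modulate[OF s0 \<Psi>, of 0 "?S k"] GS_translate_modulate[OF s0 \<Psi>, of "((0, 0), (0, - k))" 0] by simp_all
      have \<Psi>m: "\<Psi> \<in> borel_measurable borel" using \<Psi> by (intro C_infinity_borel) (simp add: GS_def)
      let ?G = "qop \<phi> (\<lambda>w. ?e w * \<Psi> w)"
      \<comment> \<open>The phase is such that quasi-periodicity of \<open>F\<close> at
        \<open>?\<Phi>\<close> compares two values of the form \<open>F (qop \<phi> ...)\<close>:
        the translate is given by \<open>qop_lattice_shift\<close>, and in the modulated function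
        the phase cancels.\<close>
      let ?\<Phi> = "\<lambda>X. exp (\<i> * complex_of_real ((0, - k) \<bullet> X)) * ?G (X - 0)"
      have G1: "?G \<in> GS s\<^sub>0 \<sigma>\<^sub>0" by (rule qop_in_GS[OF s r0 \<phi> s0 GG(2)])
      have \<Phi>: "?\<Phi> \<in> GS s\<^sub>0 \<sigma>\<^sub>0" by (rule GS_translate_modulate[OF s0 G1])
      have "(\<lambda>(x, \<xi>). ?\<Phi> (x - k, \<xi>)) = qop \<phi> (\<lambda>w. \<Psi> (w - ?S k))"
        by (rule ext) (simp add: split_paired_all qop_lattice_shift[OF \<Psi>m \<phi>m])
      moreover have "(\<lambda>(x, \<xi>). exp (\<i> * of_real (k \<bullet> \<xi>)) * ?\<Phi> (x, \<xi>)) = ?G"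
        by (rule ext) (simp add: split_paired_all mult.assoc[symmetric] exp_add[symmetric])
      moreover have "F (\<lambda>(x, \<xi>). ?\<Phi> (x - k, \<xi>)) = F (\<lambda>(x, \<xi>). exp (\<i> * of_real (k \<bullet> \<xi>)) * ?\<Phi> (x, \<xi>))"
        by (rule F'[OF \<Phi>])
      ultimately have "F (qop \<phi> (\<lambda>w. \<Psi> (w - ?S k))) = F ?G" by simp
      then have eq: "STFT \<phi> F (\<lambda>w. \<Psi> (w - ?S k)) = STFT \<phi> F (\<lambda>w. ?e w * \<Psi> w)" unfolding STFT_qop by simp
      have i1: "integrable lborel (\<lambda>w. W w * \<Psi> (w - ?S k))" and F1: "STFT \<phi> F (\<lambda>w. \<Psi> (w - ?S k)) = (LINT w|lborel. W w * \<Psi> (w - ?S k))"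
        by (rule W1[OF GG(1)]) (rule W2[OF GG(1)])
      have i2: "integrable lborel (\<lambda>w. W w * (?e w * \<Psi> w))" and F2: "STFT \<phi> F (\<lambda>w. ?e w * \<Psi> w) = (LINT w|lborel. W w * (?e w * \<Psi> w))"
        by (rule W1[OF GG(2)]) (rule W2[OF GG(2)])
      have i1': "integrable lborel (\<lambda>w. W (w + ?S k) * \<Psi> w)" using integrable_lborel_shift(2)[OF i1, of "?S k"] by simp
      have "(LINT w|lborel. W (w + ?S k) * \<Psi> w) = (LINT w|lborel. W w * \<Psi> (w - ?S k))"
        using integral_lborel_shift(2)[of "\<lambda>w. W w * \<Psi> (w - ?S k)" "?S k"] borel_measurable_integrable[OF i1] by simp
      also have "\<dots> = (LINT w|lborel. W w * (?e w * \<Psi> w))" using eq F1 F2 by (simp only:)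
      finally have e: "(LINT w|lborel. W (w + ?S k) * \<Psi> w) - (LINT w|lborel. W w * (?e w * \<Psi> w)) = 0" by (simp only: diff_self)
      have d: "(W (w + ?S k) - ?e w * W w) * \<Psi> w = W (w + ?S k) * \<Psi> w - W w * (?e w * \<Psi> w)" for w
        by (simp add: algebra_simps)
      show "integrable lborel (\<lambda>w. (W (w + ?S k) - ?e w * W w) * \<Psi> w) \<and> (LINT w|lborel. (W (w + ?S k) - ?e w * W w) * \<Psi> w) = 0"
        unfolding d using Bochner_Integration.integrable_diff[OF i1' i2] Bochner_Integration.integral_diff[OF i1' i2] e by (simp only: simp_thms)
    qed
    then show ?thesis
    proof eventually_elim
      case (elim w)
      then have "W (w + ?S k) = ?e w * W w" by simp
      then show ?case by (simp only: norm_mult) simp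
    qed
  qed
  then have "AE w in lborel. \<forall>k\<in>lattice_of E. norm (W (w + ?S k)) = norm (W w)"
    by (intro AE_ball_countable[THEN iffD2, OF countable_lattice] ballI)
  then obtain N where N: "{w \<in> space lborel. \<not> (\<forall>k\<in>lattice_of E. norm (W (w + ?S k)) = norm (W w))} \<subseteq> N"
    "emeasure lborel N = 0" "N \<in> sets lborel" by (rule AE_E)
  \<comment> \<open>Zero satisfies any decay estimate. Off \<open>N\<close> a point is compared with
    its translate into the cell, where \<open>W\<close> itself is bounded everywhere, even if the
    translate lies in \<open>N\<close>.\<close>
  let ?W = "\<lambda>w. if w \<in> N then 0 else W w"
  have "N \<in> null_sets lborel" using N(2,3) by (simp add: null_sets_def)
  then have ae: "AE w in lborel. w \<notin> N" by (rule AE_not_in)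
  have W'm: "?W \<in> borel_measurable borel" using N(3) Wm by (intro measurable_If_set) auto
  have "AE w in lborel. ?W w = W w" using ae by eventually_elim simp
  from is_function_cong_AE[OF W W'm this] have W': "is_function s\<^sub>0 \<sigma>\<^sub>0 (STFT \<phi> F) ?W" .
  obtain R where R: "R > 0" "\<And>x. x \<in> cell E \<Longrightarrow> norm x \<le> R" using bounded_cell[of E] by blast
  have dec: "\<exists>C'>0. vdecay s \<sigma> (r / 2 powr ?p) C' ?W" if r: "r > 0" and C: "C > 0"
    and bd: "\<forall>x\<in>cell E. \<forall>\<xi> \<eta> y. norm (W ((x, y), (\<xi>, \<eta>))) \<le> C * exp (- r * (norm \<eta> powr (1 / \<sigma>) + norm y powr ?p))" for r C
  proof -
    have "norm (?W ((x, y), (\<xi>, \<eta>))) \<le> (C * exp (r * R powr ?p)) *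
      exp (- (r / 2 powr ?p) * (norm \<eta> powr (1 / \<sigma>) + norm (x - y) powr ?p))" for x y \<xi> \<eta>
    proof (cases "((x, y), (\<xi>, \<eta>)) \<in> N")
      case False
      obtain x0 k where xk: "x0 \<in> cell E" "k \<in> lattice_of E" "x = x0 + k"
        using cell_lattice_decomposition[OF is_basis_coords[OF E], of x] by blast
      have "\<forall>k\<in>lattice_of E. norm (W (((x, y), (\<xi>, \<eta>)) + ?S k)) = norm (W ((x, y), (\<xi>, \<eta>)))"
      proof (rule ccontr)
        assume "\<not> ?thesis"
        then have "((x, y), (\<xi>, \<eta>)) \<in> {w \<in> space lborel. \<not> (\<forall>k\<in>lattice_of E. norm (W (w + ?S k)) = norm (W w))}"
          by (simp only: space_lborel space_borel UNIV_I simp_thms mem_Collect_eq not_False_eq_True)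
        with N(1) False show False by blast
      qed
      from this[rule_format, OF uminus_lattice[OF xk(2)]]
      have "norm (W ((x, y), (\<xi>, \<eta>))) = norm (W ((x0, y - k), (\<xi>, \<eta>)))" by (simp add: xk(3))
      also have "\<dots> \<le> C * exp (- r * (norm \<eta> powr (1 / \<sigma>) + norm (y - k) powr ?p))" using bd xk(1) by blast
      also have "\<dots> \<le> C * (exp (r * R powr ?p) * exp (- (r / 2 powr ?p) * (norm \<eta> powr (1 / \<sigma>) + norm (x - y) powr ?p)))"
      proof (intro mult_left_mono exp_lattice_shift)
        show "norm (x - k) \<le> R" using R(2)[OF xk(1)] xk(3) by simp
      qed (use s R r C in auto)
      finally show ?thesis using False by (simp only: if_False mult.assoc)
    qed (use C in simp)
    then show ?thesis unfolding vdecay_def using C by (intro exI[of _ "C * exp (r * R powr ?p)"]) auto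
  qed
  show ?thesis using W' dec by (intro exI[of _ ?W]) blast
qed

subsection \<open>The equivalences\<close>

lemma cell_compact: "compact (cell E \<times> cell (dual_basis E))"
  by (intro compact_Times compact_cell)

lemma gevrey_imp_decay:
  fixes E :: "'n::finite \<Rightarrow> real ^ 'n"
  assumes s: "s > 0" "\<sigma> > 0" and E: "is_basis E" and f: "f \<in> gevrey \<sigma> s E" and \<phi>: "\<phi> \<in> GS s \<sigma>"
  shows "\<exists>r>0. \<exists>C>0. vdecay s \<sigma> r C (stf \<phi> f)"
proof -
  let ?c = "2 powr (1 / s) * 2 powr (1 / s) :: real" and ?K = "cell E \<times> cell (dual_basis E)"
  have fs: "C_infinity f" "quasi_periodic E f" using f by (auto simp: gevrey_def)
  obtain h1 where h1: "h1 > 0" "gevrey_sup \<sigma> s h1 ?K f < \<infinity>" using f cell_compact[of E] unfolding gevrey_def by blast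
  obtain C where C: "C \<ge> 0" "\<forall>X\<in>?K. dbound s \<sigma> h1 C f X" using gevrey_sup_dbound[OF s h1(1) fs(1) h1(2)] by blast
  obtain h0 r1 where \<phi>1: "h0 > 0" "r1 > 0" "expdec s \<sigma> h0 r1 \<phi>" using GS_expdec[OF s \<phi>] by blast
  define h where "h = max h1 h0"
  \<comment> \<open>The largest growth of derivatives of \<open>f\<close> that half of the decay of
    the window still absorbs.\<close>
  define r where "r = r1 / 2 / ?c"
  have h: "h > 0" "h1 \<le> h" "h0 \<le> h" using h1 by (auto simp: h_def)
  have r: "r > 0" using \<phi>1(2) by (simp add: r_def)
  have rr: "r * 2 powr (1 / s) * 2 powr (1 / s) \<le> r1 / 2" by (simp add: r_def)
  have "dbound s \<sigma> h C f X" if "X \<in> ?K" for X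
    by (rule dbound_mono[OF _ order_refl less_imp_le[OF h1(1)] h(2)]) (use C(2) that in blast)
  note bd = this
  let ?H = "2 * max h (hh s \<sigma> r)"
  have \<phi>2: "expdec s \<sigma> ?H r1 \<phi>"
    by (rule expdec_mono[OF \<phi>1(3)]) (use h \<phi>1(1) in auto)
  let ?\<rho> = "decay_rate s \<sigma> (real CARD('n) * (2 * ?H))"
  have "?H > 0" using h by simp
  then have \<rho>: "?\<rho> > 0" using s by (simp add: decay_rate_def)
  obtain C' where "C' > 0" "vdecay s \<sigma> (?\<rho> / 2 powr (1 / s)) C' (stf \<phi> f)"
    using stf_vdecay[OF s E fs h(1) r \<phi>1(2) bd \<phi>2 rr \<rho> order_refl] by blast
  moreover have "?\<rho> / 2 powr (1 / s) > 0" using \<rho> by simp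
  ultimately show ?thesis by blast
qed

text \<open>The order of choices: the target rate determines \<open>h\<close>, then \<open>r\<close>
  is taken so large that \<open>hh\<close> stays below \<open>h\<close>, and finally a decay
  \<open>r1\<close> of the window beating the growth caused by \<open>r\<close>. The hypotheses on
  \<open>f\<close> and on the window grant every such choice.\<close>

lemma gevrey_proj_imp_decay:
  fixes E :: "'n::finite \<Rightarrow> real ^ 'n"
  assumes s: "s > 0" "\<sigma> > 0" and E: "is_basis E" and f: "f \<in> gevrey_proj \<sigma> s E" and \<phi>: "\<phi> \<in> GS_proj s \<sigma>" and R: "R > 0"
  shows "\<exists>C>0. vdecay s \<sigma> R C (stf \<phi> f)"
proof -
  let ?c = "2 powr (1 / s) * 2 powr (1 / s) :: real" and ?K = "cell E \<times> cell (dual_basis E)"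
  have fs: "C_infinity f" "quasi_periodic E f" using f by (auto simp: gevrey_proj_def)
  \<comment> \<open>Compensates in advance for the loss in leaving the cell.\<close>
  define \<rho> where "\<rho> = R * 2 powr (1 / s)"
  have \<rho>: "\<rho> > 0" using R by (simp add: \<rho>_def)
  \<comment> \<open>Solves for the constant at which the moments yield the rate
    \<open>\<rho>\<close>; the halving in \<open>h\<close> below offsets the doubling by the Leibniz
    rule.\<close>
  define q where "q s = (s / (2 * \<rho>)) powr s / (real CARD('n) * 2)" for s
  define h where "h = min (q s) (q \<sigma>) / 2"
  have q: "q s > 0" "q \<sigma> > 0" using s \<rho> by (simp_all add: q_def)
  then have h: "h > 0" by (simp add: h_def)
  obtain r where r: "r > 0" "hh s \<sigma> r \<le> h" using hh_small[OF s h] by blast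
  have mx: "max h (hh s \<sigma> r) = h" using r(2) by simp
  have "gevrey_sup \<sigma> s h ?K f < \<infinity>" using f cell_compact[of E] h unfolding gevrey_proj_def by blast
  from gevrey_sup_dbound[OF s h fs(1) this] obtain C where "\<forall>X\<in>?K. dbound s \<sigma> h C f X" by blast
  then have bd: "dbound s \<sigma> h C f X" if "X \<in> ?K" for X using that by blast
  define r1 where "r1 = 2 * (r * ?c)"
  have r1: "r1 > 0" using r(1) by (simp add: r1_def)
  have rr: "r * 2 powr (1 / s) * 2 powr (1 / s) \<le> r1 / 2" by (simp add: r1_def)
  have \<phi>2: "expdec s \<sigma> (2 * max h (hh s \<sigma> r)) r1 \<phi>"
    using h by (intro GS_proj_expdec[OF s \<phi> _ r1]) (simp add: mx)
  have D: "real CARD('n) > 0" by simp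
  have le: "real CARD('n) * (2 * (2 * h)) \<le> (t / (2 * \<rho>)) powr t" if "2 * h \<le> q t" for t
  proof -
    have "(real CARD('n) * 2) * (2 * h) \<le> (real CARD('n) * 2) * q t" using that by (intro mult_left_mono) auto
    then show ?thesis by (simp add: q_def)
  qed
  have h2: "2 * h > 0" using h by simp
  have "\<rho> \<le> decay_rate s \<sigma> (real CARD('n) * (2 * (2 * max h (hh s \<sigma> r))))"
    unfolding decay_rate_def mx
    using decay_rate_ge[OF s(1) D \<rho> h2 le] decay_rate_ge[OF s(2) D \<rho> h2 le] by (simp add: h_def)
  from stf_vdecay[OF s E fs h r(1) r1 bd \<phi>2 rr \<rho> this] show ?thesis by (simp add: \<rho>_def)
qed

lemma gevrey_proj_subset: "gevrey_proj \<sigma> s E \<subseteq> gevrey \<sigma> s E"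
  unfolding gevrey_def gevrey_proj_def using zero_less_one by blast

lemma gevrey_bounded:
  fixes E :: "'n::finite \<Rightarrow> real ^ 'n"
  assumes s: "s > 0" "\<sigma> > 0" and E: "is_basis E" and f: "f \<in> gevrey \<sigma> s E"
  shows "\<exists>M. \<forall>X. norm (f X) \<le> M"
proof -
  let ?K = "cell E \<times> cell (dual_basis E)"
  have fs: "C_infinity f" "quasi_periodic E f" using f by (auto simp: gevrey_def)
  obtain h where h: "h > 0" "gevrey_sup \<sigma> s h ?K f < \<infinity>" using f cell_compact[of E] unfolding gevrey_def by blast
  obtain C where C: "\<forall>X\<in>?K. dbound s \<sigma> h C f X" using gevrey_sup_dbound[OF s h(1) fs(1) h(2)] by blast
  have "norm (f X) \<le> C" for X
    by (rule quasi_periodic_dbound(2)[OF s E fs h(1) zero_less_one]) (use C in blast)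
  then show ?thesis by blast
qed

lemma decay_imp_gevrey:
  fixes E :: "'n::finite \<Rightarrow> real ^ 'n" and \<phi> g :: "(real ^ 'n) \<times> (real ^ 'n) \<Rightarrow> complex"
  assumes s: "s > 0" "\<sigma> > 0" and \<phi>: "\<phi> \<in> GS s \<sigma>" and \<phi>0: "\<phi> \<noteq> (\<lambda>_. 0)"
    and s0: "s\<^sub>0 > 0" "\<sigma>\<^sub>0 > 0" "s\<^sub>0 + \<sigma>\<^sub>0 \<ge> 1" and g: "g \<in> GS s\<^sub>0 \<sigma>\<^sub>0" "g X0 \<noteq> 0"
    and F: "F \<in> GS_dual s\<^sub>0 \<sigma>\<^sub>0" "quasi_periodic_dist s\<^sub>0 \<sigma>\<^sub>0 E F" and W: "is_function s\<^sub>0 \<sigma>\<^sub>0 (STFT \<phi> F) W"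
    and r: "r > 0" and C: "C > 0" and dec: "vdecay s \<sigma> r C W"
  shows "\<exists>f\<in>gevrey \<sigma> s E. is_function s\<^sub>0 \<sigma>\<^sub>0 F f"
proof -
  let ?c = "2 powr (1 / s) * 2 powr (1 / s) :: real"
  obtain h0 r1 where \<phi>1: "h0 > 0" "r1 > 0" "expdec s \<sigma> h0 r1 \<phi>" using GS_expdec[OF s \<phi>] by blast
  note ctx = s \<phi>1(2,3) \<phi>0
  obtain f Mf where f: "is_function s\<^sub>0 \<sigma>\<^sub>0 F f" "continuous_on UNIV f" "\<And>X. norm (f X) \<le> Mf"
    using dist_is_bounded_function[OF ctx s0 g F(1) W r less_imp_le[OF C] dec] by blast
  have qp: "quasi_periodic E f" by (rule quasi_periodic_of_dist[OF s0 g F(2) f(1,2)])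
  obtain C' where C': "C' \<ge> 0" "vdecay s \<sigma> r C' (stf \<phi> f)"
    using stf_vdecay_of_transform[OF ctx s0 g F(1) W f less_imp_le[OF C] dec] by blast
  \<comment> \<open>Half of the decay of the transform and half of that of the window are spent on
    the modulation; \<open>?c\<close> is the loss in splitting \<open>y\<close> along
    \<open>x\<close> and \<open>z\<close>.\<close>
  define \<rho> where "\<rho> = min r r1 / 2 / ?c"
  have \<rho>: "\<rho> > 0" using r \<phi>1(2) by (simp add: \<rho>_def)
  have \<rho>c: "\<rho> * ?c = min r r1 / 2" by (simp add: \<rho>_def)
  have \<rho>1: "\<rho> * ?c \<le> r / 2" "\<rho> * ?c \<le> r1 / 2" unfolding \<rho>c by auto
  note G = gevrey_of_stf_decay[OF ctx f(2,3) \<phi>1(1) r \<phi>1(2) \<rho> C' \<phi>1(3) \<rho>1]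
  have hp: "2 * max h0 (hh s \<sigma> \<rho>) * cc s \<sigma> TYPE(real ^ 'n) > 0"
    using \<phi>1(1) cc_pos[of s \<sigma>, where 'a = "real ^ 'n"] by simp
  have "\<exists>h>0. gevrey_sup \<sigma> s h K f < \<infinity>" if "compact K" for K
    using hp G(2)[OF that] by blast
  then have "f \<in> gevrey \<sigma> s E" unfolding gevrey_def using qp G(1) by blast
  then show ?thesis using f(1) by blast
qed

text \<open>The function \<open>f\<close> must not depend on \<open>h\<close>, so it is obtained
  once from the rate 1. For each \<open>h\<close> a large \<open>\<rho>\<close> then makes
  \<open>hh\<close> small, and the rate \<open>r\<close> demanded by \<open>\<rho>\<close> is
  available for the transform and for the window.\<close>

lemma decay_imp_gevrey_proj:
  fixes E :: "'n::finite \<Rightarrow> real ^ 'n" and \<phi> g :: "(real ^ 'n) \<times> (real ^ 'n) \<Rightarrow> complex"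
  assumes s: "s > 0" "\<sigma> > 0" and \<phi>: "\<phi> \<in> GS_proj s \<sigma>" and \<phi>0: "\<phi> \<noteq> (\<lambda>_. 0)"
    and s0: "s\<^sub>0 > 0" "\<sigma>\<^sub>0 > 0" "s\<^sub>0 + \<sigma>\<^sub>0 \<ge> 1" and g: "g \<in> GS s\<^sub>0 \<sigma>\<^sub>0" "g X0 \<noteq> 0"
    and F: "F \<in> GS_dual s\<^sub>0 \<sigma>\<^sub>0" "quasi_periodic_dist s\<^sub>0 \<sigma>\<^sub>0 E F" and W: "is_function s\<^sub>0 \<sigma>\<^sub>0 (STFT \<phi> F) W"
    and dec: "\<And>r. r > 0 \<Longrightarrow> \<exists>C>0. vdecay s \<sigma> r C W"
  shows "\<exists>f\<in>gevrey_proj \<sigma> s E. is_function s\<^sub>0 \<sigma>\<^sub>0 F f"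
proof -
  let ?c = "2 powr (1 / s) * 2 powr (1 / s) :: real" and ?cc = "cc s \<sigma> TYPE(real ^ 'n)"
  note ctx = s zero_less_one GS_proj_expdec[OF s \<phi> zero_less_one zero_less_one] \<phi>0
  obtain C where C: "C > 0" "vdecay s \<sigma> 1 C W" using dec[OF zero_less_one] by blast
  obtain f Mf where f: "is_function s\<^sub>0 \<sigma>\<^sub>0 F f" "continuous_on UNIV f" "\<And>X. norm (f X) \<le> Mf"
    using dist_is_bounded_function[OF ctx s0 g F(1) W zero_less_one less_imp_le[OF C(1)] C(2)] by blast
  have qp: "quasi_periodic E f" by (rule quasi_periodic_of_dist[OF s0 g F(2) f(1,2)])
  have ccp: "?cc > 0" by (rule cc_pos)
  have G: "C_infinity f \<and> (\<forall>K. compact K \<longrightarrow> gevrey_sup \<sigma> s h K f < \<infinity>)" if h: "h > 0" for h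
  proof -
    \<comment> \<open>Undoes the factor 2 of the Leibniz rule and the constant of passing to
      multi-indices.\<close>
    define h' where "h' = h / (2 * ?cc)"
    have h': "h' > 0" using h ccp by (simp add: h'_def)
    obtain \<rho> where \<rho>: "\<rho> > 0" "hh s \<sigma> \<rho> \<le> h'" using hh_small[OF s h'] by blast
    define r where "r = 2 * (\<rho> * ?c)"
    have r: "r > 0" using \<rho>(1) by (simp add: r_def)
    have \<rho>1: "\<rho> * ?c \<le> r / 2" by (simp add: r_def)
    obtain C where C: "C > 0" "vdecay s \<sigma> r C W" using dec[OF r] by blast
    obtain C' where C': "C' \<ge> 0" "vdecay s \<sigma> r C' (stf \<phi> f)"
      using stf_vdecay_of_transform[OF ctx s0 g F(1) W f less_imp_le[OF C(1)] C(2)] by blast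
    note G = gevrey_of_stf_decay[OF ctx f(2,3) h' r r \<rho>(1) C' GS_proj_expdec[OF s \<phi> h' r] \<rho>1 \<rho>1]
    have "2 * max h' (hh s \<sigma> \<rho>) * ?cc = h" using \<rho>(2) ccp by (simp add: h'_def max_absorb1)
    with G show ?thesis by simp
  qed
  have "C_infinity f" using G[OF zero_less_one] by blast
  then have "f \<in> gevrey_proj \<sigma> s E" unfolding gevrey_proj_def using qp G by blast
  then show ?thesis using f(1) by blast
qed

lemma zero_in_gevrey_proj:
  fixes E :: "'n::finite \<Rightarrow> real ^ 'n"
  assumes s: "s > 0" "\<sigma> > 0"
  shows "(\<lambda>_. 0) \<in> gevrey_proj \<sigma> s E"
proof -
  have d: "dbound s \<sigma> h 0 (\<lambda>_. 0 :: complex) X" for h and X :: "(real ^ 'n) \<times> (real ^ 'n)"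
  proof -
    have "dd ds (\<lambda>_ :: (real ^ 'n) \<times> (real ^ 'n). 0 :: complex) = (\<lambda>_. 0)" for ds
      using dd_cmult[OF C_infinity_const, of ds 0 0] by simp
    then show ?thesis by (simp add: dbound_def)
  qed
  have "gevrey_sup \<sigma> s h K (\<lambda>_. 0) < \<infinity>" if h: "h > 0" for h and K :: "((real ^ 'n) \<times> (real ^ 'n)) set"
  proof -
    let ?cc = "cc s \<sigma> TYPE(real ^ 'n)"
    have ccp: "?cc > 0" by (rule cc_pos)
    then have "h / ?cc > 0" using h by simp
    from gevrey_sup_finite[OF s this d order_refl] have "gevrey_sup \<sigma> s (h / ?cc * ?cc) K (\<lambda>_. 0) < \<infinity>" .
    then show ?thesis using ccp by simp
  qed
  then show ?thesis by (simp add: gevrey_proj_def quasi_periodic_def C_infinity_const)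
qed

lemma trivial_test_space:
  fixes F :: "((real ^ 'n::finite) \<times> (real ^ 'n) \<Rightarrow> complex) \<Rightarrow> complex"
  assumes s: "s > 0" "\<sigma> > 0" and r0: "r0 > 0" and \<phi>: "expdec s \<sigma> h0 r0 \<phi>"
    and s0: "s\<^sub>0 > 0" "\<sigma>\<^sub>0 > 0" "s\<^sub>0 + \<sigma>\<^sub>0 \<ge> 1" and F: "F \<in> GS_dual s\<^sub>0 \<sigma>\<^sub>0"
    and z: "\<And>g :: (real ^ 'n) \<times> (real ^ 'n) \<Rightarrow> complex. g \<in> GS s\<^sub>0 \<sigma>\<^sub>0 \<Longrightarrow> g = (\<lambda>_. 0)"
  shows "is_function s\<^sub>0 \<sigma>\<^sub>0 F (\<lambda>_. 0)" "STFT_is_function s\<^sub>0 \<sigma>\<^sub>0 \<phi> F (\<lambda>_ _ _ _. 0)"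
proof -
  have F0: "F \<Phi> = 0" if "\<Phi> \<in> GS s\<^sub>0 \<sigma>\<^sub>0" for \<Phi>
    using GS_dual_cmult[OF F that, of 0] z[OF that] by simp
  then show "is_function s\<^sub>0 \<sigma>\<^sub>0 F (\<lambda>_. 0)" by (simp add: is_function_def)
  have "STFT \<phi> F \<Psi> = 0" if "\<Psi> \<in> GS s\<^sub>0 \<sigma>\<^sub>0" for \<Psi>
    unfolding STFT_qop using F0[OF qop_in_GS[OF s r0 \<phi> s0 that]] by simp
  then show "STFT_is_function s\<^sub>0 \<sigma>\<^sub>0 \<phi> F (\<lambda>_ _ _ _. 0)"
    by (simp add: STFT_is_function_def is_function_def case_prod_unfold)
qed

lemma STFT_is_function_curry:
  "STFT_is_function s \<sigma> \<phi> F (\<lambda>x \<xi> \<eta> y. W ((x, y), (\<xi>, \<eta>))) \<longleftrightarrow> is_function s \<sigma> (STFT \<phi> F) W"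
proof -
  have "(\<lambda>((x, y), (\<xi>, \<eta>)). W ((x, y), (\<xi>, \<eta>))) = W" by auto
  then show ?thesis by (simp add: STFT_is_function_def)
qed

theorem proposition4p1:
  fixes E :: "'n::finite \<Rightarrow> real ^ 'n"
    and F :: "((real ^ 'n) \<times> (real ^ 'n) \<Rightarrow> complex) \<Rightarrow> complex"
    and \<phi> :: "(real ^ 'n) \<times> (real ^ 'n) \<Rightarrow> complex"
    and s \<sigma> s\<^sub>0 \<sigma>\<^sub>0 :: real
  assumes "s > 0" and "\<sigma> > 0"
    and "is_basis E"
    and "s\<^sub>0 > 0" and "\<sigma>\<^sub>0 > 0" and "s\<^sub>0 + \<sigma>\<^sub>0 \<ge> 1"
    and "F \<in> GS_dual s\<^sub>0 \<sigma>\<^sub>0"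
    and "quasi_periodic_dist s\<^sub>0 \<sigma>\<^sub>0 E F"
    and "\<phi> \<noteq> (\<lambda>_. 0)"
  shows
    "(\<phi> \<in> GS s \<sigma> \<longrightarrow>
       ((\<exists>f\<in>gevrey \<sigma> s E. is_function s\<^sub>0 \<sigma>\<^sub>0 F f) \<longleftrightarrow>
        (\<exists>V. STFT_is_function s\<^sub>0 \<sigma>\<^sub>0 \<phi> F V \<and>
          (\<exists>r>0. \<exists>C>0. \<forall>x\<in>cell E. \<forall>\<xi> \<eta> y.
            norm (V x \<xi> \<eta> y) \<le> C * exp (- r * (norm \<eta> powr (1/\<sigma>) + norm y powr (1/s)))))) \<and>
       ((\<exists>f\<in>gevrey \<sigma> s E. is_function s\<^sub>0 \<sigma>\<^sub>0 F f) \<longleftrightarrow>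
        (\<exists>V. STFT_is_function s\<^sub>0 \<sigma>\<^sub>0 \<phi> F V \<and>
          (\<exists>r>0. \<exists>C>0. \<forall>x \<xi> \<eta> y.
            norm (V x \<xi> \<eta> y) \<le> C * exp (- r * (norm \<eta> powr (1/\<sigma>) + norm (x - y) powr (1/s)))))))
     \<and>
     (\<phi> \<in> GS_proj s \<sigma> \<longrightarrow>
       ((\<exists>f\<in>gevrey_proj \<sigma> s E. is_function s\<^sub>0 \<sigma>\<^sub>0 F f) \<longleftrightarrow>
        (\<exists>V. STFT_is_function s\<^sub>0 \<sigma>\<^sub>0 \<phi> F V \<and>
          (\<forall>r>0. \<exists>C>0. \<forall>x\<in>cell E. \<forall>\<xi> \<eta> y.
            norm (V x \<xi> \<eta> y) \<le> C * exp (- r * (norm \<eta> powr (1/\<sigma>) + norm y powr (1/s)))))) \<and>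
       ((\<exists>f\<in>gevrey_proj \<sigma> s E. is_function s\<^sub>0 \<sigma>\<^sub>0 F f) \<longleftrightarrow>
        (\<exists>V. STFT_is_function s\<^sub>0 \<sigma>\<^sub>0 \<phi> F V \<and>
          (\<forall>r>0. \<exists>C>0. \<forall>x \<xi> \<eta> y.
            norm (V x \<xi> \<eta> y) \<le> C * exp (- r * (norm \<eta> powr (1/\<sigma>) + norm (x - y) powr (1/s)))))))"
proof -
  note s = assms(1,2) and E = assms(3) and s0 = assms(4-6) and F = assms(7,8) and \<phi>0 = assms(9)
  let ?q = "2 powr (1 / s) :: real"
  \<comment> \<open>The two estimates at a fixed rate \<open>r\<close>; the two versions of the
    theorem differ only in the quantifier put in front of \<open>r\<close>.\<close>
  define B2 where "B2 V r \<longleftrightarrow> (\<exists>C>0. \<forall>x\<in>cell E. \<forall>\<xi> \<eta> y.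
    norm (V x \<xi> \<eta> y :: complex) \<le> C * exp (- r * (norm \<eta> powr (1/\<sigma>) + norm y powr (1/s))))"
    for V :: "real ^ 'n \<Rightarrow> real ^ 'n \<Rightarrow> real ^ 'n \<Rightarrow> real ^ 'n \<Rightarrow> complex" and r
  define B3 where "B3 V r \<longleftrightarrow> (\<exists>C>0. \<forall>x \<xi> \<eta> y.
    norm (V x \<xi> \<eta> y :: complex) \<le> C * exp (- r * (norm \<eta> powr (1/\<sigma>) + norm (x - y) powr (1/s))))"
    for V :: "real ^ 'n \<Rightarrow> real ^ 'n \<Rightarrow> real ^ 'n \<Rightarrow> real ^ 'n \<Rightarrow> complex" and r
  let ?T = "STFT_is_function s\<^sub>0 \<sigma>\<^sub>0 \<phi> F"
  let ?U = "\<lambda>V ((x, y), (\<xi>, \<eta>)). V x \<xi> \<eta> y :: complex"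
  have B3: "B3 V r \<longleftrightarrow> (\<exists>C>0. vdecay s \<sigma> r C (?U V))" for V r
    unfolding B3_def vdecay_def by auto
  have B3': "B3 (\<lambda>x \<xi> \<eta> y. W ((x, y), (\<xi>, \<eta>))) r \<longleftrightarrow> (\<exists>C>0. vdecay s \<sigma> r C W)" for W r
    unfolding B3_def vdecay_def by auto
  have T: "?T V \<longleftrightarrow> is_function s\<^sub>0 \<sigma>\<^sub>0 (STFT \<phi> F) (?U V)" for V
    by (simp add: STFT_is_function_def)
  have B32: "B2 V (r / ?q)" if "B3 V r" "r > 0" for V r
  proof -
    from B3[THEN iffD1, OF that(1)] obtain C where C: "C > 0" "vdecay s \<sigma> r C (?U V)" by blast
    from vdecay_cell[OF s(1) that(2) C, of E] show ?thesis unfolding B2_def prod.case .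
  qed
  have zero: "B2 (\<lambda>_ _ _ _. 0) r" "B3 (\<lambda>_ _ _ _. 0) r" for r
    unfolding B2_def B3_def by (auto intro!: exI[of _ 1])
  let ?triv = "\<forall>g\<in>GS s\<^sub>0 \<sigma>\<^sub>0. \<forall>X :: (real ^ 'n) \<times> (real ^ 'n). g X = (0 :: complex)"
  have triv: "is_function s\<^sub>0 \<sigma>\<^sub>0 F (\<lambda>_. 0) \<and> ?T (\<lambda>_ _ _ _. 0)" if \<phi>: "\<phi> \<in> GS s \<sigma>" and z: ?triv
  proof -
    obtain h0 r0 where \<phi>1: "r0 > 0" "expdec s \<sigma> h0 r0 \<phi>" using GS_expdec[OF s \<phi>] by blast
    have "g = (\<lambda>_. 0)" if "g \<in> GS s\<^sub>0 \<sigma>\<^sub>0" for g :: "(real ^ 'n) \<times> (real ^ 'n) \<Rightarrow> complex"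
      using z that by (intro ext) blast
    from trivial_test_space[OF s \<phi>1 s0 F(1) this] show ?thesis by blast
  qed
  \<comment> \<open>A single \<open>V\<close>, the normalised transform of \<open>f\<close>, for all
    rates, as the projective version requires.\<close>
  have 13: "\<exists>V. ?T V \<and> (\<forall>r. (\<exists>C>0. vdecay s \<sigma> r C (stf \<phi> f)) \<longrightarrow> B3 V r)"
    if \<phi>: "\<phi> \<in> GS s \<sigma>" and f: "f \<in> gevrey \<sigma> s E" "is_function s\<^sub>0 \<sigma>\<^sub>0 F f" for f
  proof -
    obtain h0 r0 where \<phi>1: "r0 > 0" "expdec s \<sigma> h0 r0 \<phi>" using GS_expdec[OF s \<phi>] by blast
    obtain M where M: "\<And>X. norm (f X) \<le> M" using gevrey_bounded[OF s E f(1)] by blast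
    let ?c = "of_real (1 / (2 * pi) ^ CARD('n)) :: complex"
    let ?W = "\<lambda>w. ?c * stf \<phi> f w"
    have "B3 (\<lambda>x \<xi> \<eta> y. ?W ((x, y), (\<xi>, \<eta>))) r" if C: "C > 0" "vdecay s \<sigma> r C (stf \<phi> f)" for r C
    proof -
      have "norm ?c * C > 0" using C(1) by simp
      then show ?thesis unfolding B3'[of ?W] using vdecay_cmult[OF C(2), of ?c] by blast
    qed
    moreover have "?T (\<lambda>x \<xi> \<eta> y. ?W ((x, y), (\<xi>, \<eta>)))"
      unfolding STFT_is_function_curry[of _ _ _ _ ?W] by (rule stf_is_function[OF s \<phi>1 s0 f(2) M])
    ultimately show ?thesis by blast
  qed
  \<comment> \<open>\<open>V'\<close> may differ from \<open>V\<close> on a null set but is chosen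
    before \<open>r\<close>, so both quantifiers over the rate pass through.\<close>
  have 23: "\<exists>V'. ?T V' \<and> (\<forall>r>0. B2 V r \<longrightarrow> B3 V' (r / ?q))"
    if \<phi>: "\<phi> \<in> GS s \<sigma>" and g: "g \<in> GS s\<^sub>0 \<sigma>\<^sub>0" "g X0 \<noteq> 0" and V: "?T V"
    for V and g :: "(real ^ 'n) \<times> (real ^ 'n) \<Rightarrow> complex" and X0
  proof -
    obtain h0 r0 where \<phi>1: "r0 > 0" "expdec s \<sigma> h0 r0 \<phi>" using GS_expdec[OF s \<phi>] by blast
    from transform_truncate[OF s \<phi>1 \<phi>0 s0 g E F(2) V[unfolded T]] obtain W' where
      W': "is_function s\<^sub>0 \<sigma>\<^sub>0 (STFT \<phi> F) W'" and
      d: "\<And>r C. r > 0 \<Longrightarrow> C > 0 \<Longrightarrow> \<forall>x\<in>cell E. \<forall>\<xi> \<eta> y. norm (V x \<xi> \<eta> y) \<le> C * exp (- r * (norm \<eta> powr (1 / \<sigma>) + norm y powr (1 / s))) \<Longrightarrow>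
        \<exists>C'>0. vdecay s \<sigma> (r / ?q) C' W'" by auto
    have "B3 (\<lambda>x \<xi> \<eta> y. W' ((x, y), (\<xi>, \<eta>))) (r / ?q)" if "r > 0" "B2 V r" for r
      unfolding B3'[of W'] using that d unfolding B2_def by blast
    moreover have "?T (\<lambda>x \<xi> \<eta> y. W' ((x, y), (\<xi>, \<eta>)))" using W' unfolding STFT_is_function_curry .
    ultimately show ?thesis by blast
  qed
  have R: "((\<exists>f\<in>gevrey \<sigma> s E. is_function s\<^sub>0 \<sigma>\<^sub>0 F f) \<longleftrightarrow> (\<exists>V. ?T V \<and> (\<exists>r>0. B2 V r))) \<and>
     ((\<exists>f\<in>gevrey \<sigma> s E. is_function s\<^sub>0 \<sigma>\<^sub>0 F f) \<longleftrightarrow> (\<exists>V. ?T V \<and> (\<exists>r>0. B3 V r)))"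
    if \<phi>: "\<phi> \<in> GS s \<sigma>"
  proof (cases ?triv)
    case True
    have "(\<lambda>_. 0) \<in> gevrey \<sigma> s E" using zero_in_gevrey_proj[OF s] gevrey_proj_subset by blast
    then show ?thesis using triv[OF \<phi> True] zero zero_less_one by blast
  next
    case False
    then obtain g and X0 :: "(real ^ 'n) \<times> (real ^ 'n)" where g: "g \<in> GS s\<^sub>0 \<sigma>\<^sub>0" "g X0 \<noteq> (0 :: complex)" by blast
    have a: "\<exists>V. ?T V \<and> (\<exists>r>0. B3 V r)" if f: "f \<in> gevrey \<sigma> s E" "is_function s\<^sub>0 \<sigma>\<^sub>0 F f" for f
      using 13[OF \<phi> f] gevrey_imp_decay[OF s E f(1) \<phi>] by blast
    have b: "\<exists>r>0. B2 V r" if "r > 0" "B3 V r" for V r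
      using B32[OF that(2,1)] that(1) by (intro exI[of _ "r / ?q"]) simp
    have c: "\<exists>V. ?T V \<and> (\<exists>r>0. B3 V r)" if V: "?T V" and r: "r > 0" "B2 V r" for V r
    proof -
      obtain V' where "?T V'" "B3 V' (r / ?q)" using 23[OF \<phi> g V] r by blast
      moreover have "r / ?q > 0" using r by simp
      ultimately show ?thesis by blast
    qed
    have d: "\<exists>f\<in>gevrey \<sigma> s E. is_function s\<^sub>0 \<sigma>\<^sub>0 F f" if V: "?T V" and r: "r > 0" "B3 V r" for V r
      using decay_imp_gevrey[OF s \<phi> \<phi>0 s0 g F V[unfolded T] r(1)] r(2) unfolding B3 by blast
    have "(\<exists>f\<in>gevrey \<sigma> s E. is_function s\<^sub>0 \<sigma>\<^sub>0 F f) \<Longrightarrow> (\<exists>V. ?T V \<and> (\<exists>r>0. B3 V r))" using a by blast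
    moreover have "(\<exists>V. ?T V \<and> (\<exists>r>0. B3 V r)) \<Longrightarrow> (\<exists>V. ?T V \<and> (\<exists>r>0. B2 V r))" using b by blast
    moreover have "(\<exists>V. ?T V \<and> (\<exists>r>0. B2 V r)) \<Longrightarrow> (\<exists>V. ?T V \<and> (\<exists>r>0. B3 V r))" using c by blast
    moreover have "(\<exists>V. ?T V \<and> (\<exists>r>0. B3 V r)) \<Longrightarrow> (\<exists>f\<in>gevrey \<sigma> s E. is_function s\<^sub>0 \<sigma>\<^sub>0 F f)" using d by blast
    ultimately show ?thesis by argo
  qed
  have B: "((\<exists>f\<in>gevrey_proj \<sigma> s E. is_function s\<^sub>0 \<sigma>\<^sub>0 F f) \<longleftrightarrow> (\<exists>V. ?T V \<and> (\<forall>r>0. B2 V r))) \<and>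
     ((\<exists>f\<in>gevrey_proj \<sigma> s E. is_function s\<^sub>0 \<sigma>\<^sub>0 F f) \<longleftrightarrow> (\<exists>V. ?T V \<and> (\<forall>r>0. B3 V r)))"
    if \<phi>p: "\<phi> \<in> GS_proj s \<sigma>"
  proof (cases ?triv)
    case True
    have \<phi>: "\<phi> \<in> GS s \<sigma>" using \<phi>p GS_proj_subset_GS by blast
    show ?thesis using triv[OF \<phi> True] zero zero_in_gevrey_proj[OF s] by blast
  next
    case False
    then obtain g and X0 :: "(real ^ 'n) \<times> (real ^ 'n)" where g: "g \<in> GS s\<^sub>0 \<sigma>\<^sub>0" "g X0 \<noteq> (0 :: complex)" by blast
    have \<phi>: "\<phi> \<in> GS s \<sigma>" using \<phi>p GS_proj_subset_GS by blast
    \<comment> \<open>When all rates are available, starting from \<open>r * ?q\<close> cancels the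
      loss of the factor \<open>?q\<close>.\<close>
    have q: "r * ?q > 0" "r * ?q / ?q = r" if "r > 0" for r using that by simp_all
    have a: "\<exists>V. ?T V \<and> (\<forall>r>0. B3 V r)" if f: "f \<in> gevrey_proj \<sigma> s E" "is_function s\<^sub>0 \<sigma>\<^sub>0 F f" for f
      using 13[OF \<phi> _ f(2)] f(1) gevrey_proj_subset gevrey_proj_imp_decay[OF s E f(1) \<phi>p] by blast
    have b: "B2 V r" if "\<forall>r>0. B3 V r" "r > 0" for V r
      using B32[of V "r * ?q"] that q[of r] by simp
    have c: "\<exists>V. ?T V \<and> (\<forall>r>0. B3 V r)" if V: "?T V" and r: "\<forall>r>0. B2 V r" for V
    proof -
      obtain V' where V': "?T V'" "\<forall>r>0. B2 V r \<longrightarrow> B3 V' (r / ?q)" using 23[OF \<phi> g V] by blast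
      have "B3 V' r" if "r > 0" for r
        using V'(2)[rule_format, OF q(1)[OF that] r[rule_format, OF q(1)[OF that]]] q(2)[OF that] by simp
      then show ?thesis using V'(1) by blast
    qed
    have d: "\<exists>f\<in>gevrey_proj \<sigma> s E. is_function s\<^sub>0 \<sigma>\<^sub>0 F f" if V: "?T V" and r: "\<forall>r>0. B3 V r" for V
      using decay_imp_gevrey_proj[OF s \<phi>p \<phi>0 s0 g F V[unfolded T]] r unfolding B3 by blast
    have "(\<exists>f\<in>gevrey_proj \<sigma> s E. is_function s\<^sub>0 \<sigma>\<^sub>0 F f) \<Longrightarrow> (\<exists>V. ?T V \<and> (\<forall>r>0. B3 V r))" using a by blast
    moreover have "(\<exists>V. ?T V \<and> (\<forall>r>0. B3 V r)) \<Longrightarrow> (\<exists>V. ?T V \<and> (\<forall>r>0. B2 V r))" using b by blast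
    moreover have "(\<exists>V. ?T V \<and> (\<forall>r>0. B2 V r)) \<Longrightarrow> (\<exists>V. ?T V \<and> (\<forall>r>0. B3 V r))" using c by blast
    moreover have "(\<exists>V. ?T V \<and> (\<forall>r>0. B3 V r)) \<Longrightarrow> (\<exists>f\<in>gevrey_proj \<sigma> s E. is_function s\<^sub>0 \<sigma>\<^sub>0 F f)" using d by blast
    ultimately show ?thesis by argo
  qed
  show ?thesis
    by (rule conjI[OF impI impI], rule R[unfolded B2_def B3_def], assumption, rule B[unfolded B2_def B3_def], assumption)
qed

end
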